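(* Let $\Omega\subset\mathbb{R}^N$ ($N\ge 3$) be a bounded domain with $C^{1,1}$ boundary, and let $f\colon\Omega\times\mathbb{R}\times\mathbb{R}^+\to\mathbb{R}$ satisfy: (f1) $f$ is a Carathéodory function; (f2) there exist $\mu>0$ and $R>0$ such that $N_{f_\mu}\circ(-\Delta)^{-1}$ maps the ball $B_R=\{v\in L^2(\Omega):\|v\|_{2}\le R\}$ of $L^2(\Omega)$ into itself. Then, for this $\mu$ and for every $\lambda\ge 0$, the problem $$-\Delta u+\lambda u=f(x,u,\mu)\ \text{ in }\Omega,\qquad u=0\ \text{ on }\partial\Omega,$$ has a strong solution.
   Context: A strong solution is a function $u\in W^{2,2}(\Omega)\cap W^{1,2}_0(\Omega)$ satisfying the equation almost everywhere in $\Omega$. $(-\Delta)^{-1}\colon L^2(\Omega)\to W^{2,2}(\Omega)\cap W_0^{1,2}(\Omega)$ is the inverse of the bijection $u\mapsto-\Delta u$ from $W^{2,2}(\Omega)\cap W^{1,2}_0(\Omega)$ onto $L^2(\Omega)$. $N_{f_\mu}$ is the Nemytskii operator $N_{f_\mu}(w)(x)=f(x,w(x),\mu)$. Carathéodory means: measurable in $x\in\Omega$ for each fixed value of the remaining variables, and continuous in the remaining variables for almost every $x\in\Omega$. *)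

theory Defs
  imports "HOL-Analysis.Analysis"
begin

(* Elements of L^2(Omega) and of the Sobolev spaces are represented by functions on the whole
   space of which only the values on Omega matter; functions equal almost everywhere on Omega
   represent the same element. *)

definition L2 :: "'a::euclidean_space set \<Rightarrow> ('a \<Rightarrow> real) set" where
  "L2 \<Omega> = {v \<in> borel_measurable (lebesgue_on \<Omega>). integrable (lebesgue_on \<Omega>) (\<lambda>x. (v x)\<^sup>2)}"

definition L2_norm :: "'a::euclidean_space set \<Rightarrow> ('a \<Rightarrow> real) \<Rightarrow> real" where
  "L2_norm \<Omega> v = sqrt (LINT x|lebesgue_on \<Omega>. (v x)\<^sup>2)"

definition L2_ball :: "'a::euclidean_space set \<Rightarrow> real \<Rightarrow> ('a \<Rightarrow> real) set" where
  "L2_ball \<Omega> R = {v \<in> L2 \<Omega>. L2_norm \<Omega> v \<le> R}"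

(* A multi-index is encoded as a list of coordinate directions, its order being the length of
   the list. *)

primrec partials :: "'a::euclidean_space list \<Rightarrow> ('a \<Rightarrow> real) \<Rightarrow> 'a \<Rightarrow> real" where
  "partials [] \<phi> = \<phi>"
| "partials (b # bs) \<phi> = (\<lambda>x. frechet_derivative (partials bs \<phi>) (at x) b)"

definition smooth :: "('a::euclidean_space \<Rightarrow> real) \<Rightarrow> bool" where
  "smooth \<phi> \<longleftrightarrow> (\<forall>bs\<in>lists Basis. \<forall>x. partials bs \<phi> differentiable (at x))"

definition test_functions :: "'a::euclidean_space set \<Rightarrow> ('a \<Rightarrow> real) set" where
  "test_functions \<Omega> =
    {\<phi>. smooth \<phi> \<and> compact (closure {x. \<phi> x \<noteq> 0}) \<and> closure {x. \<phi> x \<noteq> 0} \<subseteq> \<Omega>}"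

(* Only used for u and g in L^2(Omega), so that both integrals exist. *)
definition is_weak_derivative ::
    "'a::euclidean_space set \<Rightarrow> 'a list \<Rightarrow> ('a \<Rightarrow> real) \<Rightarrow> ('a \<Rightarrow> real) \<Rightarrow> bool" where
  "is_weak_derivative \<Omega> bs u g \<longleftrightarrow>
    (\<forall>\<phi>\<in>test_functions \<Omega>.
      (LINT x|lebesgue_on \<Omega>. u x * partials bs \<phi> x) =
      (- 1) ^ length bs * (LINT x|lebesgue_on \<Omega>. g x * \<phi> x))"

(* The choice is unique up to equality almost everywhere on Omega, for open Omega. *)
definition weak_derivative ::
    "'a::euclidean_space set \<Rightarrow> 'a list \<Rightarrow> ('a \<Rightarrow> real) \<Rightarrow> 'a \<Rightarrow> real" where
  "weak_derivative \<Omega> bs u = (SOME g. g \<in> L2 \<Omega> \<and> is_weak_derivative \<Omega> bs u g)"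

(* W^{k,2}(Omega) *)
definition sobolev :: "nat \<Rightarrow> 'a::euclidean_space set \<Rightarrow> ('a \<Rightarrow> real) set" where
  "sobolev k \<Omega> =
    {u \<in> L2 \<Omega>. \<forall>bs\<in>lists Basis. length bs \<le> k \<longrightarrow> (\<exists>g\<in>L2 \<Omega>. is_weak_derivative \<Omega> bs u g)}"

definition W12_norm :: "'a::euclidean_space set \<Rightarrow> ('a \<Rightarrow> real) \<Rightarrow> real" where
  "W12_norm \<Omega> u =
    sqrt ((L2_norm \<Omega> u)\<^sup>2 + (\<Sum>b\<in>Basis. (L2_norm \<Omega> (weak_derivative \<Omega> [b] u))\<^sup>2))"

(* W_0^{1,2}(Omega): the closure of the test functions in W^{1,2}(Omega) *)
definition sobolev0 :: "'a::euclidean_space set \<Rightarrow> ('a \<Rightarrow> real) set" where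
  "sobolev0 \<Omega> =
    {u \<in> sobolev 1 \<Omega>. \<forall>\<epsilon>>0. \<exists>\<phi>\<in>test_functions \<Omega>. W12_norm \<Omega> (\<lambda>x. u x - \<phi> x) < \<epsilon>}"

definition laplacian :: "'a::euclidean_space set \<Rightarrow> ('a \<Rightarrow> real) \<Rightarrow> 'a \<Rightarrow> real" where
  "laplacian \<Omega> u = (\<lambda>x. \<Sum>b\<in>Basis. weak_derivative \<Omega> [b, b] u x)"

(* The inverse of the operator - Laplacian from W^{2,2} \<inter> W_0^{1,2} onto L^2. It returns a
   representative of the preimage, whose class is unique on bounded domains with C^{1,1}
   boundary. *)
definition neg_laplacian_inverse ::
    "'a::euclidean_space set \<Rightarrow> ('a \<Rightarrow> real) \<Rightarrow> 'a \<Rightarrow> real" where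
  "neg_laplacian_inverse \<Omega> v =
    (SOME u. u \<in> sobolev 2 \<Omega> \<inter> sobolev0 \<Omega> \<and>
      (AE x in lebesgue_on \<Omega>. - laplacian \<Omega> u x = v x))"

definition C11 :: "('a::euclidean_space \<Rightarrow> real) \<Rightarrow> bool" where
  "C11 \<gamma> \<longleftrightarrow>
    (\<exists>g L. (\<forall>x. (\<gamma> has_derivative (\<lambda>h. g x \<bullet> h)) (at x)) \<and> L-lipschitz_on UNIV g)"

(* Near each boundary point Omega is, in coordinates with last axis e, the region above the graph
   of a C^{1,1} function; gamma is only evaluated on the hyperplane orthogonal to e. *)
definition C11_boundary :: "'a::euclidean_space set \<Rightarrow> bool" where
  "C11_boundary \<Omega> \<longleftrightarrow>
    (\<forall>p\<in>frontier \<Omega>. \<exists>r>0. \<exists>e \<gamma>. norm e = 1 \<and> C11 \<gamma> \<and>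
      \<Omega> \<inter> ball p r = {x \<in> ball p r. x \<bullet> e > \<gamma> (x - (x \<bullet> e) *\<^sub>R e)})"

definition bounded_C11_domain :: "'a::euclidean_space set \<Rightarrow> bool" where
  "bounded_C11_domain \<Omega> \<longleftrightarrow>
    open \<Omega> \<and> connected \<Omega> \<and> \<Omega> \<noteq> {} \<and> bounded \<Omega> \<and> C11_boundary \<Omega>"

(* For f on Omega \<times> R \<times> R^+, where R^+ is the open half-line of positive reals. *)
definition caratheodory ::
    "'a::euclidean_space set \<Rightarrow> ('a \<Rightarrow> real \<Rightarrow> real \<Rightarrow> real) \<Rightarrow> bool" where
  "caratheodory \<Omega> f \<longleftrightarrow>
    (\<forall>s. \<forall>\<mu>>0. (\<lambda>x. f x s \<mu>) \<in> borel_measurable (lebesgue_on \<Omega>)) \<and>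
    (AE x in lebesgue_on \<Omega>. continuous_on (UNIV \<times> {0<..}) (\<lambda>(s, \<mu>). f x s \<mu>))"

definition nemytskii :: "('a \<Rightarrow> real \<Rightarrow> real \<Rightarrow> real) \<Rightarrow> real \<Rightarrow> ('a \<Rightarrow> real) \<Rightarrow> 'a \<Rightarrow> real" where
  "nemytskii f \<mu> w = (\<lambda>x. f x (w x) \<mu>)"

(* The boundary condition u = 0 is expressed by membership in W_0^{1,2}(Omega). *)
definition strong_solution ::
    "'a::euclidean_space set \<Rightarrow> ('a \<Rightarrow> real \<Rightarrow> real \<Rightarrow> real) \<Rightarrow> real \<Rightarrow> real \<Rightarrow> ('a \<Rightarrow> real) \<Rightarrow> bool"
  where
  "strong_solution \<Omega> f \<mu> l u \<longleftrightarrow>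
    u \<in> sobolev 2 \<Omega> \<inter> sobolev0 \<Omega> \<and>
    (AE x in lebesgue_on \<Omega>. - laplacian \<Omega> u x + l * u x = f x (u x) \<mu>)"

end

theory Submission imports Defs "HOL-Library.Diagonal_Subsequence"
begin

text \<open>For \<open>\<lambda> \<ge> 0\<close> let \<open>K = (-\<Delta> + \<lambda>)\<inverse>\<close> with Dirichlet boundary values. If \<open>u = K v\<close> then \<open>y = v - \<lambda> u\<close>
  satisfies \<open>-\<Delta> u = y\<close> and \<open>\<parallel>y\<parallel> \<le> \<parallel>v\<parallel>\<close>, because \<open>\<langle>y, u\<rangle> = \<parallel>\<nabla>u\<parallel>\<^sup>2 \<ge> 0\<close>. Hence (f2) shows that
  \<open>T = N\<^sub>f \<circ> K\<close> also maps the ball of radius \<open>R\<close> into itself, and a fixed point \<open>v = T v\<close> yields the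
  solution \<open>K v\<close>. As \<open>f\<close> is subject to no growth condition, \<open>T\<close> need not be continuous for the norm
  topology, but it is weakly sequentially continuous: \<open>K\<close> is compact, and a bounded sequence
  converging almost everywhere converges weakly. A fixed point therefore arises as a limit of fixed
  points, given by Brouwer's theorem, of the compressions of \<open>T\<close> to piecewise constant functions.

  That \<open>K v\<close> lies in \<open>W\<^sup>2\<^sup>,\<^sup>2\<close> is proved with difference quotients along the flow
  \<open>\<Phi>\<^sub>h x = x + h \<tau> + (\<Gamma> (x + h \<tau>) - \<Gamma> x) e\<close>, where \<open>\<Omega>\<close> is locally the region above the graph of \<open>\<Gamma>\<close> in the
  direction \<open>e\<close> and \<open>\<tau>\<close> is orthogonal to \<open>e\<close>. Each \<open>\<Phi>\<^sub>h\<close> preserves Lebesgue measure and the region, and it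
  differs from the identity by \<open>O(h)\<close> in the Lipschitz norm. This avoids flattening the boundary. The second normal
  derivative is recovered from the equation.\<close>

subsection \<open>The Hilbert space of square integrable functions\<close>

text \<open>The operator in (f2) is a choice among W^{2,2} preimages, so the hypothesis says nothing
  until preimages are known to exist, which requires regularity up to the boundary, and to be
  unique. This is why a linear theory occupies most of the development. All functions are extended
  by zero to the whole space, where translations, flows and multipliers act on one Hilbert space and
  zero boundary values become integration by parts against test functions that ignore the boundary.
  Derivatives are kept in dual form: a gradient component has a square integrable derivative once
  its pairing with derivatives of test functions is bounded by the norm of the test function. The
  boundary being only C^{1,1}, the coefficients of tangential derivatives are merely Lipschitz, and
  a C^1 test function times such a coefficient is no longer admissible; difference quotients of the
  graph function take its place. Piecewise constant functions serve as approximations because their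
  projection error is controlled by the gradient through translations alone, and the same estimate
  also gives compactness.\<close>

definition sqint :: "('a::euclidean_space \<Rightarrow> real) \<Rightarrow> bool" where
  "sqint f \<longleftrightarrow> f \<in> borel_measurable lborel \<and> integrable lborel (\<lambda>x. (f x)\<^sup>2)"

lemma sqint_meas [measurable_dest]: "sqint f \<Longrightarrow> f \<in> borel_measurable lborel"
  by (simp add: sqint_def)

lemma sqint_integrable_mult:
  assumes "sqint f" "sqint g"
  shows "integrable lborel (\<lambda>x. f x * g x)"
proof (rule Bochner_Integration.integrable_bound)
  show "integrable lborel (\<lambda>x. (f x)\<^sup>2 + (g x)\<^sup>2)"
    using assms by (simp add: sqint_def)
  show "(\<lambda>x. f x * g x) \<in> borel_measurable lborel"
    using assms by (auto simp: sqint_def)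
  have "\<bar>a * b\<bar> \<le> a\<^sup>2 + b\<^sup>2" for a b :: real
  proof -
    have "2 * (\<bar>a\<bar> * \<bar>b\<bar>) \<le> a\<^sup>2 + b\<^sup>2"
      using sum_squares_bound[of "\<bar>a\<bar>" "\<bar>b\<bar>"] by simp
    moreover have "0 \<le> \<bar>a\<bar> * \<bar>b\<bar>" by simp
    ultimately show ?thesis by (subst abs_mult) linarith
  qed
  then show "AE x in lborel. norm (f x * g x) \<le> norm ((f x)\<^sup>2 + (g x)\<^sup>2)"
    by (intro AE_I2) (simp add: abs_of_nonneg del: abs_mult)
qed

lemma sqint_add: "sqint f \<Longrightarrow> sqint g \<Longrightarrow> sqint (\<lambda>x. f x + g x)"
  using sqint_integrable_mult[of f g] unfolding sqint_def
  by (auto simp: power2_sum intro!: Bochner_Integration.integrable_add) (simp add: mult.assoc)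

lemma sqint_zero: "sqint (\<lambda>x. 0)"
  by (simp add: sqint_def)

lemma sqint_scale: "sqint f \<Longrightarrow> sqint (\<lambda>x. c * f x)"
  by (auto simp: sqint_def power_mult_distrib intro!: borel_measurable_times)

lemma sqint_minus: "sqint f \<Longrightarrow> sqint (\<lambda>x. - f x)"
  by (simp add: sqint_def)

lemma sqint_diff: "sqint f \<Longrightarrow> sqint g \<Longrightarrow> sqint (\<lambda>x. f x - g x)"
  using sqint_add[of f "\<lambda>x. - g x"] by (simp add: sqint_minus)

lemma sqint_bound:
  assumes "sqint g" "f \<in> borel_measurable lborel" "AE x in lborel. \<bar>f x\<bar> \<le> \<bar>g x\<bar>"
  shows "sqint f"
  unfolding sqint_def
proof
  show "integrable lborel (\<lambda>x. (f x)\<^sup>2)"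
  proof (rule Bochner_Integration.integrable_bound)
    show "integrable lborel (\<lambda>x. (g x)\<^sup>2)" using assms(1) by (simp add: sqint_def)
    show "(\<lambda>x. (f x)\<^sup>2) \<in> borel_measurable lborel" using assms(2) by simp
    show "AE x in lborel. norm ((f x)\<^sup>2) \<le> norm ((g x)\<^sup>2)"
      using assms(3) by eventually_elim (simp add: abs_le_square_iff)
  qed
qed fact

\<comment> \<open>Square integrability is part of the relation, hence \<open>partial\<close>: a
  function that is not square integrable belongs to no class.\<close>
quotient_type (overloaded) 'a l2 = "'a::euclidean_space \<Rightarrow> real" / partial:
  "\<lambda>f g. sqint f \<and> sqint g \<and> (AE x in lborel. f x = g x)"
proof (rule part_equivpI)
  show "\<exists>f::'a \<Rightarrow> real. sqint f \<and> sqint f \<and> (AE x in lborel. f x = f x)"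
    by (intro exI[of _ "\<lambda>x. 0"]) (simp add: sqint_zero)
  show "symp (\<lambda>f g::'a \<Rightarrow> real. sqint f \<and> sqint g \<and> (AE x in lborel. f x = g x))"
    by (auto simp: symp_def elim: eventually_mono)
  show "transp (\<lambda>f g::'a \<Rightarrow> real. sqint f \<and> sqint g \<and> (AE x in lborel. f x = g x))"
    unfolding transp_def by (auto elim: eventually_elim2)
qed

instantiation l2 :: (euclidean_space) real_vector
begin

lift_definition zero_l2 :: "'a l2" is "\<lambda>x. 0" by (simp add: sqint_zero)

lift_definition plus_l2 :: "'a l2 \<Rightarrow> 'a l2 \<Rightarrow> 'a l2" is "\<lambda>f g x. f x + g x"
  by (auto simp: sqint_add)

lift_definition minus_l2 :: "'a l2 \<Rightarrow> 'a l2 \<Rightarrow> 'a l2" is "\<lambda>f g x. f x - g x"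
  by (auto simp: sqint_diff)

lift_definition uminus_l2 :: "'a l2 \<Rightarrow> 'a l2" is "\<lambda>f x. - f x"
  by (auto simp: sqint_minus)

lift_definition scaleR_l2 :: "real \<Rightarrow> 'a l2 \<Rightarrow> 'a l2" is "\<lambda>c f x. c * f x"
  by (auto simp: sqint_scale)

instance
proof
  fix u v w :: "'a l2" and r s :: real
  show "u + v + w = u + (v + w)" by transfer (auto simp: algebra_simps sqint_add)
  show "u + v = v + u" by transfer (auto simp: algebra_simps sqint_add)
  show "0 + u = u" by transfer simp
  show "- u + u = 0" by transfer (simp add: sqint_zero)
  show "u - v = u + - v" by transfer (simp add: sqint_diff)
  show "r *\<^sub>R (u + v) = r *\<^sub>R u + r *\<^sub>R v"
    by transfer (simp add: distrib_left sqint_add sqint_scale)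
  show "(r + s) *\<^sub>R u = r *\<^sub>R u + s *\<^sub>R u"
    by transfer (simp add: distrib_right sqint_add sqint_scale)
  show "r *\<^sub>R s *\<^sub>R u = (r * s) *\<^sub>R u" by transfer (simp add: sqint_scale mult.assoc)
  show "1 *\<^sub>R u = u" by transfer simp
qed

end

instantiation l2 :: (euclidean_space) real_inner
begin

lift_definition inner_l2 :: "'a l2 \<Rightarrow> 'a l2 \<Rightarrow> real" is "\<lambda>f g. \<integral>x. f x * g x \<partial>lborel"
  by (intro integral_cong_AE) (auto simp: sqint_def intro!: borel_measurable_times)

definition norm_l2 :: "'a l2 \<Rightarrow> real" where "norm_l2 u = sqrt (inner u u)"
definition sgn_l2 :: "'a l2 \<Rightarrow> 'a l2" where "sgn_l2 u = u /\<^sub>R norm u"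
definition dist_l2 :: "'a l2 \<Rightarrow> 'a l2 \<Rightarrow> real" where "dist_l2 u v = norm (u - v)"
definition uniformity_l2 :: "('a l2 \<times> 'a l2) filter" where
  "uniformity_l2 = (INF e\<in>{0 <..}. principal {(x, y). dist x y < e})"
definition open_l2 :: "'a l2 set \<Rightarrow> bool" where
  "open_l2 U = (\<forall>x\<in>U. eventually (\<lambda>(x', y). x' = x \<longrightarrow> y \<in> U) uniformity)"

instance
proof
  fix u v w :: "'a l2" and r :: real
  show "sgn u = u /\<^sub>R norm u" by (rule sgn_l2_def)
  show "dist u v = norm (u - v)" by (rule dist_l2_def)
  show "uniformity = (INF e\<in>{0 <..}. principal {(x, y). dist (x::'a l2) y < e})"
    by (rule uniformity_l2_def)
  show "open U = (\<forall>x\<in>U. eventually (\<lambda>(x', y). x' = x \<longrightarrow> y \<in> U) uniformity)" for U :: "'a l2 set"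
    by (rule open_l2_def)
  show "inner u v = inner v u" by transfer (simp add: mult.commute)
  show "inner (u + v) w = inner u w + inner v w"
    by transfer (simp add: distrib_right sqint_integrable_mult)
  show "inner (r *\<^sub>R u) v = r * inner u v"
    by transfer (simp add: mult.assoc)
  show "0 \<le> inner u u" by transfer (simp add: integral_nonneg_AE)
  show "inner u u = 0 \<longleftrightarrow> u = 0"
    by transfer (auto simp: power2_eq_square[symmetric] integral_nonneg_eq_0_iff_AE sqint_def)
  show "norm u = sqrt (inner u u)" by (rule norm_l2_def)
qed

end

text \<open>The default value zero makes \<open>mk\<close> total; computations with it therefore
  carry \<open>sqint\<close> premises.\<close>

lift_definition mk :: "('a::euclidean_space \<Rightarrow> real) \<Rightarrow> 'a l2" is
  "\<lambda>f. if sqint f then f else (\<lambda>x. 0)" by (simp add: sqint_zero)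

definition fn :: "'a::euclidean_space l2 \<Rightarrow> 'a \<Rightarrow> real" where "fn u = rep_l2 u"

lemma sqint_fn [simp]: "sqint (fn u)"
  unfolding fn_def using Quotient_rep_reflp[OF Quotient_l2] by blast

lemma fn_measurable [measurable]: "fn u \<in> borel_measurable borel"
  using sqint_meas[OF sqint_fn[of u]] by simp

lemma mk_fn [simp]: "mk (fn u) = u"
  using sqint_fn[of u] unfolding mk_def map_fun_def comp_def id_def
  by (simp add: fn_def Quotient_abs_rep[OF Quotient_l2])

lemma mk_eq_iff: "sqint f \<Longrightarrow> sqint g \<Longrightarrow> mk f = mk g \<longleftrightarrow> (AE x in lborel. f x = g x)"
  by transfer simp

lemma fn_mk: "sqint f \<Longrightarrow> AE x in lborel. fn (mk f) x = f x"
  using mk_eq_iff[of "fn (mk f)" f] by simp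

lemma mk_add: "sqint f \<Longrightarrow> sqint g \<Longrightarrow> mk (\<lambda>x. f x + g x) = mk f + mk g"
  by transfer (simp add: sqint_add)

lemma mk_diff: "sqint f \<Longrightarrow> sqint g \<Longrightarrow> mk (\<lambda>x. f x - g x) = mk f - mk g"
  by transfer (simp add: sqint_diff)

lemma mk_scale: "sqint f \<Longrightarrow> mk (\<lambda>x. c * f x) = c *\<^sub>R mk f"
  by transfer (simp add: sqint_scale)

lemma mk_uminus: "sqint f \<Longrightarrow> mk (\<lambda>x. - f x) = - mk f"
  by transfer (simp add: sqint_minus)

lemma mk_zero: "mk (\<lambda>x. 0) = 0"
  by transfer (simp add: sqint_zero)

lemma inner_mk: "sqint f \<Longrightarrow> sqint g \<Longrightarrow> inner (mk f) (mk g) = (\<integral>x. f x * g x \<partial>lborel)"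
  by transfer simp

lemma inner_fn: "inner u v = (\<integral>x. fn u x * fn v x \<partial>lborel)"
  using inner_mk[OF sqint_fn sqint_fn, of u v] by simp

lemma inner_mk_right: "sqint g \<Longrightarrow> inner u (mk g) = (\<integral>x. fn u x * g x \<partial>lborel)"
  using inner_mk[OF sqint_fn, of g u] by simp

lemma norm_mk: "sqint f \<Longrightarrow> norm (mk f) = sqrt (\<integral>x. (f x)\<^sup>2 \<partial>lborel)"
  by (simp add: norm_l2_def inner_mk power2_eq_square)

lemma norm_mk_sq: "sqint f \<Longrightarrow> (norm (mk f))\<^sup>2 = (\<integral>x. (f x)\<^sup>2 \<partial>lborel)"
  by (simp add: norm_mk)

lemma nn_norm_mk_sq: "sqint f \<Longrightarrow> (\<integral>\<^sup>+x. ennreal ((f x)\<^sup>2) \<partial>lborel) = ennreal ((norm (mk f))\<^sup>2)"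
  by (simp add: norm_mk_sq nn_integral_eq_integral sqint_def)

lemma sqintI_nn:
  assumes "f \<in> borel_measurable lborel" "(\<integral>\<^sup>+x. ennreal ((f x)\<^sup>2) \<partial>lborel) < \<infinity>"
  shows "sqint f"
  unfolding sqint_def using assms by (intro conjI integrableI_nonneg) auto

lemma norm_mk_mono:
  assumes "sqint f" "sqint g" "AE x in lborel. \<bar>f x\<bar> \<le> \<bar>g x\<bar>"
  shows "norm (mk f) \<le> norm (mk g)"
proof -
  have "(\<integral>x. (f x)\<^sup>2 \<partial>lborel) \<le> (\<integral>x. (g x)\<^sup>2 \<partial>lborel)"
    using assms by (intro integral_mono_AE) (auto simp: sqint_def abs_le_square_iff)
  then show ?thesis using assms by (simp add: norm_mk)
qed

text \<open>Fatou's lemma for the squares. It asks for no convergence in norm, so that norm bounds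
  survive limits known only almost everywhere.\<close>

lemma fatou_l2:
  assumes f: "\<And>n. sqint (f n)" and b: "\<And>n. norm (mk (f n)) \<le> C"
    and g: "g \<in> borel_measurable lborel" and ae: "AE x in lborel. (\<lambda>n. f n x) \<longlonglongrightarrow> g x"
  shows "sqint g" "norm (mk g) \<le> C"
proof -
  have C: "0 \<le> C" using b[of 0] norm_ge_zero order_trans by blast
  have [measurable]: "f n \<in> borel_measurable lborel" for n using f by (simp add: sqint_def)
  have "(\<integral>\<^sup>+x. ennreal ((g x)\<^sup>2) \<partial>lborel) = (\<integral>\<^sup>+x. liminf (\<lambda>n. ennreal ((f n x)\<^sup>2)) \<partial>lborel)"
  proof (rule nn_integral_cong_AE)
    show "AE x in lborel. ennreal ((g x)\<^sup>2) = liminf (\<lambda>n. ennreal ((f n x)\<^sup>2))"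
      using ae
    proof eventually_elim
      case (elim x)
      then have "(\<lambda>n. ennreal ((f n x)\<^sup>2)) \<longlonglongrightarrow> ennreal ((g x)\<^sup>2)" by (intro tendsto_intros) auto
      then show ?case using lim_imp_Liminf[OF sequentially_bot] by metis
    qed
  qed
  also have "\<dots> \<le> liminf (\<lambda>n. \<integral>\<^sup>+x. ennreal ((f n x)\<^sup>2) \<partial>lborel)"
    by (rule nn_integral_liminf) simp
  also have "\<dots> = liminf (\<lambda>n. ennreal ((norm (mk (f n)))\<^sup>2))" by (simp add: nn_norm_mk_sq f)
  also have "\<dots> \<le> ennreal (C\<^sup>2)"
    using b by (intro Liminf_le) (auto intro!: always_eventually ennreal_leI power_mono)
  finally have *: "(\<integral>\<^sup>+x. ennreal ((g x)\<^sup>2) \<partial>lborel) \<le> ennreal (C\<^sup>2)" .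
  show s: "sqint g" using * g by (intro sqintI_nn) (auto intro: le_less_trans)
  have "(norm (mk g))\<^sup>2 \<le> C\<^sup>2" using * by (simp add: nn_norm_mk_sq s)
  then show "norm (mk g) \<le> C" using C by (rule power2_le_imp_le)
qed

text \<open>The weighted series of the squared increments has a finite integral, since 8^n *
  (1/4)^(2n) = (1/2)^n. At almost every point its terms are then bounded, so the increments decay
  geometrically and telescope to a limit.\<close>

lemma l2_fast_AE:
  fixes X :: "nat \<Rightarrow> 'a::euclidean_space l2"
  assumes X: "\<And>n. norm (X (Suc n) - X n) \<le> (1/4) ^ n"
  shows "\<exists>g. g \<in> borel_measurable lborel \<and> (AE x in lborel. (\<lambda>n. fn (X n) x) \<longlonglongrightarrow> g x)"
proof -
  let ?f = "\<lambda>n. fn (X n)"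
  let ?d = "\<lambda>n x. ?f (Suc n) x - ?f n x"
  have d: "sqint (?d n)" "mk (?d n) = X (Suc n) - X n" for n
    by (simp_all add: sqint_diff mk_diff)
  have dm [measurable]: "?d n \<in> borel_measurable borel" for n by simp
  have "(\<integral>\<^sup>+x. (\<Sum>n. ennreal (8 ^ n * (?d n x)\<^sup>2)) \<partial>lborel)
      = (\<Sum>n. \<integral>\<^sup>+x. ennreal (8 ^ n * (?d n x)\<^sup>2) \<partial>lborel)"
    by (rule nn_integral_suminf) simp
  also have "\<dots> = (\<Sum>n. ennreal (8 ^ n * (norm (X (Suc n) - X n))\<^sup>2))"
    by (simp add: ennreal_mult nn_integral_cmult nn_norm_mk_sq[OF d(1), unfolded d(2)])
  also have "\<dots> \<le> (\<Sum>n. ennreal ((1/2) ^ n))"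
  proof (intro suminf_le ennreal_leI)
    fix n
    have "8 ^ n * (norm (X (Suc n) - X n))\<^sup>2 \<le> 8 ^ n * ((1/4) ^ n)\<^sup>2"
      using X[of n] by (intro mult_left_mono power_mono) auto
    also have "\<dots> = (1/2::real) ^ n"
      by (simp add: power2_eq_square power_mult_distrib[symmetric])
    finally show "8 ^ n * (norm (X (Suc n) - X n))\<^sup>2 \<le> (1/2) ^ n" .
  qed auto
  also have "\<dots> = ennreal (\<Sum>n. (1/2) ^ n)"
    by (intro suminf_ennreal2) (auto intro: summable_geometric)
  also have "\<dots> < \<infinity>" by simp
  finally have "AE x in lborel. (\<Sum>n. ennreal (8 ^ n * (?d n x)\<^sup>2)) \<noteq> \<infinity>"
    by (intro nn_integral_PInf_AE) auto
  then have conv: "AE x in lborel. convergent (\<lambda>n. ?f n x)"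
  proof eventually_elim
    case (elim x)
    have "summable (\<lambda>n. 8 ^ n * (?d n x)\<^sup>2)"
      using elim by (intro summable_suminf_not_top) (auto simp: infinity_ennreal_def)
    then have "(\<lambda>n. 8 ^ n * (?d n x)\<^sup>2) \<longlonglongrightarrow> 0" by (rule summable_LIMSEQ_zero)
    then have "Bseq (\<lambda>n. 8 ^ n * (?d n x)\<^sup>2)" using convergentI convergent_imp_Bseq by blast
    then obtain K where K: "K > 0" "\<And>n. norm (8 ^ n * (?d n x)\<^sup>2) \<le> K" by (rule BseqE) auto
    have "summable (\<lambda>n. ?d n x)"
    proof (rule summable_comparison_test[OF exI[of _ 0]], intro allI impI)
      fix n
      have "(?d n x)\<^sup>2 \<le> K * (1/8) ^ n"
        using K(2)[of n] by (simp add: field_simps)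
      also have "\<dots> \<le> K * (1/4) ^ n"
        using K(1) by (intro mult_left_mono power_mono) auto
      also have "\<dots> = (sqrt K * (1/2) ^ n)\<^sup>2"
      proof -
        have "((1/2) ^ n)\<^sup>2 = (1/4::real) ^ n" by (simp add: power2_eq_square flip: power_mult_distrib)
        then show ?thesis using K(1) by (simp only: power_mult_distrib real_sqrt_pow2[OF less_imp_le])
      qed
      finally have "\<bar>?d n x\<bar> \<le> \<bar>sqrt K * (1/2) ^ n\<bar>" by (simp only: abs_le_square_iff)
      then show "norm (?d n x) \<le> sqrt K * (1/2) ^ n" using K(1) by (simp add: abs_mult)
    qed (intro summable_mult summable_geometric, simp)
    then have "convergent (\<lambda>n. \<Sum>i<n. ?d i x)" by (simp add: summable_iff_convergent)
    then have "convergent (\<lambda>n. ?f n x - ?f 0 x)" by (simp only: sum_lessThan_telescope[where f="\<lambda>n. fn (X n) x"])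
    then have "convergent (\<lambda>n. (?f n x - ?f 0 x) + ?f 0 x)"
      by (rule convergent_add) (rule convergent_const)
    then show ?case by simp
  qed
  show ?thesis
  proof (intro exI[of _ "\<lambda>x. lim (\<lambda>n. ?f n x)"] conjI)
    show "(\<lambda>x. lim (\<lambda>n. ?f n x)) \<in> borel_measurable lborel"
      by (rule borel_measurable_lim_metric) simp
    show "AE x in lborel. (\<lambda>n. fn (X n) x) \<longlonglongrightarrow> lim (\<lambda>n. ?f n x)"
      using conv by eventually_elim (simp add: convergent_LIMSEQ_iff)
  qed
qed

lemma Cauchy_fast_subseq:
  fixes X :: "nat \<Rightarrow> 'b::real_normed_vector"
  assumes "Cauchy X"
  shows "\<exists>r::nat\<Rightarrow>nat. strict_mono r \<and> (\<forall>n. norm (X (r (Suc n)) - X (r n)) \<le> (1/4) ^ n)"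
proof -
  have "\<exists>M. \<forall>m\<ge>M. \<forall>n\<ge>M. dist (X m) (X n) < (1/4) ^ k" for k
    using assms by (auto simp: Cauchy_def)
  then obtain M where M: "\<And>k m n. m \<ge> M k \<Longrightarrow> n \<ge> M k \<Longrightarrow> dist (X m) (X n) < (1/4) ^ k" by metis
  define r where "r = rec_nat (M 0) (\<lambda>n rn. max (Suc rn) (M (Suc n)))"
  have r: "r 0 = M 0" "\<And>n. r (Suc n) = max (Suc (r n)) (M (Suc n))" by (simp_all add: r_def)
  have "strict_mono r" by (simp add: strict_mono_Suc_iff r less_max_iff_disj)
  moreover have rM: "r n \<ge> M n" for n by (cases n) (simp_all add: r)
  have "norm (X (r (Suc n)) - X (r n)) \<le> (1/4) ^ n" for n
  proof -
    have "r n \<le> r (Suc n)" by (simp add: r)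
    then have "dist (X (r (Suc n))) (X (r n)) < (1/4) ^ n"
      using rM[of n] by (intro M) auto
    then show ?thesis by (simp add: dist_norm)
  qed
  ultimately show ?thesis by blast
qed

text \<open>With n fixed, Fatou's lemma applied to \<open>X k - X n\<close> as k grows turns the
  Cauchy estimate into a bound on the distance from \<open>X n\<close> to the pointwise
  limit.\<close>

lemma l2_AE_limit:
  fixes X :: "nat \<Rightarrow> 'a::euclidean_space l2"
  assumes C: "Cauchy X" and m: "g \<in> borel_measurable lborel"
    and ae: "AE x in lborel. (\<lambda>n. fn (X n) x) \<longlonglongrightarrow> g x"
  shows "X \<longlonglongrightarrow> mk g" "sqint g"
proof -
  have sm: "sqint (\<lambda>x. g x - fn (X n) x) \<and> norm (mk (\<lambda>x. g x - fn (X n) x)) \<le> e"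
    if N: "\<And>k. k \<ge> N \<Longrightarrow> norm (X k - X n) \<le> e" for n N e
  proof -
    have s: "sqint (\<lambda>x. fn (X (k + N)) x - fn (X n) x)" for k by (simp add: sqint_diff)
    have b: "norm (mk (\<lambda>x. fn (X (k + N)) x - fn (X n) x)) \<le> e" for k
      using N[of "k + N"] by (simp add: mk_diff)
    have a: "AE x in lborel. (\<lambda>k. fn (X (k + N)) x - fn (X n) x) \<longlonglongrightarrow> g x - fn (X n) x"
      using ae by eventually_elim (intro tendsto_intros LIMSEQ_ignore_initial_segment)
    have "(\<lambda>x. g x - fn (X n) x) \<in> borel_measurable lborel" using m by simp
    from fatou_l2[OF s b this a] show ?thesis by blast
  qed
  obtain B where B: "\<And>n. norm (X n) \<le> B"
    using Cauchy_Bseq[OF C] by (auto simp: Bseq_def)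
  show g: "sqint g"
    using fatou_l2[of "\<lambda>n. fn (X n)" B, OF _ _ m ae] B by simp
  show "X \<longlonglongrightarrow> mk g"
    unfolding LIMSEQ_def
  proof (intro allI impI)
    fix e :: real assume e: "e > 0"
    obtain N where N: "\<And>k n. k \<ge> N \<Longrightarrow> n \<ge> N \<Longrightarrow> norm (X k - X n) < e / 2"
      using C e unfolding Cauchy_def dist_norm by (meson half_gt_zero)
    have "dist (X n) (mk g) < e" if "n \<ge> N" for n
    proof -
      have "norm (mk (\<lambda>x. g x - fn (X n) x)) \<le> e / 2"
        using sm[of N n "e/2"] N that by (auto intro: less_imp_le)
      then have "norm (mk g - X n) \<le> e / 2" using g by (simp add: mk_diff)
      then show ?thesis using e by (simp add: dist_norm norm_minus_commute)
    qed
    then show "\<exists>N. \<forall>n\<ge>N. dist (X n) (mk g) < e" by blast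
  qed
qed

instance l2 :: (euclidean_space) complete_space
proof
  fix X :: "nat \<Rightarrow> 'a l2" assume C: "Cauchy X"
  obtain r :: "nat \<Rightarrow> nat" where r: "strict_mono r" "\<And>n. norm (X (r (Suc n)) - X (r n)) \<le> (1/4) ^ n"
    using Cauchy_fast_subseq[OF C] by blast
  obtain g where g: "g \<in> borel_measurable lborel" "AE x in lborel. (\<lambda>n. fn ((X \<circ> r) n) x) \<longlonglongrightarrow> g x"
    using l2_fast_AE[of "X \<circ> r"] r(2) by auto
  have "Cauchy (X \<circ> r)" using C r(1) by (rule Cauchy_subseq_Cauchy)
  then have "(X \<circ> r) \<longlonglongrightarrow> mk g" using l2_AE_limit(1)[OF _ g] by blast
  then have "X \<longlonglongrightarrow> mk g" using C r(1) by (metis Cauchy_converges_subseq)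
  then show "convergent X" by (auto simp: convergent_def)
qed

text \<open>Needed to insert a norm limit into the nonlinearity, which acts pointwise. A rapidly
  converging subsequence has a pointwise limit, and uniqueness of limits in norm identifies it with
  \<open>u\<close>.\<close>

lemma l2_tendsto_AE_subseq:
  fixes X :: "nat \<Rightarrow> 'a::euclidean_space l2"
  assumes "X \<longlonglongrightarrow> u"
  shows "\<exists>r::nat\<Rightarrow>nat. strict_mono r \<and> (AE x in lborel. (\<lambda>n. fn (X (r n)) x) \<longlonglongrightarrow> fn u x)"
proof -
  have C: "Cauchy X" using assms LIMSEQ_imp_Cauchy by blast
  obtain r :: "nat \<Rightarrow> nat" where r: "strict_mono r" "\<And>n. norm (X (r (Suc n)) - X (r n)) \<le> (1/4) ^ n"
    using Cauchy_fast_subseq[OF C] by blast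
  obtain g where g: "g \<in> borel_measurable lborel" "AE x in lborel. (\<lambda>n. fn ((X \<circ> r) n) x) \<longlonglongrightarrow> g x"
    using l2_fast_AE[of "X \<circ> r"] r(2) by auto
  have C': "Cauchy (X \<circ> r)" using C r(1) by (rule Cauchy_subseq_Cauchy)
  have "(X \<circ> r) \<longlonglongrightarrow> mk g" "sqint g" using l2_AE_limit[OF C' g] by blast+
  moreover have "(X \<circ> r) \<longlonglongrightarrow> u" using assms r(1) by (rule LIMSEQ_subseq_LIMSEQ)
  ultimately have "u = mk g" "sqint g" using LIMSEQ_unique by auto
  then have "AE x in lborel. fn u x = g x" using fn_mk by auto
  with g(2) have "AE x in lborel. (\<lambda>n. fn (X (r n)) x) \<longlonglongrightarrow> fn u x"
    by eventually_elim (simp add: comp_def)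
  with r(1) show ?thesis by blast
qed

text \<open>Replaces norm continuity of the nonlinearity. The test element is cut down to the set
  where the convergence has already become good; there dominated convergence applies, while the part
  cut off is small in norm and is paired with differences bounded by 2 R.\<close>

lemma AE_bounded_weak_conv:
  fixes X :: "nat \<Rightarrow> 'a::euclidean_space l2"
  assumes b: "\<And>n. norm (X n) \<le> R"
    and ae: "AE x in lborel. (\<lambda>n. fn (X n) x) \<longlonglongrightarrow> fn z x"
  shows "norm z \<le> R" "(\<lambda>n. inner (X n) y) \<longlonglongrightarrow> inner z y"
proof -
  show z: "norm z \<le> R"
    using fatou_l2(2)[of "\<lambda>n. fn (X n)" R "fn z"] b ae by simp
  have R: "0 \<le> R" using z norm_ge_zero order_trans by blast
  \<comment> \<open>The tolerance is the modulus of the test function itself: its square then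
    dominates the integrand, and the sets exhaust almost all points where \<open>fn y\<close> is
    nonzero.\<close>
  define A where "A N = {x. \<forall>n\<ge>N. \<bar>fn (X n) x - fn z x\<bar> \<le> \<bar>fn y x\<bar>}" for N
  define g where "g N x = indicator (A N) x * fn y x" for N x
  have A [measurable]: "A N \<in> sets borel" for N unfolding A_def by measurable
  have gm [measurable]: "g N \<in> borel_measurable borel" for N unfolding g_def by measurable
  have gle: "\<bar>g N x\<bar> \<le> \<bar>fn y x\<bar>" for N x by (simp add: g_def indicator_def)
  have sg: "sqint (g N)" for N
    by (rule sqint_bound[OF sqint_fn[of y]]) (use gle in auto)
  have gconv: "AE x in lborel. (\<lambda>N. g N x) \<longlonglongrightarrow> fn y x"
    using ae
  proof eventually_elim
    case (elim x)
    show ?case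
    proof (cases "fn y x = 0")
      case True then show ?thesis by (simp add: g_def)
    next
      case False
      have "(\<lambda>n. \<bar>fn (X n) x - fn z x\<bar>) \<longlonglongrightarrow> 0"
        using elim by (auto intro!: tendsto_rabs_zero simp: LIM_zero_iff)
      then obtain N where N: "\<And>n. n \<ge> N \<Longrightarrow> \<bar>fn (X n) x - fn z x\<bar> < \<bar>fn y x\<bar>"
        using False by (auto simp: LIMSEQ_def) (metis zero_less_abs_iff)
      have "g M x = fn y x" if "M \<ge> N" for M
      proof -
        have "x \<in> A M" unfolding A_def using N that by (auto intro!: less_imp_le[OF N])
        then show ?thesis by (simp add: g_def)
      qed
      then show ?thesis by (intro tendsto_eventually) (auto simp: eventually_sequentially)
    qed
  qed
  have gl2: "(\<lambda>N. mk (g N)) \<longlonglongrightarrow> y"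
  proof -
    have "(\<lambda>N. \<integral>x. (g N x - fn y x)\<^sup>2 \<partial>lborel) \<longlonglongrightarrow> (\<integral>x. 0 \<partial>(lborel::'a measure))"
    proof (rule integral_dominated_convergence)
      show "integrable lborel (\<lambda>x. (fn y x)\<^sup>2)" using sqint_fn[of y] by (simp add: sqint_def)
      show "AE x in lborel. norm ((g N x - fn y x)\<^sup>2) \<le> (fn y x)\<^sup>2" for N
        by (intro AE_I2) (simp add: g_def indicator_def)
      show "AE x in lborel. (\<lambda>N. (g N x - fn y x)\<^sup>2) \<longlonglongrightarrow> 0"
        using gconv
      proof eventually_elim
        case (elim x)
        then have "(\<lambda>N. (g N x - fn y x)\<^sup>2) \<longlonglongrightarrow> (fn y x - fn y x)\<^sup>2" by (intro tendsto_intros)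
        then show ?case by simp
      qed
    qed auto
    then have "(\<lambda>N. (norm (mk (g N) - y))\<^sup>2) \<longlonglongrightarrow> 0"
      using norm_mk_sq[OF sqint_diff[OF sg sqint_fn[of y]]] by (simp add: mk_diff sg)
    then have "(\<lambda>N. sqrt ((norm (mk (g N) - y))\<^sup>2)) \<longlonglongrightarrow> sqrt 0" by (rule tendsto_real_sqrt)
    then show ?thesis by (simp add: tendsto_norm_zero_iff LIM_zero_iff)
  qed
  have fixg: "(\<lambda>n. inner (X n - z) (mk (g N))) \<longlonglongrightarrow> 0" for N
  proof -
    \<comment> \<open>The shift by N is needed because membership in \<open>A N\<close> controls the
      differences only from index N on.\<close>
    have "(\<lambda>n. \<integral>x. (fn (X (n + N)) x - fn z x) * g N x \<partial>lborel) \<longlonglongrightarrow> (\<integral>x. 0 \<partial>(lborel::'a measure))"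
    proof (rule integral_dominated_convergence)
      show "integrable lborel (\<lambda>x. (fn y x)\<^sup>2)" using sqint_fn[of y] by (simp add: sqint_def)
      show "AE x in lborel. norm ((fn (X (n + N)) x - fn z x) * g N x) \<le> (fn y x)\<^sup>2" for n
      proof (intro AE_I2)
        fix x
        show "norm ((fn (X (n + N)) x - fn z x) * g N x) \<le> (fn y x)\<^sup>2"
        proof (cases "x \<in> A N")
          case True
          then have "\<bar>fn (X (n + N)) x - fn z x\<bar> \<le> \<bar>fn y x\<bar>" by (auto simp: A_def)
          then have "\<bar>fn (X (n + N)) x - fn z x\<bar> * \<bar>fn y x\<bar> \<le> \<bar>fn y x\<bar> * \<bar>fn y x\<bar>"
            by (intro mult_right_mono) auto
          with True show ?thesis by (simp add: g_def abs_mult power2_eq_square flip: abs_mult)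
        qed (simp add: g_def)
      qed
      show "AE x in lborel. (\<lambda>n. (fn (X (n + N)) x - fn z x) * g N x) \<longlonglongrightarrow> 0"
        using ae
      proof eventually_elim
        case (elim x)
        then have "(\<lambda>n. (fn (X (n + N)) x - fn z x) * g N x) \<longlonglongrightarrow> (fn z x - fn z x) * g N x"
          by (intro tendsto_intros LIMSEQ_ignore_initial_segment)
        then show ?case by simp
      qed
    qed auto
    then have "(\<lambda>n. inner (X (n + N) - z) (mk (g N))) \<longlonglongrightarrow> 0"
      using inner_mk[OF sqint_diff[OF sqint_fn sqint_fn] sg] by (simp add: mk_diff)
    then show ?thesis by (rule LIMSEQ_offset)
  qed
  show "(\<lambda>n. inner (X n) y) \<longlonglongrightarrow> inner z y"
    unfolding LIMSEQ_def
  proof (intro allI impI)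
    fix e :: real assume e: "e > 0"
    \<comment> \<open>The difference \<open>X n - z\<close> has norm at most 2 R, so the cut-off
      error contributes at most e / 2; the 1 added to R avoids a division by zero.\<close>
    have "\<forall>\<^sub>F N in sequentially. dist (mk (g N)) y < e / (4 * (R + 1))"
      using gl2 e R by (intro tendstoD) auto
    then obtain N where N: "norm (mk (g N) - y) < e / (4 * (R + 1))"
      by (auto simp: eventually_sequentially dist_norm)
    obtain M where M: "\<And>n. n \<ge> M \<Longrightarrow> \<bar>inner (X n - z) (mk (g N))\<bar> < e / 2"
      using tendstoD[OF fixg[of N], of "e/2"] e by (auto simp: eventually_sequentially dist_real_def)
    have "dist (inner (X n) y) (inner z y) < e" if "n \<ge> M" for n
    proof -
      have "inner (X n) y - inner z y = inner (X n - z) (mk (g N)) - inner (X n - z) (mk (g N) - y)"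
        by (simp add: inner_simps)
      moreover have "\<bar>inner (X n - z) (mk (g N) - y)\<bar> \<le> (2 * R) * (e / (4 * (R + 1)))"
      proof -
        have "\<bar>inner (X n - z) (mk (g N) - y)\<bar> \<le> norm (X n - z) * norm (mk (g N) - y)"
          by (rule Cauchy_Schwarz_ineq2)
        also have "\<dots> \<le> (2 * R) * (e / (4 * (R + 1)))"
          using norm_triangle_ineq4[of "X n" z] b[of n] z N R by (intro mult_mono) auto
        finally show ?thesis .
      qed
      moreover have "(2 * R) * (e / (4 * (R + 1))) \<le> e / 2"
        using R e by (simp add: field_simps)
      ultimately show ?thesis using M[OF that] by (simp add: dist_real_def)
    qed
    then show "\<exists>M. \<forall>n\<ge>M. dist (inner (X n) y) (inner z y) < e" by blast
  qed
qed

subsection \<open>Continuous and continuously differentiable functions of compact support\<close>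

definition dd :: "('a::euclidean_space \<Rightarrow> real) \<Rightarrow> 'a \<Rightarrow> 'a \<Rightarrow> real" where
  "dd \<phi> b x = frechet_derivative \<phi> (at x) b"

definition C1 :: "('a::euclidean_space \<Rightarrow> real) set" where
  "C1 = {\<phi>. (\<forall>x. \<phi> differentiable (at x)) \<and> (\<forall>b. continuous_on UNIV (dd \<phi> b))}"

text \<open>Some compact set carrying the function, rather than the closure of its nonzero set:
  sums, products and compositions only need unions, intersections and images of such sets.\<close>

definition csupp :: "'a::euclidean_space set \<Rightarrow> ('a \<Rightarrow> real) \<Rightarrow> bool" where
  "csupp U \<phi> \<longleftrightarrow> (\<exists>K. compact K \<and> K \<subseteq> U \<and> (\<forall>x. x \<notin> K \<longrightarrow> \<phi> x = 0))"

definition CC :: "'a::euclidean_space set \<Rightarrow> ('a \<Rightarrow> real) set" where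
  "CC U = {\<phi>. continuous_on UNIV \<phi> \<and> csupp U \<phi>}"

definition C1c :: "'a::euclidean_space set \<Rightarrow> ('a \<Rightarrow> real) set" where
  "C1c U = {\<phi>\<in>C1. csupp U \<phi>}"

lemma dd_has_derivative: "\<phi> differentiable (at x) \<Longrightarrow> (\<phi> has_derivative (\<lambda>b. dd \<phi> b x)) (at x)"
  unfolding dd_def using frechet_derivative_works by blast

lemma C1_has_derivative: "\<phi> \<in> C1 \<Longrightarrow> (\<phi> has_derivative (\<lambda>b. dd \<phi> b x)) (at x)"
  by (simp add: C1_def dd_has_derivative)

lemma dd_eq: "(\<phi> has_derivative D) (at x) \<Longrightarrow> dd \<phi> b x = D b"
  using frechet_derivative_at[of \<phi> D x] by (simp add: dd_def)

lemma C1_I: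
  assumes "\<And>x. (\<phi> has_derivative D x) (at x)" "\<And>b. continuous_on UNIV (\<lambda>x. D x b)"
  shows "\<phi> \<in> C1 \<and> dd \<phi> b = (\<lambda>x. D x b)"
proof -
  have e: "dd \<phi> b = (\<lambda>x. D x b)" for b using assms(1) by (auto intro: dd_eq)
  moreover have "\<phi> \<in> C1" unfolding C1_def using assms e by (auto simp: differentiable_def)
  ultimately show ?thesis by blast
qed

lemma C1_cont: "\<phi> \<in> C1 \<Longrightarrow> continuous_on UNIV \<phi>"
  using C1_has_derivative has_derivative_continuous continuous_on_eq_continuous_at
  by (metis continuous_at_imp_continuous_on)

lemma C1_dd_cont: "\<phi> \<in> C1 \<Longrightarrow> continuous_on UNIV (dd \<phi> b)"
  by (simp add: C1_def)

lemma C1c_C1: "\<phi> \<in> C1c U \<Longrightarrow> \<phi> \<in> C1" by (simp add: C1c_def)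

lemma csupp_mono: "csupp U \<phi> \<Longrightarrow> U \<subseteq> V \<Longrightarrow> csupp V \<phi>" unfolding csupp_def by blast

lemma CC_mono: "\<phi> \<in> CC U \<Longrightarrow> U \<subseteq> V \<Longrightarrow> \<phi> \<in> CC V" by (auto simp: CC_def csupp_mono)

lemma C1c_mono: "\<phi> \<in> C1c U \<Longrightarrow> U \<subseteq> V \<Longrightarrow> \<phi> \<in> C1c V" by (auto simp: C1c_def csupp_mono)

lemma C1c_CC: "\<phi> \<in> C1c U \<Longrightarrow> \<phi> \<in> CC U" by (auto simp: C1c_def CC_def C1_cont)

lemma dd_zero_outside:
  assumes "closed K" "\<And>x. x \<notin> K \<Longrightarrow> \<phi> x = 0" "x \<notin> K"
  shows "dd \<phi> b x = 0"
proof -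
  have "(\<phi> has_derivative (\<lambda>b. 0)) (at x)"
    by (rule has_derivative_transform_within_open[of "\<lambda>x. 0" _ x UNIV "- K"])
       (use assms in \<open>auto simp: open_Compl\<close>)
  then show ?thesis by (rule dd_eq)
qed

lemma csupp_dd: "csupp U \<phi> \<Longrightarrow> csupp U (dd \<phi> b)"
  unfolding csupp_def using dd_zero_outside compact_imp_closed by metis

lemma C1c_dd_CC: "\<phi> \<in> C1c U \<Longrightarrow> dd \<phi> b \<in> CC U"
  by (auto simp: C1c_def CC_def C1_dd_cont csupp_dd)

lemma dd_add_dir: "\<phi> \<in> C1 \<Longrightarrow> dd \<phi> (a + b) x = dd \<phi> a x + dd \<phi> b x"
  using linear_add[OF has_derivative_linear[OF C1_has_derivative]] .

lemma dd_scale_dir: "\<phi> \<in> C1 \<Longrightarrow> dd \<phi> (c *\<^sub>R b) x = c * dd \<phi> b x"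
  using linear_scale[OF has_derivative_linear[OF C1_has_derivative]] by simp

lemma dd_sum_dir: "\<phi> \<in> C1 \<Longrightarrow> dd \<phi> (\<Sum>i\<in>A. f i) x = (\<Sum>i\<in>A. dd \<phi> (f i) x)"
  using linear_sum[OF has_derivative_linear[OF C1_has_derivative]] .

lemma dd_expand: "\<phi> \<in> C1 \<Longrightarrow> dd \<phi> v x = (\<Sum>b\<in>Basis. (v \<bullet> b) * dd \<phi> b x)"
  using dd_sum_dir[of \<phi> "\<lambda>b. (v \<bullet> b) *\<^sub>R b" Basis x]
  by (simp only: euclidean_representation dd_scale_dir)

lemma C1_add: "\<phi> \<in> C1 \<Longrightarrow> \<psi> \<in> C1 \<Longrightarrow> (\<lambda>x. \<phi> x + \<psi> x) \<in> C1 \<and> dd (\<lambda>x. \<phi> x + \<psi> x) b = (\<lambda>x. dd \<phi> b x + dd \<psi> b x)"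
  by (rule C1_I[of "\<lambda>x. \<phi> x + \<psi> x" "\<lambda>x b. dd \<phi> b x + dd \<psi> b x"])
    (auto intro!: has_derivative_add C1_has_derivative continuous_on_add C1_dd_cont)

lemma C1_mult: "\<phi> \<in> C1 \<Longrightarrow> \<psi> \<in> C1 \<Longrightarrow>
    (\<lambda>x. \<phi> x * \<psi> x) \<in> C1 \<and> dd (\<lambda>x. \<phi> x * \<psi> x) b = (\<lambda>x. \<phi> x * dd \<psi> b x + dd \<phi> b x * \<psi> x)"
  by (rule C1_I[of "\<lambda>x. \<phi> x * \<psi> x" "\<lambda>x b. \<phi> x * dd \<psi> b x + dd \<phi> b x * \<psi> x"])
    (auto intro!: has_derivative_mult C1_has_derivative continuous_on_add continuous_on_mult[OF C1_cont C1_dd_cont] continuous_on_mult[OF C1_dd_cont C1_cont])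

lemma C1_const: "(\<lambda>x::'a::euclidean_space. c) \<in> C1 \<and> dd (\<lambda>x::'a. c) b = (\<lambda>x. 0)"
  by (rule C1_I[of "\<lambda>x. c" "\<lambda>x b. 0"]) auto

lemma C1_scale: "\<phi> \<in> C1 \<Longrightarrow> (\<lambda>x. c * \<phi> x) \<in> C1 \<and> dd (\<lambda>x. c * \<phi> x) b = (\<lambda>x. c * dd \<phi> b x)"
  using C1_mult[of "\<lambda>x. c" \<phi> b] C1_const[of c b] by simp

lemma C1_diff: "\<phi> \<in> C1 \<Longrightarrow> \<psi> \<in> C1 \<Longrightarrow> (\<lambda>x. \<phi> x - \<psi> x) \<in> C1 \<and> dd (\<lambda>x. \<phi> x - \<psi> x) b = (\<lambda>x. dd \<phi> b x - dd \<psi> b x)"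
  using C1_add[of \<phi> "\<lambda>x. -1 * \<psi> x" b] C1_scale[of \<psi> "-1" b] by simp

lemma csupp_add: "csupp U \<phi> \<Longrightarrow> csupp U \<psi> \<Longrightarrow> csupp U (\<lambda>x. \<phi> x + \<psi> x)"
  unfolding csupp_def by (elim exE, rule_tac x="K \<union> Ka" in exI) auto

lemma csupp_mult1: "csupp U \<phi> \<Longrightarrow> csupp U (\<lambda>x. \<phi> x * m x)"
  unfolding csupp_def by (elim exE, rule_tac x="K" in exI) auto

lemma csupp_mult2: "csupp U \<phi> \<Longrightarrow> csupp U (\<lambda>x. m x * \<phi> x)"
  unfolding csupp_def by (elim exE, rule_tac x="K" in exI) auto

lemma csupp_diff: "csupp U \<phi> \<Longrightarrow> csupp U \<psi> \<Longrightarrow> csupp U (\<lambda>x. \<phi> x - \<psi> x)"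
  unfolding csupp_def by (elim exE, rule_tac x="K \<union> Ka" in exI) auto

lemma csupp_zero: "csupp U (\<lambda>x. 0)"
  unfolding csupp_def by (intro exI[of _ "{}"]) auto

lemma C1c_add: "\<phi> \<in> C1c U \<Longrightarrow> \<psi> \<in> C1c U \<Longrightarrow> (\<lambda>x. \<phi> x + \<psi> x) \<in> C1c U"
  by (auto simp: C1c_def C1_add csupp_add)

lemma C1c_diff: "\<phi> \<in> C1c U \<Longrightarrow> \<psi> \<in> C1c U \<Longrightarrow> (\<lambda>x. \<phi> x - \<psi> x) \<in> C1c U"
  by (auto simp: C1c_def C1_diff csupp_diff)

lemma C1c_scale: "\<phi> \<in> C1c U \<Longrightarrow> (\<lambda>x. c * \<phi> x) \<in> C1c U"
  by (auto simp: C1c_def C1_scale csupp_mult2)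

lemma C1c_mult: "m \<in> C1 \<Longrightarrow> \<phi> \<in> C1c U \<Longrightarrow> (\<lambda>x. m x * \<phi> x) \<in> C1c U"
  by (auto simp: C1c_def C1_mult csupp_mult2)

lemma C1c_mult': "m \<in> C1c U \<Longrightarrow> \<phi> \<in> C1 \<Longrightarrow> (\<lambda>x. m x * \<phi> x) \<in> C1c U"
  by (auto simp: C1c_def C1_mult csupp_mult1)

lemma C1c_zero: "(\<lambda>x. 0) \<in> C1c U"
  by (auto simp: C1c_def C1_const csupp_zero)

lemma C1_divide:
  assumes "\<phi> \<in> C1" "\<And>x. \<phi> x \<noteq> 0"
  shows "(\<lambda>x. 1 / \<phi> x) \<in> C1 \<and> dd (\<lambda>x. 1 / \<phi> x) b = (\<lambda>x. - dd \<phi> b x / (\<phi> x)\<^sup>2)"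
proof -
  have "((\<lambda>x. 1 / \<phi> x) has_derivative (\<lambda>b. - dd \<phi> b x / (\<phi> x)\<^sup>2)) (at x)" for x
    using C1_has_derivative[OF assms(1), of x] assms(2)[of x]
    by (auto intro!: derivative_eq_intros simp: power2_eq_square field_simps)
  moreover have "continuous_on UNIV (\<lambda>x. - dd \<phi> b x / (\<phi> x)\<^sup>2)" for b
    using assms by (intro continuous_intros C1_dd_cont C1_cont) auto
  ultimately show ?thesis by (rule C1_I[of "\<lambda>x. 1 / \<phi> x" "\<lambda>x b. - dd \<phi> b x / (\<phi> x)\<^sup>2"])
qed

lemma C1_compose_affine:
  assumes "\<phi> \<in> C1"
  shows "(\<lambda>x. \<phi> (x + v)) \<in> C1 \<and> dd (\<lambda>x. \<phi> (x + v)) b = (\<lambda>x. dd \<phi> b (x + v))"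
proof -
  have "((\<lambda>x. \<phi> (x + v)) has_derivative (\<lambda>b. dd \<phi> b (x + v))) (at x)" for x
    by (rule has_derivative_compose[of "\<lambda>x. x + v" "\<lambda>b. b" x UNIV \<phi> "\<lambda>b. dd \<phi> b (x + v)", OF _ C1_has_derivative[OF assms]])
       (auto intro!: derivative_eq_intros)
  moreover have "continuous_on UNIV (\<lambda>x. dd \<phi> b (x + v))" for b
    by (rule continuous_on_compose2[OF C1_dd_cont[OF assms]]) (auto intro!: continuous_intros)
  ultimately show ?thesis by (rule C1_I[of "\<lambda>x. \<phi> (x + v)" "\<lambda>x b. dd \<phi> b (x + v)"])
qed

lemma CC_cont: "\<phi> \<in> CC U \<Longrightarrow> continuous_on UNIV \<phi>" by (simp add: CC_def)

lemma CC_mult: "continuous_on UNIV m \<Longrightarrow> \<phi> \<in> CC U \<Longrightarrow> (\<lambda>x. m x * \<phi> x) \<in> CC U"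
  by (auto simp: CC_def csupp_mult2 intro: continuous_on_mult)

lemma CC_add: "\<phi> \<in> CC U \<Longrightarrow> \<psi> \<in> CC U \<Longrightarrow> (\<lambda>x. \<phi> x + \<psi> x) \<in> CC U"
  by (auto simp: CC_def csupp_add intro: continuous_on_add)

lemma CC_measurable: "\<phi> \<in> CC U \<Longrightarrow> \<phi> \<in> borel_measurable borel"
  by (simp add: CC_def borel_measurable_continuous_onI)

lemma CC_bounded:
  assumes "\<phi> \<in> CC U"
  shows "\<exists>B\<ge>0. \<forall>x. \<bar>\<phi> x\<bar> \<le> B"
proof -
  obtain K where K: "compact K" "\<And>x. x \<notin> K \<Longrightarrow> \<phi> x = 0" using assms by (auto simp: CC_def csupp_def)
  have "compact (\<phi> ` K)"
    using K(1) assms by (intro compact_continuous_image) (auto simp: CC_def intro: continuous_on_subset)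
  then obtain B where "B > 0" "\<And>y. y \<in> \<phi> ` K \<Longrightarrow> norm y \<le> B" using compact_imp_bounded bounded_pos by metis
  then have "\<bar>\<phi> x\<bar> \<le> B" for x using K(2)[of x] by (cases "x \<in> K") auto
  then show ?thesis using \<open>B > 0\<close> by (intro exI[of _ B]) auto
qed

text \<open>Turns uniform estimates on a fixed compact set into estimates in L^2; the limits of
  difference quotients and the density of test functions both rest on it.\<close>

lemma csupp_bounded_integrable:
  assumes m: "f \<in> borel_measurable borel" and K: "compact K" "\<And>x. x \<notin> K \<Longrightarrow> f x = 0"
    and B: "\<And>x. \<bar>f x\<bar> \<le> B"
  shows "integrable lborel f" "sqint f" "norm (mk f) \<le> B * sqrt (measure lborel K)"
proof -
  have fin: "emeasure lborel K < \<infinity>"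
    using emeasure_bounded_finite[OF compact_imp_bounded[OF K(1)]] by simp
  have [measurable]: "K \<in> sets borel" using K(1) by (simp add: compact_imp_closed)
  have i: "integrable lborel (indicator K :: 'a \<Rightarrow> real)" using fin by simp
  have B0: "0 \<le> B" using B[of undefined] by linarith
  show "integrable lborel f"
    by (rule Bochner_Integration.integrable_bound[OF integrable_mult_right[OF i, of B]])
       (use m K B B0 in \<open>auto simp: indicator_def\<close>)
  have le: "(f x)\<^sup>2 \<le> B\<^sup>2 * indicator K x" for x
    using K(2)[of x] power_mono[OF B[of x], of 2] by (cases "x \<in> K") auto
  have sq: "integrable lborel (\<lambda>x. (f x)\<^sup>2)"
    by (rule Bochner_Integration.integrable_bound[OF integrable_mult_right[OF i, of "B\<^sup>2"]])
       (use m le in \<open>auto\<close>)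
  then show s: "sqint f" using m by (simp add: sqint_def)
  have "(norm (mk f))\<^sup>2 \<le> (\<integral>x. B\<^sup>2 * indicator K x \<partial>lborel)"
    unfolding norm_mk_sq[OF s] using sq i le by (intro integral_mono) auto
  also have "\<dots> = (B * sqrt (measure lborel K))\<^sup>2" by (simp add: power_mult_distrib)
  finally show "norm (mk f) \<le> B * sqrt (measure lborel K)"
    by (rule power2_le_imp_le) (use B0 in auto)
qed

lemma CC_integrable: "\<phi> \<in> CC U \<Longrightarrow> integrable lborel \<phi>"
  and CC_sqint: "\<phi> \<in> CC U \<Longrightarrow> sqint \<phi>"
proof -
  assume \<phi>: "\<phi> \<in> CC U"
  obtain B where B: "\<And>x. \<bar>\<phi> x\<bar> \<le> B" using CC_bounded[OF \<phi>] by blast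
  obtain K where K: "compact K" "\<And>x. x \<notin> K \<Longrightarrow> \<phi> x = 0"
    using \<phi> unfolding CC_def csupp_def by blast
  show "integrable lborel \<phi>" "sqint \<phi>"
    using csupp_bounded_integrable(1,2)[OF CC_measurable[OF \<phi>] K B] by blast+
qed

lemma C1c_sqint: "\<phi> \<in> C1c U \<Longrightarrow> sqint \<phi>" using C1c_CC CC_sqint by blast

lemma C1c_dd_sqint: "\<phi> \<in> C1c U \<Longrightarrow> sqint (dd \<phi> b)" using C1c_dd_CC CC_sqint by blast

lemma CC_unif_cont:
  assumes "\<phi> \<in> CC U" "e > 0"
  shows "\<exists>d>0. \<forall>x y. dist x y < d \<longrightarrow> \<bar>\<phi> x - \<phi> y\<bar> < e"
proof -
  obtain K where K: "compact K" "\<And>x. x \<notin> K \<Longrightarrow> \<phi> x = 0" using assms by (auto simp: CC_def csupp_def)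
  obtain B where B: "\<And>x. x \<in> K \<Longrightarrow> norm x \<le> B" using K(1) compact_imp_bounded bounded_iff by metis
  \<comment> \<open>A ball with one unit of room: if one of two points at distance below 1 lies in
    \<open>K\<close>, both lie in this ball.\<close>
  have "uniformly_continuous_on (cball 0 (B + 1)) \<phi>"
    using assms(1) by (intro compact_uniformly_continuous) (auto simp: CC_def intro: continuous_on_subset)
  then obtain d where d: "d > 0" "\<And>x y. x \<in> cball 0 (B+1) \<Longrightarrow> y \<in> cball 0 (B+1) \<Longrightarrow> dist y x < d \<Longrightarrow> dist (\<phi> y) (\<phi> x) < e"
    using assms(2) unfolding uniformly_continuous_on_def by metis
  have "\<bar>\<phi> x - \<phi> y\<bar> < e" if "dist x y < min d 1" for x y
  proof (cases "x \<in> K \<or> y \<in> K")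
    case True
    then have "norm x \<le> B + 1 \<and> norm y \<le> B + 1"
      using B that norm_triangle_sub[of x y] norm_triangle_sub[of y x]
      by (auto simp: dist_norm norm_minus_commute) (smt (verit) B norm_minus_commute)+
    then show ?thesis using d(2)[of y x] that by (auto simp: dist_real_def)
  next
    case False
    then show ?thesis using K(2) assms(2) by simp
  qed
  then show ?thesis using d(1) by (intro exI[of _ "min d 1"]) auto
qed

subsection \<open>Measure preserving maps and multipliers acting on square integrable functions\<close>

definition mpres :: "('a::euclidean_space \<Rightarrow> 'a) \<Rightarrow> bool" where
  "mpres \<Phi> \<longleftrightarrow> \<Phi> \<in> borel_measurable borel \<and> distr lborel borel \<Phi> = lborel"

lemma mpres_integral:
  assumes "mpres \<Phi>" "f \<in> borel_measurable borel"
  shows "(\<integral>x. f (\<Phi> x) \<partial>lborel) = (\<integral>x. f x \<partial>lborel :: real)" "integrable lborel (\<lambda>x. f (\<Phi> x)) \<longleftrightarrow> integrable lborel f"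
proof -
  have m: "\<Phi> \<in> measurable lborel borel" using assms by (simp add: mpres_def)
  have e: "distr lborel borel \<Phi> = lborel" using assms by (simp add: mpres_def)
  show "(\<integral>x. f (\<Phi> x) \<partial>lborel) = (\<integral>x. f x \<partial>lborel)"
    using integral_distr[OF m assms(2)] by (simp add: e)
  show "integrable lborel (\<lambda>x. f (\<Phi> x)) \<longleftrightarrow> integrable lborel f"
    using integrable_distr_eq[OF m assms(2)] by (simp add: e)
qed

lemma mpres_nn_integral:
  assumes "mpres \<Phi>" "f \<in> borel_measurable borel"
  shows "(\<integral>\<^sup>+x. f (\<Phi> x) \<partial>lborel) = (\<integral>\<^sup>+x. f x \<partial>lborel)"
  using nn_integral_distr[of \<Phi> lborel borel f] assms by (simp add: mpres_def)

lemma mpres_AE: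
  assumes "mpres \<Phi>" "AE x in lborel. P x"
  shows "AE x in lborel. P (\<Phi> x)"
proof (rule AE_distrD[of \<Phi> lborel borel P])
  show "\<Phi> \<in> measurable lborel borel" using assms by (simp add: mpres_def)
  have "distr lborel borel \<Phi> = lborel" using assms by (simp add: mpres_def)
  then show "AE x in distr lborel borel \<Phi>. P x" using assms(2) by metis
qed

lemma mpres_sqint: "mpres \<Phi> \<Longrightarrow> sqint f \<Longrightarrow> sqint (\<lambda>x. f (\<Phi> x))"
  using mpres_integral(2)[of \<Phi> "\<lambda>x. (f x)\<^sup>2"] by (auto simp: sqint_def mpres_def intro: measurable_compose)

lemma mpres_translation: "mpres (\<lambda>x. x + v)"
proof -
  have "(\<lambda>x. x + v) = (+) v" by (auto simp: add.commute)
  then show ?thesis using lborel_distr_plus[of v] by (simp add: mpres_def)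
qed

lemma mpres_reflection: "mpres (\<lambda>y. v - y)"
proof -
  have "lborel = density (distr lborel borel (\<lambda>x. v + (-1) *\<^sub>R x)) (\<lambda>_. ennreal (\<bar>-1::real\<bar> ^ DIM('a)))"
    by (rule lborel_affine) auto
  then show ?thesis by (simp add: mpres_def density_1)
qed

definition comp_op :: "('a::euclidean_space \<Rightarrow> 'a) \<Rightarrow> 'a l2 \<Rightarrow> 'a l2" where
  "comp_op \<Phi> u = mk (\<lambda>x. fn u (\<Phi> x))"

text \<open>Measure preservation makes the composition independent of the representative: the
  preimage of a null set is null.\<close>

lemma comp_op_mk: "mpres \<Phi> \<Longrightarrow> sqint f \<Longrightarrow> comp_op \<Phi> (mk f) = mk (\<lambda>x. f (\<Phi> x))"
  unfolding comp_op_def using mpres_AE[OF _ fn_mk, of \<Phi> f]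
  by (subst mk_eq_iff) (simp_all add: mpres_sqint)

lemma comp_op_inner: "mpres \<Phi> \<Longrightarrow> comp_op \<Phi> u \<bullet> comp_op \<Phi> v = u \<bullet> v"
  unfolding comp_op_def using mpres_integral(1)[of \<Phi> "\<lambda>x. fn u x * fn v x"]
  by (simp add: inner_mk mpres_sqint inner_fn[of u v])

lemma comp_op_linear: assumes "mpres \<Phi>" shows "linear (comp_op \<Phi>)"
proof
  fix u v :: "'a l2" and c :: real
  note c = comp_op_mk[OF assms]
  show "comp_op \<Phi> (u + v) = comp_op \<Phi> u + comp_op \<Phi> v"
    using c[OF sqint_add[OF sqint_fn[of u] sqint_fn[of v]]] by (simp add: mk_add mpres_sqint[OF assms] comp_op_def)
  show "comp_op \<Phi> (c *\<^sub>R u) = c *\<^sub>R comp_op \<Phi> u"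
    using c[OF sqint_scale[OF sqint_fn[of u]], of c] by (simp add: mk_scale mpres_sqint[OF assms] comp_op_def)
qed

lemma comp_op_norm: "mpres \<Phi> \<Longrightarrow> norm (comp_op \<Phi> u) = norm u"
  by (simp add: norm_eq_sqrt_inner comp_op_inner)

lemma comp_op_bounded_linear: "mpres \<Phi> \<Longrightarrow> bounded_linear (comp_op \<Phi>)"
  by (intro bounded_linear_intro[where K=1]) (auto simp: comp_op_norm linear_add[OF comp_op_linear] linear_scale[OF comp_op_linear])

lemma comp_op_compose:
  assumes "mpres \<Phi>" "mpres \<Psi>"
  shows "comp_op \<Phi> (comp_op \<Psi> u) = comp_op (\<lambda>x. \<Psi> (\<Phi> x)) u"
  unfolding comp_op_def[of \<Psi>] comp_op_mk[OF assms(1) mpres_sqint[OF assms(2) sqint_fn]]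
  by (simp add: comp_op_def)

definition bmult :: "('a::euclidean_space \<Rightarrow> real) \<Rightarrow> bool" where
  "bmult m \<longleftrightarrow> m \<in> borel_measurable borel \<and> (\<exists>B. \<forall>x. \<bar>m x\<bar> \<le> B)"

definition mul :: "('a::euclidean_space \<Rightarrow> real) \<Rightarrow> 'a l2 \<Rightarrow> 'a l2" where
  "mul m u = mk (\<lambda>x. m x * fn u x)"

lemma bmult_sqint:
  assumes "bmult m" "sqint f"
  shows "sqint (\<lambda>x. m x * f x)"
proof -
  obtain B where B: "\<And>x. \<bar>m x\<bar> \<le> B" using assms by (auto simp: bmult_def)
  have "\<bar>m x * f x\<bar> \<le> \<bar>B * f x\<bar>" for x
    using B[of x] by (auto simp: abs_mult intro!: mult_right_mono)
  moreover have "(\<lambda>x. m x * f x) \<in> borel_measurable lborel"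
    using assms by (auto simp: bmult_def sqint_def)
  ultimately show ?thesis using sqint_bound[OF sqint_scale[OF assms(2), of B]] by auto
qed

lemma mul_mk: "bmult m \<Longrightarrow> sqint f \<Longrightarrow> mul m (mk f) = mk (\<lambda>x. m x * f x)"
  unfolding mul_def using fn_mk[of f]
  by (subst mk_eq_iff) (simp_all add: bmult_sqint eventually_mono)

lemma mul_linear: assumes "bmult m" shows "linear (mul m)"
proof
  fix u v :: "'a l2" and c :: real
  note c = mul_mk[OF assms]
  show "mul m (u + v) = mul m u + mul m v"
    using c[OF sqint_add[OF sqint_fn[of u] sqint_fn[of v]]]
    by (simp add: mk_add bmult_sqint[OF assms] mul_def distrib_left)
  show "mul m (c *\<^sub>R u) = c *\<^sub>R mul m u"
    using c[OF sqint_scale[OF sqint_fn[of u]], of c] mk_scale[OF bmult_sqint[OF assms sqint_fn[of u]], of c]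
    by (simp add: mk_scale mul_def mult.left_commute)
qed

lemma mul_norm:
  assumes "m \<in> borel_measurable borel" "\<And>x. \<bar>m x\<bar> \<le> B"
  shows "norm (mul m u) \<le> B * norm u"
proof -
  have B: "0 \<le> B" using assms(2)[of undefined] by linarith
  have m: "bmult m" using assms by (auto simp: bmult_def)
  have "norm (mk (\<lambda>x. m x * fn u x)) \<le> norm (mk (\<lambda>x. B * fn u x))"
    using assms(2) B by (intro norm_mk_mono bmult_sqint[OF m] sqint_scale sqint_fn)
      (auto simp: abs_mult intro!: mult_right_mono)
  also have "\<dots> = B * norm u" using B by (simp add: mk_scale)
  finally show ?thesis by (simp add: mul_def)
qed

lemma mul_bounded_linear: "bmult m \<Longrightarrow> bounded_linear (mul m)"
proof -
  assume m: "bmult m"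
  then obtain B where B: "\<And>x. \<bar>m x\<bar> \<le> B" by (auto simp: bmult_def)
  show ?thesis
    by (rule bounded_linear_intro[where K=B])
       (use m mul_norm[OF _ B] in \<open>auto simp: linear_add[OF mul_linear] linear_scale[OF mul_linear] bmult_def mult.commute\<close>)
qed

lemma mul_inner: "bmult m \<Longrightarrow> mul m u \<bullet> v = u \<bullet> mul m v"
  unfolding mul_def by (subst inner_mk_right, simp add: bmult_sqint, subst inner_commute,
    subst inner_mk_right, simp add: bmult_sqint) (simp add: mult_ac)

subsection \<open>Shears are measure preserving\<close>

text \<open>Where \<beta> is constant the map is a translation. A level set is invariant along e, so
  the translation carries the part of it that lands in U onto the part of U inside the level set;
  there are only countably many levels.\<close>

lemma emeasure_countable_shear:
  fixes e :: "'a::euclidean_space" and \<beta> :: "'a \<Rightarrow> int"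
  assumes [measurable]: "\<beta> \<in> measurable borel (count_space UNIV)" "U \<in> sets borel"
    and inv: "\<And>x t. \<beta> (x + t *\<^sub>R e) = \<beta> x"
  shows "emeasure lborel {x. x + (c * real_of_int (\<beta> x)) *\<^sub>R e \<in> U} = emeasure lborel U"
proof -
  define A where "A n = {x. \<beta> x = int_decode n \<and> x + (c * real_of_int (int_decode n)) *\<^sub>R e \<in> U}" for n
  define B where "B n = {x. \<beta> x = int_decode n \<and> x \<in> U}" for n
  have [measurable]: "A n \<in> sets borel" "B n \<in> sets borel" for n unfolding A_def B_def by measurable
  have eq: "emeasure lborel (A n) = emeasure lborel (B n)" for n
  proof -
    let ?v = "(c * real_of_int (int_decode n)) *\<^sub>R e"
    have "A n = (\<lambda>x. x + ?v) -` B n" unfolding A_def B_def by (auto simp: inv)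
    moreover have "emeasure (distr lborel borel (\<lambda>x. x + ?v)) (B n) = emeasure lborel ((\<lambda>x. x + ?v) -` B n)"
      by (subst emeasure_distr) auto
    moreover have "distr lborel borel (\<lambda>x. x + ?v) = lborel" using mpres_translation[of ?v] by (simp add: mpres_def)
    ultimately show ?thesis by simp
  qed
  have d: "disjoint_family A" "disjoint_family B" unfolding disjoint_family_on_def A_def B_def by (auto simp: int_decode_eq)
  have "{x. x + (c * real_of_int (\<beta> x)) *\<^sub>R e \<in> U} = (\<Union>n. A n)"
    unfolding A_def by auto (metis int_encode_inverse)
  also have "emeasure lborel \<dots> = (\<Sum>n. emeasure lborel (A n))" by (rule suminf_emeasure[symmetric]) (auto simp: d)
  also have "\<dots> = (\<Sum>n. emeasure lborel (B n))" by (simp add: eq)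
  also have "\<dots> = emeasure lborel (\<Union>n. B n)" by (rule suminf_emeasure) (auto simp: d)
  also have "(\<Union>n. B n) = U" unfolding B_def by auto (metis int_encode_inverse)
  finally show ?thesis .
qed

text \<open>\<beta> is approximated by step functions with values in the multiples of 1 / (n + 1),
  for which equality holds. U being open, its indicator is lower semicontinuous, and Fatou's lemma
  yields one inequality.\<close>

lemma emeasure_shear_le:
  fixes e :: "'a::euclidean_space" and \<beta> :: "'a \<Rightarrow> real"
  assumes c: "continuous_on UNIV \<beta>" and inv: "\<And>x t. \<beta> (x + t *\<^sub>R e) = \<beta> x" and U: "open U"
  shows "emeasure lborel {x. x + \<beta> x *\<^sub>R e \<in> U} \<le> emeasure lborel U"
proof -
  have [measurable]: "\<beta> \<in> borel_measurable borel" using c by (rule borel_measurable_continuous_onI)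
  have [measurable]: "U \<in> sets borel" using U by simp
  define b where "b n x = \<lfloor>real (Suc n) * \<beta> x\<rfloor>" for n x
  define S where "S n x = x + ((1 / real (Suc n)) * real_of_int (b n x)) *\<^sub>R e" for n x
  have [measurable]: "b n \<in> measurable borel (count_space UNIV)" for n unfolding b_def by measurable
  have em: "emeasure lborel {x. S n x \<in> U} = emeasure lborel U" for n
    unfolding S_def by (rule emeasure_countable_shear) (auto simp: b_def inv)
  have [measurable]: "{x. S n x \<in> U} \<in> sets borel" for n unfolding S_def by measurable
  have [measurable]: "{x. x + \<beta> x *\<^sub>R e \<in> U} \<in> sets borel" by measurable
  have conv: "(\<lambda>n. S n x) \<longlonglongrightarrow> x + \<beta> x *\<^sub>R e" for x
  proof -
    have le: "\<bar>(1 / real (Suc n)) * real_of_int (b n x) - \<beta> x\<bar> \<le> 1 / real (Suc n)" for n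
    proof -
      have "real_of_int (b n x) \<le> real (Suc n) * \<beta> x" "real (Suc n) * \<beta> x < real_of_int (b n x) + 1"
        unfolding b_def by linarith+
      then have "\<bar>real_of_int (b n x) - real (Suc n) * \<beta> x\<bar> \<le> 1" by linarith
      moreover have "(1 / real (Suc n)) * real_of_int (b n x) - \<beta> x = (real_of_int (b n x) - real (Suc n) * \<beta> x) / real (Suc n)"
        by (simp add: diff_divide_distrib del: of_nat_Suc)
      ultimately show ?thesis by (simp add: abs_divide divide_right_mono del: of_nat_Suc)
    qed
    have "(\<lambda>n. (1 / real (Suc n)) * real_of_int (b n x) - \<beta> x) \<longlonglongrightarrow> 0"
      by (rule Lim_null_comparison[OF always_eventually LIMSEQ_Suc[OF lim_1_over_n]]) (use le in auto)
    then have "(\<lambda>n. (1 / real (Suc n)) * real_of_int (b n x)) \<longlonglongrightarrow> \<beta> x" by (simp only: LIM_zero_iff)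
    then show ?thesis unfolding S_def by (intro tendsto_intros)
  qed
  have "emeasure lborel {x. x + \<beta> x *\<^sub>R e \<in> U} = (\<integral>\<^sup>+x. indicator {x. x + \<beta> x *\<^sub>R e \<in> U} x \<partial>lborel)"
    by simp
  also have "\<dots> \<le> (\<integral>\<^sup>+x. liminf (\<lambda>n. indicator {x. S n x \<in> U} x) \<partial>lborel)"
  proof (rule nn_integral_mono)
    fix x
    show "indicator {x. x + \<beta> x *\<^sub>R e \<in> U} x \<le> liminf (\<lambda>n. indicator {x. S n x \<in> U} x :: ennreal)"
    proof (cases "x + \<beta> x *\<^sub>R e \<in> U")
      case True
      have "eventually (\<lambda>n. S n x \<in> U) sequentially" using conv U True by (rule topological_tendstoD)
      then have "eventually (\<lambda>n. 1 \<le> (indicator {x. S n x \<in> U} x :: ennreal)) sequentially"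
        by eventually_elim simp
      then have "1 \<le> liminf (\<lambda>n. indicator {x. S n x \<in> U} x :: ennreal)" by (rule Liminf_bounded)
      then show ?thesis by (simp add: indicator_def)
    qed simp
  qed
  also have "\<dots> \<le> liminf (\<lambda>n. \<integral>\<^sup>+x. indicator {x. S n x \<in> U} x \<partial>lborel)"
    by (rule nn_integral_liminf) simp
  also have "\<dots> = emeasure lborel U" by (simp add: em Liminf_const)
  finally show ?thesis .
qed

text \<open>The opposite inequality is the same estimate for the inverse shear, which subtracts
  \<beta>: being constant along e, \<beta> takes the same value before and after the move. Equality
  on open boxes identifies the measure.\<close>

lemma mpres_shear:
  fixes e :: "'a::euclidean_space" and \<beta> :: "'a \<Rightarrow> real"
  assumes c: "continuous_on UNIV \<beta>" and inv: "\<And>x t. \<beta> (x + t *\<^sub>R e) = \<beta> x"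
  shows "mpres (\<lambda>x. x + \<beta> x *\<^sub>R e)"
proof -
  let ?S = "\<lambda>x. x + \<beta> x *\<^sub>R e"
  have cS: "continuous_on UNIV ?S" using c by (intro continuous_intros)
  then have m[measurable]: "?S \<in> borel_measurable borel" by (rule borel_measurable_continuous_onI)
  have eq: "emeasure lborel (?S -` U) = emeasure lborel U" if U: "open U" for U
  proof (rule antisym)
    have v: "?S -` U = {x. x + \<beta> x *\<^sub>R e \<in> U}" by auto
    show "emeasure lborel (?S -` U) \<le> emeasure lborel U" unfolding v using c inv U by (rule emeasure_shear_le)
    have "open (?S -` U)" using cS U by (simp add: continuous_on_open_vimage)
    then have "emeasure lborel {x. x + (- \<beta> x) *\<^sub>R e \<in> ?S -` U} \<le> emeasure lborel (?S -` U)"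
      using c inv by (intro emeasure_shear_le) (auto intro: continuous_intros)
    moreover have "{x. x + (- \<beta> x) *\<^sub>R e \<in> ?S -` U} = U"
    proof -
      have "?S (x + (- \<beta> x) *\<^sub>R e) = x" for x by (simp only: inv) simp
      then show ?thesis by (simp only: vimage_def mem_Collect_eq) simp
    qed
    ultimately show "emeasure lborel U \<le> emeasure lborel (?S -` U)" by simp
  qed
  have "lborel = distr lborel borel ?S"
  proof (rule lborel_eqI)
    fix l u :: 'a assume lu: "\<And>b. b \<in> Basis \<Longrightarrow> l \<bullet> b \<le> u \<bullet> b"
    have "emeasure (distr lborel borel ?S) (box l u) = emeasure lborel (?S -` box l u)"
      by (subst emeasure_distr) auto
    also have "\<dots> = emeasure lborel (box l u)" by (rule eq) (rule open_box)
    finally show "emeasure (distr lborel borel ?S) (box l u) = ennreal (\<Prod>b\<in>Basis. (u - l) \<bullet> b)"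
      using lu by simp
  qed simp
  then show ?thesis using m by (simp add: mpres_def)
qed

subsection \<open>The tangential flow along the graph of a function\<close>

lemma mvt_direction:
  fixes f :: "'a::real_normed_vector \<Rightarrow> real"
  assumes "\<And>x. (f has_derivative D x) (at x)"
  shows "\<exists>t\<in>{0<..<1}. f (x + v) - f x = D (x + t *\<^sub>R v) v"
proof -
  have d: "((\<lambda>t. f (x + t *\<^sub>R v)) has_derivative (\<lambda>s. D (x + t *\<^sub>R v) (s *\<^sub>R v))) (at t)" for t
    by (rule has_derivative_compose[of "\<lambda>t. x + t *\<^sub>R v" "\<lambda>s. s *\<^sub>R v" t UNIV f "D (x + t *\<^sub>R v)", OF _ assms])
       (auto intro!: derivative_eq_intros)
  have "\<exists>t\<in>{0<..<1}. f (x + 1 *\<^sub>R v) - f (x + 0 *\<^sub>R v) = D (x + t *\<^sub>R v) ((1 - 0) *\<^sub>R v)"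
    by (rule mvt_simple[of 0 "1::real" "\<lambda>t. f (x + t *\<^sub>R v)" "\<lambda>t s. D (x + t *\<^sub>R v) (s *\<^sub>R v)"])
      (auto intro: has_derivative_at_withinI[OF d])
  then show ?thesis by simp
qed

text \<open>\<Gamma> is a function on the whole space that is constant along e, instead of a
  function on the hyperplane, and g is its gradient. Orthogonality of \<tau> and e is left to the
  place where the region has to be preserved, so that \<Gamma> = 0 makes every translation an
  instance.\<close>

locale graph_shear =
  fixes e \<tau> :: "'a::euclidean_space" and \<Gamma> :: "'a \<Rightarrow> real" and g :: "'a \<Rightarrow> 'a" and L :: real
  assumes e: "norm e = 1"
    and deriv: "\<And>x. (\<Gamma> has_derivative (\<lambda>h. g x \<bullet> h)) (at x)"
    and lip: "\<And>x y. norm (g x - g y) \<le> L * norm (x - y)"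
    and inv: "\<And>x t. \<Gamma> (x + t *\<^sub>R e) = \<Gamma> x"
begin

definition flow :: "real \<Rightarrow> 'a \<Rightarrow> 'a" where
  "flow h x = x + h *\<^sub>R \<tau> + (\<Gamma> (x + h *\<^sub>R \<tau>) - \<Gamma> x) *\<^sub>R e"

text \<open>The generator of the flow.\<close>

definition fieldd :: "('a \<Rightarrow> real) \<Rightarrow> 'a \<Rightarrow> real" where
  "fieldd \<phi> x = dd \<phi> \<tau> x + (g x \<bullet> \<tau>) * dd \<phi> e x"

lemma L_nonneg: "0 \<le> L"
proof -
  have "0 \<le> norm (g e - g 0)" by simp
  also have "\<dots> \<le> L * 1" using lip[of e 0] by (simp add: e)
  finally show ?thesis by simp
qed

lemma g_cont: "continuous_on UNIV g"
proof -
  have "L-lipschitz_on UNIV g" using lip L_nonneg by (auto simp: lipschitz_on_def dist_norm)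
  then show ?thesis by (rule lipschitz_on_continuous_on)
qed

lemma \<Gamma>_cont: "continuous_on UNIV \<Gamma>"
  using deriv has_derivative_continuous by (metis continuous_at_imp_continuous_on)

lemma dd_\<Gamma>: "\<Gamma> \<in> C1 \<and> dd \<Gamma> b = (\<lambda>x. g x \<bullet> b)"
  by (rule C1_I[of \<Gamma> "\<lambda>x b. g x \<bullet> b"]) (auto intro!: deriv continuous_intros g_cont)

lemma g_e: "g x \<bullet> e = 0"
proof -
  have "((\<lambda>t. \<Gamma> (x + t *\<^sub>R e)) has_derivative (\<lambda>s. g x \<bullet> (s *\<^sub>R e))) (at 0)"
    by (rule has_derivative_compose[of "\<lambda>t. x + t *\<^sub>R e" "\<lambda>s. s *\<^sub>R e" 0 UNIV \<Gamma> "\<lambda>h. g x \<bullet> h"])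
       (auto intro!: derivative_eq_intros deriv)
  then have "((\<lambda>t::real. \<Gamma> x) has_derivative (\<lambda>s. s * (g x \<bullet> e))) (at 0)" by (simp add: inv)
  moreover have "((\<lambda>t::real. \<Gamma> x) has_derivative (\<lambda>s. 0)) (at 0)" by simp
  ultimately have "(\<lambda>s::real. s * (g x \<bullet> e)) = (\<lambda>s. 0)" by (rule has_derivative_unique)
  then show ?thesis by (metis mult_1)
qed

lemma g_inv: "g (x + t *\<^sub>R e) = g x"
proof -
  have "((\<lambda>y. \<Gamma> (y + t *\<^sub>R e)) has_derivative (\<lambda>h. g (x + t *\<^sub>R e) \<bullet> h)) (at x)"
    by (rule has_derivative_compose[of "\<lambda>y. y + t *\<^sub>R e" "\<lambda>h. h" x UNIV \<Gamma>])
       (auto intro!: derivative_eq_intros deriv)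
  then have "(\<Gamma> has_derivative (\<lambda>h. g (x + t *\<^sub>R e) \<bullet> h)) (at x)" by (simp add: inv)
  then have "(\<lambda>h. g (x + t *\<^sub>R e) \<bullet> h) = (\<lambda>h. g x \<bullet> h)" using deriv by (rule has_derivative_unique)
  then have "\<forall>h. g (x + t *\<^sub>R e) \<bullet> h = g x \<bullet> h" by metis
  then show ?thesis by (simp only: vector_eq_rdot)
qed

lemma flow_0: "flow 0 x = x" by (simp add: flow_def)

text \<open>\<Gamma> does not see displacements along e, so the corrections in direction e telescope
  and the maps form a one-parameter group.\<close>

lemma flow_flow: "flow k (flow h x) = flow (h + k) x"
proof -
  have 1: "\<Gamma> (flow h x) = \<Gamma> (x + h *\<^sub>R \<tau>)" by (simp add: flow_def inv)
  have "flow h x + k *\<^sub>R \<tau> = (x + (h + k) *\<^sub>R \<tau>) + (\<Gamma> (x + h *\<^sub>R \<tau>) - \<Gamma> x) *\<^sub>R e"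
    by (simp add: flow_def algebra_simps)
  then have 2: "\<Gamma> (flow h x + k *\<^sub>R \<tau>) = \<Gamma> (x + (h + k) *\<^sub>R \<tau>)" by (simp only: inv)
  have "flow k (flow h x) = flow h x + k *\<^sub>R \<tau> + (\<Gamma> (flow h x + k *\<^sub>R \<tau>) - \<Gamma> (flow h x)) *\<^sub>R e"
    by (simp only: flow_def[of k])
  also have "\<dots> = flow (h + k) x" by (simp only: 1 2) (simp add: flow_def algebra_simps)
  finally show ?thesis .
qed

lemma flow_inverse: "flow h (flow (- h) x) = x" "flow (- h) (flow h x) = x"
  by (simp_all add: flow_flow flow_0)

text \<open>The flow is a shear in direction e followed by a translation.\<close>

lemma flow_mpres: "mpres (flow h)"
proof -
  have "mpres (\<lambda>x. x + (\<Gamma> (x + h *\<^sub>R \<tau>) - \<Gamma> x) *\<^sub>R e)"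
  proof (rule mpres_shear)
    show "continuous_on UNIV (\<lambda>x. \<Gamma> (x + h *\<^sub>R \<tau>) - \<Gamma> x)"
      by (intro continuous_intros continuous_on_compose2[OF \<Gamma>_cont]) auto
    show "\<Gamma> (x + t *\<^sub>R e + h *\<^sub>R \<tau>) - \<Gamma> (x + t *\<^sub>R e) = \<Gamma> (x + h *\<^sub>R \<tau>) - \<Gamma> x" for x t
      using inv[of "x + h *\<^sub>R \<tau>" t] by (simp add: inv add_ac)
  qed
  then have 1: "(\<lambda>x. x + (\<Gamma> (x + h *\<^sub>R \<tau>) - \<Gamma> x) *\<^sub>R e) \<in> borel_measurable borel"
    "distr lborel borel (\<lambda>x. x + (\<Gamma> (x + h *\<^sub>R \<tau>) - \<Gamma> x) *\<^sub>R e) = lborel" by (auto simp: mpres_def)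
  have 2: "(\<lambda>x. x + h *\<^sub>R \<tau>) \<in> borel_measurable borel" "distr lborel borel (\<lambda>x. x + h *\<^sub>R \<tau>) = lborel"
    using mpres_translation[of "h *\<^sub>R \<tau>"] by (auto simp: mpres_def)
  have f: "flow h = (\<lambda>x. x + h *\<^sub>R \<tau>) \<circ> (\<lambda>x. x + (\<Gamma> (x + h *\<^sub>R \<tau>) - \<Gamma> x) *\<^sub>R e)"
    by (auto simp: flow_def algebra_simps)
  have "distr lborel borel (flow h) = distr (distr lborel borel (\<lambda>x. x + (\<Gamma> (x + h *\<^sub>R \<tau>) - \<Gamma> x) *\<^sub>R e)) borel (\<lambda>x. x + h *\<^sub>R \<tau>)"
    unfolding f using 1(1) 2(1) by (subst distr_distr) auto
  then have "distr lborel borel (flow h) = lborel" using 1 2 by simp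
  moreover have "flow h \<in> borel_measurable borel" unfolding f comp_def using 1(1) by simp
  ultimately show ?thesis by (simp add: mpres_def)
qed

text \<open>The mean value theorem and the Lipschitz bound on g; the factor 1/2 of a Taylor
  remainder is not kept.\<close>

lemma \<Gamma>_taylor: "\<bar>\<Gamma> (x + h *\<^sub>R \<tau>) - \<Gamma> x - h * (g x \<bullet> \<tau>)\<bar> \<le> L * h\<^sup>2 * (norm \<tau>)\<^sup>2"
proof -
  obtain t where t: "t \<in> {0<..<1}" "\<Gamma> (x + h *\<^sub>R \<tau>) - \<Gamma> x = g (x + t *\<^sub>R h *\<^sub>R \<tau>) \<bullet> (h *\<^sub>R \<tau>)"
    using mvt_direction[of \<Gamma> "\<lambda>x h. g x \<bullet> h" x "h *\<^sub>R \<tau>"] deriv by blast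
  have "\<bar>\<Gamma> (x + h *\<^sub>R \<tau>) - \<Gamma> x - h * (g x \<bullet> \<tau>)\<bar> = \<bar>(g (x + t *\<^sub>R h *\<^sub>R \<tau>) - g x) \<bullet> (h *\<^sub>R \<tau>)\<bar>"
    using t by (simp add: inner_diff_left algebra_simps)
  also have "\<dots> \<le> norm (g (x + t *\<^sub>R h *\<^sub>R \<tau>) - g x) * norm (h *\<^sub>R \<tau>)" by (rule Cauchy_Schwarz_ineq2)
  also have "\<dots> \<le> (L * (\<bar>h\<bar> * norm \<tau>)) * (\<bar>h\<bar> * norm \<tau>)"
  proof (intro mult_mono)
    have "norm (g (x + t *\<^sub>R h *\<^sub>R \<tau>) - g x) \<le> L * norm (t *\<^sub>R h *\<^sub>R \<tau>)" using lip[of "x + t *\<^sub>R h *\<^sub>R \<tau>" x] by simp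
    also have "norm (t *\<^sub>R h *\<^sub>R \<tau>) = t * (\<bar>h\<bar> * norm \<tau>)" using t(1) by (simp add: abs_mult)
    also have "L * \<dots> \<le> L * (\<bar>h\<bar> * norm \<tau>)" using t(1) L_nonneg
      by (intro mult_left_mono mult_left_le_one_le) auto
    finally show "norm (g (x + t *\<^sub>R h *\<^sub>R \<tau>) - g x) \<le> L * (\<bar>h\<bar> * norm \<tau>)" .
  qed (use L_nonneg in auto)
  also have "\<dots> = L * h\<^sup>2 * (norm \<tau>)\<^sup>2" by (simp add: power2_eq_square mult_ac flip: abs_mult)
  finally show ?thesis .
qed

lemma g_bounded: "\<exists>M\<ge>0. \<forall>x\<in>cball 0 B. norm (g x) \<le> M"
proof -
  have "norm (g x) \<le> norm (g 0) + L * \<bar>B\<bar>" if "x \<in> cball 0 B" for x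
  proof -
    have "norm (g x) \<le> norm (g 0) + norm (g x - g 0)" by (rule norm_triangle_sub)
    also have "norm (g x - g 0) \<le> L * norm (x - 0)" by (rule lip)
    also have "\<dots> \<le> L * \<bar>B\<bar>" using that L_nonneg by (intro mult_left_mono) auto
    finally show ?thesis by simp
  qed
  moreover have "0 \<le> norm (g 0) + L * \<bar>B\<bar>" using L_nonneg by simp
  ultimately show ?thesis by blast
qed

lemma flow_taylor: "norm (flow h x - x - h *\<^sub>R (\<tau> + (g x \<bullet> \<tau>) *\<^sub>R e)) \<le> L * h\<^sup>2 * (norm \<tau>)\<^sup>2"
proof -
  have "flow h x - x - h *\<^sub>R (\<tau> + (g x \<bullet> \<tau>) *\<^sub>R e) = (\<Gamma> (x + h *\<^sub>R \<tau>) - \<Gamma> x - h * (g x \<bullet> \<tau>)) *\<^sub>R e"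
    by (simp add: flow_def algebra_simps)
  then show ?thesis using \<Gamma>_taylor by (simp add: e)
qed

lemma flow_displacement: "\<exists>M\<ge>0. \<forall>x\<in>cball 0 B. \<forall>h. \<bar>h\<bar> \<le> 1 \<longrightarrow> norm (flow h x - x) \<le> M * \<bar>h\<bar>"
proof -
  obtain G where G: "G \<ge> 0" "\<And>x. x \<in> cball 0 B \<Longrightarrow> norm (g x) \<le> G" using g_bounded by blast
  let ?M = "norm \<tau> + G * norm \<tau> + L * (norm \<tau>)\<^sup>2"
  have "norm (flow h x - x) \<le> ?M * \<bar>h\<bar>" if x: "x \<in> cball 0 B" and h: "\<bar>h\<bar> \<le> 1" for x h
  proof -
    have "norm (flow h x - x) \<le> norm (h *\<^sub>R (\<tau> + (g x \<bullet> \<tau>) *\<^sub>R e)) + norm (flow h x - x - h *\<^sub>R (\<tau> + (g x \<bullet> \<tau>) *\<^sub>R e))"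
      by (rule norm_triangle_sub)
    also have "norm (h *\<^sub>R (\<tau> + (g x \<bullet> \<tau>) *\<^sub>R e)) \<le> \<bar>h\<bar> * (norm \<tau> + G * norm \<tau>)"
    proof -
      have "norm (\<tau> + (g x \<bullet> \<tau>) *\<^sub>R e) \<le> norm \<tau> + \<bar>g x \<bullet> \<tau>\<bar>"
        using norm_triangle_ineq[of \<tau> "(g x \<bullet> \<tau>) *\<^sub>R e"] by (simp add: e)
      also have "\<bar>g x \<bullet> \<tau>\<bar> \<le> norm (g x) * norm \<tau>" by (rule Cauchy_Schwarz_ineq2)
      also have "\<dots> \<le> G * norm \<tau>" using G(2)[OF x] by (intro mult_right_mono) auto
      finally show ?thesis by (simp add: mult_left_mono)
    qed
    also have "norm (flow h x - x - h *\<^sub>R (\<tau> + (g x \<bullet> \<tau>) *\<^sub>R e)) \<le> L * h\<^sup>2 * (norm \<tau>)\<^sup>2" by (rule flow_taylor)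
    also have "L * h\<^sup>2 * (norm \<tau>)\<^sup>2 \<le> L * \<bar>h\<bar> * (norm \<tau>)\<^sup>2"
    proof -
      have "h\<^sup>2 \<le> \<bar>h\<bar>" using h mult_left_le[of "\<bar>h\<bar>" "\<bar>h\<bar>"] by (simp add: power2_eq_square flip: abs_mult)
      then show ?thesis using L_nonneg by (intro mult_right_mono mult_left_mono) auto
    qed
    finally show ?thesis by (simp add: algebra_simps)
  qed
  moreover have "?M \<ge> 0" using G(1) L_nonneg by simp
  ultimately show ?thesis by blast
qed

text \<open>Convergence is first shown uniformly on one ball outside which every function involved
  vanishes for times up to 1; a uniform bound there is a bound in L^2. The mean value theorem
  replaces the difference by a derivative at a nearby point.\<close>

lemma flow_diff_quotient:
  assumes \<phi>: "\<phi> \<in> C1c UNIV"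
  shows "((\<lambda>h. (1 / h) *\<^sub>R (comp_op (flow h) (mk \<phi>) - mk \<phi>)) \<longlongrightarrow> mk (fieldd \<phi>)) (at 0)"
    and "sqint (fieldd \<phi>)"
proof -
  have C1: "\<phi> \<in> C1" using \<phi> by (rule C1c_C1)
  obtain K where K: "compact K" "\<And>x. x \<notin> K \<Longrightarrow> \<phi> x = 0" using \<phi> unfolding C1c_def csupp_def by blast
  obtain B where B: "\<And>x. x \<in> K \<Longrightarrow> norm x \<le> B" using K(1) compact_imp_bounded bounded_iff by metis
  obtain M where M: "M \<ge> 0" "\<And>x h. x \<in> cball 0 B \<Longrightarrow> \<bar>h\<bar> \<le> 1 \<Longrightarrow> norm (flow h x - x) \<le> M * \<bar>h\<bar>"
    using flow_displacement by blast
  \<comment> \<open>Enlarging the radius by the largest displacement for times up to 1 ensures that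
    outside this ball neither x nor \<open>flow h x\<close> meets \<open>K\<close>; for the latter
    the displacement bound is applied to the inverse flow.\<close>
  let ?K = "cball 0 (B + M) :: 'a set"
  have out: "x \<notin> K \<and> flow h x \<notin> K" if "x \<notin> ?K" "\<bar>h\<bar> \<le> 1" for x h
  proof
    show "x \<notin> K" using B[of x] that M(1) by auto
    show "flow h x \<notin> K"
    proof
      assume f: "flow h x \<in> K"
      have "norm (flow (- h) (flow h x) - flow h x) \<le> M * \<bar>- h\<bar>"
        using B[OF f] that by (intro M(2)) auto
      also have "\<dots> \<le> M" using that M(1) by (simp add: mult_left_le)
      finally have "norm (x - flow h x) \<le> M" by (simp add: flow_inverse)
      then have "norm x \<le> B + M" using B[OF f] norm_triangle_sub[of x "flow h x"] by linarith
      then show False using that by simp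
    qed
  qed
  obtain M2 where M2: "M2 \<ge> 0" "\<And>x h. x \<in> ?K \<Longrightarrow> \<bar>h\<bar> \<le> 1 \<Longrightarrow> norm (flow h x - x) \<le> M2 * \<bar>h\<bar>"
    using flow_displacement by blast
  have ddCC: "dd \<phi> b \<in> CC UNIV" for b using \<phi> by (rule C1c_dd_CC)
  define BB where "BB = (SOME B. B \<ge> 0 \<and> (\<forall>x. \<bar>dd \<phi> e x\<bar> \<le> B))"
  have BB: "BB \<ge> 0" "\<And>x. \<bar>dd \<phi> e x\<bar> \<le> BB"
    using someI_ex[OF CC_bounded[OF ddCC[of e]]] by (auto simp: BB_def)
  have fCC: "fieldd \<phi> \<in> CC UNIV"
    unfolding fieldd_def by (intro CC_add CC_mult ddCC continuous_intros g_cont)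
  then show fs: "sqint (fieldd \<phi>)" by (rule CC_sqint)
  define sK where "sK = sqrt (measure lborel ?K)"
  have sK: "sK \<ge> 0" by (simp add: sK_def)
  show "((\<lambda>h. (1 / h) *\<^sub>R (comp_op (flow h) (mk \<phi>) - mk \<phi>)) \<longlongrightarrow> mk (fieldd \<phi>)) (at 0)"
  proof (rule tendstoI)
    fix \<epsilon> :: real assume \<epsilon>: "\<epsilon> > 0"
    \<comment> \<open>A uniform error \<eta> costs \<open>\<eta> * sK\<close> in norm; this choice
      makes that at most \<epsilon> / 2.\<close>
    define \<eta> where "\<eta> = \<epsilon> / (2 * (sK + 1))"
    have \<eta>: "\<eta> > 0" using \<epsilon> sK by (simp add: \<eta>_def)
    define N where "N = real (card (Basis::'a set))"
    have N: "N > 0" by (simp add: N_def DIM_positive)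
    have "\<forall>b. \<exists>d>0. \<forall>x y. dist x y < d \<longrightarrow> \<bar>dd \<phi> b x - dd \<phi> b y\<bar> < \<eta> / (2 * N * (M2 + 1))"
      using CC_unif_cont[OF ddCC] \<eta> N M2(1) by (simp add: add_nonneg_pos)
    then obtain d where d: "\<And>b. d b > 0"
      "\<And>b x y. dist x y < d b \<Longrightarrow> \<bar>dd \<phi> b x - dd \<phi> b y\<bar> < \<eta> / (2 * N * (M2 + 1))" by metis
    define \<delta> where "\<delta> = Min (d ` Basis)"
    have \<delta>: "\<delta> > 0" "\<And>b. b \<in> Basis \<Longrightarrow> \<delta> \<le> d b" unfolding \<delta>_def using d(1) by auto
    \<comment> \<open>The first bound makes the displacement estimates available, the second keeps
      the intermediate point within distance \<delta> of x, and the third absorbs the quadratic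
      remainder of \<Gamma> into half of the error.\<close>
    define h0 where "h0 = min 1 (min (\<delta> / (M2 + 1)) (\<eta> / (2 * (L * (norm \<tau>)\<^sup>2 * BB + 1))))"
    have h0: "h0 > 0" unfolding h0_def using \<delta> M2(1) \<eta> L_nonneg BB(1) by (auto intro!: divide_pos_pos add_nonneg_pos)
    have main: "\<bar>(1 / h) * (\<phi> (flow h x) - \<phi> x) - fieldd \<phi> x\<bar> \<le> \<eta>" if h: "h \<noteq> 0" "\<bar>h\<bar> < h0" and x: "x \<in> ?K" for h x
    proof -
      let ?v = "flow h x - x"
      have h1: "\<bar>h\<bar> \<le> 1" using h by (simp add: h0_def)
      have v: "norm ?v \<le> M2 * \<bar>h\<bar>" using M2(2)[OF x h1] .
      obtain t where t: "t \<in> {0<..<1}" "\<phi> (x + ?v) - \<phi> x = dd \<phi> ?v (x + t *\<^sub>R ?v)"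
        using mvt_direction[of \<phi> "\<lambda>x b. dd \<phi> b x" x ?v] C1_has_derivative[OF C1] by blast
      let ?y = "x + t *\<^sub>R ?v"
      have "norm (t *\<^sub>R ?v) \<le> norm ?v" using t(1) by (auto intro!: mult_left_le_one_le)
      also have "\<dots> < \<delta>"
      proof -
        have "\<bar>h\<bar> < \<delta> / (M2 + 1)" using h by (simp add: h0_def)
        then have "(M2 + 1) * \<bar>h\<bar> < \<delta>" using M2(1) by (simp add: field_simps)
        then show ?thesis using v by (simp add: algebra_simps)
      qed
      finally have dy: "dist ?y x < \<delta>" by (simp add: dist_norm)
      have "\<bar>dd \<phi> ?v ?y - dd \<phi> ?v x\<bar> = \<bar>\<Sum>b\<in>Basis. (?v \<bullet> b) * (dd \<phi> b ?y - dd \<phi> b x)\<bar>"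
        by (simp add: dd_expand[OF C1, of ?v] right_diff_distrib sum_subtractf)
      also have "\<dots> \<le> (\<Sum>b\<in>(Basis::'a set). (M2 * \<bar>h\<bar>) * (\<eta> / (2 * N * (M2 + 1))))"
      proof (rule order_trans[OF sum_abs sum_mono])
        fix b :: 'a assume b: "b \<in> Basis"
        have "\<bar>?v \<bullet> b\<bar> \<le> M2 * \<bar>h\<bar>" using Basis_le_norm[OF b, of ?v] v by linarith
        moreover have "\<bar>dd \<phi> b ?y - dd \<phi> b x\<bar> \<le> \<eta> / (2 * N * (M2 + 1))"
          using d(2)[of ?y x b] dy \<delta>(2)[OF b] by auto
        ultimately show "\<bar>(?v \<bullet> b) * (dd \<phi> b ?y - dd \<phi> b x)\<bar> \<le> (M2 * \<bar>h\<bar>) * (\<eta> / (2 * N * (M2 + 1)))"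
          using M2(1) unfolding abs_mult by (intro mult_mono) auto
      qed
      also have "\<dots> = N * ((M2 * \<bar>h\<bar>) * (\<eta> / (2 * N * (M2 + 1))))" by (simp add: N_def)
      also have "\<dots> = \<bar>h\<bar> * ((M2 / (M2 + 1)) * (\<eta> / 2))"
      proof -
        have "N * ((M2 * \<bar>h\<bar>) * (\<eta> / (2 * N * P))) = \<bar>h\<bar> * ((M2 / P) * (\<eta> / 2))" if "P \<noteq> 0" for P
          using N that by (simp add: field_simps)
        then show ?thesis using M2(1) by simp
      qed
      also have "\<dots> \<le> \<bar>h\<bar> * (1 * (\<eta> / 2))"
        using M2(1) \<eta> by (intro mult_left_mono mult_right_mono) auto
      finally have 1: "\<bar>dd \<phi> ?v ?y - dd \<phi> ?v x\<bar> \<le> \<bar>h\<bar> * (\<eta> / 2)" by simp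
      have "?v = h *\<^sub>R \<tau> + (\<Gamma> (x + h *\<^sub>R \<tau>) - \<Gamma> x) *\<^sub>R e" by (simp add: flow_def)
      then have "dd \<phi> ?v x = h * dd \<phi> \<tau> x + (\<Gamma> (x + h *\<^sub>R \<tau>) - \<Gamma> x) * dd \<phi> e x"
        by (simp only: dd_add_dir[OF C1] dd_scale_dir[OF C1])
      then have "\<bar>dd \<phi> ?v x - h * fieldd \<phi> x\<bar> = \<bar>\<Gamma> (x + h *\<^sub>R \<tau>) - \<Gamma> x - h * (g x \<bullet> \<tau>)\<bar> * \<bar>dd \<phi> e x\<bar>"
        by (simp add: fieldd_def algebra_simps flip: abs_mult)
      also have "\<dots> \<le> (L * h\<^sup>2 * (norm \<tau>)\<^sup>2) * BB"
        using \<Gamma>_taylor BB L_nonneg by (intro mult_mono) auto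
      also have "\<dots> = \<bar>h\<bar> * (\<bar>h\<bar> * (L * (norm \<tau>)\<^sup>2 * BB))"
        by (simp add: power2_eq_square mult_ac flip: abs_mult)
      also have "\<dots> \<le> \<bar>h\<bar> * (\<eta> / 2)"
      proof -
        let ?c = "L * (norm \<tau>)\<^sup>2 * BB"
        have c: "?c \<ge> 0" using L_nonneg BB(1) by simp
        have "\<bar>h\<bar> < \<eta> / (2 * (?c + 1))" using h by (simp add: h0_def)
        then have "\<bar>h\<bar> * (?c + 1) \<le> \<eta> / 2" using c by (simp add: field_simps)
        then have "\<bar>h\<bar> * ?c \<le> \<eta> / 2" by (simp add: algebra_simps)
        then show ?thesis by (intro mult_left_mono) auto
      qed
      finally have 2: "\<bar>dd \<phi> ?v x - h * fieldd \<phi> x\<bar> \<le> \<bar>h\<bar> * (\<eta> / 2)" .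
      have "\<bar>(\<phi> (flow h x) - \<phi> x) - h * fieldd \<phi> x\<bar> \<le> \<bar>h\<bar> * \<eta>"
      proof -
        have "\<phi> (flow h x) - \<phi> x = dd \<phi> ?v ?y" using t(2) by simp
        moreover have "\<bar>h\<bar> * (\<eta> / 2) + \<bar>h\<bar> * (\<eta> / 2) = \<bar>h\<bar> * \<eta>" by simp
        ultimately show ?thesis using 1 2 by linarith
      qed
      moreover have "(1 / h) * (\<phi> (flow h x) - \<phi> x) - fieldd \<phi> x = ((\<phi> (flow h x) - \<phi> x) - h * fieldd \<phi> x) / h"
        using h by (simp add: field_simps)
      ultimately show ?thesis using h by (simp add: abs_divide divide_le_eq mult.commute)
    qed
    have s\<phi>: "sqint \<phi>" using \<phi> by (rule C1c_sqint)
    have "dist ((1 / h) *\<^sub>R (comp_op (flow h) (mk \<phi>) - mk \<phi>)) (mk (fieldd \<phi>)) < \<epsilon>" if h: "h \<noteq> 0" "\<bar>h\<bar> < h0" for h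
    proof -
      let ?f = "\<lambda>x. (1 / h) * (\<phi> (flow h x) - \<phi> x) - fieldd \<phi> x"
      have h1: "\<bar>h\<bar> \<le> 1" using h by (simp add: h0_def)
      have sf: "sqint (\<lambda>x. \<phi> (flow h x))" by (rule mpres_sqint[OF flow_mpres s\<phi>])
      have zero: "?f x = 0" if "x \<notin> ?K" for x
      proof -
        have "x \<notin> K" "flow h x \<notin> K" using out[OF that h1] by auto
        moreover have "dd \<phi> b x = 0" for b
          using dd_zero_outside[of K \<phi> x b, OF compact_imp_closed[OF K(1)] K(2) \<open>x \<notin> K\<close>] .
        ultimately show ?thesis using K(2) by (simp add: fieldd_def)
      qed
      have "\<bar>?f x\<bar> \<le> \<eta>" for x
        using main[OF h, of x] zero[of x] \<eta> by (cases "x \<in> ?K") auto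
      moreover have "?f \<in> borel_measurable borel"
        using sf s\<phi> fs by (auto simp: sqint_def)
      ultimately have "norm (mk ?f) \<le> \<eta> * sK"
        unfolding sK_def by (intro csupp_bounded_integrable(3)) (use zero in auto)
      also have "\<dots> < \<epsilon>"
      proof -
        have "\<eta> * sK = (\<epsilon> / 2) * (sK / (sK + 1))" using sK by (simp add: \<eta>_def field_simps)
        also have "\<dots> \<le> (\<epsilon> / 2) * 1" using sK \<epsilon> by (intro mult_left_mono) auto
        finally show ?thesis using \<epsilon> by simp
      qed
      also have "mk ?f = (1 / h) *\<^sub>R (comp_op (flow h) (mk \<phi>) - mk \<phi>) - mk (fieldd \<phi>)"
        by (simp only: comp_op_mk[OF flow_mpres s\<phi>] mk_diff mk_scale sf s\<phi> fs sqint_diff sqint_scale)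
      finally show ?thesis by (simp add: dist_norm)
    qed
    then show "\<forall>\<^sub>F h in at 0. dist ((1 / h) *\<^sub>R (comp_op (flow h) (mk \<phi>) - mk \<phi>)) (mk (fieldd \<phi>)) < \<epsilon>"
      unfolding eventually_at using h0 by (auto simp: dist_real_def)
  qed
qed

text \<open>By the group law a step h consists of n + 1 equal steps, each an isometry, so the total
  displacement is at most n + 1 times that of one step. Letting n grow turns this into the norm of
  the generator, with constant 1.\<close>

lemma flow_bound:
  assumes \<phi>: "\<phi> \<in> C1c UNIV"
  shows "norm (comp_op (flow h) (mk \<phi>) - mk \<phi>) \<le> \<bar>h\<bar> * norm (mk (fieldd \<phi>))"
proof (cases "h = 0")
  case True
  have "flow 0 = (\<lambda>x. x)" by (auto simp: flow_0)
  then show ?thesis using True by (simp add: comp_op_def)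
next
  case False
  let ?T = "\<lambda>h. comp_op (flow h) :: 'a l2 \<Rightarrow> 'a l2"
  have T: "?T h (?T k u) = ?T (h + k) u" for h k u
    using comp_op_compose[OF flow_mpres flow_mpres, of h k u] by (simp add: flow_flow)
  have step: "norm (?T (real n * k) u - u) \<le> real n * norm (?T k u - u)" for n k u
  proof (induction n)
    case 0
    have "flow 0 = (\<lambda>x. x)" by (auto simp: flow_0)
    then show ?case by (simp add: comp_op_def)
  next
    case (Suc n)
    have "?T (real (Suc n) * k) u = ?T (real n * k) (?T k u)" by (simp add: T algebra_simps)
    then have "?T (real (Suc n) * k) u - u = ?T (real n * k) (?T k u - u) + (?T (real n * k) u - u)"
      by (simp add: linear_diff[OF comp_op_linear[OF flow_mpres]])
    then have "norm (?T (real (Suc n) * k) u - u) \<le> norm (?T k u - u) + norm (?T (real n * k) u - u)"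
      using norm_triangle_ineq comp_op_norm[OF flow_mpres] by metis
    then show ?case using Suc by (simp add: algebra_simps)
  qed
  have le: "norm (?T h (mk \<phi>) - mk \<phi>) \<le> \<bar>h\<bar> * norm ((1 / (h / real (Suc n))) *\<^sub>R (?T (h / real (Suc n)) (mk \<phi>) - mk \<phi>))" for n
  proof -
    have "norm (?T h (mk \<phi>) - mk \<phi>) \<le> real (Suc n) * norm (?T (h / real (Suc n)) (mk \<phi>) - mk \<phi>)"
      using step[of "Suc n" "h / real (Suc n)" "mk \<phi>"] by (simp del: of_nat_Suc)
    also have "\<dots> = \<bar>h\<bar> * norm ((1 / (h / real (Suc n))) *\<^sub>R (?T (h / real (Suc n)) (mk \<phi>) - mk \<phi>))"
      using False by (simp del: of_nat_Suc)
    finally show ?thesis .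
  qed
  have "filterlim (\<lambda>n. h / real (Suc n)) (at 0) sequentially"
    unfolding filterlim_at using False LIMSEQ_Suc[OF lim_const_over_n[of h]] by (auto simp del: of_nat_Suc)
  then have "(\<lambda>n. \<bar>h\<bar> * norm ((1 / (h / real (Suc n))) *\<^sub>R (?T (h / real (Suc n)) (mk \<phi>) - mk \<phi>))) \<longlonglongrightarrow> \<bar>h\<bar> * norm (mk (fieldd \<phi>))"
    by (intro tendsto_intros filterlim_compose[OF flow_diff_quotient(1)[OF \<phi>]])
  then show ?thesis by (rule LIMSEQ_le_const) (use le in blast)
qed

end

subsection \<open>Translations and integration by parts\<close>

text \<open>The flow of the zero graph function is the translation by h \<tau>, so the estimates for
  flows specialise to translations.\<close>

lemma translation_shear:
  fixes z :: "'a::euclidean_space"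
  shows "\<exists>e. graph_shear e (\<lambda>x. 0) (\<lambda>x. 0::'a) 0"
proof -
  obtain e :: 'a where "e \<in> Basis" using nonempty_Basis by blast
  then show ?thesis by (intro exI[of _ e] graph_shear.intro) auto
qed

lemma translation_quotient:
  fixes z :: "'a::euclidean_space"
  assumes "\<phi> \<in> C1c UNIV"
  shows "((\<lambda>h. (1 / h) *\<^sub>R (comp_op (\<lambda>x. x + h *\<^sub>R z) (mk \<phi>) - mk \<phi>)) \<longlongrightarrow> mk (dd \<phi> z)) (at 0)"
    and "norm (comp_op (\<lambda>x. x + z) (mk \<phi>) - mk \<phi>) \<le> norm (mk (dd \<phi> z))"
proof -
  obtain e :: 'a where e: "graph_shear e (\<lambda>x. 0) (\<lambda>x. 0::'a) 0" using translation_shear by blast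
  interpret graph_shear e z "\<lambda>x. 0" "\<lambda>x. 0::'a" 0 by (rule e)
  have f: "flow h = (\<lambda>x. x + h *\<^sub>R z)" for h by (auto simp: flow_def)
  have g: "fieldd \<phi> = dd \<phi> z" by (auto simp: fieldd_def)
  show "((\<lambda>h. (1 / h) *\<^sub>R (comp_op (\<lambda>x. x + h *\<^sub>R z) (mk \<phi>) - mk \<phi>)) \<longlongrightarrow> mk (dd \<phi> z)) (at 0)"
    using flow_diff_quotient(1)[OF assms] by (simp add: f g)
  show "norm (comp_op (\<lambda>x. x + z) (mk \<phi>) - mk \<phi>) \<le> norm (mk (dd \<phi> z))"
    using flow_bound[OF assms, of 1] by (simp add: f g)
qed

lemma translation_adjoint: "comp_op (\<lambda>x. x + z) u \<bullet> v = u \<bullet> comp_op (\<lambda>x. x - z) v"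
proof -
  have m: "mpres (\<lambda>x. x - z)" using mpres_translation[of "- z"] by simp
  have "u \<bullet> comp_op (\<lambda>x. x - z) v = comp_op (\<lambda>x. x + z) u \<bullet> comp_op (\<lambda>x. x + z) (comp_op (\<lambda>x. x - z) v)"
    by (rule comp_op_inner[OF mpres_translation, symmetric])
  also have "comp_op (\<lambda>x. x + z) (comp_op (\<lambda>x. x - z) v) = v"
    by (simp add: comp_op_compose[OF mpres_translation m]) (simp add: comp_op_def)
  finally show ?thesis by simp
qed

lemma quotient_adjoint:
  "(1 / h) *\<^sub>R (comp_op (\<lambda>x. x + h *\<^sub>R z) u - u) \<bullet> v =
   - (u \<bullet> (1 / (- h)) *\<^sub>R (comp_op (\<lambda>x. x + (- h) *\<^sub>R z) v - v))"
  using translation_adjoint[of "h *\<^sub>R z" u v] by (simp add: inner_diff_left inner_diff_right algebra_simps)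

lemma filterlim_uminus_at_0: "filterlim (\<lambda>h::real. - h) (at 0) (at 0)"
  by (auto simp: filterlim_at eventually_at_filter intro!: tendsto_eq_intros)

text \<open>The adjoint of the difference quotient with step h is minus the one with step -h; both
  sides are limits of the same inner product.\<close>

lemma ibp:
  assumes \<phi>: "\<phi> \<in> C1c UNIV" and \<psi>: "\<psi> \<in> C1c UNIV"
  shows "mk (dd \<phi> b) \<bullet> mk \<psi> = - (mk \<phi> \<bullet> mk (dd \<psi> b))"
proof -
  have 1: "((\<lambda>h. (1 / h) *\<^sub>R (comp_op (\<lambda>x. x + h *\<^sub>R b) (mk \<phi>) - mk \<phi>) \<bullet> mk \<psi>) \<longlongrightarrow> mk (dd \<phi> b) \<bullet> mk \<psi>) (at 0)"
    by (intro tendsto_intros translation_quotient \<phi>)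
  have "((\<lambda>h. - (mk \<phi> \<bullet> (1 / (- h)) *\<^sub>R (comp_op (\<lambda>x. x + (- h) *\<^sub>R b) (mk \<psi>) - mk \<psi>))) \<longlongrightarrow> - (mk \<phi> \<bullet> mk (dd \<psi> b))) (at 0)"
    by (intro tendsto_intros filterlim_compose[OF translation_quotient(1)[OF \<psi>] filterlim_uminus_at_0])
  then have 2: "((\<lambda>h. (1 / h) *\<^sub>R (comp_op (\<lambda>x. x + h *\<^sub>R b) (mk \<phi>) - mk \<phi>) \<bullet> mk \<psi>) \<longlongrightarrow> - (mk \<phi> \<bullet> mk (dd \<psi> b))) (at 0)"
    by (simp only: quotient_adjoint)
  show ?thesis by (rule tendsto_unique[OF _ 1 2]) simp
qed

lemma csupp_translate: "csupp UNIV \<phi> \<Longrightarrow> csupp UNIV (\<lambda>x. \<phi> (x + v))"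
proof -
  assume "csupp UNIV \<phi>"
  then obtain K where K: "compact K" "\<And>x. x \<notin> K \<Longrightarrow> \<phi> x = 0" unfolding csupp_def by blast
  have "compact ((+) (- v) ` K)" using K(1) by (rule compact_translation)
  moreover have "\<phi> (x + v) = 0" if "x \<notin> (+) (- v) ` K" for x
  proof -
    have "x + v \<notin> K"
    proof
      assume "x + v \<in> K"
      then have "(- v) + (x + v) \<in> (+) (- v) ` K" by (rule imageI)
      with that show False by simp
    qed
    then show ?thesis by (rule K(2))
  qed
  ultimately show ?thesis unfolding csupp_def by blast
qed

lemma C1c_translate: "\<phi> \<in> C1c UNIV \<Longrightarrow> (\<lambda>x. \<phi> (x + v)) \<in> C1c UNIV"
  by (auto simp: C1c_def C1_compose_affine csupp_translate)

text \<open>Neither function has second derivatives. The derivative in direction a is replaced by a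
  difference quotient, which stays in the class and commutes with the derivative in direction b, so
  that one integration by parts suffices before the limit.\<close>

lemma mixed_derivatives:
  assumes \<phi>: "\<phi> \<in> C1c UNIV" and \<psi>: "\<psi> \<in> C1c UNIV"
  shows "mk (dd \<phi> a) \<bullet> mk (dd \<psi> b) = mk (dd \<phi> b) \<bullet> mk (dd \<psi> a)"
proof -
  let ?T = "\<lambda>h u. (1 / h) *\<^sub>R (comp_op (\<lambda>x. x + h *\<^sub>R a) u - u)"
  have eq: "?T h (mk \<phi>) \<bullet> mk (dd \<psi> b) = mk (dd \<phi> b) \<bullet> ?T (- h) (mk \<psi>)" for h
  proof -
    let ?\<phi> = "\<lambda>x. (1 / h) * (\<phi> (x + h *\<^sub>R a) - \<phi> x)"
    have t: "(\<lambda>x. \<phi> (x + h *\<^sub>R a)) \<in> C1c UNIV" using \<phi> by (rule C1c_translate)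
    have q: "?\<phi> \<in> C1c UNIV" by (intro C1c_scale C1c_diff t \<phi>)
    have dq: "dd ?\<phi> b = (\<lambda>x. (1 / h) * (dd \<phi> b (x + h *\<^sub>R a) - dd \<phi> b x))"
      using C1_scale[of "\<lambda>x. \<phi> (x + h *\<^sub>R a) - \<phi> x" "1 / h" b] C1_diff[of "\<lambda>x. \<phi> (x + h *\<^sub>R a)" \<phi> b]
        C1_compose_affine[of \<phi> "h *\<^sub>R a" b] C1c_C1[OF \<phi>] by simp
    have sd: "sqint (\<lambda>x. dd \<phi> b (x + h *\<^sub>R a))"
      by (rule mpres_sqint[OF mpres_translation C1c_dd_sqint[OF \<phi>]])
    have "?T h (mk \<phi>) = mk ?\<phi>"
      by (simp only: comp_op_mk[OF mpres_translation] C1c_sqint[OF \<phi>] C1c_sqint[OF t] mk_diff mk_scale sqint_diff)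
    then have "?T h (mk \<phi>) \<bullet> mk (dd \<psi> b) = - (mk (dd ?\<phi> b) \<bullet> mk \<psi>)"
      using ibp[OF q \<psi>, of b] by simp
    also have "mk (dd ?\<phi> b) = ?T h (mk (dd \<phi> b))"
      by (simp only: sd dq comp_op_mk[OF mpres_translation] C1c_dd_sqint[OF \<phi>] mk_diff mk_scale sqint_diff)
    also have "- (?T h (mk (dd \<phi> b)) \<bullet> mk \<psi>) = mk (dd \<phi> b) \<bullet> ?T (- h) (mk \<psi>)"
      by (simp only: quotient_adjoint minus_minus)
    finally show ?thesis .
  qed
  have 1: "((\<lambda>h. ?T h (mk \<phi>) \<bullet> mk (dd \<psi> b)) \<longlongrightarrow> mk (dd \<phi> a) \<bullet> mk (dd \<psi> b)) (at 0)"
    by (intro tendsto_intros translation_quotient \<phi>)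
  have "((\<lambda>h. mk (dd \<phi> b) \<bullet> ?T (- h) (mk \<psi>)) \<longlongrightarrow> mk (dd \<phi> b) \<bullet> mk (dd \<psi> a)) (at 0)"
    by (intro tendsto_intros filterlim_compose[OF translation_quotient(1)[OF \<psi>] filterlim_uminus_at_0])
  then have 2: "((\<lambda>h. ?T h (mk \<phi>) \<bullet> mk (dd \<psi> b)) \<longlongrightarrow> mk (dd \<phi> b) \<bullet> mk (dd \<psi> a)) (at 0)"
    by (simp only: eq)
  show ?thesis by (rule tendsto_unique[OF _ 1 2]) simp
qed

text \<open>Translating by more than the diameter makes \<open>\<phi>\<close> and its translate orthogonal, so
  that the translation estimate becomes the Poincare inequality.\<close>

lemma poincare_C1c:
  fixes U :: "'a::euclidean_space set"
  assumes "bounded U" "b \<in> Basis"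
  shows "\<exists>P\<ge>0. \<forall>\<phi>\<in>C1c U. norm (mk \<phi>) \<le> P * norm (mk (dd \<phi> b))"
proof -
  obtain B where B: "\<And>x. x \<in> U \<Longrightarrow> norm x \<le> B" using assms(1) bounded_iff by metis
  let ?P = "2 * \<bar>B\<bar> + 1"
  have "norm (mk \<phi>) \<le> ?P * norm (mk (dd \<phi> b))" if \<phi>: "\<phi> \<in> C1c U" for \<phi>
  proof -
    let ?z = "?P *\<^sub>R b"
    let ?T = "comp_op (\<lambda>x. x + ?z) :: 'a l2 \<Rightarrow> 'a l2"
    have \<phi>': "\<phi> \<in> C1c UNIV" using \<phi> C1c_mono by blast
    have s: "sqint \<phi>" using \<phi> by (rule C1c_sqint)
    have zero: "\<phi> x = 0" if "x \<notin> U" for x using \<phi> that unfolding C1c_def csupp_def by blast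
    have "\<phi> (x + ?z) * \<phi> x = 0" for x
    proof (rule ccontr)
      assume "\<phi> (x + ?z) * \<phi> x \<noteq> 0"
      then have "x + ?z \<in> U" "x \<in> U" using zero by auto
      then have "norm (x + ?z) \<le> B" "norm x \<le> B" using B by auto
      moreover have "norm ?z \<le> norm (x + ?z) + norm x" using norm_triangle_ineq4[of "x + ?z" x] by simp
      moreover have "norm ?z = ?P" using assms(2) by simp
      ultimately show False by linarith
    qed
    then have z: "(\<lambda>x. \<phi> (x + ?z) * \<phi> x) = (\<lambda>x. 0)" by (rule ext)
    have orth: "?T (mk \<phi>) \<bullet> mk \<phi> = 0"
      by (simp only: comp_op_mk[OF mpres_translation s] inner_mk[OF mpres_sqint[OF mpres_translation s] s] z) simp
    \<comment> \<open>By orthogonality the squared norm of the difference is twice that of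
      \<open>mk \<phi>\<close>.\<close>
    have "(norm (mk \<phi>))\<^sup>2 \<le> (norm (?T (mk \<phi>) - mk \<phi>))\<^sup>2"
      using orth by (simp add: power2_norm_eq_inner inner_diff_left inner_diff_right inner_commute)
    then have "norm (mk \<phi>) \<le> norm (?T (mk \<phi>) - mk \<phi>)" by (rule power2_le_imp_le) simp
    also have "\<dots> \<le> norm (mk (dd \<phi> ?z))" by (rule translation_quotient(2)[OF \<phi>'])
    also have "dd \<phi> ?z = (\<lambda>x. ?P * dd \<phi> b x)" using dd_scale_dir[OF C1c_C1[OF \<phi>]] by blast
    also have "norm (mk (\<lambda>x. ?P * dd \<phi> b x)) = ?P * norm (mk (dd \<phi> b))"
      by (subst mk_scale[OF C1c_dd_sqint[OF \<phi>]]) simp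
    finally show ?thesis .
  qed
  moreover have "?P \<ge> 0" by simp
  ultimately show ?thesis by blast
qed

subsection \<open>Smooth bump functions and mollification\<close>

text \<open>The negative powers make the family closed under differentiation, up to linear combinations.\<close>

definition bexp :: "nat \<Rightarrow> real \<Rightarrow> real" where
  "bexp k t = (if t > 0 then exp (- 1 / t) / t ^ k else 0)"

lemma bexp_tendsto_0: "(bexp k \<longlongrightarrow> 0) (at 0)"
proof -
  have "((\<lambda>t. inverse t ^ k / exp (inverse t)) \<longlongrightarrow> (0::real)) (at_right 0)"
    using filterlim_compose[OF tendsto_power_div_exp_0 filterlim_inverse_at_top_right] .
  moreover have "\<forall>\<^sub>F t in at_right (0::real). inverse t ^ k / exp (inverse t) = bexp k t"
    unfolding eventually_at_right_field
    by (intro exI[of _ 1]) (auto simp: bexp_def field_simps exp_minus)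
  ultimately have "(bexp k \<longlongrightarrow> 0) (at_right 0)" by (rule Lim_transform_eventually)
  moreover have "(bexp k \<longlongrightarrow> 0) (at_left 0)"
    by (rule tendsto_eventually) (auto simp: eventually_at_left_field bexp_def intro!: exI[of _ "-1"])
  ultimately show ?thesis by (simp add: filterlim_split_at)
qed

lemma bexp_deriv: "(bexp k has_real_derivative (bexp (k + 2) t - k * bexp (k + 1) t)) (at t)"
proof (cases t "0::real" rule: linorder_cases)
  case less
  have "((\<lambda>t. 0) has_real_derivative 0) (at t)" by simp
  then have "(bexp k has_real_derivative 0) (at t)"
    by (rule has_field_derivative_transform_within_open[of _ _ _ "{..<0}"]) (use less in \<open>auto simp: bexp_def\<close>)
  then show ?thesis using less by (simp add: bexp_def)
next
  case equal
  \<comment> \<open>For h different from 0 the quotient is exactly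
    \<open>bexp (k + 1) h\<close>.\<close>
  have "((\<lambda>h. (bexp k h - bexp k 0) / (h - 0)) \<longlongrightarrow> 0) (at 0)"
  proof (rule Lim_transform_eventually[OF bexp_tendsto_0[of "k + 1"]])
    show "\<forall>\<^sub>F h in at 0. bexp (k + 1) h = (bexp k h - bexp k 0) / (h - 0)"
      by (auto simp: bexp_def eventually_at_filter field_simps)
  qed
  then have "(bexp k has_real_derivative 0) (at 0)" by (simp add: has_field_derivative_iff)
  then show ?thesis using equal by (simp add: bexp_def)
next
  case greater
  have "((\<lambda>t. exp (- 1 / t) / t ^ k) has_real_derivative
      (exp (- 1 / t) / t ^ (k + 2) - k * (exp (- 1 / t) / t ^ (k + 1)))) (at t)"
    using greater
    apply (cases k)
     apply (auto intro!: derivative_eq_intros simp: field_simps power2_eq_square)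
    subgoal for n by (cases n) auto
    done
  then have "(bexp k has_real_derivative (exp (- 1 / t) / t ^ (k + 2) - k * (exp (- 1 / t) / t ^ (k + 1)))) (at t)"
    by (rule has_field_derivative_transform_within_open[of _ _ _ "{0<..}"]) (use greater in \<open>auto simp: bexp_def\<close>)
  then show ?thesis using greater by (simp add: bexp_def)
qed

text \<open>An algebra that contains the bump of radius \<epsilon> and the derivatives of its own
  members. Smoothness follows from this closure alone, without formulas for iterated
  derivatives.\<close>

inductive_set bump_alg :: "real \<Rightarrow> ('a::euclidean_space \<Rightarrow> real) set" for \<epsilon> :: real where
  const: "(\<lambda>x. c) \<in> bump_alg \<epsilon>"
| inner: "(\<lambda>x. x \<bullet> b) \<in> bump_alg \<epsilon>"
| bexp: "(\<lambda>x. bexp k (\<epsilon>\<^sup>2 - x \<bullet> x)) \<in> bump_alg \<epsilon>"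
| add: "f \<in> bump_alg \<epsilon> \<Longrightarrow> f' \<in> bump_alg \<epsilon> \<Longrightarrow> (\<lambda>x. f x + f' x) \<in> bump_alg \<epsilon>"
| mult: "f \<in> bump_alg \<epsilon> \<Longrightarrow> f' \<in> bump_alg \<epsilon> \<Longrightarrow> (\<lambda>x. f x * f' x) \<in> bump_alg \<epsilon>"

lemma bump_alg_deriv:
  "f \<in> bump_alg \<epsilon> \<Longrightarrow> \<exists>D. (\<forall>x. (f has_derivative D x) (at x)) \<and> (\<forall>b. (\<lambda>x. D x b) \<in> bump_alg \<epsilon>)"
proof (induction rule: bump_alg.induct)
  case (const c)
  show ?case by (rule exI[of _ "\<lambda>x b. 0"]) (auto intro: bump_alg.const)
next
  case (inner v)
  show ?case by (rule exI[of _ "\<lambda>x b. b \<bullet> v"]) (auto intro!: bump_alg.const derivative_eq_intros)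
next
  case (bexp k)
  let ?D = "\<lambda>x b. (bexp (k + 2) (\<epsilon>\<^sup>2 - x \<bullet> x) + (- real k) * bexp (k + 1) (\<epsilon>\<^sup>2 - x \<bullet> x)) * ((-2) * (x \<bullet> b))"
  have "((\<lambda>x. bexp k (\<epsilon>\<^sup>2 - x \<bullet> x)) has_derivative ?D x) (at x)" for x :: 'a
  proof -
    have i: "((\<lambda>x. \<epsilon>\<^sup>2 - x \<bullet> x) has_derivative (\<lambda>b. (-2) * (x \<bullet> b))) (at x)"
      by (auto intro!: derivative_eq_intros simp: inner_commute)
    show ?thesis
      using has_derivative_compose[OF i bexp_deriv[unfolded has_field_derivative_def]] by (simp add: mult_ac)
  qed
  moreover have "(\<lambda>x. ?D x b) \<in> bump_alg \<epsilon>" for b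
    by (intro bump_alg.intros)
  ultimately show ?case by (intro exI[of _ ?D]) auto
next
  case (add f f')
  then obtain D D' where "\<forall>x. (f has_derivative D x) (at x)" "\<forall>b. (\<lambda>x. D x b) \<in> bump_alg \<epsilon>"
    "\<forall>x. (f' has_derivative D' x) (at x)" "\<forall>b. (\<lambda>x. D' x b) \<in> bump_alg \<epsilon>" by blast
  then show ?case by (intro exI[of _ "\<lambda>x b. D x b + D' x b"]) (auto intro!: has_derivative_add bump_alg.intros)
next
  case (mult f f')
  then obtain D D' where D: "\<And>x. (f has_derivative D x) (at x)" "\<forall>b. (\<lambda>x. D x b) \<in> bump_alg \<epsilon>"
    "\<And>x. (f' has_derivative D' x) (at x)" "\<forall>b. (\<lambda>x. D' x b) \<in> bump_alg \<epsilon>" by blast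
  show ?case
    by (rule exI[of _ "\<lambda>x b. f x * D' x b + D x b * f' x"])
       (use mult D in \<open>auto intro!: has_derivative_mult bump_alg.intros\<close>)
qed

lemma bump_alg_C1: "f \<in> bump_alg \<epsilon> \<Longrightarrow> f \<in> C1 \<and> dd f b \<in> bump_alg \<epsilon>"
proof -
  assume f: "f \<in> bump_alg \<epsilon>"
  have cont: "continuous_on UNIV h" if "h \<in> bump_alg \<epsilon>" for h :: "'a \<Rightarrow> real"
    using bump_alg_deriv[OF that] has_derivative_continuous by (metis continuous_at_imp_continuous_on)
  obtain D where D: "\<And>x. (f has_derivative D x) (at x)" "\<And>b. (\<lambda>x. D x b) \<in> bump_alg \<epsilon>"
    using bump_alg_deriv[OF f] by blast
  have "f \<in> C1 \<and> dd f b = (\<lambda>x. D x b)" by (rule C1_I) (use D cont in auto)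
  then show ?thesis using D(2) by simp
qed

lemma smooth_if_closed:
  assumes S: "\<And>f. f \<in> S \<Longrightarrow> f \<in> C1" "\<And>f b. f \<in> S \<Longrightarrow> dd f b \<in> S" and f: "f \<in> S"
  shows "smooth f"
proof -
  have "partials bs f \<in> S" for bs
  proof (induction bs)
    case (Cons b bs)
    then show ?case using S(2)[of "partials bs f" b] by (simp add: dd_def[abs_def])
  qed (simp add: f)
  then show ?thesis using S(1) unfolding smooth_def C1_def by blast
qed

section \<open>Convolution with a bump function\<close>

definition conv :: "('a::euclidean_space \<Rightarrow> real) \<Rightarrow> ('a \<Rightarrow> real) \<Rightarrow> 'a \<Rightarrow> real" where
  "conv \<phi> \<theta> x = (\<integral>y. \<phi> y * \<theta> (x - y) \<partial>lborel)"

lemma conv_swap: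
  assumes "\<phi> \<in> borel_measurable borel" "\<theta> \<in> borel_measurable borel"
  shows "conv \<phi> \<theta> x = (\<integral>y. \<phi> (x - y) * \<theta> y \<partial>lborel)"
  using mpres_integral(1)[OF mpres_reflection[of x], of "\<lambda>y. \<phi> y * \<theta> (x - y)"] assms by (simp add: conv_def)

lemma integral_cbox_lborel:
  fixes f :: "'a::euclidean_space \<Rightarrow> real"
  assumes c: "continuous_on UNIV f" and z: "\<And>x. x \<notin> cbox a b \<Longrightarrow> f x = 0"
  shows "(\<integral>x. f x \<partial>lborel) = integral (cbox a b) f"
proof -
  have "f \<in> CC UNIV" using c z unfolding CC_def csupp_def by (auto intro!: exI[of _ "cbox a b"])
  then have "integrable lborel f" by (rule CC_integrable)
  then have "(\<integral>x. f x \<partial>lborel) = integral UNIV f" by (simp add: integral_lborel)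
  also have "\<dots> = integral UNIV (\<lambda>x. if x \<in> cbox a b then f x else 0)"
    by (rule arg_cong[where f="integral UNIV"]) (use z in auto)
  also have "\<dots> = integral (cbox a b) f" by (rule integral_restrict_UNIV)
  finally show ?thesis .
qed

text \<open>Differentiation under the integral sign, all derivatives falling on \<theta>.
  Restricting to a box that contains the support of \<phi> makes the integrand and its derivative
  jointly continuous over a compact domain of integration.\<close>

lemma conv_C1:
  assumes \<phi>: "\<phi> \<in> CC UNIV" and \<theta>: "\<theta> \<in> C1"
  shows "conv \<phi> \<theta> \<in> C1 \<and> dd (conv \<phi> \<theta>) b = conv \<phi> (dd \<theta> b)"
proof -
  obtain K where K: "compact K" "\<And>x. x \<notin> K \<Longrightarrow> \<phi> x = 0" using \<phi> unfolding CC_def csupp_def by blast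
  obtain a c where ac: "K \<subseteq> cbox a c"
    using bounded_subset_cbox_symmetric[OF compact_imp_bounded[OF K(1)]] by blast
  have z: "\<phi> x = 0" if "x \<notin> cbox a c" for x using ac K(2) that by blast
  have c\<phi>: "continuous_on UNIV \<phi>" using \<phi> by (rule CC_cont)
  have cc: "continuous_on A (\<lambda>p. f (fst p - snd p))" if "continuous_on UNIV f" for f :: "'a \<Rightarrow> 'b::topological_space" and A
    by (rule continuous_on_compose2[OF that]) (auto intro!: continuous_intros)
  have c\<phi>2: "continuous_on A (\<lambda>p. \<phi> (snd p))" for A
    by (rule continuous_on_compose2[OF c\<phi>]) (auto intro!: continuous_intros)
  have conv_eq: "conv \<phi> f = (\<lambda>x. integral (cbox a c) (\<lambda>y. \<phi> y * f (x - y)))" if f: "continuous_on UNIV f" for f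
  proof
    fix x
    have "continuous_on UNIV (\<lambda>y. f (x - y))"
      by (rule continuous_on_compose2[OF f]) (auto intro!: continuous_intros)
    then show "conv \<phi> f x = integral (cbox a c) (\<lambda>y. \<phi> y * f (x - y))"
      unfolding conv_def using c\<phi> z by (intro integral_cbox_lborel continuous_intros) auto
  qed
  have conv_cont: "continuous_on UNIV (conv \<phi> f)" if f: "continuous_on UNIV f" for f
    unfolding conv_eq[OF f]
    by (rule integral_continuous_on_param) (auto simp: split_beta intro!: continuous_on_mult cc[OF f] c\<phi>2)
  \<comment> \<open>The gradient of \<theta>: the derivative must depend continuously on the point
    as a bounded linear functional, and pairing with a continuous vector field provides
    this.\<close>
  define G where "G x = (\<Sum>b\<in>Basis. dd \<theta> b x *\<^sub>R b)" for x
  have G: "G x \<bullet> v = dd \<theta> v x" for x v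
    by (simp add: G_def inner_sum_left dd_expand[OF \<theta>, of v] inner_commute[of v] mult.commute)
  have G': "v \<bullet> G x = dd \<theta> v x" for x v using G inner_commute by metis
  have Gc: "continuous_on UNIV G" unfolding G_def by (intro continuous_intros C1_dd_cont \<theta>)
  let ?fx = "\<lambda>x y. \<phi> y *\<^sub>R blinfun_inner_left (G (x - y))"
  have fxc: "continuous_on A (\<lambda>(x, y). ?fx x y)" for A
    unfolding split_beta
    by (intro continuous_intros c\<phi>2 bounded_linear.continuous_on[OF bounded_linear_blinfun_inner_left] cc[OF Gc])
  have ld: "((\<lambda>x. integral (cbox a c) (\<lambda>y. \<phi> y * \<theta> (x - y))) has_derivative blinfun_apply (integral (cbox a c) (?fx x))) (at x)" for x
  proof -
    have "((\<lambda>x. integral (cbox a c) (\<lambda>y. \<phi> y * \<theta> (x - y))) has_derivative blinfun_apply (integral (cbox a c) (?fx x))) (at x within UNIV)"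
    proof (rule leibniz_rule)
      fix x t
      have "((\<lambda>x. \<theta> (x - t)) has_derivative (\<lambda>b. dd \<theta> b (x - t))) (at x)"
        by (rule has_derivative_compose[of "\<lambda>x. x - t" "\<lambda>b. b" x UNIV \<theta> "\<lambda>b. dd \<theta> b (x - t)", OF _ C1_has_derivative[OF \<theta>]])
           (auto intro!: derivative_eq_intros)
      then have "((\<lambda>x. \<phi> t * \<theta> (x - t)) has_derivative (\<lambda>b. \<phi> t * dd \<theta> b (x - t))) (at x)"
        by (rule has_derivative_mult_right)
      moreover have "blinfun_apply (?fx x t) = (\<lambda>b. \<phi> t * dd \<theta> b (x - t))"
        by (auto simp: scaleR_blinfun.rep_eq G')
      ultimately show "((\<lambda>x. \<phi> t * \<theta> (x - t)) has_derivative blinfun_apply (?fx x t)) (at x within UNIV)" by simp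
    next
      fix x
      have "continuous_on UNIV (\<lambda>y. \<theta> (x - y))"
        by (rule continuous_on_compose2[OF C1_cont[OF \<theta>]]) (auto intro!: continuous_intros)
      then have c: "continuous_on UNIV (\<lambda>y. \<phi> y * \<theta> (x - y))" using c\<phi> by (intro continuous_intros)
      show "(\<lambda>y. \<phi> y * \<theta> (x - y)) integrable_on cbox a c"
        by (rule integrable_continuous[OF continuous_on_subset[OF c]]) simp
    qed (use fxc in auto)
    then show ?thesis by simp
  qed
  have fxi: "blinfun_apply (integral (cbox a c) (?fx x)) v = conv \<phi> (dd \<theta> v) x" for x v
  proof -
    have "?fx x integrable_on cbox a c"
    proof (rule integrable_continuous)
      have "continuous_on (cbox a c) (\<lambda>y. (\<lambda>(x, y). ?fx x y) (x, y))"
        by (rule continuous_on_compose2[OF fxc[of UNIV]]) (auto intro!: continuous_intros)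
      then show "continuous_on (cbox a c) (?fx x)" by simp
    qed
    then have "blinfun_apply (integral (cbox a c) (?fx x)) v = integral (cbox a c) (\<lambda>y. blinfun_apply (?fx x y) v)"
      by (rule blinfun_apply_integral)
    also have "\<dots> = conv \<phi> (dd \<theta> v) x"
      by (simp add: conv_eq[OF C1_dd_cont[OF \<theta>]] scaleR_blinfun.rep_eq G')
    finally show ?thesis .
  qed
  show ?thesis
  proof (rule C1_I[of "conv \<phi> \<theta>" "\<lambda>x b. conv \<phi> (dd \<theta> b) x"])
    show "(conv \<phi> \<theta> has_derivative (\<lambda>b. conv \<phi> (dd \<theta> b) x)) (at x)" for x
    proof -
      have "blinfun_apply (integral (cbox a c) (?fx x)) = (\<lambda>b. conv \<phi> (dd \<theta> b) x)" by (rule ext) (rule fxi)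
      then show ?thesis using ld[of x] unfolding conv_eq[OF C1_cont[OF \<theta>]] by metis
    qed
    show "continuous_on UNIV (\<lambda>x. conv \<phi> (dd \<theta> b) x)" for b
      by (rule conv_cont[OF C1_dd_cont[OF \<theta>]])
  qed
qed

lemma conv_commute:
  assumes "\<phi> \<in> borel_measurable borel" "\<theta> \<in> borel_measurable borel"
  shows "conv \<phi> \<theta> = conv \<theta> \<phi>"
proof
  fix x
  have "conv \<theta> \<phi> x = (\<integral>y. \<theta> (x - y) * \<phi> y \<partial>lborel)" by (rule conv_swap[OF assms(2,1)])
  also have "\<dots> = conv \<phi> \<theta> x" unfolding conv_def by (simp only: mult.commute)
  finally show "conv \<phi> \<theta> x = conv \<theta> \<phi> x" by (rule sym)
qed

definition bump :: "real \<Rightarrow> 'a::euclidean_space \<Rightarrow> real" where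
  "bump \<epsilon> x = bexp 0 (\<epsilon>\<^sup>2 - x \<bullet> x)"

lemma bump_nonneg: "0 \<le> bump \<epsilon> x" by (simp add: bump_def bexp_def)

lemma bump_pos_iff: "\<epsilon> > 0 \<Longrightarrow> bump \<epsilon> x \<noteq> 0 \<longleftrightarrow> norm x < \<epsilon>"
  using power2_less_imp_less[of "norm x" \<epsilon>] power_strict_mono[of "norm x" \<epsilon> 2] by (auto simp: bump_def bexp_def power2_norm_eq_inner[symmetric])

lemma bump_bump_alg: "bump \<epsilon> \<in> bump_alg \<epsilon>"
  unfolding bump_def[abs_def] by (rule bump_alg.bexp)

lemma bump_C1c: "\<epsilon> > 0 \<Longrightarrow> bump \<epsilon> \<in> C1c UNIV"
proof -
  assume e: "\<epsilon> > 0"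
  have "bump \<epsilon> x = 0" if "x \<notin> cball 0 \<epsilon>" for x :: 'a
    using bump_pos_iff[OF e, of x] that by auto
  then have "csupp UNIV (bump \<epsilon> :: 'a \<Rightarrow> real)"
    unfolding csupp_def using compact_cball by blast
  then show ?thesis using bump_alg_C1[OF bump_bump_alg] by (auto simp: C1c_def)
qed

lemma bump_integral_pos:
  assumes "\<epsilon> > 0"
  shows "0 < (\<integral>x. bump \<epsilon> x \<partial>(lborel :: 'a::euclidean_space measure))"
proof (rule ccontr)
  let ?I = "\<integral>x. bump \<epsilon> x \<partial>(lborel :: 'a measure)"
  have i: "integrable (lborel :: 'a measure) (bump \<epsilon>)" using CC_integrable C1c_CC bump_C1c assms by blast
  assume "\<not> 0 < ?I"
  moreover have "0 \<le> ?I" by (rule integral_nonneg_AE) (simp add: bump_nonneg)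
  ultimately have "?I = 0" by linarith
  then have "AE x::'a in lborel. bump \<epsilon> x = 0"
    using integral_nonneg_eq_0_iff_AE[OF i] by (simp add: bump_nonneg)
  then have "AE x::'a in lborel. x \<notin> ball 0 \<epsilon>"
    by eventually_elim (use bump_pos_iff[OF assms] in auto)
  then have "emeasure lborel {x::'a. \<not> x \<notin> ball 0 \<epsilon>} = 0" by (subst (asm) AE_iff_measurable[OF _ refl]) auto
  moreover have "{x::'a. \<not> x \<notin> ball 0 \<epsilon>} = ball 0 \<epsilon>" by blast
  ultimately have "emeasure lborel (ball (0::'a) \<epsilon>) = 0" by metis
  then show False using content_ball_pos[OF assms, of "0::'a"] by (simp add: measure_def)
qed

lemma C1c_smooth_test:
  assumes "smooth \<psi>" "csupp U \<psi>"
  shows "\<psi> \<in> test_functions U"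
proof -
  obtain K where K: "compact K" "K \<subseteq> U" "\<And>x. x \<notin> K \<Longrightarrow> \<psi> x = 0" using assms unfolding csupp_def by blast
  have "closure {x. \<psi> x \<noteq> 0} \<subseteq> K" using K by (intro closure_minimal) (auto simp: compact_imp_closed)
  moreover from this have "compact (closure {x. \<psi> x \<noteq> 0})"
    using K(1) by (meson bounded_subset closed_closure compact_eq_bounded_closed)
  ultimately show ?thesis using assms K(2) by (auto simp: test_functions_def)
qed

lemma test_C1c: "\<phi> \<in> test_functions U \<Longrightarrow> \<phi> \<in> C1c U"
proof -
  assume \<phi>: "\<phi> \<in> test_functions U"
  have s: "partials bs \<phi> differentiable (at x)" if "bs \<in> lists Basis" for bs x
    using \<phi> that by (auto simp: test_functions_def smooth_def)
  have 0: "\<phi> differentiable (at x)" for x using s[of "[]"] by simp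
  have c: "continuous_on UNIV (dd \<phi> b)" if "b \<in> Basis" for b
    using s[of "[b]"] that differentiable_imp_continuous_within
    by (auto simp: dd_def[abs_def] continuous_on_eq_continuous_within)
  \<comment> \<open>Smoothness is defined through the coordinate directions; the other directional
    derivatives are expanded in them.\<close>
  have e: "dd \<phi> v = (\<lambda>x. \<Sum>b\<in>Basis. (v \<bullet> b) * dd \<phi> b x)" for v
  proof
    fix x
    have "linear (\<lambda>b. dd \<phi> b x)" using dd_has_derivative[OF 0] has_derivative_linear by blast
    then have "dd \<phi> (\<Sum>b\<in>Basis. (v \<bullet> b) *\<^sub>R b) x = (\<Sum>b\<in>Basis. (v \<bullet> b) * dd \<phi> b x)"
      using linear_sum[of "\<lambda>b. dd \<phi> b x" "\<lambda>b. (v \<bullet> b) *\<^sub>R b" Basis]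
        linear_scale[of "\<lambda>b. dd \<phi> b x"] by simp
    then show "dd \<phi> v x = (\<Sum>b\<in>Basis. (v \<bullet> b) * dd \<phi> b x)" by (simp add: euclidean_representation)
  qed
  have "continuous_on UNIV (dd \<phi> v)" for v
    by (subst e) (intro continuous_on_sum continuous_on_mult continuous_on_const c)
  then have "\<phi> \<in> C1" using 0 by (auto simp: C1_def)
  moreover have "csupp U \<phi>" unfolding csupp_def
    using \<phi> by (intro exI[of _ "closure {x. \<phi> x \<noteq> 0}"]) (auto simp: test_functions_def intro: closure_subset[THEN subsetD])
  ultimately show ?thesis by (simp add: C1c_def)
qed

lemma test_dd: "\<phi> \<in> test_functions U \<Longrightarrow> b \<in> Basis \<Longrightarrow> dd \<phi> b \<in> test_functions U"
proof -
  assume \<phi>: "\<phi> \<in> test_functions U" and b: "b \<in> Basis"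
  have p: "partials bs (dd \<phi> b) = partials (bs @ [b]) \<phi>" for bs
    by (induction bs) (auto simp: dd_def[abs_def])
  have "smooth (dd \<phi> b)" using \<phi> b unfolding smooth_def p by (auto simp: test_functions_def smooth_def)
  moreover have "csupp U (dd \<phi> b)" using test_C1c[OF \<phi>] by (auto simp: C1c_def csupp_dd)
  ultimately show ?thesis by (rule C1c_smooth_test)
qed

text \<open>One compact set serves all accuracies, so that uniform closeness yields closeness in
  norm. Closeness of the derivatives belongs to the same conclusion because both estimates have to
  hold for the same \<psi>.\<close>

lemma mollify:
  fixes U :: "'a::euclidean_space set"
  assumes U: "open U" and \<phi>: "\<phi> \<in> CC U"
  shows "\<exists>K. compact K \<and> K \<subseteq> U \<and> (\<forall>x. x \<notin> K \<longrightarrow> \<phi> x = 0) \<and> (\<forall>e>0. \<exists>\<psi>\<in>test_functions U. (\<forall>x. x \<notin> K \<longrightarrow> \<psi> x = 0) \<and>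
    (\<forall>x. \<bar>\<psi> x - \<phi> x\<bar> \<le> e) \<and> (\<phi> \<in> C1c U \<longrightarrow> (\<forall>b\<in>Basis. \<forall>x. \<bar>dd \<psi> b x - dd \<phi> b x\<bar> \<le> e)))"
proof -
  obtain K where K: "compact K" "K \<subseteq> U" "\<And>x. x \<notin> K \<Longrightarrow> \<phi> x = 0" using \<phi> unfolding CC_def csupp_def by blast
  obtain r where r: "r > 0" "(\<Union>x\<in>K. cball x r) \<subseteq> U"
    using compact_subset_open_imp_cball_epsilon_subset[OF K(1) U K(2)] by blast
  let ?K = "(\<Union>x\<in>K. \<Union>y\<in>cball 0 r. {x + y})"
  have cK: "compact ?K" using K(1) by (rule compact_sums') simp
  have KU: "?K \<subseteq> U" using r(2) by (auto simp: dist_norm subset_eq)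
  have \<phi>': "\<phi> \<in> CC UNIV" using \<phi> CC_mono by blast
  have approx: "\<bar>conv f (bump \<delta>) x / (\<integral>x. bump \<delta> x \<partial>(lborel :: 'a measure)) - f x\<bar> \<le> e"
    if f: "f \<in> CC UNIV" and d: "\<delta> > 0" and u: "\<And>x y. dist x y < \<delta> \<Longrightarrow> \<bar>f x - f y\<bar> \<le> e" for f :: "'a \<Rightarrow> real" and e x and \<delta> :: real
  proof -
    let ?I = "\<integral>x. bump \<delta> x \<partial>(lborel :: 'a measure)"
    have I: "?I > 0" using bump_integral_pos[OF d] .
    have bC: "bump \<delta> \<in> CC (UNIV::'a set)" using bump_C1c[OF d] C1c_CC by blast
    have bi: "integrable (lborel :: 'a measure) (bump \<delta>)" using bC by (rule CC_integrable)
    have "continuous_on UNIV (\<lambda>y. f (x - y))"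
      by (rule continuous_on_compose2[OF CC_cont[OF f]]) (auto intro!: continuous_intros)
    then have i1: "integrable lborel (\<lambda>y. f (x - y) * bump \<delta> y)" by (rule CC_integrable[OF CC_mult[of "\<lambda>y. f (x - y)" "bump \<delta>", OF _ bC]])
    have "conv f (bump \<delta>) x - f x * ?I = (\<integral>y. f (x - y) * bump \<delta> y - f x * bump \<delta> y \<partial>lborel)"
      using i1 bi by (simp add: conv_swap[OF CC_measurable[OF f] CC_measurable[OF bC]])
    also have "\<bar>\<dots>\<bar> \<le> (\<integral>y. \<bar>f (x - y) * bump \<delta> y - f x * bump \<delta> y\<bar> \<partial>lborel)" by (rule integral_abs_bound)
    also have "\<dots> \<le> (\<integral>y. e * bump \<delta> y \<partial>(lborel :: 'a measure))"
    proof (rule integral_mono)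
      fix y :: 'a
      have "\<bar>f (x - y) - f x\<bar> * bump \<delta> y \<le> e * bump \<delta> y"
      proof (cases "bump \<delta> y = 0")
        case False
        then have "dist (x - y) x < \<delta>" using bump_pos_iff[OF d, of y] by (simp add: dist_norm)
        then show ?thesis using u bump_nonneg by (intro mult_right_mono) auto
      qed simp
      then show "\<bar>f (x - y) * bump \<delta> y - f x * bump \<delta> y\<bar> \<le> e * bump \<delta> y"
        by (simp add: left_diff_distrib[symmetric] abs_mult bump_nonneg)
    qed (use i1 bi in \<open>auto\<close>)
    also have "\<dots> = e * ?I" by simp
    finally have "\<bar>conv f (bump \<delta>) x - f x * ?I\<bar> \<le> e * ?I" .
    then have "\<bar>(conv f (bump \<delta>) x - f x * ?I) / ?I\<bar> \<le> e" using I by (simp add: abs_divide divide_le_eq)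
    then show ?thesis using I by (simp add: diff_divide_distrib)
  qed
  have "\<exists>\<psi>\<in>test_functions U. (\<forall>x. x \<notin> ?K \<longrightarrow> \<psi> x = 0) \<and>
    (\<forall>x. \<bar>\<psi> x - \<phi> x\<bar> \<le> e) \<and> (\<phi> \<in> C1c U \<longrightarrow> (\<forall>b\<in>Basis. \<forall>x. \<bar>dd \<psi> b x - dd \<phi> b x\<bar> \<le> e))" if e: "e > 0" for e
  proof -
    obtain d0 where d0: "d0 > 0" "\<And>x y. dist x y < d0 \<Longrightarrow> \<bar>\<phi> x - \<phi> y\<bar> < e"
      using CC_unif_cont[OF \<phi>' e] by blast
    have "\<forall>b. \<exists>d>0. \<phi> \<in> C1c U \<longrightarrow> (\<forall>x y. dist x y < d \<longrightarrow> \<bar>dd \<phi> b x - dd \<phi> b y\<bar> < e)"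
      using CC_unif_cont[OF C1c_dd_CC e] zero_less_one by meson
    then obtain d where d: "\<And>b. d b > 0" "\<And>b x y. \<phi> \<in> C1c U \<Longrightarrow> dist x y < d b \<Longrightarrow> \<bar>dd \<phi> b x - dd \<phi> b y\<bar> < e" by metis
    \<comment> \<open>The bound r keeps the support inside the enlarged compact set; the others are
      moduli of continuity of \<phi> and of its partial derivatives.\<close>
    define \<delta> where "\<delta> = min r (min d0 (Min (d ` Basis)))"
    have \<delta>: "\<delta> > 0" "\<delta> \<le> r" "\<delta> \<le> d0" "\<And>b. b \<in> Basis \<Longrightarrow> \<delta> \<le> d b"
      unfolding \<delta>_def using r(1) d0(1) d(1) by (auto simp: min_le_iff_disj)
    let ?I = "\<integral>x. bump \<delta> x \<partial>(lborel :: 'a measure)"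
    have I: "?I > 0" using bump_integral_pos[OF \<delta>(1)] .
    define \<psi> where "\<psi> x = (1 / ?I) * conv \<phi> (bump \<delta>) x" for x
    have mb: "bump \<delta> \<in> borel_measurable (borel :: 'a measure)"
      using CC_measurable[OF C1c_CC[OF bump_C1c[OF \<delta>(1)]]] .
    have outK: "\<psi> x = 0" if x: "x \<notin> ?K" for x
    proof -
      have z: "\<phi> y * bump \<delta> (x - y) = 0" for y
      proof (rule ccontr)
        assume "\<phi> y * bump \<delta> (x - y) \<noteq> 0"
        then have "y \<in> K" "norm (x - y) < \<delta>" using K(3) bump_pos_iff[OF \<delta>(1), of "x - y"] by auto
        then have "x \<in> ?K" using \<delta>(2) by (intro UN_I[of y] UN_I[of "x - y"]) auto
        with x show False by simp
      qed
      have "(\<lambda>y. \<phi> y * bump \<delta> (x - y)) = (\<lambda>y. 0)" using z by (rule ext)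
      then show ?thesis by (simp only: \<psi>_def conv_def) simp
    qed
    have "smooth \<psi>"
    proof (rule smooth_if_closed)
      let ?S = "{\<lambda>x. (1 / ?I) * conv \<phi> \<theta> x | \<theta>. \<theta> \<in> bump_alg \<delta>}"
      show "f \<in> C1" if fS: "f \<in> ?S" for f
      proof -
        obtain \<theta> where \<theta>: "f = (\<lambda>x. (1 / ?I) * conv \<phi> \<theta> x)" "\<theta> \<in> bump_alg \<delta>" using fS by blast
        show ?thesis
          unfolding \<theta>(1) using conv_C1[OF \<phi>', of \<theta>] bump_alg_C1[OF \<theta>(2)] C1_scale[of "conv \<phi> \<theta>" "1 / ?I"] by blast
      qed
      show "dd f b \<in> ?S" if fS: "f \<in> ?S" for f b
      proof -
        obtain \<theta> where \<theta>: "f = (\<lambda>x. (1 / ?I) * conv \<phi> \<theta> x)" "\<theta> \<in> bump_alg \<delta>" using fS by blast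
        have "dd f b = (\<lambda>x. (1 / ?I) * conv \<phi> (dd \<theta> b) x)"
          using conv_C1[OF \<phi>', of \<theta> b] bump_alg_C1[OF \<theta>(2)] C1_scale[of "conv \<phi> \<theta>" "1 / ?I" b] \<theta>(1) by simp
        then show ?thesis using bump_alg_C1[OF \<theta>(2)] by auto
      qed
      show "\<psi> \<in> ?S" unfolding \<psi>_def[abs_def] using bump_bump_alg by auto
    qed
    moreover have "csupp U \<psi>" unfolding csupp_def using cK KU outK by blast
    ultimately have t: "\<psi> \<in> test_functions U" by (rule C1c_smooth_test)
    have a1: "\<bar>\<psi> x - \<phi> x\<bar> \<le> e" for x
      using approx[OF \<phi>' \<delta>(1), of e x] d0(2) \<delta>(3) by (force simp: \<psi>_def intro: less_imp_le)
    have a2: "\<bar>dd \<psi> b x - dd \<phi> b x\<bar> \<le> e" if c: "\<phi> \<in> C1c U" and b: "b \<in> Basis" for b x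
    proof -
      have bC: "bump \<delta> \<in> CC (UNIV::'a set)" using bump_C1c[OF \<delta>(1)] C1c_CC by blast
      \<comment> \<open>After commuting the convolution the derivative falls on \<phi> instead of
        the bump, so the derivative of the mollification is the mollified derivative.\<close>
      have "conv \<phi> (bump \<delta>) = conv (bump \<delta>) \<phi>" by (rule conv_commute[OF CC_measurable[OF \<phi>] mb])
      then have "conv \<phi> (bump \<delta>) \<in> C1 \<and> dd (conv \<phi> (bump \<delta>)) b = conv (bump \<delta>) (dd \<phi> b)"
        using conv_C1[OF bC C1c_C1[OF c], of b] by simp
      also have "conv (bump \<delta>) (dd \<phi> b) = conv (dd \<phi> b) (bump \<delta>)"
        by (rule conv_commute[OF mb CC_measurable[OF C1c_dd_CC[OF c]]])
      finally have "dd \<psi> b x = conv (dd \<phi> b) (bump \<delta>) x / ?I"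
        using C1_scale[of "conv \<phi> (bump \<delta>)" "1 / ?I" b] by (simp add: \<psi>_def[abs_def])
      moreover have "\<bar>conv (dd \<phi> b) (bump \<delta>) x / ?I - dd \<phi> b x\<bar> \<le> e"
      proof (rule approx[OF _ \<delta>(1)])
        show "dd \<phi> b \<in> CC UNIV" using C1c_dd_CC[OF c] CC_mono by blast
        show "\<bar>dd \<phi> b x - dd \<phi> b y\<bar> \<le> e" if "dist x y < \<delta>" for x y
          using d(2)[OF c, of x y b] that \<delta>(4)[OF b] by auto
      qed
      ultimately show ?thesis by simp
    qed
    show ?thesis using t outK a1 a2 by blast
  qed
  moreover have "\<phi> x = 0" if x: "x \<notin> ?K" for x
  proof -
    have "x \<notin> K"
    proof
      assume "x \<in> K"
      then have "x \<in> ?K" using r(1) by (intro UN_I[of x] UN_I[of 0]) auto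
      with x show False by contradiction
    qed
    then show ?thesis by (rule K(3))
  qed
  ultimately show ?thesis using cK KU by (intro exI[of _ ?K] conjI allI impI)
qed

subsection \<open>Density of test functions\<close>

lemma mk_close:
  assumes K: "compact K" and f: "f \<in> CC UNIV" and g: "g \<in> CC UNIV"
    and z: "\<And>x. x \<notin> K \<Longrightarrow> f x = 0" "\<And>x. x \<notin> K \<Longrightarrow> g x = 0" and e: "\<And>x. \<bar>f x - g x\<bar> \<le> e"
  shows "norm (mk f - mk g) \<le> e * sqrt (measure lborel K)"
proof -
  have "norm (mk (\<lambda>x. f x - g x)) \<le> e * sqrt (measure lborel K)"
    by (rule csupp_bounded_integrable(3)[OF _ K]) (use CC_measurable[OF f] CC_measurable[OF g] z e in auto)
  then show ?thesis using CC_sqint[OF f] CC_sqint[OF g] by (simp add: mk_diff)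
qed

lemma test_dense_C1c:
  fixes U :: "'a::euclidean_space set"
  assumes U: "open U" and \<phi>: "\<phi> \<in> CC U" and e: "e > 0"
  shows "\<exists>\<psi>\<in>test_functions U. norm (mk \<psi> - mk \<phi>) < e \<and>
    (\<phi> \<in> C1c U \<longrightarrow> (\<forall>b\<in>Basis. norm (mk (dd \<psi> b) - mk (dd \<phi> b)) < e))"
proof -
  obtain K where K: "compact K" "K \<subseteq> U" "\<And>x. x \<notin> K \<Longrightarrow> \<phi> x = 0"
    and ap: "\<And>e. e > 0 \<Longrightarrow> \<exists>\<psi>\<in>test_functions U. (\<forall>x. x \<notin> K \<longrightarrow> \<psi> x = 0) \<and>
    (\<forall>x. \<bar>\<psi> x - \<phi> x\<bar> \<le> e) \<and> (\<phi> \<in> C1c U \<longrightarrow> (\<forall>b\<in>Basis. \<forall>x. \<bar>dd \<psi> b x - dd \<phi> b x\<bar> \<le> e))"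
    using mollify[OF U \<phi>] by blast
  define s where "s = sqrt (measure lborel K)"
  have s: "s \<ge> 0" by (simp add: s_def)
  define \<eta> where "\<eta> = e / (s + 1)"
  have \<eta>: "\<eta> > 0" "\<eta> * s < e" using s e by (simp_all add: \<eta>_def divide_less_eq mult_pos_pos)
  obtain \<psi> where \<psi>: "\<psi> \<in> test_functions U" "\<And>x. x \<notin> K \<Longrightarrow> \<psi> x = 0" "\<And>x. \<bar>\<psi> x - \<phi> x\<bar> \<le> \<eta>"
    "\<And>b x. \<phi> \<in> C1c U \<Longrightarrow> b \<in> Basis \<Longrightarrow> \<bar>dd \<psi> b x - dd \<phi> b x\<bar> \<le> \<eta>"
    using ap[OF \<eta>(1)] by blast
  have \<psi>C: "\<psi> \<in> C1c UNIV" using test_C1c[OF \<psi>(1)] C1c_mono by blast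
  have "norm (mk \<psi> - mk \<phi>) \<le> \<eta> * s"
    unfolding s_def using K \<psi> CC_mono[OF \<phi>] C1c_CC[OF \<psi>C] by (intro mk_close) auto
  moreover have "norm (mk (dd \<psi> b) - mk (dd \<phi> b)) \<le> \<eta> * s" if c: "\<phi> \<in> C1c U" and b: "b \<in> Basis" for b
    unfolding s_def
  proof (rule mk_close[OF K(1)])
    show "dd \<psi> b \<in> CC UNIV" using C1c_dd_CC[OF \<psi>C] .
    show "dd \<phi> b \<in> CC UNIV" using C1c_dd_CC[OF c] CC_mono by blast
    show "dd \<psi> b x = 0" if "x \<notin> K" for x
      by (rule dd_zero_outside[of K \<psi>]) (use that K \<psi> in \<open>auto simp: compact_imp_closed\<close>)
    show "dd \<phi> b x = 0" if "x \<notin> K" for x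
      by (rule dd_zero_outside[of K \<phi>]) (use that K in \<open>auto simp: compact_imp_closed\<close>)
  qed (rule \<psi>(4)[OF c b])
  ultimately show ?thesis using \<psi>(1) \<eta>(2) by (intro bexI[of _ \<psi>]) (auto intro: le_less_trans)
qed

lemma sqint_indicator: "A \<in> sets borel \<Longrightarrow> emeasure lborel A < \<infinity> \<Longrightarrow> sqint (indicator A :: 'a::euclidean_space \<Rightarrow> real)"
proof -
  assume a: "A \<in> sets borel" "emeasure lborel A < \<infinity>"
  have e: "(\<lambda>x. (indicator A x :: real)\<^sup>2) = indicator A" by (auto simp: indicator_def)
  show ?thesis using a by (simp add: sqint_def e)
qed

lemma norm_mk_indicator: "A \<in> sets borel \<Longrightarrow> emeasure lborel A < \<infinity> \<Longrightarrow>
    norm (mk (indicator A :: 'a::euclidean_space \<Rightarrow> real)) = sqrt (measure lborel A)"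
proof -
  assume a: "A \<in> sets borel" "emeasure lborel A < \<infinity>"
  have e: "(\<lambda>x. (indicator A x :: real)\<^sup>2) = indicator A" by (auto simp: indicator_def)
  show ?thesis using a by (simp add: norm_mk[OF sqint_indicator[OF a]] e)
qed

text \<open>Multiples of the distance to the complement of V, truncated at 1, increase to the
  indicator of V and are carried by its closure; dominated convergence passes from these continuous
  functions to the indicator.\<close>

lemma fundamental_lemma_open:
  fixes z :: "'a::euclidean_space l2"
  assumes U: "open U" and z: "\<And>\<phi>. \<phi> \<in> CC U \<Longrightarrow> z \<bullet> mk \<phi> = 0"
    and V: "open V" "bounded V" "closure V \<subseteq> U"
  shows "z \<bullet> mk (indicator V) = 0"
proof -
  have "V \<noteq> UNIV" using V(2) not_bounded_UNIV by metis
  then have ne: "- V \<noteq> {}" by blast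
  have Vm [measurable]: "V \<in> sets borel" using V(1) by simp
  have fin: "emeasure lborel V < \<infinity>" using emeasure_bounded_finite[OF V(2)] by simp
  define \<phi> where "\<phi> n x = min 1 (real n * infdist x (- V))" for n and x :: 'a
  have out: "\<phi> n x = 0" if "x \<notin> V" for n x using that by (simp add: \<phi>_def)
  have CC: "\<phi> n \<in> CC U" for n
  proof -
    have "continuous_on UNIV (\<phi> n)" unfolding \<phi>_def[abs_def] by (intro continuous_intros)
    moreover have "csupp U (\<phi> n)" unfolding csupp_def
      using V(2,3) out closure_subset[of V] by (intro exI[of _ "closure V"]) (auto simp: compact_closure)
    ultimately show ?thesis by (simp add: CC_def)
  qed
  have lim: "(\<lambda>n. \<phi> n x) \<longlonglongrightarrow> indicator V x" for x
  proof (cases "x \<in> V")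
    case True
    have "closed (- V)" using V(1) by (rule closed_Compl)
    then have p: "infdist x (- V) > 0" using infdist_pos_not_in_closed[of "- V" x] ne True by auto
    obtain N where N: "1 < real N * infdist x (- V)" using reals_Archimedean3[OF p] by blast
    have "\<phi> n x = 1" if "n \<ge> N" for n
    proof -
      have "real N * infdist x (- V) \<le> real n * infdist x (- V)" using that p by (intro mult_right_mono) auto
      then show ?thesis using N by (simp add: \<phi>_def)
    qed
    then show ?thesis using True by (intro tendsto_eventually) (auto simp: eventually_sequentially)
  qed (simp add: out)
  have si: "sqint (indicator V :: 'a \<Rightarrow> real)" using sqint_indicator[OF Vm fin] .
  have "(\<lambda>n. \<integral>x. fn z x * \<phi> n x \<partial>lborel) \<longlonglongrightarrow> (\<integral>x. fn z x * indicator V x \<partial>lborel)"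
  proof (rule integral_dominated_convergence)
    show "integrable lborel (\<lambda>x. \<bar>fn z x * indicator V x\<bar>)" using sqint_integrable_mult[OF sqint_fn si] by auto
    show "AE x in lborel. (\<lambda>n. fn z x * \<phi> n x) \<longlonglongrightarrow> fn z x * indicator V x"
      by (intro AE_I2 tendsto_intros lim)
    show "AE x in lborel. norm (fn z x * \<phi> n x) \<le> \<bar>fn z x * indicator V x\<bar>" for n
    proof (intro AE_I2)
      fix x
      have "0 \<le> \<phi> n x" "\<phi> n x \<le> 1" by (auto simp: \<phi>_def infdist_nonneg)
      then have "\<bar>\<phi> n x\<bar> \<le> indicator V x" using out[of x n] by (cases "x \<in> V") auto
      then show "norm (fn z x * \<phi> n x) \<le> \<bar>fn z x * indicator V x\<bar>"
        by (simp add: abs_mult mult_left_mono)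
    qed
  qed (use CC_measurable[OF CC] in auto)
  moreover have "(\<integral>x. fn z x * \<phi> n x \<partial>lborel) = 0" for n
    using z[OF CC] inner_mk_right[OF CC_sqint[OF CC]] by metis
  ultimately have "(\<integral>x. fn z x * indicator V x \<partial>lborel) = 0"
    by (simp add: LIMSEQ_const_iff)
  then show ?thesis by (simp add: inner_mk_right[OF si])
qed

text \<open>Outer regularity places the Borel set in an open set of nearly the same measure, to
  which the open case applies; the Cauchy-Schwarz inequality bounds the contribution of the
  difference.\<close>

lemma fundamental_lemma_borel:
  fixes z :: "'a::euclidean_space l2"
  assumes U: "open U" and z: "\<And>\<phi>. \<phi> \<in> CC U \<Longrightarrow> z \<bullet> mk \<phi> = 0"
    and W: "open W" "bounded W" "closure W \<subseteq> U" and A: "A \<in> sets borel" "A \<subseteq> W"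
  shows "z \<bullet> mk (indicator A) = 0"
proof (rule ccontr)
  assume ne: "z \<bullet> mk (indicator A) \<noteq> 0"
  define \<epsilon> where "\<epsilon> = \<bar>z \<bullet> mk (indicator A)\<bar>"
  have \<epsilon>: "\<epsilon> > 0" using ne by (simp add: \<epsilon>_def)
  \<comment> \<open>The indicator of a set of measure below \<delta> has norm at most
    \<open>\<epsilon> / (norm z + 1)\<close>, which paired with z gives less than
    \<epsilon>.\<close>
  define \<delta> where "\<delta> = (\<epsilon> / (norm z + 1))\<^sup>2"
  have nz: "norm z + 1 > 0" by (simp add: add_nonneg_pos)
  have \<delta>: "\<delta> > 0" using \<epsilon> nz by (simp add: \<delta>_def)
  obtain T where T: "open T" "A \<subseteq> T" "emeasure lborel (T - A) < ennreal \<delta>"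
    using outer_regular_lborel[OF A(1) \<delta>] by blast
  let ?V = "T \<inter> W"
  have V: "open ?V" "bounded ?V" "closure ?V \<subseteq> U" "A \<subseteq> ?V"
    using T W A closure_mono[of ?V W] by (auto intro: bounded_subset)
  have Vm: "?V \<in> sets borel" using V(1) by simp
  have Dm: "?V - A \<in> sets borel" using Vm A(1) by blast
  have f1: "emeasure lborel ?V < \<infinity>" using emeasure_bounded_finite[OF V(2)] by simp
  have f2: "emeasure lborel A < \<infinity>"
    using f1 emeasure_mono[OF V(4), of lborel] Vm by (auto intro: le_less_trans)
  have Dle: "emeasure lborel (?V - A) < ennreal \<delta>"
    by (rule le_less_trans[OF emeasure_mono T(3)]) (use T(1) A(1) in auto)
  then have f3: "emeasure lborel (?V - A) < \<infinity>" by (auto intro: less_trans)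
  have i: "indicator ?V = (\<lambda>x. indicator A x + indicator (?V - A) x :: real)"
    by (rule ext) (use V(4) in \<open>auto simp: indicator_def\<close>)
  have "mk (indicator ?V) = mk (indicator A) + mk (indicator (?V - A))"
    unfolding i by (rule mk_add[OF sqint_indicator[OF A(1) f2] sqint_indicator[OF Dm f3]])
  then have "\<epsilon> = \<bar>z \<bullet> mk (indicator (?V - A))\<bar>"
    using fundamental_lemma_open[OF U z V(1-3)] by (simp add: \<epsilon>_def inner_add_right)
  also have "\<dots> \<le> norm z * norm (mk (indicator (?V - A) :: 'a \<Rightarrow> real))" by (rule Cauchy_Schwarz_ineq2)
  also have "\<dots> = norm z * sqrt (measure lborel (?V - A))" by (simp add: norm_mk_indicator[OF Dm f3])
  also have "\<dots> \<le> norm z * sqrt \<delta>"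
  proof -
    have "measure lborel (?V - A) \<le> \<delta>"
      using Dle \<delta> f3 by (auto simp: emeasure_eq_ennreal_measure ennreal_less_iff top_unique less_top)
    then show ?thesis by (intro mult_left_mono) auto
  qed
  also have "sqrt \<delta> = \<epsilon> / (norm z + 1)" using \<epsilon> nz by (simp add: \<delta>_def)
  also have "norm z * (\<epsilon> / (norm z + 1)) < \<epsilon>"
    using \<epsilon> nz by (simp add: divide_less_eq mult_pos_pos)
  finally show False by simp
qed

text \<open>Tests z with the indicator of the set where it is positive; the one-sided conclusion is
  later applied to both z and - z.\<close>

lemma fundamental_lemma_nonpos:
  fixes z :: "'a::euclidean_space l2"
  assumes U: "open U" and z: "\<And>\<phi>. \<phi> \<in> CC U \<Longrightarrow> z \<bullet> mk \<phi> = 0"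
    and W: "open W" "bounded W" "closure W \<subseteq> U"
  shows "AE x in lborel. x \<in> W \<longrightarrow> fn z x \<le> 0"
proof -
  let ?A = "{x. fn z x > 0} \<inter> W"
  have Am: "?A \<in> sets borel" using W(1) by measurable
  have fin: "emeasure lborel ?A < \<infinity>" using emeasure_bounded_finite[of ?A] W(2) by (auto intro: bounded_subset)
  note si = sqint_indicator[OF Am fin]
  have "(\<integral>x. fn z x * indicator ?A x \<partial>lborel) = 0"
    using fundamental_lemma_borel[OF U z W Am] inner_mk_right[OF si] by simp
  then have "AE x in lborel. fn z x * indicator ?A x = 0"
    using integral_nonneg_eq_0_iff_AE[OF sqint_integrable_mult[OF sqint_fn si]]
    by (simp add: indicator_def)
  then show ?thesis by eventually_elim (auto simp: indicator_def split: if_splits)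
qed

lemma fundamental_lemma:
  fixes z :: "'a::euclidean_space l2"
  assumes U: "open U" "bounded U" and z: "\<And>\<phi>. \<phi> \<in> test_functions U \<Longrightarrow> z \<bullet> mk \<phi> = 0"
  shows "AE x in lborel. x \<in> U \<longrightarrow> fn z x = 0"
proof -
  have zC: "z \<bullet> mk \<phi> = 0" if \<phi>: "\<phi> \<in> CC U" for \<phi>
  proof (rule ccontr)
    assume ne: "z \<bullet> mk \<phi> \<noteq> 0"
    have nz: "norm z + 1 > 0" by (simp add: add_nonneg_pos)
    have "\<bar>z \<bullet> mk \<phi>\<bar> / (norm z + 1) > 0" using ne nz by simp
    then obtain \<psi> where \<psi>: "\<psi> \<in> test_functions U" "norm (mk \<psi> - mk \<phi>) < \<bar>z \<bullet> mk \<phi>\<bar> / (norm z + 1)"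
      using test_dense_C1c[OF U(1) \<phi>] by blast
    have "\<bar>z \<bullet> mk \<phi>\<bar> = \<bar>z \<bullet> (mk \<psi> - mk \<phi>)\<bar>" using z[OF \<psi>(1)] by (simp add: inner_diff_right)
    also have "\<dots> \<le> norm z * norm (mk \<psi> - mk \<phi>)" by (rule Cauchy_Schwarz_ineq2)
    also have "\<dots> \<le> norm z * (\<bar>z \<bullet> mk \<phi>\<bar> / (norm z + 1))" using \<psi>(2) by (intro mult_left_mono) auto
    also have "\<dots> < \<bar>z \<bullet> mk \<phi>\<bar>" using ne nz by (simp add: divide_less_eq)
    finally show False by simp
  qed
  have mz: "(- z) \<bullet> mk \<phi> = 0" if "\<phi> \<in> CC U" for \<phi> using zC[OF that] by simp
  \<comment> \<open>Points at distance more than 1 / (n + 1) from the complement: open sets that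
    exhaust U and whose closures lie in U.\<close>
  define W where "W n = {x. infdist x (- U) > 1 / real (Suc n)}" for n
  have "U \<noteq> UNIV" using U(2) not_bounded_UNIV by metis
  then have ne: "- U \<noteq> {}" by blast
  have W: "open (W n)" "bounded (W n)" "closure (W n) \<subseteq> U" for n
  proof -
    show "open (W n)" unfolding W_def by (intro open_Collect_less continuous_intros)
    have "closure (W n) \<subseteq> {x. infdist x (- U) \<ge> 1 / real (Suc n)}"
      by (rule closure_minimal) (auto simp: W_def intro!: closed_Collect_le continuous_intros)
    moreover have "{x. infdist x (- U) \<ge> 1 / real (Suc n)} \<subseteq> U"
    proof safe
      fix x assume "1 / real (Suc n) \<le> infdist x (- U)"
      moreover have "1 / real (Suc n) > 0" by simp
      ultimately have "infdist x (- U) \<noteq> 0" by linarith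
      then show "x \<in> U" by (cases "x \<in> U") auto
    qed
    ultimately show c: "closure (W n) \<subseteq> U" by blast
    then show "bounded (W n)" using U(2) closure_subset bounded_subset by metis
  qed
  have neg: "AE x in lborel. fn (- z) x = - fn z x"
    using fn_mk[OF sqint_minus[OF sqint_fn[of z]]] by (simp add: mk_uminus)
  have "AE x in lborel. x \<in> W n \<longrightarrow> fn z x = 0" for n
  proof -
    have "AE x in lborel. x \<in> W n \<longrightarrow> fn z x \<le> 0"
      by (rule fundamental_lemma_nonpos[OF U(1) _ W]) (rule zC)
    moreover have "AE x in lborel. x \<in> W n \<longrightarrow> fn (- z) x \<le> 0"
      by (rule fundamental_lemma_nonpos[OF U(1) _ W]) (rule mz)
    ultimately show ?thesis using neg by eventually_elim force
  qed
  then have all: "AE x in lborel. \<forall>n. x \<in> W n \<longrightarrow> fn z x = 0" by (subst AE_all_countable) blast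
  have "\<exists>n. x \<in> W n" if "x \<in> U" for x
  proof -
    have "closed (- U)" using U(1) by (rule closed_Compl)
    then have "infdist x (- U) > 0" using infdist_pos_not_in_closed[of "- U" x] ne that by auto
    then show ?thesis using nat_approx_posE unfolding W_def by (metis mem_Collect_eq)
  qed
  then show ?thesis by (intro eventually_mono[OF all]) blast
qed

subsection \<open>Minimising sequences of quadratic functionals\<close>

lemma discriminant_bound:
  fixes A B C :: real
  assumes "\<And>t. 0 \<le> A * t\<^sup>2 + 2 * B * t + C" "A \<ge> 0"
  shows "B\<^sup>2 \<le> A * C"
proof (cases "A = 0")
  case True
  have "B = 0"
  proof (rule ccontr)
    assume "B \<noteq> 0"
    then have "2 * B * (- (C + 1) / (2 * B)) + C = -1" by simp
    with assms(1)[of "- (C + 1) / (2 * B)"] True show False by simp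
  qed
  then show ?thesis using True by simp
next
  case False
  then have A: "A > 0" using assms(2) by simp
  have "0 \<le> A * (- B / A)\<^sup>2 + 2 * B * (- B / A) + C" by (rule assms(1))
  also have "\<dots> = (A * C - B\<^sup>2) / A" using A by (simp add: power2_eq_square field_simps)
  finally show ?thesis using A by (simp add: zero_le_divide_iff)
qed

text \<open>The vector operations are the parameters p and s because the carrier is a set of
  functions rather than a type. No completeness is assumed: the result is a minimising sequence,
  Cauchy for the form, and the limit is taken in each application, once for the L^2 product and once
  for the energy.\<close>

lemma prehilbert_riesz:
  fixes a :: "'v \<Rightarrow> 'v \<Rightarrow> real" and F :: "'v \<Rightarrow> real" and p :: "'v \<Rightarrow> 'v \<Rightarrow> 'v" and s :: "real \<Rightarrow> 'v \<Rightarrow> 'v"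
  assumes ne: "V \<noteq> {}"
    and pV: "\<And>x y. x \<in> V \<Longrightarrow> y \<in> V \<Longrightarrow> p x y \<in> V" and sV: "\<And>c x. x \<in> V \<Longrightarrow> s c x \<in> V"
    and ap: "\<And>x y z. x \<in> V \<Longrightarrow> y \<in> V \<Longrightarrow> z \<in> V \<Longrightarrow> a (p x y) z = a x z + a y z"
    and as: "\<And>c x z. x \<in> V \<Longrightarrow> z \<in> V \<Longrightarrow> a (s c x) z = c * a x z"
    and sym: "\<And>x y. x \<in> V \<Longrightarrow> y \<in> V \<Longrightarrow> a x y = a y x" and pos: "\<And>x. x \<in> V \<Longrightarrow> 0 \<le> a x x"
    and Fp: "\<And>x y. x \<in> V \<Longrightarrow> y \<in> V \<Longrightarrow> F (p x y) = F x + F y"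
    and Fs: "\<And>c x. x \<in> V \<Longrightarrow> F (s c x) = c * F x"
    and C: "\<And>x. x \<in> V \<Longrightarrow> \<bar>F x\<bar> \<le> C * sqrt (a x x)"
  shows "\<exists>x. (\<forall>n. x n \<in> V) \<and> (\<forall>e>0. \<exists>N. \<forall>m\<ge>N. \<forall>n\<ge>N. a (p (x m) (s (-1) (x n))) (p (x m) (s (-1) (x n))) < e) \<and>
    (\<forall>y\<in>V. (\<lambda>n. a (x n) y) \<longlonglongrightarrow> F y)"
proof -
  have ap': "a z (p x y) = a z x + a z y" if "x \<in> V" "y \<in> V" "z \<in> V" for x y z
    using that ap[of x y z] sym[of z x] sym[of z y] sym[of z "p x y"] pV by simp
  have as': "a z (s c x) = c * a z x" if "x \<in> V" "z \<in> V" for c x z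
    using that as[of x z c] sym[of z x] sym[of z "s c x"] sV by simp
  \<comment> \<open>The functional whose minimiser would represent F; it is bounded below because F
    is bounded by the form.\<close>
  define J where "J x = a x x - 2 * F x" for x
  have quad: "J (p x (s t y)) = J x + 2 * t * (a x y - F y) + t\<^sup>2 * a y y" if "x \<in> V" "y \<in> V" for x y t
    using that by (simp add: J_def ap ap' as as' sV pV Fp Fs sym[of y x] power2_eq_square algebra_simps)
  have low: "J x \<ge> - C\<^sup>2" if "x \<in> V" for x
  proof -
    have "0 \<le> (sqrt (a x x) - C)\<^sup>2" by simp
    also have "\<dots> = a x x - 2 * C * sqrt (a x x) + C\<^sup>2" using pos[OF that] by (simp add: power2_diff)
    finally show ?thesis using C[OF that] unfolding J_def by linarith
  qed
  define m where "m = Inf (J ` V)"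
  have bb: "bdd_below (J ` V)" using low by (auto intro!: bdd_belowI)
  have mle: "m \<le> J x" if "x \<in> V" for x unfolding m_def using bb that by (auto intro: cInf_lower)
  have "\<exists>x\<in>V. J x < m + 1 / real (Suc n)" for n
  proof -
    have "Inf (J ` V) < m + 1 / real (Suc n)" by (simp add: m_def)
    then show ?thesis using ne bb by (subst (asm) cInf_less_iff) auto
  qed
  then obtain x where x: "\<And>n. x n \<in> V" "\<And>n. J (x n) < m + 1 / real (Suc n)" by metis
  \<comment> \<open>The parallelogram law: the midpoint of u and w cannot have a value of J below
    m.\<close>
  have cau: "a (p u (s (-1) w)) (p u (s (-1) w)) \<le> 2 * (J u - m) + 2 * (J w - m)" if "u \<in> V" "w \<in> V" for u w
  proof -
    let ?h = "p u (s 1 w)"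
    have h: "s (1/2) ?h \<in> V" using that by (intro sV pV)
    have "J (s (1/2) ?h) = (1/4) * (a u u + 2 * a u w + a w w) - (F u + F w)"
      using that by (simp add: J_def ap ap' as as' sV pV Fp Fs sym[of w u] algebra_simps)
    moreover have "a (p u (s (-1) w)) (p u (s (-1) w)) = a u u - 2 * a u w + a w w"
      using that by (simp add: ap ap' as as' sV pV sym[of w u] algebra_simps)
    ultimately show ?thesis using mle[OF h] by (simp add: J_def algebra_simps)
  qed
  have "\<exists>N. \<forall>i\<ge>N. \<forall>j\<ge>N. a (p (x i) (s (-1) (x j))) (p (x i) (s (-1) (x j))) < e" if e: "e > 0" for e
  proof -
    obtain N where N: "1 / real (Suc N) < e / 4" using e nat_approx_posE[of "e / 4"] by auto
    have "J (x i) - m < e / 4" if "i \<ge> N" for i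
    proof -
      have "1 / real (Suc i) \<le> 1 / real (Suc N)" using that by (intro divide_left_mono) auto
      then show ?thesis using x(2)[of i] N by linarith
    qed
    note Jm = this
    have "a (p (x i) (s (-1) (x j))) (p (x i) (s (-1) (x j))) < e" if "i \<ge> N" "j \<ge> N" for i j
    proof -
      have *: "q < e" if "q \<le> 2 * A + 2 * B" "A < e / 4" "B < e / 4" for q A B using that by linarith
      show ?thesis by (rule *[OF cau[OF x(1) x(1)] Jm[OF that(1)] Jm[OF that(2)]])
    qed
    then show ?thesis by blast
  qed
  moreover have "(\<lambda>n. a (x n) y) \<longlonglongrightarrow> F y" if y: "y \<in> V" for y
  proof -
    \<comment> \<open>Along the line through x n in direction y the excess of J over m is a
      nonnegative quadratic polynomial in t; its discriminant gives this bound.\<close>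
    have "(a (x n) y - F y)\<^sup>2 \<le> a y y * (1 / real (Suc n))" for n
    proof -
      have "(a (x n) y - F y)\<^sup>2 \<le> a y y * (J (x n) - m)"
      proof (rule discriminant_bound)
        fix t
        show "0 \<le> a y y * t\<^sup>2 + 2 * (a (x n) y - F y) * t + (J (x n) - m)"
          using mle[OF pV[OF x(1) sV[OF y]], of n t] quad[OF x(1) y, of n t] by (simp add: algebra_simps)
      qed (rule pos[OF y])
      also have "\<dots> \<le> a y y * (1 / real (Suc n))" using x(2)[of n] pos[OF y] by (intro mult_left_mono) auto
      finally show ?thesis .
    qed
    moreover have "(\<lambda>n. a y y * (1 / real (Suc n))) \<longlonglongrightarrow> 0"
      using tendsto_mult[OF tendsto_const LIMSEQ_Suc[OF lim_1_over_n], of "a y y"] by simp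
    ultimately have "(\<lambda>n. (a (x n) y - F y)\<^sup>2) \<longlonglongrightarrow> 0"
      by (intro Lim_null_comparison[of "\<lambda>n. (a (x n) y - F y)\<^sup>2" "\<lambda>n. a y y * (1 / real (Suc n))"]) auto
    then have "(\<lambda>n. a (x n) y - F y) \<longlonglongrightarrow> 0" by (simp add: power_tendsto_0_iff)
    then show ?thesis by (simp add: LIM_zero_iff)
  qed
  ultimately show ?thesis using x(1) by blast
qed

text \<open>The representing element need not belong to the class itself: the minimising sequence is
  Cauchy in norm and has its limit in the complete space.\<close>

lemma riesz_C1c:
  fixes F :: "('a::euclidean_space \<Rightarrow> real) \<Rightarrow> real"
  assumes Fp: "\<And>\<phi> \<psi>. \<phi> \<in> C1c U \<Longrightarrow> \<psi> \<in> C1c U \<Longrightarrow> F (\<lambda>x. \<phi> x + \<psi> x) = F \<phi> + F \<psi>"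
    and Fs: "\<And>c \<phi>. \<phi> \<in> C1c U \<Longrightarrow> F (\<lambda>x. c * \<phi> x) = c * F \<phi>"
    and C: "\<And>\<phi>. \<phi> \<in> C1c U \<Longrightarrow> \<bar>F \<phi>\<bar> \<le> C * norm (mk \<phi>)"
  shows "\<exists>H. \<forall>\<phi>\<in>C1c U. F \<phi> = H \<bullet> mk \<phi>"
proof -
  have "\<exists>f. (\<forall>n. f n \<in> C1c U) \<and> (\<forall>e>0. \<exists>N. \<forall>m\<ge>N. \<forall>n\<ge>N. mk (\<lambda>x. f m x + -1 * f n x) \<bullet> mk (\<lambda>x. f m x + -1 * f n x) < e) \<and>
    (\<forall>y\<in>C1c U. (\<lambda>n. mk (f n) \<bullet> mk y) \<longlonglongrightarrow> F y)"
    by (rule prehilbert_riesz[where a="\<lambda>\<phi> \<psi>. mk \<phi> \<bullet> mk \<psi>" and p="\<lambda>\<phi> \<psi> x. \<phi> x + \<psi> x" and s="\<lambda>c \<phi> x. c * \<phi> x" and C=C])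
       (use C1c_zero in \<open>auto simp: C1c_add C1c_scale mk_add mk_scale C1c_sqint inner_add_left inner_add_right inner_commute Fp Fs C
          simp flip: norm_eq_sqrt_inner\<close>)
  then obtain f where f: "\<And>n. f n \<in> C1c U"
    "\<And>e. e > 0 \<Longrightarrow> \<exists>N. \<forall>m\<ge>N. \<forall>n\<ge>N. mk (\<lambda>x. f m x + -1 * f n x) \<bullet> mk (\<lambda>x. f m x + -1 * f n x) < e"
    "\<And>y. y \<in> C1c U \<Longrightarrow> (\<lambda>n. mk (f n) \<bullet> mk y) \<longlonglongrightarrow> F y" by blast
  have eq: "mk (\<lambda>x. f m x + -1 * f n x) \<bullet> mk (\<lambda>x. f m x + -1 * f n x) = (norm (mk (f m) - mk (f n)))\<^sup>2" for m n
    using mk_diff[OF C1c_sqint[OF f(1)] C1c_sqint[OF f(1)], of m n] by (simp add: power2_norm_eq_inner)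
  have "Cauchy (\<lambda>n. mk (f n))"
    unfolding Cauchy_def dist_norm
  proof (intro allI impI)
    fix e :: real assume e: "e > 0"
    then have "\<exists>N. \<forall>m\<ge>N. \<forall>n\<ge>N. (norm (mk (f m) - mk (f n)))\<^sup>2 < e\<^sup>2"
      using f(2)[of "e\<^sup>2"] unfolding eq by simp
    then show "\<exists>M. \<forall>m\<ge>M. \<forall>n\<ge>M. norm (mk (f m) - mk (f n)) < e"
      using e by (meson less_imp_le power_less_imp_less_base)
  qed
  then obtain H where H: "(\<lambda>n. mk (f n)) \<longlonglongrightarrow> H" using Cauchy_convergent convergent_def by blast
  have "F \<phi> = H \<bullet> mk \<phi>" if "\<phi> \<in> C1c U" for \<phi>
    by (rule LIMSEQ_unique[OF f(3)[OF that]]) (intro tendsto_intros H)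
  then show ?thesis by blast
qed

subsection \<open>The space of functions with vanishing boundary values\<close>

definition Dl :: "('a::euclidean_space \<Rightarrow> real) \<Rightarrow> 'a \<Rightarrow> 'a l2" where
  "Dl \<phi> b = mk (dd \<phi> b)"

text \<open>Membership in \<open>W\<^sub>0\<^sup>1\<^sup>,\<^sup>2\<close> as a property of the pair of a function, extended by zero, and its
  gradient. The gradient is indexed by all vectors \<open>b\<close>, which makes it linear in \<open>b\<close> and allows
  directional derivatives in oblique directions.\<close>

definition h0 :: "'a::euclidean_space set \<Rightarrow> 'a l2 \<Rightarrow> ('a \<Rightarrow> 'a l2) \<Rightarrow> bool" where
  "h0 U u G \<longleftrightarrow> (\<exists>\<phi>. (\<forall>n. \<phi> n \<in> C1c U) \<and> (\<lambda>n. mk (\<phi> n)) \<longlonglongrightarrow> u \<and> (\<forall>b. (\<lambda>n. Dl (\<phi> n) b) \<longlonglongrightarrow> G b))"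

definition en :: "('a::euclidean_space \<Rightarrow> 'a l2) \<Rightarrow> ('a \<Rightarrow> 'a l2) \<Rightarrow> real" where
  "en G H = (\<Sum>b\<in>Basis. G b \<bullet> H b)"

definition gn :: "('a::euclidean_space \<Rightarrow> 'a l2) \<Rightarrow> real" where
  "gn G = L2_set (\<lambda>b. norm (G b)) Basis"

text \<open>By Riesz representation this says that \<open>\<partial>\<^sub>b q\<close> exists weakly in \<open>U\<close> and is square integrable.\<close>

definition dbounded :: "'a::euclidean_space set \<Rightarrow> 'a l2 \<Rightarrow> 'a \<Rightarrow> bool" where
  "dbounded U q b \<longleftrightarrow> (\<exists>C. \<forall>\<phi>\<in>C1c U. \<bar>q \<bullet> Dl \<phi> b\<bar> \<le> C * norm (mk \<phi>))"

lemma gn_nonneg: "0 \<le> gn G" by (simp add: gn_def)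

lemma gn_sq: "(gn G)\<^sup>2 = en G G"
  by (simp add: gn_def en_def L2_set_def sum_nonneg power2_norm_eq_inner)

lemma norm_le_gn: "b \<in> Basis \<Longrightarrow> norm (G b) \<le> gn G"
  unfolding gn_def by (rule member_le_L2_set) auto

lemma norm_dir_le_gn:
  fixes G :: "'a::euclidean_space \<Rightarrow> 'a l2"
  assumes "linear G"
  shows "norm (G v) \<le> (real DIM('a) * norm v) * gn G"
proof -
  have "G v = (\<Sum>b\<in>Basis. (v \<bullet> b) *\<^sub>R G b)"
    using linear_sum[OF assms, of "\<lambda>b. (v \<bullet> b) *\<^sub>R b" Basis] linear_scale[OF assms]
    by (simp add: euclidean_representation)
  also have "norm \<dots> \<le> (\<Sum>b\<in>(Basis::'a set). norm v * gn G)"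
  proof (rule sum_norm_le)
    fix b :: 'a assume b: "b \<in> Basis"
    have "\<bar>v \<bullet> b\<bar> * norm (G b) \<le> norm v * gn G"
      by (intro mult_mono Basis_le_norm norm_le_gn b) auto
    then show "norm ((v \<bullet> b) *\<^sub>R G b) \<le> norm v * gn G" by simp
  qed
  finally show ?thesis by simp
qed

lemma Dl_linear: assumes \<phi>: "\<phi> \<in> C1c U" shows "linear (Dl \<phi>)"
proof
  fix a b :: 'a and c :: real
  have "dd \<phi> (a + b) = (\<lambda>x. dd \<phi> a x + dd \<phi> b x)" using dd_add_dir[OF C1c_C1[OF \<phi>]] by blast
  then show "Dl \<phi> (a + b) = Dl \<phi> a + Dl \<phi> b" by (simp add: Dl_def mk_add C1c_dd_sqint[OF \<phi>])
  have "dd \<phi> (c *\<^sub>R b) = (\<lambda>x. c * dd \<phi> b x)" using dd_scale_dir[OF C1c_C1[OF \<phi>]] by blast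
  then show "Dl \<phi> (c *\<^sub>R b) = c *\<^sub>R Dl \<phi> b" by (simp add: Dl_def mk_scale C1c_dd_sqint[OF \<phi>])
qed

lemma Dl_expand: "\<phi> \<in> C1c U \<Longrightarrow> Dl \<phi> v = (\<Sum>b\<in>Basis. (v \<bullet> b) *\<^sub>R Dl \<phi> b)"
  using linear_sum[OF Dl_linear, of \<phi> U "\<lambda>b. (v \<bullet> b) *\<^sub>R b" Basis] linear_scale[OF Dl_linear, of \<phi> U]
  by (simp add: euclidean_representation)

lemma Dl_add: "\<phi> \<in> C1c U \<Longrightarrow> \<psi> \<in> C1c U \<Longrightarrow> Dl (\<lambda>x. \<phi> x + \<psi> x) b = Dl \<phi> b + Dl \<psi> b"
  using C1_add[of \<phi> \<psi> b] by (simp add: Dl_def C1c_C1 mk_add C1c_dd_sqint)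

lemma Dl_diff: "\<phi> \<in> C1c U \<Longrightarrow> \<psi> \<in> C1c U \<Longrightarrow> Dl (\<lambda>x. \<phi> x - \<psi> x) b = Dl \<phi> b - Dl \<psi> b"
  using C1_diff[of \<phi> \<psi> b] by (simp add: Dl_def C1c_C1 mk_diff C1c_dd_sqint)

lemma Dl_scale: "\<phi> \<in> C1c U \<Longrightarrow> Dl (\<lambda>x. c * \<phi> x) b = c *\<^sub>R Dl \<phi> b"
  using C1_scale[of \<phi> c b] by (simp add: Dl_def C1c_C1 mk_scale C1c_dd_sqint)

lemma Dl_mult: "m \<in> C1 \<Longrightarrow> \<phi> \<in> C1c U \<Longrightarrow> Dl (\<lambda>x. m x * \<phi> x) b = mk (\<lambda>x. m x * dd \<phi> b x) + mk (\<lambda>x. dd m b x * \<phi> x)"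
proof -
  assume m: "m \<in> C1" and \<phi>: "\<phi> \<in> C1c U"
  have s: "sqint (\<lambda>x. m x * dd \<phi> b x)" "sqint (\<lambda>x. dd m b x * \<phi> x)"
    using CC_sqint CC_mult[OF C1_cont[OF m] C1c_dd_CC[OF \<phi>]] CC_mult[OF C1_dd_cont[OF m] C1c_CC[OF \<phi>]] by blast+
  show ?thesis using C1_mult[OF m C1c_C1[OF \<phi>], of b] by (simp add: Dl_def mk_add[OF s])
qed

lemma h0_C1c: "\<phi> \<in> C1c U \<Longrightarrow> h0 U (mk \<phi>) (Dl \<phi>)"
  unfolding h0_def by (intro exI[of _ "\<lambda>n. \<phi>"]) auto

lemma h0_mono: "h0 U u G \<Longrightarrow> U \<subseteq> V \<Longrightarrow> h0 V u G"
  unfolding h0_def using C1c_mono by metis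

lemma h0_diff:
  assumes "h0 U u G" "h0 U v H"
  shows "h0 U (u - v) (\<lambda>b. G b - H b)"
proof -
  obtain \<phi> where \<phi>: "\<And>n. \<phi> n \<in> C1c U" "(\<lambda>n. mk (\<phi> n)) \<longlonglongrightarrow> u" "\<And>b. (\<lambda>n. Dl (\<phi> n) b) \<longlonglongrightarrow> G b"
    using assms(1) unfolding h0_def by blast
  obtain \<psi> where \<psi>: "\<And>n. \<psi> n \<in> C1c U" "(\<lambda>n. mk (\<psi> n)) \<longlonglongrightarrow> v" "\<And>b. (\<lambda>n. Dl (\<psi> n) b) \<longlonglongrightarrow> H b"
    using assms(2) unfolding h0_def by blast
  have e: "mk (\<lambda>x. \<phi> n x - \<psi> n x) = mk (\<phi> n) - mk (\<psi> n)" for n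
    by (rule mk_diff[OF C1c_sqint[OF \<phi>(1)] C1c_sqint[OF \<psi>(1)]])
  show ?thesis unfolding h0_def
  proof (intro exI[of _ "\<lambda>n x. \<phi> n x - \<psi> n x"] conjI allI)
    show "(\<lambda>x. \<phi> n x - \<psi> n x) \<in> C1c U" for n by (rule C1c_diff[OF \<phi>(1) \<psi>(1)])
    show "(\<lambda>n. mk (\<lambda>x. \<phi> n x - \<psi> n x)) \<longlonglongrightarrow> u - v" unfolding e by (intro tendsto_intros \<phi> \<psi>)
    show "(\<lambda>n. Dl (\<lambda>x. \<phi> n x - \<psi> n x) b) \<longlonglongrightarrow> G b - H b" for b
      unfolding Dl_diff[OF \<phi>(1) \<psi>(1)] by (intro tendsto_intros \<phi> \<psi>)
  qed
qed

lemma h0_linear: assumes "h0 U u G" shows "linear G"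
proof -
  obtain \<phi> where \<phi>: "\<And>n. \<phi> n \<in> C1c U" "\<And>b. (\<lambda>n. Dl (\<phi> n) b) \<longlonglongrightarrow> G b"
    using assms unfolding h0_def by blast
  show ?thesis
  proof
    fix a b :: 'a and c :: real
    have "(\<lambda>n. Dl (\<phi> n) a + Dl (\<phi> n) b) \<longlonglongrightarrow> G a + G b" by (intro tendsto_intros \<phi>)
    moreover have "(\<lambda>n. Dl (\<phi> n) a + Dl (\<phi> n) b) \<longlonglongrightarrow> G (a + b)"
      using \<phi>(2)[of "a + b"] by (simp add: linear_add[OF Dl_linear[OF \<phi>(1)]])
    ultimately show "G (a + b) = G a + G b" by (metis LIMSEQ_unique)
    have "(\<lambda>n. c *\<^sub>R Dl (\<phi> n) b) \<longlonglongrightarrow> c *\<^sub>R G b" by (intro tendsto_intros \<phi>)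
    moreover have "(\<lambda>n. c *\<^sub>R Dl (\<phi> n) b) \<longlonglongrightarrow> G (c *\<^sub>R b)"
      using \<phi>(2)[of "c *\<^sub>R b"] by (simp add: linear_scale[OF Dl_linear[OF \<phi>(1)]])
    ultimately show "G (c *\<^sub>R b) = c *\<^sub>R G b" by (metis LIMSEQ_unique)
  qed
qed

text \<open>The test function need not vanish near the boundary. This is what zero boundary values
  mean here: the extension by zero has the weak gradient G on the whole space.\<close>

lemma h0_ibp:
  assumes "h0 U u G" "\<phi> \<in> C1c UNIV"
  shows "G b \<bullet> mk \<phi> = - (u \<bullet> Dl \<phi> b)"
proof -
  obtain f where f: "\<And>n. f n \<in> C1c U" "(\<lambda>n. mk (f n)) \<longlonglongrightarrow> u" "\<And>b. (\<lambda>n. Dl (f n) b) \<longlonglongrightarrow> G b"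
    using assms unfolding h0_def by blast
  have "Dl (f n) b \<bullet> mk \<phi> = - (mk (f n) \<bullet> Dl \<phi> b)" for n
    unfolding Dl_def by (rule ibp[OF C1c_mono[OF f(1)] assms(2)]) simp
  moreover have "(\<lambda>n. Dl (f n) b \<bullet> mk \<phi>) \<longlonglongrightarrow> G b \<bullet> mk \<phi>" by (intro tendsto_intros f)
  moreover have "(\<lambda>n. - (mk (f n) \<bullet> Dl \<phi> b)) \<longlonglongrightarrow> - (u \<bullet> Dl \<phi> b)" by (intro tendsto_intros f)
  ultimately show ?thesis by (metis (no_types, lifting) LIMSEQ_unique ext)
qed

text \<open>Symmetry of second derivatives in the weak sense; it survives the limit although no
  second derivative of u is known to exist yet.\<close>

lemma h0_mixed:
  assumes "h0 U u G" "\<phi> \<in> C1c UNIV"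
  shows "G a \<bullet> Dl \<phi> b = G b \<bullet> Dl \<phi> a"
proof -
  obtain f where f: "\<And>n. f n \<in> C1c U" "\<And>b. (\<lambda>n. Dl (f n) b) \<longlonglongrightarrow> G b"
    using assms unfolding h0_def by blast
  have "Dl (f n) a \<bullet> Dl \<phi> b = Dl (f n) b \<bullet> Dl \<phi> a" for n
    unfolding Dl_def by (rule mixed_derivatives[OF C1c_mono[OF f(1)] assms(2)]) simp
  moreover have "(\<lambda>n. Dl (f n) a \<bullet> Dl \<phi> b) \<longlonglongrightarrow> G a \<bullet> Dl \<phi> b" by (intro tendsto_intros f)
  moreover have "(\<lambda>n. Dl (f n) b \<bullet> Dl \<phi> a) \<longlonglongrightarrow> G b \<bullet> Dl \<phi> a" by (intro tendsto_intros f)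
  ultimately show ?thesis by (metis (no_types, lifting) LIMSEQ_unique ext)
qed

lemma h0_poincare:
  fixes U :: "'a::euclidean_space set"
  assumes "bounded U"
  shows "\<exists>P\<ge>0. \<forall>u G. h0 U u G \<longrightarrow> norm u \<le> P * gn G"
proof -
  obtain b :: 'a where b: "b \<in> Basis" using nonempty_Basis by blast
  obtain P where P: "P \<ge> 0" "\<And>\<phi>. \<phi> \<in> C1c U \<Longrightarrow> norm (mk \<phi>) \<le> P * norm (Dl \<phi> b)"
    using poincare_C1c[OF assms b] unfolding Dl_def by blast
  have "norm u \<le> P * gn G" if h: "h0 U u G" for u G
  proof -
    obtain f where f: "\<And>n. f n \<in> C1c U" "(\<lambda>n. mk (f n)) \<longlonglongrightarrow> u" "\<And>b. (\<lambda>n. Dl (f n) b) \<longlonglongrightarrow> G b"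
      using h unfolding h0_def by blast
    have "norm u \<le> P * norm (G b)"
      by (rule LIMSEQ_le[of "\<lambda>n. norm (mk (f n))" _ "\<lambda>n. P * norm (Dl (f n) b)"])
         (use P(2)[OF f(1)] in \<open>auto intro!: tendsto_intros f\<close>)
    also have "\<dots> \<le> P * gn G" using P(1) norm_le_gn[OF b] by (intro mult_left_mono) auto
    finally show ?thesis .
  qed
  then show ?thesis using P(1) by blast
qed

text \<open>The coordinate directions suffice, since linearity in the direction supplies the limits
  in all others.\<close>

lemma h0_of_Cauchy:
  assumes f: "\<And>n. f n \<in> C1c U" "Cauchy (\<lambda>n. mk (f n))" "\<And>b. b \<in> Basis \<Longrightarrow> Cauchy (\<lambda>n. Dl (f n) b)"
  shows "\<exists>u G. h0 U u G \<and> (\<lambda>n. mk (f n)) \<longlonglongrightarrow> u \<and> (\<forall>b. (\<lambda>n. Dl (f n) b) \<longlonglongrightarrow> G b)"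
proof -
  obtain u where u: "(\<lambda>n. mk (f n)) \<longlonglongrightarrow> u" using f(2) Cauchy_convergent convergent_def by blast
  have "\<exists>g. (\<lambda>n. Dl (f n) b) \<longlonglongrightarrow> g" if "b \<in> Basis" for b
    using f(3)[OF that] Cauchy_convergent convergent_def by blast
  then obtain G0 where G0: "\<And>b. b \<in> Basis \<Longrightarrow> (\<lambda>n. Dl (f n) b) \<longlonglongrightarrow> G0 b" by metis
  define G where "G v = (\<Sum>b\<in>Basis. (v \<bullet> b) *\<^sub>R G0 b)" for v
  have "(\<lambda>n. Dl (f n) v) \<longlonglongrightarrow> G v" for v
    unfolding G_def Dl_expand[OF f(1), of _ v] by (intro tendsto_intros G0)
  then show ?thesis using u f(1) unfolding h0_def by blast
qed

lemma en_Dl_tendsto: "(\<And>b. (\<lambda>n. H n b) \<longlonglongrightarrow> K b) \<Longrightarrow> (\<lambda>n. en G (H n)) \<longlonglongrightarrow> en G K"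
  unfolding en_def by (intro tendsto_intros)

lemma en_tendsto_left: "(\<And>b. (\<lambda>n. H n b) \<longlonglongrightarrow> K b) \<Longrightarrow> (\<lambda>n. en (H n) G) \<longlonglongrightarrow> en K G"
  unfolding en_def by (intro tendsto_intros)

lemma en_commute: "en G H = en H G"
  by (simp add: en_def inner_commute)

text \<open>Minimisation of the energy over C^1 functions of compact support. A minimising sequence
  is Cauchy in each gradient component because l is nonnegative, and then in L^2 by the Poincare
  inequality.\<close>

lemma weak_solution:
  fixes U :: "'a::euclidean_space set" and v :: "'a l2"
  assumes U: "bounded U" and l: "l \<ge> 0"
  shows "\<exists>u G. h0 U u G \<and> (\<forall>\<phi>\<in>C1c U. en G (Dl \<phi>) + l * (u \<bullet> mk \<phi>) = v \<bullet> mk \<phi>)"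
proof -
  obtain b0 :: 'a where b0: "b0 \<in> Basis" using nonempty_Basis by blast
  obtain P where P: "P \<ge> 0" "\<And>\<phi>. \<phi> \<in> C1c U \<Longrightarrow> norm (mk \<phi>) \<le> P * norm (Dl \<phi> b0)"
    using poincare_C1c[OF U b0] unfolding Dl_def by blast
  let ?a = "\<lambda>(\<phi>::'a \<Rightarrow> real) (\<psi>::'a \<Rightarrow> real). en (Dl \<phi>) (Dl \<psi>) + l * (mk \<phi> \<bullet> mk \<psi>)"
  let ?p = "\<lambda>\<phi> \<psi> (x::'a). \<phi> x + \<psi> x :: real" and ?s = "\<lambda>c \<phi> (x::'a). c * \<phi> x :: real"
  have apos: "0 \<le> l * (mk \<phi> \<bullet> mk \<phi>)" for \<phi> :: "'a \<Rightarrow> real" using l by simp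
  have grad: "norm (Dl \<phi> b) \<le> sqrt (?a \<phi> \<phi>)" if "b \<in> Basis" for \<phi> and b :: 'a
  proof (rule real_le_rsqrt)
    have "(norm (Dl \<phi> b))\<^sup>2 \<le> (gn (Dl \<phi>))\<^sup>2" using norm_le_gn[OF that] by (intro power_mono) auto
    then show "(norm (Dl \<phi> b))\<^sup>2 \<le> ?a \<phi> \<phi>" using apos[of \<phi>] by (simp add: gn_sq)
  qed
  have "\<exists>f. (\<forall>n. f n \<in> C1c U) \<and> (\<forall>e>0. \<exists>N. \<forall>m\<ge>N. \<forall>n\<ge>N. ?a (?p (f m) (?s (-1) (f n))) (?p (f m) (?s (-1) (f n))) < e) \<and>
    (\<forall>y\<in>C1c U. (\<lambda>n. ?a (f n) y) \<longlonglongrightarrow> v \<bullet> mk y)"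
  proof (rule prehilbert_riesz[where a="?a" and p="?p" and s="?s" and V="C1c U" and F="\<lambda>\<phi>. v \<bullet> mk \<phi>" and C="norm v * P"])
    show "C1c U \<noteq> {}" using C1c_zero by blast
    show "?p x y \<in> C1c U" if "x \<in> C1c U" "y \<in> C1c U" for x y by (rule C1c_add[OF that])
    show "?s c x \<in> C1c U" if "x \<in> C1c U" for c x by (rule C1c_scale[OF that])
    show "?a (?p x y) z = ?a x z + ?a y z" if "x \<in> C1c U" "y \<in> C1c U" "z \<in> C1c U" for x y z
      using that by (simp add: en_def Dl_add mk_add C1c_sqint inner_add_left sum.distrib algebra_simps)
    show "?a (?s c x) z = c * ?a x z" if "x \<in> C1c U" "z \<in> C1c U" for c x z
      using that by (simp add: en_def Dl_scale mk_scale C1c_sqint sum_distrib_left algebra_simps)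
    show "?a x y = ?a y x" for x y by (simp add: en_commute[of "Dl x"] inner_commute)
    show "0 \<le> ?a x x" for x using apos[of x] zero_le_power2[of "gn (Dl x)"] by (simp add: gn_sq)
    show "v \<bullet> mk (?p x y) = v \<bullet> mk x + v \<bullet> mk y" if "x \<in> C1c U" "y \<in> C1c U" for x y
      using that by (simp add: mk_add C1c_sqint inner_add_right)
    show "v \<bullet> mk (?s c x) = c * (v \<bullet> mk x)" if "x \<in> C1c U" for c x
      using that by (simp add: mk_scale C1c_sqint)
    show "\<bar>v \<bullet> mk x\<bar> \<le> norm v * P * sqrt (?a x x)" if x: "x \<in> C1c U" for x
    proof -
      have "\<bar>v \<bullet> mk x\<bar> \<le> norm v * norm (mk x)" by (rule Cauchy_Schwarz_ineq2)
      also have "\<dots> \<le> norm v * (P * sqrt (?a x x))"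
        using P(2)[OF x] grad[OF b0, of x] P(1)
        by (intro mult_left_mono order_trans[OF P(2)[OF x]]) auto
      finally show ?thesis by (simp add: mult.assoc)
    qed
  qed
  then obtain f where f: "\<And>n. f n \<in> C1c U"
    "\<And>e. e > 0 \<Longrightarrow> \<exists>N. \<forall>m\<ge>N. \<forall>n\<ge>N. ?a (?p (f m) (?s (-1) (f n))) (?p (f m) (?s (-1) (f n))) < e"
    "\<And>y. y \<in> C1c U \<Longrightarrow> (\<lambda>n. ?a (f n) y) \<longlonglongrightarrow> v \<bullet> mk y" by blast
  have dif: "?p (f m) (?s (-1) (f n)) = (\<lambda>x. f m x - f n x)" for m n by simp
  have C: "Cauchy (\<lambda>n. Dl (f n) b)" if b: "b \<in> Basis" for b
    unfolding Cauchy_def dist_norm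
  proof (intro allI impI)
    fix e :: real assume e: "e > 0"
    then obtain N where N: "\<forall>m\<ge>N. \<forall>n\<ge>N. ?a (\<lambda>x. f m x - f n x) (\<lambda>x. f m x - f n x) < e\<^sup>2"
      using f(2)[of "e\<^sup>2"] unfolding dif by auto
    have "norm (Dl (f m) b - Dl (f n) b) < e" if mn: "m \<ge> N" "n \<ge> N" for m n
    proof -
      have "norm (Dl (f m) b - Dl (f n) b) \<le> sqrt (?a (\<lambda>x. f m x - f n x) (\<lambda>x. f m x - f n x))"
        using grad[OF b, of "\<lambda>x. f m x - f n x"] by (simp only: Dl_diff[OF f(1) f(1)])
      also have "\<dots> < sqrt (e\<^sup>2)" using N mn by (intro real_sqrt_less_mono) auto
      finally show ?thesis using e by simp
    qed
    then show "\<exists>M. \<forall>m\<ge>M. \<forall>n\<ge>M. norm (Dl (f m) b - Dl (f n) b) < e" by blast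
  qed
  have C0: "Cauchy (\<lambda>n. mk (f n))"
    unfolding Cauchy_def dist_norm
  proof (intro allI impI)
    fix e :: real assume e: "e > 0"
    then have "e / (P + 1) > 0" using P(1) by simp
    then obtain N where N: "\<forall>m\<ge>N. \<forall>n\<ge>N. norm (Dl (f m) b0 - Dl (f n) b0) < e / (P + 1)"
      using C[OF b0] unfolding Cauchy_def dist_norm by blast
    have "norm (mk (f m) - mk (f n)) < e" if mn: "m \<ge> N" "n \<ge> N" for m n
    proof -
      have "norm (mk (f m) - mk (f n)) \<le> P * norm (Dl (f m) b0 - Dl (f n) b0)"
        using P(2)[OF C1c_diff[OF f(1) f(1)]] by (simp add: mk_diff C1c_sqint[OF f(1)] Dl_diff[OF f(1) f(1)])
      also have "\<dots> \<le> P * (e / (P + 1))" using N mn P(1) by (intro mult_left_mono) (auto intro: less_imp_le)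
      also have "\<dots> < e" using P(1) e by (simp add: divide_less_eq algebra_simps)
      finally show ?thesis .
    qed
    then show "\<exists>M. \<forall>m\<ge>M. \<forall>n\<ge>M. norm (mk (f m) - mk (f n)) < e" by blast
  qed
  obtain u G where uG: "h0 U u G" "(\<lambda>n. mk (f n)) \<longlonglongrightarrow> u" "\<And>b. (\<lambda>n. Dl (f n) b) \<longlonglongrightarrow> G b"
    using h0_of_Cauchy[OF f(1) C0 C] by blast
  have "en G (Dl \<phi>) + l * (u \<bullet> mk \<phi>) = v \<bullet> mk \<phi>" if \<phi>: "\<phi> \<in> C1c U" for \<phi>
  proof (rule LIMSEQ_unique[OF _ f(3)[OF \<phi>]])
    show "(\<lambda>n. ?a (f n) \<phi>) \<longlonglongrightarrow> en G (Dl \<phi>) + l * (u \<bullet> mk \<phi>)"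
      by (intro tendsto_intros en_tendsto_left uG)
  qed
  then show ?thesis using uG(1) by blast
qed

text \<open>By density every element with zero boundary values is admissible as a test function, in
  particular the solution itself and differences of solutions.\<close>

lemma weak_eq_h0:
  assumes eq: "\<And>\<phi>. \<phi> \<in> C1c U \<Longrightarrow> en G (Dl \<phi>) + l * (u \<bullet> mk \<phi>) = v \<bullet> mk \<phi>" and h: "h0 U w W"
  shows "en G W + l * (u \<bullet> w) = v \<bullet> w"
proof -
  obtain f where f: "\<And>n. f n \<in> C1c U" "(\<lambda>n. mk (f n)) \<longlonglongrightarrow> w" "\<And>b. (\<lambda>n. Dl (f n) b) \<longlonglongrightarrow> W b"
    using h unfolding h0_def by blast
  have "(\<lambda>n. en G (Dl (f n)) + l * (u \<bullet> mk (f n))) \<longlonglongrightarrow> en G W + l * (u \<bullet> w)"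
    by (intro tendsto_intros en_Dl_tendsto f)
  moreover have "(\<lambda>n. v \<bullet> mk (f n)) \<longlonglongrightarrow> v \<bullet> w" by (intro tendsto_intros f)
  ultimately show ?thesis unfolding eq[OF f(1)] by (rule LIMSEQ_unique)
qed

lemma energy_bound_h0:
  assumes eq: "\<And>\<phi>. \<phi> \<in> C1c U \<Longrightarrow> \<bar>en G (Dl \<phi>)\<bar> \<le> C * norm (mk \<phi>)" and h: "h0 U w W"
  shows "\<bar>en G W\<bar> \<le> C * norm w"
proof -
  obtain f where f: "\<And>n. f n \<in> C1c U" "(\<lambda>n. mk (f n)) \<longlonglongrightarrow> w" "\<And>b. (\<lambda>n. Dl (f n) b) \<longlonglongrightarrow> W b"
    using h unfolding h0_def by blast
  show ?thesis
    by (rule LIMSEQ_le[of "\<lambda>n. \<bar>en G (Dl (f n))\<bar>" _ "\<lambda>n. C * norm (mk (f n))"])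
       (use eq[OF f(1)] in \<open>auto intro!: tendsto_intros en_Dl_tendsto f\<close>)
qed

subsection \<open>Tangential difference quotients\<close>

context graph_shear
begin

text \<open>The derivative of \<open>flow h\<close> in direction \<open>b\<close> is \<open>b + \<rho> h b e\<close>.\<close>

definition \<rho> :: "real \<Rightarrow> 'a \<Rightarrow> 'a \<Rightarrow> real" where
  "\<rho> h b x = (g (x + h *\<^sub>R \<tau>) - g x) \<bullet> b"

definition shift :: "real \<Rightarrow> 'a l2 \<Rightarrow> 'a l2" where "shift h = comp_op (flow h)"

text \<open>The gradient of the composition by the chain rule. The second summand measures the
  deviation of the flow from a translation and is of order h.\<close>

definition shift_grad :: "real \<Rightarrow> ('a \<Rightarrow> 'a l2) \<Rightarrow> 'a \<Rightarrow> 'a l2" where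
  "shift_grad h W b = shift h (W b) + mul (\<rho> h b) (shift h (W e))"

lemma \<rho>_cont: "continuous_on UNIV (\<rho> h b)"
  unfolding \<rho>_def by (intro continuous_intros g_cont continuous_on_compose2[OF g_cont]) auto

lemma \<rho>_bound: "\<bar>\<rho> h b x\<bar> \<le> L * \<bar>h\<bar> * norm \<tau> * norm b"
proof -
  have "\<bar>\<rho> h b x\<bar> \<le> norm (g (x + h *\<^sub>R \<tau>) - g x) * norm b"
    unfolding \<rho>_def by (rule Cauchy_Schwarz_ineq2)
  also have "\<dots> \<le> (L * \<bar>h\<bar> * norm \<tau>) * norm b"
    using lip[of "x + h *\<^sub>R \<tau>" x] by (intro mult_right_mono) auto
  finally show ?thesis .
qed

lemma \<rho>_bmult: "bmult (\<rho> h b)"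
  using \<rho>_bound borel_measurable_continuous_onI[OF \<rho>_cont] unfolding bmult_def by blast

lemma \<rho>_e: "\<rho> h e x = 0" by (simp add: \<rho>_def inner_diff_left g_e)

lemma g_flow: "g (flow h x) = g (x + h *\<^sub>R \<tau>)" by (simp add: flow_def g_inv)

text \<open>Differentiating the identity \<open>flow h (flow (- h) x) = x\<close> shows that the two
  corrections cancel.\<close>

lemma \<rho>_flow: "\<rho> h b (flow (- h) x) = - \<rho> (- h) b x"
proof -
  have "flow (- h) x + h *\<^sub>R \<tau> = x + (\<Gamma> (x + - h *\<^sub>R \<tau>) - \<Gamma> x) *\<^sub>R e"
    by (simp add: flow_def)
  then have "g (flow (- h) x + h *\<^sub>R \<tau>) = g x" by (simp only: g_inv)
  then show ?thesis by (simp add: \<rho>_def g_flow inner_diff_left)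
qed

lemma C1_flow:
  assumes "\<phi> \<in> C1"
  shows "(\<lambda>x. \<phi> (flow h x)) \<in> C1 \<and> dd (\<lambda>x. \<phi> (flow h x)) b = (\<lambda>x. dd \<phi> b (flow h x) + \<rho> h b x * dd \<phi> e (flow h x))"
proof -
  have fd: "(flow h has_derivative (\<lambda>b. b + \<rho> h b x *\<^sub>R e)) (at x)" for x
  proof -
    have "((\<lambda>x. \<Gamma> (x + h *\<^sub>R \<tau>)) has_derivative (\<lambda>b. g (x + h *\<^sub>R \<tau>) \<bullet> b)) (at x)"
      by (rule has_derivative_compose[of "\<lambda>x. x + h *\<^sub>R \<tau>" "\<lambda>b. b" x UNIV \<Gamma>])
         (auto intro!: derivative_eq_intros deriv)
    then show ?thesis unfolding flow_def
      by (auto intro!: derivative_eq_intros deriv simp: \<rho>_def inner_diff_left)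
  qed
  have "((\<lambda>x. \<phi> (flow h x)) has_derivative (\<lambda>b. dd \<phi> b (flow h x) + \<rho> h b x * dd \<phi> e (flow h x))) (at x)" for x
    using has_derivative_compose[OF fd C1_has_derivative[OF assms]]
    by (simp add: dd_add_dir[OF assms] dd_scale_dir[OF assms])
  moreover have "continuous_on UNIV (\<lambda>x. dd \<phi> b (flow h x) + \<rho> h b x * dd \<phi> e (flow h x))" for b
  proof -
    have fc: "continuous_on UNIV (flow h)"
      using fd has_derivative_continuous by (metis continuous_at_imp_continuous_on)
    have "continuous_on UNIV (\<lambda>x. dd \<phi> b (flow h x))" for b
      using continuous_on_compose2[OF C1_dd_cont[OF assms] fc] by simp
    then show ?thesis by (intro continuous_intros \<rho>_cont)
  qed
  ultimately show ?thesis
    by (rule C1_I[of "\<lambda>x. \<phi> (flow h x)" "\<lambda>x b. dd \<phi> b (flow h x) + \<rho> h b x * dd \<phi> e (flow h x)"])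
qed

lemma flow_cont: "continuous_on UNIV (flow h)"
  unfolding flow_def by (intro continuous_intros \<Gamma>_cont continuous_on_compose2[OF \<Gamma>_cont]) auto

lemma csupp_flow:
  assumes "csupp U \<phi>" "\<And>x. x \<in> U \<Longrightarrow> flow (- h) x \<in> V"
  shows "csupp V (\<lambda>x. \<phi> (flow h x))"
proof -
  obtain K where K: "compact K" "K \<subseteq> U" "\<And>x. x \<notin> K \<Longrightarrow> \<phi> x = 0" using assms(1) unfolding csupp_def by blast
  have "compact (flow (- h) ` K)" using K(1) by (intro compact_continuous_image continuous_on_subset[OF flow_cont]) auto
  moreover have "flow (- h) ` K \<subseteq> V" using K(2) assms(2) by blast
  moreover have "\<phi> (flow h x) = 0" if "x \<notin> flow (- h) ` K" for x
  proof (rule K(3))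
    show "flow h x \<notin> K" using that flow_inverse(2)[of h x] by (metis imageI)
  qed
  ultimately show ?thesis unfolding csupp_def by blast
qed

lemma shift_bl: "bounded_linear (shift h)"
  unfolding shift_def by (rule comp_op_bounded_linear[OF flow_mpres])

lemma shift_shift: "shift h (shift k u) = shift (h + k) u"
  unfolding shift_def using comp_op_compose[OF flow_mpres flow_mpres, of h k u] by (simp add: flow_flow)

lemma shift_0: "shift 0 u = u"
proof -
  have "flow 0 = (\<lambda>x. x)" by (auto simp: flow_0)
  then show ?thesis by (simp add: shift_def comp_op_def)
qed

lemma shift_norm: "norm (shift h u) = norm u"
  unfolding shift_def by (rule comp_op_norm[OF flow_mpres])

lemma shift_adjoint: "shift h u \<bullet> v = u \<bullet> shift (- h) v"
proof -
  have "u \<bullet> shift (- h) v = shift h u \<bullet> shift h (shift (- h) v)"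
    unfolding shift_def by (rule comp_op_inner[OF flow_mpres, symmetric])
  then show ?thesis by (simp add: shift_shift shift_0)
qed

text \<open>The composition with \<open>flow h\<close> is carried by the image of the original
  support under the inverse flow, which V has to contain.\<close>

lemma h0_shift:
  assumes h: "h0 U w W" and V: "\<And>x. x \<in> U \<Longrightarrow> flow (- h) x \<in> V"
  shows "h0 V (shift h w) (shift_grad h W)"
proof -
  obtain f where f: "\<And>n. f n \<in> C1c U" "(\<lambda>n. mk (f n)) \<longlonglongrightarrow> w" "\<And>b. (\<lambda>n. Dl (f n) b) \<longlonglongrightarrow> W b"
    using h unfolding h0_def by blast
  have c: "(\<lambda>x. f n (flow h x)) \<in> C1c V" for n
    using f(1)[of n] C1_flow csupp_flow[OF _ V] unfolding C1c_def by blast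
  have m: "mk (\<lambda>x. f n (flow h x)) = shift h (mk (f n))" for n
    unfolding shift_def by (rule comp_op_mk[OF flow_mpres C1c_sqint[OF f(1)], symmetric])
  have D: "Dl (\<lambda>x. f n (flow h x)) b = shift_grad h (Dl (f n)) b" for n b
  proof -
    have s: "sqint (\<lambda>x. dd (f n) b (flow h x))" for b by (rule mpres_sqint[OF flow_mpres C1c_dd_sqint[OF f(1)]])
    have "Dl (\<lambda>x. f n (flow h x)) b = mk (\<lambda>x. dd (f n) b (flow h x) + \<rho> h b x * dd (f n) e (flow h x))"
      using C1_flow[OF C1c_C1[OF f(1)[of n]], of h b] by (simp add: Dl_def)
    also have "\<dots> = mk (\<lambda>x. dd (f n) b (flow h x)) + mk (\<lambda>x. \<rho> h b x * dd (f n) e (flow h x))"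
      by (rule mk_add[OF s bmult_sqint[OF \<rho>_bmult s]])
    also have "\<dots> = shift_grad h (Dl (f n)) b"
      by (simp add: shift_grad_def shift_def Dl_def comp_op_mk[OF flow_mpres C1c_dd_sqint[OF f(1)]] mul_mk[OF \<rho>_bmult s])
    finally show ?thesis .
  qed
  show ?thesis unfolding h0_def
  proof (intro exI[of _ "\<lambda>n x. f n (flow h x)"] conjI allI)
    show "(\<lambda>x. f n (flow h x)) \<in> C1c V" for n by (rule c)
    show "(\<lambda>n. mk (\<lambda>x. f n (flow h x))) \<longlonglongrightarrow> shift h w"
      unfolding m by (intro bounded_linear.tendsto[OF shift_bl] f)
    show "(\<lambda>n. Dl (\<lambda>x. f n (flow h x)) b) \<longlonglongrightarrow> shift_grad h W b" for b
      unfolding D shift_grad_def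
      by (intro tendsto_add bounded_linear.tendsto[OF mul_bounded_linear[OF \<rho>_bmult]] bounded_linear.tendsto[OF shift_bl] f)
  qed
qed

text \<open>Cut off because the slope of the graph is bounded on bounded sets only.\<close>

definition coeff :: "'a set \<Rightarrow> 'a \<Rightarrow> real" where
  "coeff U x = indicator U x * (g x \<bullet> \<tau>)"

lemma coeff_bound: "(\<And>x. x \<in> U \<Longrightarrow> norm (g x) \<le> M) \<Longrightarrow> 0 \<le> M \<Longrightarrow> \<bar>coeff U x\<bar> \<le> M * norm \<tau>"
  unfolding coeff_def indicator_def
  using Cauchy_Schwarz_ineq2[of "g x" \<tau>] mult_right_mono[of "norm (g x)" M "norm \<tau>"] by fastforce

lemma coeff_meas: "U \<in> sets borel \<Longrightarrow> coeff U \<in> borel_measurable borel"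
proof -
  assume [measurable]: "U \<in> sets borel"
  have [measurable]: "g \<in> borel_measurable borel" using borel_measurable_continuous_onI[OF g_cont] .
  show ?thesis unfolding coeff_def[abs_def] by measurable
qed

lemma coeff_bmult: "U \<in> sets borel \<Longrightarrow> (\<And>x. x \<in> U \<Longrightarrow> norm (g x) \<le> M) \<Longrightarrow> 0 \<le> M \<Longrightarrow> bmult (coeff U)"
  using coeff_bound[of U M] coeff_meas[of U] unfolding bmult_def by blast

lemma mk_fieldd:
  assumes \<phi>: "\<phi> \<in> C1c U" and U: "U \<in> sets borel" and M: "\<And>x. x \<in> U \<Longrightarrow> norm (g x) \<le> M" "0 \<le> M"
  shows "mk (fieldd \<phi>) = Dl \<phi> \<tau> + mul (coeff U) (Dl \<phi> e)"
proof -
  note b = coeff_bmult[OF U M]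
  have z: "dd \<phi> e x = 0" if "x \<notin> U" for x
    using csupp_dd[of U \<phi> e] \<phi> that unfolding C1c_def csupp_def by blast
  have "fieldd \<phi> = (\<lambda>x. dd \<phi> \<tau> x + coeff U x * dd \<phi> e x)"
    by (rule ext) (use z in \<open>auto simp: fieldd_def coeff_def indicator_def\<close>)
  then show ?thesis
    by (simp add: Dl_def mul_mk[OF b C1c_dd_sqint[OF \<phi>]] mk_add C1c_dd_sqint[OF \<phi>] bmult_sqint[OF b])
qed

lemma h0_shift_bound:
  assumes h: "h0 U w W" and U: "U \<in> sets borel" and M: "\<And>x. x \<in> U \<Longrightarrow> norm (g x) \<le> M" "0 \<le> M"
  shows "norm (shift h w - w) \<le> \<bar>h\<bar> * norm (W \<tau> + mul (coeff U) (W e))"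
proof -
  obtain f where f: "\<And>n. f n \<in> C1c U" "(\<lambda>n. mk (f n)) \<longlonglongrightarrow> w" "\<And>b. (\<lambda>n. Dl (f n) b) \<longlonglongrightarrow> W b"
    using h unfolding h0_def by blast
  note b = coeff_bmult[OF U M]
  show ?thesis
  proof (rule LIMSEQ_le)
    show "(\<lambda>n. norm (shift h (mk (f n)) - mk (f n))) \<longlonglongrightarrow> norm (shift h w - w)"
      by (intro tendsto_intros bounded_linear.tendsto[OF shift_bl] f)
    show "(\<lambda>n. \<bar>h\<bar> * norm (Dl (f n) \<tau> + mul (coeff U) (Dl (f n) e))) \<longlonglongrightarrow> \<bar>h\<bar> * norm (W \<tau> + mul (coeff U) (W e))"
      by (intro tendsto_intros bounded_linear.tendsto[OF mul_bounded_linear[OF b]] f)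
    have "norm (shift h (mk (f n)) - mk (f n)) \<le> \<bar>h\<bar> * norm (Dl (f n) \<tau> + mul (coeff U) (Dl (f n) e))" for n
      using flow_bound[of "f n" h, OF C1c_mono[OF f(1)]] mk_fieldd[OF f(1) U M, of n] by (simp add: shift_def)
    then show "\<exists>N. \<forall>n\<ge>N. norm (shift h (mk (f n)) - mk (f n)) \<le> \<bar>h\<bar> * norm (Dl (f n) \<tau> + mul (coeff U) (Dl (f n) e))"
      by blast
  qed
qed

text \<open>The convergence is known for C^1 functions; the bound of the quotients by the
  derivative, uniform in h, carries it over to their closure.\<close>

lemma h0_shift_quotient:
  assumes h: "h0 U w W" and U: "U \<in> sets borel" and M: "\<And>x. x \<in> U \<Longrightarrow> norm (g x) \<le> M" "0 \<le> M"
  shows "((\<lambda>h. (1 / h) *\<^sub>R (shift h w - w)) \<longlongrightarrow> W \<tau> + mul (coeff U) (W e)) (at 0)"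
proof (rule tendstoI)
  fix \<epsilon> :: real assume \<epsilon>: "\<epsilon> > 0"
  obtain f where f: "\<And>n. f n \<in> C1c U" "(\<lambda>n. mk (f n)) \<longlonglongrightarrow> w" "\<And>b. (\<lambda>n. Dl (f n) b) \<longlonglongrightarrow> W b"
    using h unfolding h0_def by blast
  note b = coeff_bmult[OF U M]
  let ?X = "\<lambda>W. W \<tau> + mul (coeff U) (W e)"
  let ?Q = "\<lambda>h w. (1 / h) *\<^sub>R (shift h w - w)"
  have "(\<lambda>n. ?X (Dl (f n))) \<longlonglongrightarrow> ?X W"
    by (intro tendsto_intros bounded_linear.tendsto[OF mul_bounded_linear[OF b]] f)
  then have "\<forall>\<^sub>F n in sequentially. dist (?X (Dl (f n))) (?X W) < \<epsilon> / 3" using \<epsilon> by (intro tendstoD) auto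
  then obtain n where n: "norm (?X (Dl (f n)) - ?X W) < \<epsilon> / 3"
    by (auto simp: eventually_sequentially dist_norm)
  have lin: "?X (\<lambda>b. W b - Dl (f n) b) = ?X W - ?X (Dl (f n))"
    by (simp add: linear_diff[OF mul_linear[OF b]])
  have "((\<lambda>h. ?Q h (mk (f n))) \<longlongrightarrow> ?X (Dl (f n))) (at 0)"
    using flow_diff_quotient(1)[of "f n", OF C1c_mono[OF f(1)]] mk_fieldd[OF f(1) U M, of n] by (simp add: shift_def)
  then have "\<forall>\<^sub>F h in at 0. dist (?Q h (mk (f n))) (?X (Dl (f n))) < \<epsilon> / 3" using \<epsilon> by (intro tendstoD) auto
  moreover have "\<forall>\<^sub>F h::real in at 0. h \<noteq> 0" by (simp add: eventually_at_filter)
  ultimately show "\<forall>\<^sub>F h in at 0. dist (?Q h w) (?X W) < \<epsilon>"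
  proof eventually_elim
    case (elim h)
    have "norm (shift h (w - mk (f n)) - (w - mk (f n))) \<le> \<bar>h\<bar> * norm (?X (\<lambda>b. W b - Dl (f n) b))"
      by (rule h0_shift_bound[OF h0_diff[OF assms(1) h0_C1c[OF f(1)]] U M])
    moreover have "?Q h w - ?Q h (mk (f n)) = (1 / h) *\<^sub>R (shift h (w - mk (f n)) - (w - mk (f n)))"
      by (simp add: linear_diff[OF bounded_linear.linear[OF shift_bl]] algebra_simps)
    ultimately have "norm (?Q h w - ?Q h (mk (f n))) \<le> norm (?X W - ?X (Dl (f n)))"
      using elim(2) lin by (simp add: divide_le_eq mult.commute)
    then have 1: "norm (?Q h w - ?Q h (mk (f n))) < \<epsilon> / 3" using n by (simp add: norm_minus_commute)
    have 2: "norm (?Q h (mk (f n)) - ?X (Dl (f n))) < \<epsilon> / 3" using elim(1) by (simp add: dist_norm)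
    have "?Q h w - ?X W = (?Q h w - ?Q h (mk (f n))) + (?Q h (mk (f n)) - ?X (Dl (f n))) + (?X (Dl (f n)) - ?X W)" by simp
    then have "norm (?Q h w - ?X W) \<le> norm (?Q h w - ?Q h (mk (f n))) + norm (?Q h (mk (f n)) - ?X (Dl (f n))) + norm (?X (Dl (f n)) - ?X W)"
      by (metis norm_triangle_mono norm_triangle_ineq order_refl)
    then show ?case unfolding dist_norm using 1 2 n by linarith
  qed
qed

end

lemma dbounded_I: "(\<And>\<phi>. \<phi> \<in> C1c U \<Longrightarrow> \<bar>q \<bullet> Dl \<phi> b\<bar> \<le> C * norm (mk \<phi>)) \<Longrightarrow> dbounded U q b"
  unfolding dbounded_def by blast

lemma dbounded_nonneg: "dbounded U q b \<Longrightarrow> \<exists>C\<ge>0. \<forall>\<phi>\<in>C1c U. \<bar>q \<bullet> Dl \<phi> b\<bar> \<le> C * norm (mk \<phi>)"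
proof -
  assume "dbounded U q b"
  then obtain C where C: "\<And>\<phi>. \<phi> \<in> C1c U \<Longrightarrow> \<bar>q \<bullet> Dl \<phi> b\<bar> \<le> C * norm (mk \<phi>)" unfolding dbounded_def by blast
  have "\<bar>q \<bullet> Dl \<phi> b\<bar> \<le> \<bar>C\<bar> * norm (mk \<phi>)" if "\<phi> \<in> C1c U" for \<phi>
    by (rule order_trans[OF C[OF that]]) (intro mult_right_mono, auto)
  then show ?thesis by (intro exI[of _ "\<bar>C\<bar>"]) auto
qed

lemma dbounded_mono: "dbounded V q b \<Longrightarrow> U \<subseteq> V \<Longrightarrow> dbounded U q b"
  unfolding dbounded_def using C1c_mono by metis

lemma dbounded_add: "dbounded U q b \<Longrightarrow> dbounded U r b \<Longrightarrow> dbounded U (q + r) b"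
proof -
  assume "dbounded U q b" "dbounded U r b"
  then obtain C D where C: "\<And>\<phi>. \<phi> \<in> C1c U \<Longrightarrow> \<bar>q \<bullet> Dl \<phi> b\<bar> \<le> C * norm (mk \<phi>)"
    and D: "\<And>\<phi>. \<phi> \<in> C1c U \<Longrightarrow> \<bar>r \<bullet> Dl \<phi> b\<bar> \<le> D * norm (mk \<phi>)" unfolding dbounded_def by blast
  show ?thesis
  proof (rule dbounded_I[where C="C + D"])
    fix \<phi> assume "\<phi> \<in> C1c U"
    from C[OF this] D[OF this] show "\<bar>(q + r) \<bullet> Dl \<phi> b\<bar> \<le> (C + D) * norm (mk \<phi>)"
      unfolding inner_add_left distrib_right by linarith
  qed
qed

lemma dbounded_scale: "dbounded U q b \<Longrightarrow> dbounded U (c *\<^sub>R q) b"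
proof -
  assume "dbounded U q b"
  then obtain C where C: "\<And>\<phi>. \<phi> \<in> C1c U \<Longrightarrow> \<bar>q \<bullet> Dl \<phi> b\<bar> \<le> C * norm (mk \<phi>)" unfolding dbounded_def by blast
  show ?thesis
    by (rule dbounded_I[where C="\<bar>c\<bar> * C"]) (use C in \<open>auto simp: abs_mult mult.assoc intro!: mult_left_mono\<close>)
qed

lemma dbounded_diff: "dbounded U q b \<Longrightarrow> dbounded U r b \<Longrightarrow> dbounded U (q - r) b"
  using dbounded_add[of U q b "(-1) *\<^sub>R r"] dbounded_scale[of U r b "-1"] by simp

lemma dbounded_zero: "dbounded U 0 b"
  unfolding dbounded_def by (intro exI[of _ 0]) auto

lemma dbounded_sum: "(\<And>i. i \<in> A \<Longrightarrow> dbounded U (f i) b) \<Longrightarrow> dbounded U (\<Sum>i\<in>A. f i) b"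
  by (induction A rule: infinite_finite_induct) (auto simp: dbounded_zero dbounded_add)

lemma dbounded_dir_add: "dbounded U q a \<Longrightarrow> dbounded U q b \<Longrightarrow> dbounded U q (a + b)"
proof -
  assume "dbounded U q a" "dbounded U q b"
  then obtain C D where C: "\<And>\<phi>. \<phi> \<in> C1c U \<Longrightarrow> \<bar>q \<bullet> Dl \<phi> a\<bar> \<le> C * norm (mk \<phi>)"
    and D: "\<And>\<phi>. \<phi> \<in> C1c U \<Longrightarrow> \<bar>q \<bullet> Dl \<phi> b\<bar> \<le> D * norm (mk \<phi>)" unfolding dbounded_def by blast
  show ?thesis
  proof (rule dbounded_I[where C="C + D"])
    fix \<phi> assume \<phi>: "\<phi> \<in> C1c U"
    show "\<bar>q \<bullet> Dl \<phi> (a + b)\<bar> \<le> (C + D) * norm (mk \<phi>)"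
      unfolding linear_add[OF Dl_linear[OF \<phi>]] inner_add_right distrib_right using C[OF \<phi>] D[OF \<phi>] by linarith
  qed
qed

lemma dbounded_dir_scale: "dbounded U q b \<Longrightarrow> dbounded U q (c *\<^sub>R b)"
proof -
  assume "dbounded U q b"
  then obtain C where C: "\<And>\<phi>. \<phi> \<in> C1c U \<Longrightarrow> \<bar>q \<bullet> Dl \<phi> b\<bar> \<le> C * norm (mk \<phi>)" unfolding dbounded_def by blast
  show ?thesis
  proof (rule dbounded_I[where C="\<bar>c\<bar> * C"])
    fix \<phi> assume \<phi>: "\<phi> \<in> C1c U"
    show "\<bar>q \<bullet> Dl \<phi> (c *\<^sub>R b)\<bar> \<le> \<bar>c\<bar> * C * norm (mk \<phi>)"
      using C[OF \<phi>] by (auto simp: linear_scale[OF Dl_linear[OF \<phi>]] abs_mult mult.assoc intro!: mult_left_mono)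
  qed
qed

lemma mk_mult_norm:
  assumes "f \<in> CC U" "continuous_on UNIV m" "\<And>x. x \<in> U \<Longrightarrow> \<bar>m x\<bar> \<le> B"
  shows "norm (mk (\<lambda>x. m x * f x)) \<le> \<bar>B\<bar> * norm (mk f)"
proof -
  have s: "sqint f" "sqint (\<lambda>x. m x * f x)" using CC_sqint assms(1) CC_mult[OF assms(2,1)] by blast+
  have "\<bar>m x * f x\<bar> \<le> \<bar>\<bar>B\<bar> * f x\<bar>" for x
  proof (cases "x \<in> U")
    case True
    then have "\<bar>m x\<bar> \<le> \<bar>B\<bar>" using assms(3) by force
    then show ?thesis by (simp add: abs_mult mult_right_mono)
  next
    case False
    then have "f x = 0" using assms(1) unfolding CC_def csupp_def by blast
    then show ?thesis by simp
  qed
  then have "norm (mk (\<lambda>x. m x * f x)) \<le> norm (mk (\<lambda>x. \<bar>B\<bar> * f x))"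
    by (intro norm_mk_mono s sqint_scale) auto
  then show ?thesis by (simp add: mk_scale s)
qed

text \<open>The tangential parts of the coordinate vectors are linearly dependent, but they form a
  Parseval frame of the hyperplane orthogonal to e. This spares the choice of an orthonormal basis
  adapted to e.\<close>

lemma en_frame:
  fixes e :: "'a::euclidean_space"
  assumes e: "norm e = 1" and G: "linear G" and H: "linear H"
  shows "en G H = G e \<bullet> H e + (\<Sum>b\<in>Basis. G (b - (b \<bullet> e) *\<^sub>R e) \<bullet> H (b - (b \<bullet> e) *\<^sub>R e))"
proof -
  have ex: "F e = (\<Sum>b\<in>Basis. (b \<bullet> e) *\<^sub>R F b)" if "linear F" for F :: "'a \<Rightarrow> 'a l2"
  proof -
    have "F e = (\<Sum>b\<in>Basis. (e \<bullet> b) *\<^sub>R F b)"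
      using linear_sum[OF that, of "\<lambda>b. (e \<bullet> b) *\<^sub>R b" Basis] linear_scale[OF that]
      by (simp add: euclidean_representation)
    then show ?thesis by (simp only: inner_commute[of e])
  qed
  have "(\<Sum>b\<in>(Basis::'a set). (b \<bullet> e) * (b \<bullet> e)) = e \<bullet> e"
    using euclidean_inner[of e e] by (simp add: inner_commute)
  then have 1: "(\<Sum>b\<in>(Basis::'a set). (b \<bullet> e) * (b \<bullet> e)) = 1" using e by (simp add: norm_eq_1)
  have "(\<Sum>b\<in>Basis. G (b - (b \<bullet> e) *\<^sub>R e) \<bullet> H (b - (b \<bullet> e) *\<^sub>R e)) =
    (\<Sum>b\<in>Basis. G b \<bullet> H b - (b \<bullet> e) * (G e \<bullet> H b) - (b \<bullet> e) * (G b \<bullet> H e) + ((b \<bullet> e) * (b \<bullet> e)) * (G e \<bullet> H e))"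
    by (intro sum.cong) (auto simp: linear_diff[OF G] linear_diff[OF H] linear_scale[OF G] linear_scale[OF H]
        inner_diff_left inner_diff_right algebra_simps)
  also have "\<dots> = en G H - G e \<bullet> (\<Sum>b\<in>Basis. (b \<bullet> e) *\<^sub>R H b) - (\<Sum>b\<in>Basis. (b \<bullet> e) *\<^sub>R G b) \<bullet> H e
      + (\<Sum>b\<in>(Basis::'a set). (b \<bullet> e) * (b \<bullet> e)) * (G e \<bullet> H e)"
    by (simp add: en_def sum.distrib sum_subtractf inner_sum_left inner_sum_right sum_distrib_right)
  also have "\<dots> = en G H - G e \<bullet> H e" unfolding 1 ex[OF G, symmetric] ex[OF H, symmetric] by simp
  finally show ?thesis by simp
qed

section \<open>Energy estimates for tangential differences\<close>

context graph_shear
begin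

lemma mul_shift: "bmult m \<Longrightarrow> shift k (mul m (shift (- k) u)) = mul (\<lambda>x. m (flow k x)) u"
proof -
  assume m: "bmult m"
  have s: "sqint (\<lambda>x. fn u (flow (- k) x))" by (rule mpres_sqint[OF flow_mpres sqint_fn])
  have "mul m (shift (- k) u) = mk (\<lambda>x. m x * fn u (flow (- k) x))"
    unfolding shift_def comp_op_def by (rule mul_mk[OF m s])
  then have "shift k (mul m (shift (- k) u)) = mk (\<lambda>x. m (flow k x) * fn u (flow (- k) (flow k x)))"
    unfolding shift_def using comp_op_mk[OF flow_mpres bmult_sqint[OF m s]] by simp
  then show ?thesis by (simp add: flow_inverse mul_def)
qed

lemma mul_uminus: "bmult m \<Longrightarrow> mul (\<lambda>x. - m x) u = - mul m u"
  unfolding mul_def using mk_uminus[OF bmult_sqint[OF _ sqint_fn]] by simp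

text \<open>The second difference of w along the flow serves as the test function. Up to commutator
  terms of order h the energy then equals the squared gradient norm of the first difference, while
  the right-hand side gains a factor h from the outer difference; dividing by the gradient norm
  leaves a bound linear in h.\<close>

lemma tangential_energy:
  assumes UV: "U \<subseteq> V" and V: "V \<in> sets borel" and M: "\<And>x. x \<in> V \<Longrightarrow> norm (g x) \<le> M" "0 \<le> M"
    and inv: "\<And>h x. \<bar>h\<bar> < \<delta> \<Longrightarrow> x \<in> U \<Longrightarrow> flow h x \<in> V"
    and h0: "h0 U w W"
    and C: "\<And>\<phi>. \<phi> \<in> C1c V \<Longrightarrow> \<bar>en W (Dl \<phi>)\<bar> \<le> C * norm (mk \<phi>)" "0 \<le> C"
  shows "\<exists>K\<ge>0. \<forall>h. \<bar>h\<bar> < \<delta> \<longrightarrow> gn (\<lambda>b. shift_grad h W b - W b) \<le> K * \<bar>h\<bar>"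
proof -
  define D where "D = real DIM('a)"
  have D: "D \<ge> 0" by (simp add: D_def)
  \<comment> \<open>The first summand bounds the right-hand side through the derivative of the
    difference along the field; the second bounds the two commutator sums with \<open>r\<close> and
    \<open>s\<close>, which contribute equally.\<close>
  define K where "K = C * (D * norm \<tau> + M * norm \<tau> * D) + 2 * (D * (L * norm \<tau> * (D * gn W)))"
  have linW: "linear W" using h0 by (rule h0_linear)
  have K: "K \<ge> 0" unfolding K_def using C(2) M(2) D L_nonneg gn_nonneg[of W] by (intro add_nonneg_nonneg mult_nonneg_nonneg) auto
  have "gn (\<lambda>b. shift_grad h W b - W b) \<le> K * \<bar>h\<bar>" if h: "\<bar>h\<bar> < \<delta>" for h
  proof -
    define \<Psi> where "\<Psi> b = shift_grad h W b - W b" for b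
    have hV: "h0 V w W" using h0 UV by (rule h0_mono)
    have hp: "h0 V (shift h w) (shift_grad h W)" by (rule h0_shift[OF h0]) (use inv[of "- h"] h in auto)
    have hm: "h0 V (shift (- h) w) (shift_grad (- h) W)" by (rule h0_shift[OF h0]) (use inv[of h] h in auto)
    have h\<psi>: "h0 V (shift h w - w) \<Psi>" unfolding \<Psi>_def by (rule h0_diff[OF hp hV])
    have lin\<Psi>: "linear \<Psi>" using h\<psi> by (rule h0_linear)
    \<comment> \<open>This is the gradient of the outer difference, with step -h, of
      \<open>shift h w - w\<close>. Written with single shifts of w it stays supported in V, whereas
      shifting the first difference again might leave V.\<close>
    define X where "X b = W b - shift_grad (- h) W b - \<Psi> b" for b
    have hX: "h0 V ((w - shift (- h) w) - (shift h w - w)) X"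
      unfolding X_def by (intro h0_diff hV hm h\<psi>)
    have sl: "linear (shift h)" for h by (rule bounded_linear.linear[OF shift_bl])
    have ml: "linear (mul (\<rho> h b))" for h b by (rule mul_linear[OF \<rho>_bmult])
    define r where "r b = mul (\<rho> h b) (shift h (W e))" for b
    define s where "s b = mul (\<rho> (- h) b) (shift (- h) (\<Psi> e))" for b
    have \<Psi>e: "\<Psi> e = shift h (W e) - W e"
    proof -
      have "\<rho> h e = (\<lambda>x. 0)" by (auto simp: \<rho>_e)
      then have "mul (\<rho> h e) (shift h (W e)) = 0" by (simp add: mul_def mk_zero)
      then show ?thesis by (simp add: \<Psi>_def shift_grad_def)
    qed
    \<comment> \<open>The chain rule for the outer shift, with \<open>s b\<close> as its correction
      term. The remaining corrections of the inner and the outer shift, both acting on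
      \<open>W e\<close>, cancel by \<open>\<rho>_flow\<close>.\<close>
    have Xeq: "X b = shift (- h) (\<Psi> b) - \<Psi> b + s b" for b
    proof -
      have "shift (- h) (r b) = mul (\<lambda>x. \<rho> h b (flow (- h) x)) (W e)"
        unfolding r_def using mul_shift[OF \<rho>_bmult, of "- h" h b "W e"] by simp
      also have "\<dots> = - mul (\<rho> (- h) b) (W e)" unfolding \<rho>_flow by (rule mul_uminus[OF \<rho>_bmult])
      finally have sr: "shift (- h) (r b) = - mul (\<rho> (- h) b) (W e)" .
      have "shift (- h) (\<Psi> b) = W b + shift (- h) (r b) - shift (- h) (W b)"
        unfolding \<Psi>_def shift_grad_def r_def[symmetric]
        by (simp add: linear_add[OF sl] linear_diff[OF sl] shift_shift shift_0)
      moreover have "s b = mul (\<rho> (- h) b) (W e) - mul (\<rho> (- h) b) (shift (- h) (W e))"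
        unfolding s_def \<Psi>e by (simp add: linear_diff[OF sl] linear_diff[OF ml] shift_shift shift_0)
      ultimately show ?thesis unfolding X_def shift_grad_def sr by simp
    qed
    \<comment> \<open>The adjoint of the shift moves it to W, and \<open>shift h (W b)\<close>
      differs from \<open>W b\<close> by \<open>\<Psi> b\<close> up to the correction
      \<open>r b\<close>.\<close>
    have summand: "W b \<bullet> X b = \<Psi> b \<bullet> \<Psi> b - r b \<bullet> \<Psi> b + W b \<bullet> s b" for b
    proof -
      have "W b \<bullet> shift (- h) (\<Psi> b) = shift h (W b) \<bullet> \<Psi> b" by (simp add: shift_adjoint)
      moreover have "shift h (W b) = \<Psi> b - r b + W b" by (simp add: \<Psi>_def shift_grad_def r_def)
      ultimately show ?thesis unfolding Xeq by (simp add: inner_add_right inner_diff_right inner_add_left inner_diff_left)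
    qed
    have sum: "en W X = (gn \<Psi>)\<^sup>2 - (\<Sum>b\<in>Basis. r b \<bullet> \<Psi> b) + (\<Sum>b\<in>Basis. W b \<bullet> s b)"
      unfolding gn_sq by (simp add: en_def summand sum.distrib sum_subtractf)
    have nWe: "norm (W e) \<le> D * gn W" using norm_dir_le_gn[OF linW, of e] by (simp add: D_def e)
    have n\<Psi>e: "norm (\<Psi> e) \<le> D * gn \<Psi>" using norm_dir_le_gn[OF lin\<Psi>, of e] by (simp add: D_def e)
    have mulb: "norm (mul (\<rho> k b) v) \<le> (L * \<bar>k\<bar> * norm \<tau>) * norm v" if "b \<in> Basis" for k b v
    proof (rule mul_norm)
      show "\<rho> k b \<in> borel_measurable borel" by (rule borel_measurable_continuous_onI[OF \<rho>_cont])
      show "\<bar>\<rho> k b x\<bar> \<le> L * \<bar>k\<bar> * norm \<tau>" for x using \<rho>_bound[of k b x] that by simp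
    qed
    have Lh: "0 \<le> L * \<bar>h\<bar> * norm \<tau>" using L_nonneg by simp
    have rb: "\<bar>\<Sum>b\<in>Basis. r b \<bullet> \<Psi> b\<bar> \<le> \<bar>h\<bar> * (D * (L * norm \<tau> * (D * gn W))) * gn \<Psi>"
    proof -
      have "\<bar>\<Sum>b\<in>Basis. r b \<bullet> \<Psi> b\<bar> \<le> (\<Sum>b\<in>(Basis::'a set). ((L * \<bar>h\<bar> * norm \<tau>) * (D * gn W)) * gn \<Psi>)"
      proof (rule order_trans[OF sum_abs sum_mono])
        fix b :: 'a assume b: "b \<in> Basis"
        have "norm (r b) \<le> (L * \<bar>h\<bar> * norm \<tau>) * norm (W e)"
          unfolding r_def using mulb[OF b, of h "shift h (W e)"] by (simp add: shift_norm)
        also have "\<dots> \<le> (L * \<bar>h\<bar> * norm \<tau>) * (D * gn W)" using nWe Lh by (rule mult_left_mono)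
        finally have "norm (r b) * norm (\<Psi> b) \<le> ((L * \<bar>h\<bar> * norm \<tau>) * (D * gn W)) * gn \<Psi>"
          using norm_le_gn[OF b] by (intro mult_mono) (auto intro: order_trans[OF norm_ge_zero])
        then show "\<bar>r b \<bullet> \<Psi> b\<bar> \<le> ((L * \<bar>h\<bar> * norm \<tau>) * (D * gn W)) * gn \<Psi>"
          using Cauchy_Schwarz_ineq2 order_trans by blast
      qed
      also have "\<dots> = \<bar>h\<bar> * (D * (L * norm \<tau> * (D * gn W))) * gn \<Psi>" by (simp add: D_def mult_ac)
      finally show ?thesis .
    qed
    have sb: "\<bar>\<Sum>b\<in>Basis. W b \<bullet> s b\<bar> \<le> \<bar>h\<bar> * (D * (L * norm \<tau> * (D * gn W))) * gn \<Psi>"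
    proof -
      have "\<bar>\<Sum>b\<in>Basis. W b \<bullet> s b\<bar> \<le> (\<Sum>b\<in>(Basis::'a set). gn W * ((L * \<bar>h\<bar> * norm \<tau>) * (D * gn \<Psi>)))"
      proof (rule order_trans[OF sum_abs sum_mono])
        fix b :: 'a assume b: "b \<in> Basis"
        have "norm (s b) \<le> (L * \<bar>h\<bar> * norm \<tau>) * norm (\<Psi> e)"
          unfolding s_def using mulb[OF b, of "- h" "shift (- h) (\<Psi> e)"] by (simp add: shift_norm)
        also have "\<dots> \<le> (L * \<bar>h\<bar> * norm \<tau>) * (D * gn \<Psi>)" using n\<Psi>e Lh by (rule mult_left_mono)
        finally have "norm (W b) * norm (s b) \<le> gn W * ((L * \<bar>h\<bar> * norm \<tau>) * (D * gn \<Psi>))"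
          using norm_le_gn[OF b] gn_nonneg by (intro mult_mono) auto
        then show "\<bar>W b \<bullet> s b\<bar> \<le> gn W * ((L * \<bar>h\<bar> * norm \<tau>) * (D * gn \<Psi>))"
          using Cauchy_Schwarz_ineq2 order_trans by blast
      qed
      also have "\<dots> = \<bar>h\<bar> * (D * (L * norm \<tau> * (D * gn W))) * gn \<Psi>" by (simp add: D_def mult_ac)
      finally show ?thesis .
    qed
    have "\<bar>en W X\<bar> \<le> C * norm ((w - shift (- h) w) - (shift h w - w))"
      using C(1) hX by (rule energy_bound_h0)
    also have "(w - shift (- h) w) - (shift h w - w) = shift (- h) (shift h w - w) - (shift h w - w)"
      by (simp add: linear_diff[OF sl] shift_shift shift_0)
    \<comment> \<open>The outer difference of \<open>shift h w - w\<close> is bounded by its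
      derivative along the flow field; this is where the right-hand side gains its factor h.\<close>
    also have "norm \<dots> \<le> \<bar>- h\<bar> * norm (\<Psi> \<tau> + mul (coeff V) (\<Psi> e))"
      by (rule h0_shift_bound[OF h\<psi> V M])
    also have "norm (\<Psi> \<tau> + mul (coeff V) (\<Psi> e)) \<le> (D * norm \<tau> + M * norm \<tau> * D) * gn \<Psi>"
    proof -
      have "norm (mul (coeff V) (\<Psi> e)) \<le> (M * norm \<tau>) * norm (\<Psi> e)"
        using coeff_meas[OF V] coeff_bound[OF M] by (rule mul_norm)
      also have "\<dots> \<le> (M * norm \<tau>) * (D * gn \<Psi>)" using n\<Psi>e M(2) by (intro mult_left_mono) auto
      moreover have "norm (\<Psi> \<tau>) \<le> D * norm \<tau> * gn \<Psi>" using norm_dir_le_gn[OF lin\<Psi>, of \<tau>] by (simp add: D_def)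
      ultimately show ?thesis using norm_triangle_ineq[of "\<Psi> \<tau>" "mul (coeff V) (\<Psi> e)"] by (simp add: algebra_simps)
    qed
    finally have enX: "\<bar>en W X\<bar> \<le> C * (\<bar>- h\<bar> * ((D * norm \<tau> + M * norm \<tau> * D) * gn \<Psi>))"
      using C(2) by (simp add: mult_left_mono)
    have "(gn \<Psi>)\<^sup>2 \<le> (K * \<bar>h\<bar>) * gn \<Psi>"
    proof -
      have eq: "(K * \<bar>h\<bar>) * gn \<Psi> = C * (\<bar>- h\<bar> * ((D * norm \<tau> + M * norm \<tau> * D) * gn \<Psi>))
          + 2 * (\<bar>h\<bar> * (D * (L * norm \<tau> * (D * gn W))) * gn \<Psi>)"
        by (simp add: K_def algebra_simps)
      show ?thesis using enX rb sb unfolding sum eq by linarith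
    qed
    then have "gn \<Psi> \<le> K * \<bar>h\<bar>"
    proof (cases "gn \<Psi> = 0")
      case False
      then have "gn \<Psi> > 0" using gn_nonneg[of \<Psi>] by linarith
      then show ?thesis using \<open>(gn \<Psi>)\<^sup>2 \<le> (K * \<bar>h\<bar>) * gn \<Psi>\<close> by (simp add: power2_eq_square)
    qed (use K in auto)
    then show ?thesis unfolding \<Psi>_def[abs_def] .
  qed
  then show ?thesis using K by blast
qed

text \<open>The quotients have gradients bounded uniformly in h, so integration by parts bounds
  their pairing with derivatives of test functions; the bound passes to the limit, which is the
  tangential derivative. Zero boundary values allow test functions on the whole space.\<close>

lemma tangential_dbounded:
  assumes UV: "U \<subseteq> V" and V: "V \<in> sets borel" and M: "\<And>x. x \<in> V \<Longrightarrow> norm (g x) \<le> M" "0 \<le> M"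
    and \<delta>: "\<delta> > 0" and inv: "\<And>h x. \<bar>h\<bar> < \<delta> \<Longrightarrow> x \<in> U \<Longrightarrow> flow h x \<in> V"
    and h0: "h0 U w W"
    and C: "\<And>\<phi>. \<phi> \<in> C1c V \<Longrightarrow> \<bar>en W (Dl \<phi>)\<bar> \<le> C * norm (mk \<phi>)" "0 \<le> C"
  shows "dbounded UNIV (W \<tau> + mul (coeff V) (W e)) b"
proof -
  obtain K where K: "K \<ge> 0" "\<And>h. \<bar>h\<bar> < \<delta> \<Longrightarrow> gn (\<lambda>b. shift_grad h W b - W b) \<le> K * \<bar>h\<bar>"
    using tangential_energy[OF UV V M inv h0 C] by blast
  have hV: "h0 V w W" using h0 UV by (rule h0_mono)
  let ?q = "W \<tau> + mul (coeff V) (W e)"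
  show ?thesis
  proof (rule dbounded_I[where C="(real DIM('a) * norm b) * K"])
    fix \<phi> :: "'a \<Rightarrow> real" assume \<phi>: "\<phi> \<in> C1c UNIV"
    have lim: "((\<lambda>h. \<bar>((1 / h) *\<^sub>R (shift h w - w)) \<bullet> Dl \<phi> b\<bar>) \<longlongrightarrow> \<bar>?q \<bullet> Dl \<phi> b\<bar>) (at 0)"
      by (intro tendsto_intros h0_shift_quotient[OF hV V M])
    have "\<forall>\<^sub>F h in at 0. \<bar>((1 / h) *\<^sub>R (shift h w - w)) \<bullet> Dl \<phi> b\<bar> \<le> (real DIM('a) * norm b) * K * norm (mk \<phi>)"
      unfolding eventually_at
    proof (intro exI[of _ \<delta>] conjI ballI impI \<delta>)
      fix h :: real assume "h \<noteq> 0 \<and> dist h 0 < \<delta>"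
      then have hh: "h \<noteq> 0" "\<bar>h\<bar> < \<delta>" by (auto simp: dist_real_def)
      let ?\<Psi> = "\<lambda>b. shift_grad h W b - W b"
      have hp: "h0 V (shift h w) (shift_grad h W)" by (rule h0_shift[OF h0]) (use inv[of "- h"] hh in auto)
      have h\<psi>: "h0 V (shift h w - w) ?\<Psi>" by (rule h0_diff[OF hp hV])
      have "\<bar>(shift h w - w) \<bullet> Dl \<phi> b\<bar> = \<bar>?\<Psi> b \<bullet> mk \<phi>\<bar>" using h0_ibp[OF h\<psi> \<phi>, of b] by simp
      also have "\<dots> \<le> norm (?\<Psi> b) * norm (mk \<phi>)" by (rule Cauchy_Schwarz_ineq2)
      also have "\<dots> \<le> ((real DIM('a) * norm b) * (K * \<bar>h\<bar>)) * norm (mk \<phi>)"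
      proof (rule mult_right_mono)
        have "norm (?\<Psi> b) \<le> (real DIM('a) * norm b) * gn ?\<Psi>" by (rule norm_dir_le_gn[OF h0_linear[OF h\<psi>]])
        also have "\<dots> \<le> (real DIM('a) * norm b) * (K * \<bar>h\<bar>)" using K(2)[OF hh(2)] by (intro mult_left_mono) auto
        finally show "norm (?\<Psi> b) \<le> (real DIM('a) * norm b) * (K * \<bar>h\<bar>)" .
      qed simp
      finally have "\<bar>(shift h w - w) \<bullet> Dl \<phi> b\<bar> \<le> \<bar>h\<bar> * ((real DIM('a) * norm b) * K * norm (mk \<phi>))" by (simp add: mult_ac)
      then show "\<bar>((1 / h) *\<^sub>R (shift h w - w)) \<bullet> Dl \<phi> b\<bar> \<le> (real DIM('a) * norm b) * K * norm (mk \<phi>)"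
        using hh(1) by (simp add: abs_mult divide_le_eq mult_ac)
    qed
    then show "\<bar>?q \<bullet> Dl \<phi> b\<bar> \<le> (real DIM('a) * norm b) * K * norm (mk \<phi>)"
      by (intro tendsto_upperbound[OF lim]) auto
  qed
qed

text \<open>Continuously differentiable approximations of the merely Lipschitz coefficient, obtained as
  difference quotients of the graph function; they are constant in the normal direction.\<close>

definition mh :: "nat \<Rightarrow> 'a \<Rightarrow> real" where
  "mh n x = real (Suc n) * (\<Gamma> (x + (1 / real (Suc n)) *\<^sub>R \<tau>) - \<Gamma> x)"

lemma mh_C1: "mh n \<in> C1 \<and> dd (mh n) b = (\<lambda>x. real (Suc n) * \<rho> (1 / real (Suc n)) b x)"
proof -
  have G: "\<Gamma> \<in> C1" "dd \<Gamma> b = (\<lambda>x. g x \<bullet> b)" for b using dd_\<Gamma> by auto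
  let ?v = "(1 / real (Suc n)) *\<^sub>R \<tau>"
  have s: "(\<lambda>x. \<Gamma> (x + ?v)) \<in> C1 \<and> dd (\<lambda>x. \<Gamma> (x + ?v)) b = (\<lambda>x. g (x + ?v) \<bullet> b)"
    using C1_compose_affine[OF G(1), of ?v b] by (simp add: G(2))
  have d: "(\<lambda>x. \<Gamma> (x + ?v) - \<Gamma> x) \<in> C1 \<and> dd (\<lambda>x. \<Gamma> (x + ?v) - \<Gamma> x) b = (\<lambda>x. g (x + ?v) \<bullet> b - g x \<bullet> b)"
    using C1_diff[of "\<lambda>x. \<Gamma> (x + ?v)" \<Gamma> b] s G by simp
  then show ?thesis using C1_scale[of "\<lambda>x. \<Gamma> (x + ?v) - \<Gamma> x" "real (Suc n)" b]
    unfolding mh_def[abs_def] by (simp add: \<rho>_def inner_diff_left del: of_nat_Suc)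
qed

lemma mh_dd_bound: "\<bar>dd (mh n) b x\<bar> \<le> L * norm \<tau> * norm b"
proof -
  have "real (Suc n) * \<bar>\<rho> (1 / real (Suc n)) b x\<bar> \<le> real (Suc n) * (L * \<bar>1 / real (Suc n)\<bar> * norm \<tau> * norm b)"
    by (intro mult_left_mono \<rho>_bound) auto
  also have "\<dots> = L * norm \<tau> * norm b" by (simp del: of_nat_Suc)
  finally show ?thesis using mh_C1[of n b] by (simp add: abs_mult del: of_nat_Suc)
qed

lemma mh_dd_e: "dd (mh n) e x = 0"
  using mh_C1[of n e] by (simp add: \<rho>_e)

lemma mh_approx: "\<bar>mh n x - g x \<bullet> \<tau>\<bar> \<le> L * (norm \<tau>)\<^sup>2 / real (Suc n)"
proof -
  have "mh n x - g x \<bullet> \<tau> = real (Suc n) * (\<Gamma> (x + (1 / real (Suc n)) *\<^sub>R \<tau>) - \<Gamma> x - (1 / real (Suc n)) * (g x \<bullet> \<tau>))"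
    by (simp add: mh_def algebra_simps del: of_nat_Suc)
  then have "\<bar>mh n x - g x \<bullet> \<tau>\<bar> = real (Suc n) * \<bar>\<Gamma> (x + (1 / real (Suc n)) *\<^sub>R \<tau>) - \<Gamma> x - (1 / real (Suc n)) * (g x \<bullet> \<tau>)\<bar>"
    by (simp add: abs_mult del: of_nat_Suc)
  also have "\<dots> \<le> real (Suc n) * (L * (1 / real (Suc n))\<^sup>2 * (norm \<tau>)\<^sup>2)" by (intro mult_left_mono \<Gamma>_taylor) auto
  also have "\<dots> = L * (norm \<tau>)\<^sup>2 / real (Suc n)" by (simp add: power2_eq_square del: of_nat_Suc)
  finally show ?thesis .
qed

lemma mh_bound:
  assumes "norm (g x) \<le> M"
  shows "\<bar>mh n x\<bar> \<le> M * norm \<tau> + L * (norm \<tau>)\<^sup>2"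
proof -
  have "L * (norm \<tau>)\<^sup>2 / real (Suc n) \<le> L * (norm \<tau>)\<^sup>2 / 1" using L_nonneg by (intro divide_left_mono) auto
  moreover have "\<bar>g x \<bullet> \<tau>\<bar> \<le> M * norm \<tau>"
    using Cauchy_Schwarz_ineq2[of "g x" \<tau>] mult_right_mono[OF assms norm_ge_zero[of \<tau>]] by linarith
  ultimately show ?thesis using mh_approx[of n x] by linarith
qed

lemma mh_cont: "continuous_on UNIV (mh n)" using mh_C1 C1_cont by blast

lemma mh_tendsto:
  assumes f: "f \<in> CC V" and V: "V \<in> sets borel" and M: "\<And>x. x \<in> V \<Longrightarrow> norm (g x) \<le> M" "0 \<le> M"
  shows "(\<lambda>n. mk (\<lambda>x. mh n x * f x)) \<longlonglongrightarrow> mul (coeff V) (mk f)"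
proof -
  note b = coeff_bmult[OF V M]
  have s: "sqint f" using f by (rule CC_sqint)
  have sm: "sqint (\<lambda>x. mh n x * f x)" for n by (rule CC_sqint[OF CC_mult[OF mh_cont f]])
  have z: "f x = 0" if "x \<notin> V" for x using f that unfolding CC_def csupp_def by blast
  have le: "norm (mk (\<lambda>x. mh n x * f x) - mul (coeff V) (mk f)) \<le> (L * (norm \<tau>)\<^sup>2 * norm (mk f)) * (1 / real (Suc n))" for n
  proof -
    have e: "(\<lambda>x. mh n x * f x - coeff V x * f x) = (\<lambda>x. (mh n x - g x \<bullet> \<tau>) * f x)"
      by (rule ext) (use z in \<open>auto simp: coeff_def indicator_def algebra_simps\<close>)
    have "mk (\<lambda>x. mh n x * f x) - mul (coeff V) (mk f) = mk (\<lambda>x. (mh n x - g x \<bullet> \<tau>) * f x)"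
    proof -
      have d: "mk (\<lambda>x. mh n x * f x - coeff V x * f x) = mk (\<lambda>x. mh n x * f x) - mk (\<lambda>x. coeff V x * f x)"
        by (rule mk_diff[OF sm bmult_sqint[OF b s]])
      have "mk (\<lambda>x. mh n x * f x) - mul (coeff V) (mk f) = mk (\<lambda>x. mh n x * f x) - mk (\<lambda>x. coeff V x * f x)"
        using mul_mk[OF b s] by simp
      then show ?thesis using d e by simp
    qed
    also have "norm \<dots> \<le> \<bar>L * (norm \<tau>)\<^sup>2 / real (Suc n)\<bar> * norm (mk f)"
      using mh_approx by (intro mk_mult_norm[OF f] continuous_intros mh_cont g_cont)
    also have "\<dots> = (L * (norm \<tau>)\<^sup>2 * norm (mk f)) * (1 / real (Suc n))" using L_nonneg by simp
    finally show ?thesis .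
  qed
  have "(\<lambda>n. (L * (norm \<tau>)\<^sup>2 * norm (mk f)) * (1 / real (Suc n))) \<longlonglongrightarrow> 0"
    using tendsto_mult[OF tendsto_const LIMSEQ_Suc[OF lim_1_over_n], of "L * (norm \<tau>)\<^sup>2 * norm (mk f)"] by simp
  then have "(\<lambda>n. mk (\<lambda>x. mh n x * f x) - mul (coeff V) (mk f)) \<longlonglongrightarrow> 0"
    by (rule Lim_null_comparison[OF always_eventually, rotated]) (use le in auto)
  then show ?thesis by (simp only: LIM_zero_iff)
qed

lemma mh_Dl: "\<phi> \<in> C1c V \<Longrightarrow> mk (\<lambda>x. mh n x * dd \<phi> b x) = Dl (\<lambda>x. mh n x * \<phi> x) b - mk (\<lambda>x. dd (mh n) b x * \<phi> x)"
  using Dl_mult[of "mh n" \<phi> V b] mh_C1[of n b] by simp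

text \<open>The coefficient is only Lipschitz, so its product with a test function is not one. The
  approximations \<open>mh\<close> are C^1, with values on V and derivatives bounded independently
  of the index, which lets the product rule be applied before the limit.\<close>

lemma dbounded_coeff:
  assumes q: "dbounded V q b" and V: "V \<in> sets borel" and M: "\<And>x. x \<in> V \<Longrightarrow> norm (g x) \<le> M" "0 \<le> M"
  shows "\<exists>K\<ge>0. \<forall>\<phi>\<in>C1c V. \<bar>q \<bullet> mul (coeff V) (Dl \<phi> b)\<bar> \<le> K * norm (mk \<phi>)"
proof -
  obtain C where C: "C \<ge> 0" "\<And>\<phi>. \<phi> \<in> C1c V \<Longrightarrow> \<bar>q \<bullet> Dl \<phi> b\<bar> \<le> C * norm (mk \<phi>)" using dbounded_nonneg[OF q] by blast
  let ?B = "M * norm \<tau> + L * (norm \<tau>)\<^sup>2"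
  let ?K = "C * \<bar>?B\<bar> + norm q * \<bar>L * norm \<tau> * norm b\<bar>"
  have "\<bar>q \<bullet> mul (coeff V) (Dl \<phi> b)\<bar> \<le> ?K * norm (mk \<phi>)" if \<phi>: "\<phi> \<in> C1c V" for \<phi>
  proof (rule LIMSEQ_le_const2)
    show "(\<lambda>n. \<bar>q \<bullet> mk (\<lambda>x. mh n x * dd \<phi> b x)\<bar>) \<longlonglongrightarrow> \<bar>q \<bullet> mul (coeff V) (Dl \<phi> b)\<bar>"
      unfolding Dl_def by (intro tendsto_intros mh_tendsto[OF C1c_dd_CC[OF \<phi>] V M])
    have "\<bar>q \<bullet> mk (\<lambda>x. mh n x * dd \<phi> b x)\<bar> \<le> ?K * norm (mk \<phi>)" for n
    proof -
      have m: "mh n \<in> C1" using mh_C1 by blast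
      have "\<bar>q \<bullet> Dl (\<lambda>x. mh n x * \<phi> x) b\<bar> \<le> C * norm (mk (\<lambda>x. mh n x * \<phi> x))" by (rule C(2)[OF C1c_mult[OF m \<phi>]])
      also have "\<dots> \<le> C * (\<bar>?B\<bar> * norm (mk \<phi>))"
        using mh_bound[OF M(1)] by (intro mult_left_mono C mk_mult_norm[OF C1c_CC[OF \<phi>] mh_cont]) auto
      finally have 1: "\<bar>q \<bullet> Dl (\<lambda>x. mh n x * \<phi> x) b\<bar> \<le> C * \<bar>?B\<bar> * norm (mk \<phi>)" by (simp only: mult.assoc)
      have "\<bar>q \<bullet> mk (\<lambda>x. dd (mh n) b x * \<phi> x)\<bar> \<le> norm q * norm (mk (\<lambda>x. dd (mh n) b x * \<phi> x))" by (rule Cauchy_Schwarz_ineq2)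
      also have "\<dots> \<le> norm q * (\<bar>L * norm \<tau> * norm b\<bar> * norm (mk \<phi>))"
        using mh_dd_bound by (intro mult_left_mono mk_mult_norm[OF C1c_CC[OF \<phi>] C1_dd_cont[OF m]]) auto
      finally have 2: "\<bar>q \<bullet> mk (\<lambda>x. dd (mh n) b x * \<phi> x)\<bar> \<le> norm q * \<bar>L * norm \<tau> * norm b\<bar> * norm (mk \<phi>)" by (simp only: mult.assoc)
      show ?thesis unfolding mh_Dl[OF \<phi>] inner_diff_right distrib_right using 1 2 by linarith
    qed
    then show "\<exists>N. \<forall>n\<ge>N. \<bar>q \<bullet> mk (\<lambda>x. mh n x * dd \<phi> b x)\<bar> \<le> ?K * norm (mk \<phi>)" by blast
  qed
  moreover have "?K \<ge> 0" using C(1) by simp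
  ultimately show ?thesis by blast
qed

text \<open>Symmetry of second derivatives, applied to the test function multiplied by
  \<open>mh\<close>. The derivative of \<open>mh\<close> along e vanishes, so only the product rule
  term in direction \<tau> remains, and it contains \<phi> undifferentiated.\<close>

lemma coeff_commute:
  assumes h: "h0 V w W" and V: "V \<in> sets borel" and M: "\<And>x. x \<in> V \<Longrightarrow> norm (g x) \<le> M" "0 \<le> M" and \<phi>: "\<phi> \<in> C1c V"
  shows "\<bar>W e \<bullet> mul (coeff V) (Dl \<phi> \<tau>) - W \<tau> \<bullet> mul (coeff V) (Dl \<phi> e)\<bar> \<le> norm (W e) * \<bar>L * norm \<tau> * norm \<tau>\<bar> * norm (mk \<phi>)"
proof (rule LIMSEQ_le_const2)
  show "(\<lambda>n. \<bar>W e \<bullet> mk (\<lambda>x. mh n x * dd \<phi> \<tau> x) - W \<tau> \<bullet> mk (\<lambda>x. mh n x * dd \<phi> e x)\<bar>)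
    \<longlonglongrightarrow> \<bar>W e \<bullet> mul (coeff V) (Dl \<phi> \<tau>) - W \<tau> \<bullet> mul (coeff V) (Dl \<phi> e)\<bar>"
    unfolding Dl_def by (intro tendsto_intros mh_tendsto[OF C1c_dd_CC[OF \<phi>] V M])
  have "\<bar>W e \<bullet> mk (\<lambda>x. mh n x * dd \<phi> \<tau> x) - W \<tau> \<bullet> mk (\<lambda>x. mh n x * dd \<phi> e x)\<bar> \<le> norm (W e) * \<bar>L * norm \<tau> * norm \<tau>\<bar> * norm (mk \<phi>)" for n
  proof -
    have m: "mh n \<in> C1" using mh_C1 by blast
    have c: "(\<lambda>x. mh n x * \<phi> x) \<in> C1c UNIV" using C1c_mult[OF m \<phi>] C1c_mono by blast
    have "W e \<bullet> Dl (\<lambda>x. mh n x * \<phi> x) \<tau> = W \<tau> \<bullet> Dl (\<lambda>x. mh n x * \<phi> x) e" by (rule h0_mixed[OF h c])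
    moreover have "mk (\<lambda>x. dd (mh n) e x * \<phi> x) = 0" by (simp add: mh_dd_e mk_zero)
    ultimately have "\<bar>W e \<bullet> mk (\<lambda>x. mh n x * dd \<phi> \<tau> x) - W \<tau> \<bullet> mk (\<lambda>x. mh n x * dd \<phi> e x)\<bar> = \<bar>W e \<bullet> mk (\<lambda>x. dd (mh n) \<tau> x * \<phi> x)\<bar>"
      unfolding mh_Dl[OF \<phi>] inner_diff_right by simp
    also have "\<dots> \<le> norm (W e) * norm (mk (\<lambda>x. dd (mh n) \<tau> x * \<phi> x))" by (rule Cauchy_Schwarz_ineq2)
    also have "\<dots> \<le> norm (W e) * (\<bar>L * norm \<tau> * norm \<tau>\<bar> * norm (mk \<phi>))"
      using mh_dd_bound by (intro mult_left_mono mk_mult_norm[OF C1c_CC[OF \<phi>] C1_dd_cont[OF m]]) auto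
    finally show ?thesis by (simp only: mult.assoc)
  qed
  then show "\<exists>N. \<forall>n\<ge>N. \<bar>W e \<bullet> mk (\<lambda>x. mh n x * dd \<phi> \<tau> x) - W \<tau> \<bullet> mk (\<lambda>x. mh n x * dd \<phi> e x)\<bar> \<le> norm (W e) * \<bar>L * norm \<tau> * norm \<tau>\<bar> * norm (mk \<phi>)"
    by blast
qed

text \<open>Modulo bounded terms a second tangential derivative is a nonnegative multiple of the second normal
  one. Summation over the tangential directions turns the equation into a bound for the latter alone.\<close>

lemma tangential_term:
  assumes h: "h0 V w W" and V: "V \<in> sets borel" and M: "\<And>x. x \<in> V \<Longrightarrow> norm (g x) \<le> M" "0 \<le> M"
    and q: "\<And>b. dbounded V (W \<tau> + mul (coeff V) (W e)) b"
  shows "\<exists>K\<ge>0. \<forall>\<phi>\<in>C1c V. \<bar>W \<tau> \<bullet> Dl \<phi> \<tau> - W e \<bullet> mul (coeff V) (mul (coeff V) (Dl \<phi> e))\<bar> \<le> K * norm (mk \<phi>)"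
proof -
  let ?q = "W \<tau> + mul (coeff V) (W e)"
  note b = coeff_bmult[OF V M]
  obtain K1 where K1: "K1 \<ge> 0" "\<And>\<phi>. \<phi> \<in> C1c V \<Longrightarrow> \<bar>?q \<bullet> Dl \<phi> \<tau>\<bar> \<le> K1 * norm (mk \<phi>)"
    using dbounded_nonneg[OF q] by blast
  obtain K2 where K2: "K2 \<ge> 0" "\<And>\<phi>. \<phi> \<in> C1c V \<Longrightarrow> \<bar>?q \<bullet> mul (coeff V) (Dl \<phi> e)\<bar> \<le> K2 * norm (mk \<phi>)"
    using dbounded_coeff[OF q V M] by blast
  define K3 where "K3 = norm (W e) * \<bar>L * norm \<tau> * norm \<tau>\<bar>"
  have "\<bar>W \<tau> \<bullet> Dl \<phi> \<tau> - W e \<bullet> mul (coeff V) (mul (coeff V) (Dl \<phi> e))\<bar> \<le> (K1 + K2 + K3) * norm (mk \<phi>)"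
    if \<phi>: "\<phi> \<in> C1c V" for \<phi>
  proof -
    \<comment> \<open>By the two identities the quantity to be bounded is \<open>?q\<close> tested
      with \<open>Dl \<phi> \<tau>\<close>, minus \<open>?q\<close> tested with the coefficient
      times \<open>Dl \<phi> e\<close>, minus the difference estimated in
      \<open>coeff_commute\<close>.\<close>
    have 1: "W \<tau> \<bullet> Dl \<phi> \<tau> = ?q \<bullet> Dl \<phi> \<tau> - W e \<bullet> mul (coeff V) (Dl \<phi> \<tau>)"
      by (simp add: inner_add_left mul_inner[OF b])
    have 2: "W \<tau> \<bullet> mul (coeff V) (Dl \<phi> e) = ?q \<bullet> mul (coeff V) (Dl \<phi> e) - W e \<bullet> mul (coeff V) (mul (coeff V) (Dl \<phi> e))"
      by (simp add: inner_add_left mul_inner[OF b])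
    show ?thesis
      using 1 2 K1(2)[OF \<phi>] K2(2)[OF \<phi>] coeff_commute[OF h V M \<phi>, folded K3_def] unfolding distrib_right by linarith
  qed
  moreover have "K1 + K2 + K3 \<ge> 0" using K1 K2 by (simp add: K3_def)
  ultimately show ?thesis by blast
qed

end

section \<open>Recovery of the normal second derivative\<close>

lemma C1_sum:
  "(\<And>i. i \<in> A \<Longrightarrow> f i \<in> C1) \<Longrightarrow> (\<lambda>x. \<Sum>i\<in>A. f i x) \<in> C1 \<and> dd (\<lambda>x. \<Sum>i\<in>A. f i x) b = (\<lambda>x. \<Sum>i\<in>A. dd (f i) b x)"
proof (induction A rule: infinite_finite_induct)
  case (insert i A)
  then show ?case using C1_add[of "f i" "\<lambda>x. \<Sum>i\<in>A. f i x" b] by simp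
qed (auto simp: C1_const)

lemma mk_sum: "(\<And>i. i \<in> A \<Longrightarrow> sqint (f i)) \<Longrightarrow> sqint (\<lambda>x. \<Sum>i\<in>A. f i x) \<and> mk (\<lambda>x. \<Sum>i\<in>A. f i x) = (\<Sum>i\<in>A. mk (f i))"
proof (induction A rule: infinite_finite_induct)
  case (insert i A)
  then show ?case using sqint_add[of "f i" "\<lambda>x. \<Sum>i\<in>A. f i x"] mk_add[of "f i" "\<lambda>x. \<Sum>i\<in>A. f i x"] by simp
qed (auto simp: sqint_zero mk_zero)

lemma CC_bmult: "m \<in> CC U \<Longrightarrow> bmult m"
  unfolding bmult_def using CC_measurable CC_bounded by blast

lemma bmult_mult: "bmult m \<Longrightarrow> bmult m' \<Longrightarrow> bmult (\<lambda>x. m x * m' x)"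
proof -
  assume a: "bmult m" "bmult m'"
  then obtain B B' where B: "\<And>x. \<bar>m x\<bar> \<le> B" "\<And>x. \<bar>m' x\<bar> \<le> B'" unfolding bmult_def by blast
  have "\<bar>m x * m' x\<bar> \<le> B * B'" for x
    unfolding abs_mult using B by (intro mult_mono) (auto intro: order_trans[OF abs_ge_zero])
  moreover have "(\<lambda>x. m x * m' x) \<in> borel_measurable borel"
    using a unfolding bmult_def by (intro borel_measurable_times) auto
  ultimately show ?thesis unfolding bmult_def by blast
qed

lemma mul_mul: "bmult m \<Longrightarrow> bmult m' \<Longrightarrow> mul m (mul m' u) = mul (\<lambda>x. m x * m' x) u"
  unfolding mul_def[of m' u] by (subst mul_mk) (simp_all add: bmult_sqint mul_def mult.assoc)

context graph_shear
begin

text \<open>An explicit rate, because it is applied to functions that vary with n while their norms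
  stay bounded; a limit for fixed f would not be enough.\<close>

lemma mh_sq_close:
  assumes f: "f \<in> CC V" and V: "V \<in> sets borel" and M: "\<And>x. x \<in> V \<Longrightarrow> norm (g x) \<le> M" "0 \<le> M"
  shows "norm (mul (coeff V) (mul (coeff V) (mk f)) - mk (\<lambda>x. (mh n x)\<^sup>2 * f x))
    \<le> (L * (norm \<tau>)\<^sup>2 * (2 * M * norm \<tau> + L * (norm \<tau>)\<^sup>2) * norm (mk f)) * (1 / real (Suc n))"
proof -
  note b = coeff_bmult[OF V M]
  have s: "sqint f" using f by (rule CC_sqint)
  have c: "continuous_on UNIV (\<lambda>x. (mh n x)\<^sup>2)" by (intro continuous_intros mh_cont)
  have sm: "sqint (\<lambda>x. (mh n x)\<^sup>2 * f x)" by (rule CC_sqint[OF CC_mult[OF c f]])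
  have z: "f x = 0" if "x \<notin> V" for x using f that unfolding CC_def csupp_def by blast
  have 1: "mul (coeff V) (mul (coeff V) (mk f)) = mk (\<lambda>x. coeff V x * (coeff V x * f x))"
    by (simp add: mul_mk[OF b s] mul_mk[OF b bmult_sqint[OF b s]])
  have sc: "sqint (\<lambda>x. coeff V x * (coeff V x * f x))" by (intro bmult_sqint[OF b] s)
  have e: "(\<lambda>x. coeff V x * (coeff V x * f x) - (mh n x)\<^sup>2 * f x) = (\<lambda>x. ((g x \<bullet> \<tau>)\<^sup>2 - (mh n x)\<^sup>2) * f x)"
    by (rule ext) (use z in \<open>auto simp: coeff_def indicator_def algebra_simps power2_eq_square\<close>)
  have "mul (coeff V) (mul (coeff V) (mk f)) - mk (\<lambda>x. (mh n x)\<^sup>2 * f x) = mk (\<lambda>x. ((g x \<bullet> \<tau>)\<^sup>2 - (mh n x)\<^sup>2) * f x)"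
    using mk_diff[OF sc sm] 1 e by simp
  also have "norm \<dots> \<le> \<bar>(L * (norm \<tau>)\<^sup>2 / real (Suc n)) * (2 * M * norm \<tau> + L * (norm \<tau>)\<^sup>2)\<bar> * norm (mk f)"
  proof (rule mk_mult_norm[OF f])
    show "continuous_on UNIV (\<lambda>x. (g x \<bullet> \<tau>)\<^sup>2 - (mh n x)\<^sup>2)" by (intro continuous_intros mh_cont g_cont)
    fix x assume x: "x \<in> V"
    have "(g x \<bullet> \<tau>)\<^sup>2 - (mh n x)\<^sup>2 = (g x \<bullet> \<tau> - mh n x) * (g x \<bullet> \<tau> + mh n x)"
      by (simp add: power2_eq_square algebra_simps)
    then have "\<bar>(g x \<bullet> \<tau>)\<^sup>2 - (mh n x)\<^sup>2\<bar> = \<bar>mh n x - g x \<bullet> \<tau>\<bar> * \<bar>g x \<bullet> \<tau> + mh n x\<bar>"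
      by (simp add: abs_mult abs_minus_commute)
    also have "\<dots> \<le> (L * (norm \<tau>)\<^sup>2 / real (Suc n)) * (2 * M * norm \<tau> + L * (norm \<tau>)\<^sup>2)"
    proof (intro mult_mono mh_approx)
      have "\<bar>g x \<bullet> \<tau>\<bar> \<le> M * norm \<tau>"
        using Cauchy_Schwarz_ineq2[of "g x" \<tau>] mult_right_mono[OF M(1)[OF x] norm_ge_zero[of \<tau>]] by linarith
      then show "\<bar>g x \<bullet> \<tau> + mh n x\<bar> \<le> 2 * M * norm \<tau> + L * (norm \<tau>)\<^sup>2"
        using mh_bound[OF M(1)[OF x], of n] by linarith
    qed (use L_nonneg in auto)
    finally show "\<bar>(g x \<bullet> \<tau>)\<^sup>2 - (mh n x)\<^sup>2\<bar> \<le> (L * (norm \<tau>)\<^sup>2 / real (Suc n)) * (2 * M * norm \<tau> + L * (norm \<tau>)\<^sup>2)" .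
  qed
  also have "\<dots> = (L * (norm \<tau>)\<^sup>2 * (2 * M * norm \<tau> + L * (norm \<tau>)\<^sup>2) * norm (mk f)) * (1 / real (Suc n))"
    using L_nonneg M(2) by (simp add: abs_mult)
  finally show ?thesis .
qed

end

text \<open>With the tangential terms replaced by multiples of the normal one, the equation bounds
  \<open>W e\<close> tested with 1 plus the sum of the squared slopes, times
  \<open>Dl \<phi> e\<close>. This factor is at least 1 and constant along e, so dividing the test
  function by it isolates the normal derivative.\<close>

lemma normal_recovery:
  fixes e :: "'a::euclidean_space"
  assumes gs: "graph_shear e \<Gamma> g L" and h: "h0 V w W"
    and V: "V \<in> sets borel" and M: "\<And>x. x \<in> V \<Longrightarrow> norm (g x) \<le> M" "0 \<le> M"
    and q: "\<And>\<tau> b. \<tau> \<bullet> e = 0 \<Longrightarrow> dbounded V (W \<tau> + mul (graph_shear.coeff \<tau> g V) (W e)) b"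
    and C: "\<And>\<phi>. \<phi> \<in> C1c V \<Longrightarrow> \<bar>en W (Dl \<phi>)\<bar> \<le> C * norm (mk \<phi>)"
  shows "dbounded V (W a) b"
proof -
  have e1: "norm e = 1" "e \<bullet> e = 1" using graph_shear.e[OF gs] by (auto simp: norm_eq_1)
  define T where "T b = b - (b \<bullet> e) *\<^sub>R e" for b
  have Te: "T b \<bullet> e = 0" for b by (simp add: T_def inner_diff_left e1)
  have Tb: "b = (b \<bullet> e) *\<^sub>R e + T b" for b by (simp add: T_def)
  have linW: "linear W" using h by (rule h0_linear)
  let ?c = "\<lambda>\<tau>. graph_shear.coeff \<tau> g V"
  let ?m = "\<lambda>\<tau>. graph_shear.mh \<tau> \<Gamma>"
  have "\<forall>b. \<exists>K\<ge>0. \<forall>\<phi>\<in>C1c V. \<bar>W (T b) \<bullet> Dl \<phi> (T b) - W e \<bullet> mul (?c (T b)) (mul (?c (T b)) (Dl \<phi> e))\<bar> \<le> K * norm (mk \<phi>)"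
    using graph_shear.tangential_term[OF gs h V M q[OF Te]] by blast
  then obtain K where K: "\<And>b. K b \<ge> 0"
    "\<And>b \<phi>. \<phi> \<in> C1c V \<Longrightarrow> \<bar>W (T b) \<bullet> Dl \<phi> (T b) - W e \<bullet> mul (?c (T b)) (mul (?c (T b)) (Dl \<phi> e))\<bar> \<le> K b * norm (mk \<phi>)"
    by metis
  define K0 where "K0 = \<bar>C\<bar> + (\<Sum>b\<in>Basis. K b)"
  have K0: "K0 \<ge> 0" unfolding K0_def using K(1) by (simp add: sum_nonneg)
  have D: "\<bar>W e \<bullet> (Dl \<phi> e + (\<Sum>b\<in>Basis. mul (?c (T b)) (mul (?c (T b)) (Dl \<phi> e))))\<bar> \<le> K0 * norm (mk \<phi>)"
    if \<phi>: "\<phi> \<in> C1c V" for \<phi>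
  proof -
    let ?t = "\<lambda>b. W (T b) \<bullet> Dl \<phi> (T b)" and ?s = "\<lambda>b. W e \<bullet> mul (?c (T b)) (mul (?c (T b)) (Dl \<phi> e))"
    have fr: "en W (Dl \<phi>) = W e \<bullet> Dl \<phi> e + (\<Sum>b\<in>Basis. ?t b)"
      unfolding T_def by (rule en_frame[OF e1(1) linW Dl_linear[OF \<phi>]])
    have "\<bar>(\<Sum>b\<in>Basis. ?t b) - (\<Sum>b\<in>Basis. ?s b)\<bar> \<le> (\<Sum>b\<in>Basis. K b * norm (mk \<phi>))"
      unfolding sum_subtractf[symmetric] by (rule order_trans[OF sum_abs sum_mono]) (rule K(2)[OF \<phi>])
    then have s: "\<bar>(\<Sum>b\<in>Basis. ?t b) - (\<Sum>b\<in>Basis. ?s b)\<bar> \<le> (\<Sum>b\<in>Basis. K b) * norm (mk \<phi>)"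
      by (simp add: sum_distrib_right)
    have "C * norm (mk \<phi>) \<le> \<bar>C\<bar> * norm (mk \<phi>)" by (intro mult_right_mono) auto
    then show ?thesis
      using s fr C[OF \<phi>] unfolding K0_def inner_add_right inner_sum_right distrib_right by linarith
  qed
  have We_e: "dbounded V (W e) e"
  proof (rule dbounded_I[where C=K0])
    fix \<phi> assume \<phi>: "\<phi> \<in> C1c V"
    \<comment> \<open>The C^1 approximation of the factor. Its derivative along e is zero, hence
      dividing a test function by it commutes with differentiation along e.\<close>
    define \<kappa> where "\<kappa> n x = 1 + (\<Sum>b\<in>Basis. ?m (T b) n x * ?m (T b) n x)" for n x
    have mC1: "?m \<tau> n \<in> C1" for \<tau> n using graph_shear.mh_C1[OF gs] by blast
    have mde: "dd (?m \<tau> n) e x = 0" for \<tau> n x by (rule graph_shear.mh_dd_e[OF gs])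
    have sq: "(\<lambda>x. ?m \<tau> n x * ?m \<tau> n x) \<in> C1 \<and> dd (\<lambda>x. ?m \<tau> n x * ?m \<tau> n x) e = (\<lambda>x. 0)" for \<tau> n
      using C1_mult[OF mC1 mC1, of \<tau> n \<tau> n e] by (simp add: mde)
    have \<kappa>: "\<kappa> n \<in> C1 \<and> dd (\<kappa> n) e = (\<lambda>x. 0)" for n
    proof -
      have s: "(\<lambda>x. \<Sum>b\<in>Basis. ?m (T b) n x * ?m (T b) n x) \<in> C1 \<and> dd (\<lambda>x. \<Sum>b\<in>Basis. ?m (T b) n x * ?m (T b) n x) e = (\<lambda>x. 0)"
        using C1_sum[of Basis "\<lambda>b x. ?m (T b) n x * ?m (T b) n x" e] sq by simp
      show ?thesis unfolding \<kappa>_def[abs_def]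
        using C1_add[OF conjunct1[OF C1_const] conjunct1[OF s], of 1 e] C1_const[of 1 e] s by simp
    qed
    have \<kappa>1: "\<kappa> n x \<ge> 1" for n x unfolding \<kappa>_def by (simp add: sum_nonneg)
    then have \<kappa>0: "\<kappa> n x \<noteq> 0" for n x by (metis not_one_le_zero)
    have inv: "(\<lambda>x. 1 / \<kappa> n x) \<in> C1 \<and> dd (\<lambda>x. 1 / \<kappa> n x) e = (\<lambda>x. 0)" for n
      using C1_divide[of "\<kappa> n" e] \<kappa>[of n] \<kappa>0 by simp
    have inv1: "\<bar>1 / \<kappa> n x\<bar> \<le> 1" for n x using \<kappa>1[of n x] by simp
    define \<xi> where "\<xi> n x = (1 / \<kappa> n x) * dd \<phi> e x" for n x
    have \<xi>C: "\<xi> n \<in> CC V" for n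
      unfolding \<xi>_def[abs_def] using CC_mult[OF C1_cont C1c_dd_CC[OF \<phi>]] inv by blast
    define \<psi> where "\<psi> n x = (1 / \<kappa> n x) * \<phi> x" for n x
    have \<psi>: "\<psi> n \<in> C1c V" for n unfolding \<psi>_def[abs_def] using C1c_mult[OF _ \<phi>] inv by blast
    have D\<psi>: "Dl (\<psi> n) e = mk (\<xi> n)" for n
      unfolding \<psi>_def[abs_def] \<xi>_def[abs_def] using Dl_mult[OF conjunct1[OF inv] \<phi>, of n e] inv[of n] by (simp add: mk_zero)
    have n\<psi>: "norm (mk (\<psi> n)) \<le> norm (mk \<phi>)" for n
      using mk_mult_norm[OF C1c_CC[OF \<phi>] C1_cont[OF conjunct1[OF inv]] inv1, of n] by (simp add: \<psi>_def[abs_def])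
    have n\<xi>: "norm (mk (\<xi> n)) \<le> norm (Dl \<phi> e)" for n
      using mk_mult_norm[OF C1c_dd_CC[OF \<phi>] C1_cont[OF conjunct1[OF inv]] inv1, of n e] by (simp add: \<xi>_def[abs_def] Dl_def)
    have mC: "(\<lambda>x. (?m \<tau> n x)\<^sup>2 * \<xi> n x) \<in> CC V" for \<tau> n
      by (intro CC_mult[OF _ \<xi>C] continuous_intros C1_cont mC1)
    \<comment> \<open>Multiplying \<xi> by the approximate factor recovers
      \<open>Dl \<phi> e\<close>, whereas the estimate \<open>D\<close> contains the exact slopes;
      the discrepancy \<open>?R\<close> tends to zero.\<close>
    have split: "Dl \<phi> e = mk (\<xi> n) + (\<Sum>b\<in>Basis. mk (\<lambda>x. (?m (T b) n x)\<^sup>2 * \<xi> n x))" for n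
    proof -
      have "dd \<phi> e = (\<lambda>x. \<xi> n x + (\<Sum>b\<in>Basis. (?m (T b) n x)\<^sup>2 * \<xi> n x))"
      proof
        fix x
        have "\<xi> n x + (\<Sum>b\<in>Basis. (?m (T b) n x)\<^sup>2 * \<xi> n x) = \<kappa> n x * \<xi> n x"
          by (simp add: \<kappa>_def sum_distrib_right distrib_right power2_eq_square)
        then show "dd \<phi> e x = \<xi> n x + (\<Sum>b\<in>Basis. (?m (T b) n x)\<^sup>2 * \<xi> n x)" using \<kappa>0 by (simp add: \<xi>_def)
      qed
      then show ?thesis
        using mk_sum[of Basis "\<lambda>b x. (?m (T b) n x)\<^sup>2 * \<xi> n x"] CC_sqint[OF mC] CC_sqint[OF \<xi>C]
          mk_add[of "\<xi> n" "\<lambda>x. \<Sum>b\<in>Basis. (?m (T b) n x)\<^sup>2 * \<xi> n x"]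
        by (simp add: Dl_def)
    qed
    let ?R = "\<lambda>n b. mul (?c (T b)) (mul (?c (T b)) (mk (\<xi> n))) - mk (\<lambda>x. (?m (T b) n x)\<^sup>2 * \<xi> n x)"
    define E where "E b = L * (norm (T b))\<^sup>2 * (2 * M * norm (T b) + L * (norm (T b))\<^sup>2)" for b
    have E: "E b \<ge> 0" for b unfolding E_def using graph_shear.L_nonneg[OF gs] M(2) by simp
    have R0: "(\<lambda>n. ?R n b) \<longlonglongrightarrow> 0" for b
    proof (rule Lim_null_comparison[OF always_eventually])
      show "\<forall>n. norm (?R n b) \<le> (E b * norm (Dl \<phi> e)) * (1 / real (Suc n))"
      proof
        fix n
        have "norm (?R n b) \<le> (E b * norm (mk (\<xi> n))) * (1 / real (Suc n))"
          unfolding E_def by (rule graph_shear.mh_sq_close[OF gs \<xi>C V M])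
        also have "\<dots> \<le> (E b * norm (Dl \<phi> e)) * (1 / real (Suc n))"
          using n\<xi>[of n] E[of b] by (intro mult_right_mono mult_left_mono) auto
        finally show "norm (?R n b) \<le> (E b * norm (Dl \<phi> e)) * (1 / real (Suc n))" .
      qed
      show "(\<lambda>n. (E b * norm (Dl \<phi> e)) * (1 / real (Suc n))) \<longlonglongrightarrow> 0"
        using tendsto_mult[OF tendsto_const LIMSEQ_Suc[OF lim_1_over_n], of "E b * norm (Dl \<phi> e)"] by simp
    qed
    have "(\<lambda>n. \<bar>W e \<bullet> (Dl \<phi> e + (\<Sum>b\<in>Basis. ?R n b))\<bar>) \<longlonglongrightarrow> \<bar>W e \<bullet> (Dl \<phi> e + (\<Sum>b\<in>(Basis::'a set). 0))\<bar>"
      by (intro tendsto_intros R0)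
    then have lim: "(\<lambda>n. \<bar>W e \<bullet> (Dl \<phi> e + (\<Sum>b\<in>Basis. ?R n b))\<bar>) \<longlonglongrightarrow> \<bar>W e \<bullet> Dl \<phi> e\<bar>" by simp
    have "\<bar>W e \<bullet> (Dl \<phi> e + (\<Sum>b\<in>Basis. ?R n b))\<bar> \<le> K0 * norm (mk \<phi>)" for n
    proof -
      have "Dl \<phi> e + (\<Sum>b\<in>Basis. ?R n b) = mk (\<xi> n) + (\<Sum>b\<in>Basis. mul (?c (T b)) (mul (?c (T b)) (mk (\<xi> n))))"
        unfolding split[of n] sum_subtractf by simp
      then have "\<bar>W e \<bullet> (Dl \<phi> e + (\<Sum>b\<in>Basis. ?R n b))\<bar> \<le> K0 * norm (mk (\<psi> n))"
        using D[OF \<psi>, of n] unfolding D\<psi> by simp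
      also have "\<dots> \<le> K0 * norm (mk \<phi>)" using n\<psi> K0 by (rule mult_left_mono)
      finally show ?thesis .
    qed
    then show "\<bar>W e \<bullet> Dl \<phi> e\<bar> \<le> K0 * norm (mk \<phi>)" by (intro LIMSEQ_le_const2[OF lim]) blast
  qed
  \<comment> \<open>\<open>W \<tau>\<close> differs from the tangential derivative by the
    coefficient times \<open>W e\<close>, so it inherits every weak derivative that
    \<open>W e\<close> has.\<close>
  have from_q: "dbounded V (W \<tau>) b" if \<tau>: "\<tau> \<bullet> e = 0" and b: "dbounded V (W e) b" for \<tau> b
  proof -
    interpret graph_shear e \<tau> \<Gamma> g L by (rule gs)
    obtain K1 where K1: "\<And>\<phi>. \<phi> \<in> C1c V \<Longrightarrow> \<bar>(W \<tau> + mul (coeff V) (W e)) \<bullet> Dl \<phi> b\<bar> \<le> K1 * norm (mk \<phi>)"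
      using q[OF \<tau>, of b] unfolding dbounded_def by blast
    obtain K2 where K2: "\<And>\<phi>. \<phi> \<in> C1c V \<Longrightarrow> \<bar>W e \<bullet> mul (coeff V) (Dl \<phi> b)\<bar> \<le> K2 * norm (mk \<phi>)"
      using dbounded_coeff[OF b V M] by blast
    show ?thesis
    proof (rule dbounded_I[where C="K1 + K2"])
      fix \<phi> assume \<phi>: "\<phi> \<in> C1c V"
      have "W \<tau> \<bullet> Dl \<phi> b = (W \<tau> + mul (coeff V) (W e)) \<bullet> Dl \<phi> b - W e \<bullet> mul (coeff V) (Dl \<phi> b)"
        by (simp add: inner_add_left mul_inner[OF coeff_bmult[OF V M]])
      then show "\<bar>W \<tau> \<bullet> Dl \<phi> b\<bar> \<le> (K1 + K2) * norm (mk \<phi>)"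
        using K1[OF \<phi>] K2[OF \<phi>] unfolding distrib_right by linarith
    qed
  qed
  \<comment> \<open>A tangential derivative of the normal component is a normal derivative of a
    tangential component, which the preceding step covers.\<close>
  have We: "dbounded V (W e) b" for b
  proof -
    have "dbounded V (W (T b)) e" by (rule from_q[OF Te We_e])
    then have "dbounded V (W e) (T b)"
      unfolding dbounded_def using h0_mixed[OF h C1c_mono[OF _ subset_UNIV], of _ V e "T b"] by simp
    then have "dbounded V (W e) ((b \<bullet> e) *\<^sub>R e + T b)" by (intro dbounded_dir_add dbounded_dir_scale We_e)
    then show ?thesis by (simp only: Tb[symmetric])
  qed
  have "W a = (a \<bullet> e) *\<^sub>R W e + W (T a)"
    using linear_add[OF linW, of "(a \<bullet> e) *\<^sub>R e" "T a"] linear_scale[OF linW] by (simp only: Tb[symmetric])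
  then show ?thesis using dbounded_add[OF dbounded_scale[OF We] from_q[OF Te We]] by simp
qed

subsection \<open>Localization\<close>

text \<open>Handles lower order terms created by localisation: the derivative is moved off \<phi>,
  partly onto u, whose gradient is known, and partly onto the multiplier.\<close>

lemma dbounded_mul_h0:
  assumes h: "h0 U u G" and m: "m \<in> C1c UNIV"
  shows "dbounded U (mul m u) b"
proof -
  obtain B where B: "B \<ge> 0" "\<And>x. \<bar>m x\<bar> \<le> B" using CC_bounded[OF C1c_CC[OF m]] by blast
  obtain B' where B': "B' \<ge> 0" "\<And>x. \<bar>dd m b x\<bar> \<le> B'" using CC_bounded[OF C1c_dd_CC[OF m]] by blast
  note bm = CC_bmult[OF C1c_CC[OF m]]
  show ?thesis
  proof (rule dbounded_I[where C="norm (G b) * B + norm u * B'"])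
    fix \<phi> assume \<phi>: "\<phi> \<in> C1c U"
    have "mul m (Dl \<phi> b) = Dl (\<lambda>x. m x * \<phi> x) b - mk (\<lambda>x. dd m b x * \<phi> x)"
      using Dl_mult[OF C1c_C1[OF m] \<phi>, of b] by (simp add: Dl_def mul_mk[OF bm C1c_dd_sqint[OF \<phi>]])
    then have "mul m u \<bullet> Dl \<phi> b = u \<bullet> Dl (\<lambda>x. m x * \<phi> x) b - u \<bullet> mk (\<lambda>x. dd m b x * \<phi> x)"
      by (simp add: mul_inner[OF bm] inner_diff_right)
    moreover have "u \<bullet> Dl (\<lambda>x. m x * \<phi> x) b = - (G b \<bullet> mk (\<lambda>x. m x * \<phi> x))"
      using h0_ibp[OF h C1c_mult'[OF m C1c_C1[OF \<phi>]], of b] by simp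
    moreover have "\<bar>G b \<bullet> mk (\<lambda>x. m x * \<phi> x)\<bar> \<le> norm (G b) * B * norm (mk \<phi>)"
    proof -
      have "\<bar>G b \<bullet> mk (\<lambda>x. m x * \<phi> x)\<bar> \<le> norm (G b) * norm (mk (\<lambda>x. m x * \<phi> x))" by (rule Cauchy_Schwarz_ineq2)
      also have "\<dots> \<le> norm (G b) * (\<bar>B\<bar> * norm (mk \<phi>))"
        by (intro mult_left_mono mk_mult_norm[OF C1c_CC[OF \<phi>] C1_cont[OF C1c_C1[OF m]] B(2)]) auto
      finally show ?thesis using B(1) by (simp add: mult.assoc)
    qed
    moreover have "\<bar>u \<bullet> mk (\<lambda>x. dd m b x * \<phi> x)\<bar> \<le> norm u * B' * norm (mk \<phi>)"
    proof -
      have "\<bar>u \<bullet> mk (\<lambda>x. dd m b x * \<phi> x)\<bar> \<le> norm u * norm (mk (\<lambda>x. dd m b x * \<phi> x))" by (rule Cauchy_Schwarz_ineq2)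
      also have "\<dots> \<le> norm u * (\<bar>B'\<bar> * norm (mk \<phi>))"
        by (intro mult_left_mono mk_mult_norm[OF C1c_CC[OF \<phi>] C1_dd_cont[OF C1c_C1[OF m]] B'(2)]) auto
      finally show ?thesis using B'(1) by (simp add: mult.assoc)
    qed
    ultimately show "\<bar>mul m u \<bullet> Dl \<phi> b\<bar> \<le> (norm (G b) * B + norm u * B') * norm (mk \<phi>)"
      unfolding distrib_right by linarith
  qed
qed

lemma csupp_mult_Int: "csupp U \<phi> \<Longrightarrow> csupp B \<zeta> \<Longrightarrow> csupp (U \<inter> B) (\<lambda>x. \<zeta> x * \<phi> x)"
proof -
  assume "csupp U \<phi>" "csupp B \<zeta>"
  then obtain K K' where "compact K" "K \<subseteq> U" "\<forall>x. x \<notin> K \<longrightarrow> \<phi> x = 0" "compact K'" "K' \<subseteq> B" "\<forall>x. x \<notin> K' \<longrightarrow> \<zeta> x = 0"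
    unfolding csupp_def by blast
  then show ?thesis unfolding csupp_def by (intro exI[of _ "K \<inter> K'"]) (auto intro: compact_Int)
qed

lemma h0_mult:
  assumes h: "h0 U u G" and \<zeta>: "\<zeta> \<in> C1c B"
  shows "h0 (U \<inter> B) (mul \<zeta> u) (\<lambda>b. mul \<zeta> (G b) + mul (dd \<zeta> b) u)"
proof -
  obtain f where f: "\<And>n. f n \<in> C1c U" "(\<lambda>n. mk (f n)) \<longlonglongrightarrow> u" "\<And>b. (\<lambda>n. Dl (f n) b) \<longlonglongrightarrow> G b"
    using h unfolding h0_def by blast
  note b0 = CC_bmult[OF C1c_CC[OF \<zeta>]] and b1 = CC_bmult[OF C1c_dd_CC[OF \<zeta>]]
  have c: "(\<lambda>x. \<zeta> x * f n x) \<in> C1c (U \<inter> B)" for n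
    using f(1)[of n] \<zeta> C1_mult[of \<zeta> "f n"] csupp_mult_Int[of U "f n" B \<zeta>] unfolding C1c_def by blast
  have m: "mk (\<lambda>x. \<zeta> x * f n x) = mul \<zeta> (mk (f n))" for n
    by (rule mul_mk[OF b0 C1c_sqint[OF f(1)], symmetric])
  have D: "Dl (\<lambda>x. \<zeta> x * f n x) b = mul \<zeta> (Dl (f n) b) + mul (dd \<zeta> b) (mk (f n))" for n b
    using Dl_mult[OF C1c_C1[OF \<zeta>] f(1)] by (simp add: Dl_def mul_mk[OF b0 C1c_dd_sqint[OF f(1)]] mul_mk[OF b1 C1c_sqint[OF f(1)]])
  show ?thesis unfolding h0_def
  proof (intro exI[of _ "\<lambda>n x. \<zeta> x * f n x"] conjI allI)
    show "(\<lambda>x. \<zeta> x * f n x) \<in> C1c (U \<inter> B)" for n by (rule c)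
    show "(\<lambda>n. mk (\<lambda>x. \<zeta> x * f n x)) \<longlonglongrightarrow> mul \<zeta> u"
      unfolding m by (intro bounded_linear.tendsto[OF mul_bounded_linear[OF b0]] f)
    show "(\<lambda>n. Dl (\<lambda>x. \<zeta> x * f n x) b) \<longlonglongrightarrow> mul \<zeta> (G b) + mul (dd \<zeta> b) u" for b
      unfolding D by (intro tendsto_add bounded_linear.tendsto[OF mul_bounded_linear[OF b0]]
          bounded_linear.tendsto[OF mul_bounded_linear[OF b1]] f)
  qed
qed

lemma mul_Dl: "\<zeta> \<in> C1c B \<Longrightarrow> \<phi> \<in> C1c U \<Longrightarrow> mul \<zeta> (Dl \<phi> b) = Dl (\<lambda>x. \<zeta> x * \<phi> x) b - mul (dd \<zeta> b) (mk \<phi>)"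
  using Dl_mult[OF C1c_C1, of \<zeta> B \<phi> U b]
  by (simp add: Dl_def mul_mk[OF CC_bmult[OF C1c_CC] C1c_dd_sqint] mul_mk[OF CC_bmult[OF C1c_dd_CC] C1c_sqint])

lemma mul_CC_norm: "m \<in> CC B \<Longrightarrow> \<exists>K\<ge>0. \<forall>u. norm (mul m u) \<le> K * norm u"
  using CC_bounded[of m B] mul_norm[OF CC_measurable[of m B]] by blast

text \<open>Cutting off u changes the equation only by terms without second derivatives of u. One of
  them still has a derivative on the test function and is integrated by parts again, which
  differentiates \<zeta> twice; hence \<zeta> is a smooth test function.\<close>

lemma energy_mult:
  assumes h: "h0 \<Omega> u G" and \<zeta>: "\<zeta> \<in> test_functions UNIV"
    and C: "\<And>\<phi>. \<phi> \<in> C1c \<Omega> \<Longrightarrow> \<bar>en G (Dl \<phi>)\<bar> \<le> C * norm (mk \<phi>)"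
  shows "\<exists>K\<ge>0. \<forall>\<phi>\<in>C1c \<Omega>. \<bar>en (\<lambda>b. mul \<zeta> (G b) + mul (dd \<zeta> b) u) (Dl \<phi>)\<bar> \<le> K * norm (mk \<phi>)"
proof -
  have \<zeta>C: "\<zeta> \<in> C1c UNIV" using \<zeta> by (rule test_C1c)
  note b0 = CC_bmult[OF C1c_CC[OF \<zeta>C]]
  have d: "\<exists>K\<ge>0. \<forall>\<phi>\<in>C1c \<Omega>. \<bar>mul (dd \<zeta> b) u \<bullet> Dl \<phi> b\<bar> \<le> K * norm (mk \<phi>)" if "b \<in> Basis" for b
    by (rule dbounded_nonneg[OF dbounded_mul_h0[OF h test_C1c[OF test_dd[OF \<zeta> that]]]])
  then obtain K1 where K1: "\<And>b. b \<in> Basis \<Longrightarrow> K1 b \<ge> 0"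
    "\<And>b \<phi>. b \<in> Basis \<Longrightarrow> \<phi> \<in> C1c \<Omega> \<Longrightarrow> \<bar>mul (dd \<zeta> b) u \<bullet> Dl \<phi> b\<bar> \<le> K1 b * norm (mk \<phi>)" by metis
  obtain K0 where K0: "K0 \<ge> 0" "\<And>u. norm (mul \<zeta> u) \<le> K0 * norm u" using mul_CC_norm[OF C1c_CC[OF \<zeta>C]] by blast
  have "\<exists>K\<ge>0. \<forall>u. norm (mul (dd \<zeta> b) u) \<le> K * norm u" for b by (rule mul_CC_norm[OF C1c_dd_CC[OF \<zeta>C]])
  then obtain K2 where K2: "\<And>b. K2 b \<ge> 0" "\<And>b u. norm (mul (dd \<zeta> b) u) \<le> K2 b * norm u" by metis
  define K where "K = \<bar>C\<bar> * K0 + (\<Sum>b\<in>Basis. norm (G b) * K2 b) + (\<Sum>b\<in>Basis. K1 b)"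
  have "\<bar>en (\<lambda>b. mul \<zeta> (G b) + mul (dd \<zeta> b) u) (Dl \<phi>)\<bar> \<le> K * norm (mk \<phi>)" if \<phi>: "\<phi> \<in> C1c \<Omega>" for \<phi>
  proof -
    have z\<phi>: "(\<lambda>x. \<zeta> x * \<phi> x) \<in> C1c \<Omega>" by (rule C1c_mult[OF C1c_C1[OF \<zeta>C] \<phi>])
    have eq: "en (\<lambda>b. mul \<zeta> (G b) + mul (dd \<zeta> b) u) (Dl \<phi>) =
      en G (Dl (\<lambda>x. \<zeta> x * \<phi> x)) - (\<Sum>b\<in>Basis. G b \<bullet> mul (dd \<zeta> b) (mk \<phi>)) + (\<Sum>b\<in>Basis. mul (dd \<zeta> b) u \<bullet> Dl \<phi> b)"
      unfolding en_def by (simp add: inner_add_left mul_inner[OF b0] mul_Dl[OF \<zeta>C \<phi>] inner_diff_right sum.distrib sum_subtractf)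
    have "\<bar>en G (Dl (\<lambda>x. \<zeta> x * \<phi> x))\<bar> \<le> C * norm (mk (\<lambda>x. \<zeta> x * \<phi> x))" by (rule C[OF z\<phi>])
    also have "\<dots> \<le> \<bar>C\<bar> * norm (mul \<zeta> (mk \<phi>))"
      unfolding mul_mk[OF b0 C1c_sqint[OF \<phi>]] by (intro mult_right_mono) auto
    also have "\<dots> \<le> \<bar>C\<bar> * (K0 * norm (mk \<phi>))" using K0 by (intro mult_left_mono) auto
    finally have 1: "\<bar>en G (Dl (\<lambda>x. \<zeta> x * \<phi> x))\<bar> \<le> \<bar>C\<bar> * K0 * norm (mk \<phi>)" by (simp only: mult.assoc)
    have "\<bar>\<Sum>b\<in>Basis. G b \<bullet> mul (dd \<zeta> b) (mk \<phi>)\<bar> \<le> (\<Sum>b\<in>Basis. norm (G b) * (K2 b * norm (mk \<phi>)))"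
      by (rule order_trans[OF sum_abs sum_mono], rule order_trans[OF Cauchy_Schwarz_ineq2])
         (intro mult_left_mono K2 norm_ge_zero)
    then have 2: "\<bar>\<Sum>b\<in>Basis. G b \<bullet> mul (dd \<zeta> b) (mk \<phi>)\<bar> \<le> (\<Sum>b\<in>Basis. norm (G b) * K2 b) * norm (mk \<phi>)"
      by (simp add: sum_distrib_right mult.assoc)
    have "\<bar>\<Sum>b\<in>Basis. mul (dd \<zeta> b) u \<bullet> Dl \<phi> b\<bar> \<le> (\<Sum>b\<in>Basis. K1 b * norm (mk \<phi>))"
      by (rule order_trans[OF sum_abs sum_mono]) (rule K1(2)[OF _ \<phi>])
    then have 3: "\<bar>\<Sum>b\<in>Basis. mul (dd \<zeta> b) u \<bullet> Dl \<phi> b\<bar> \<le> (\<Sum>b\<in>Basis. K1 b) * norm (mk \<phi>)"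
      by (simp add: sum_distrib_right)
    show ?thesis unfolding eq K_def distrib_right using 1 2 3 by linarith
  qed
  moreover have "K \<ge> 0" unfolding K_def using K0 K1 K2 by (intro add_nonneg_nonneg sum_nonneg mult_nonneg_nonneg) auto
  ultimately show ?thesis by blast
qed

lemma bump_translate_test:
  assumes "\<epsilon> > 0"
  shows "(\<lambda>x. bump \<epsilon> (x + v)) \<in> test_functions UNIV"
proof (rule C1c_smooth_test)
  let ?S = "{\<lambda>x. \<theta> (x + v) | \<theta>. \<theta> \<in> bump_alg \<epsilon>}"
  show "smooth (\<lambda>x. bump \<epsilon> (x + v))"
  proof (rule smooth_if_closed)
    show "f \<in> C1" if fS: "f \<in> ?S" for f
    proof -
      obtain \<theta> where \<theta>: "f = (\<lambda>x. \<theta> (x + v))" "\<theta> \<in> bump_alg \<epsilon>" using fS by blast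
      show ?thesis unfolding \<theta>(1) using C1_compose_affine[of \<theta> v] bump_alg_C1[OF \<theta>(2)] by blast
    qed
    show "dd f b \<in> ?S" if fS: "f \<in> ?S" for f b
    proof -
      obtain \<theta> where \<theta>: "f = (\<lambda>x. \<theta> (x + v))" "\<theta> \<in> bump_alg \<epsilon>" using fS by blast
      have "dd f b = (\<lambda>x. dd \<theta> b (x + v))"
        unfolding \<theta>(1) using C1_compose_affine[of \<theta> v b] bump_alg_C1[OF \<theta>(2)] by blast
      then show ?thesis using bump_alg_C1[OF \<theta>(2)] by blast
    qed
    show "(\<lambda>x. bump \<epsilon> (x + v)) \<in> ?S" using bump_bump_alg by blast
  qed
  show "csupp UNIV (\<lambda>x. bump \<epsilon> (x + v))"
    by (rule csupp_translate) (use bump_C1c[OF assms] in \<open>auto simp: C1c_def\<close>)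
qed

text \<open>The premise on \<open>y \<bullet> e - \<Gamma> y\<close> says that within the ball the
  region is a union of levels of this height. It holds for a ball inside the domain and for the
  region above a graph, so interior and boundary points are treated together.\<close>

lemma local_regularity:
  fixes e p :: "'a::euclidean_space"
  assumes gs: "graph_shear e \<Gamma> g L" and \<Omega>: "open \<Omega>" and r: "r > 0"
    and inv: "\<And>x y. x \<in> \<Omega> \<Longrightarrow> x \<in> ball p r \<Longrightarrow> y \<in> ball p r \<Longrightarrow> y \<bullet> e - \<Gamma> y = x \<bullet> e - \<Gamma> x \<Longrightarrow> y \<in> \<Omega>"
    and h: "h0 \<Omega> u G" and C: "\<And>\<phi>. \<phi> \<in> C1c \<Omega> \<Longrightarrow> \<bar>en G (Dl \<phi>)\<bar> \<le> C * norm (mk \<phi>)"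
  shows "\<exists>\<zeta>\<in>test_functions UNIV. \<zeta> p \<noteq> 0 \<and> (\<forall>a b. dbounded \<Omega> (mul (\<lambda>x. \<zeta> x * \<zeta> x) (G a)) b)"
proof -
  have e1: "norm e = 1" "e \<bullet> e = 1" using graph_shear.e[OF gs] by (auto simp: norm_eq_1)
  \<comment> \<open>Three radii: the cut-off is supported within r / 2, the localised function lives
    in the ball of radius 2 r / 3, and the ball of radius r leaves room r / 3 for the flow.\<close>
  define \<zeta> where "\<zeta> x = bump (r / 2) (x + - p)" for x
  have \<zeta>t: "\<zeta> \<in> test_functions UNIV" unfolding \<zeta>_def[abs_def] using r by (intro bump_translate_test) auto
  have \<zeta>C: "\<zeta> \<in> C1c UNIV" using \<zeta>t by (rule test_C1c)
  have \<zeta>0: "\<zeta> x = 0" if "x \<notin> cball p (r / 2)" for x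
    using bump_pos_iff[of "r / 2" "x + - p"] r that by (auto simp: \<zeta>_def dist_norm norm_minus_commute)
  have \<zeta>p: "\<zeta> p \<noteq> 0" using bump_pos_iff[of "r / 2" "p + - p"] r by (simp add: \<zeta>_def)
  let ?B = "ball p (2 * r / 3)"
  have "cball p (r / 2) \<subseteq> ?B" using r by auto
  then have "csupp ?B \<zeta>" unfolding csupp_def using \<zeta>0 compact_cball by blast
  then have \<zeta>B: "\<zeta> \<in> C1c ?B" using \<zeta>C by (simp add: C1c_def)
  define U where "U = \<Omega> \<inter> ?B"
  define V where "V = \<Omega> \<inter> ball p r"
  have UV: "U \<subseteq> V" unfolding U_def V_def using r by auto
  have Vm: "V \<in> sets borel" unfolding V_def using \<Omega> by auto
  have VB: "V \<subseteq> cball 0 (norm p + r)"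
  proof
    fix x assume "x \<in> V"
    then have "norm (p - x) < r" by (simp add: V_def dist_norm)
    then show "x \<in> cball 0 (norm p + r)" using norm_triangle_ineq4[of p "p - x"] by simp
  qed
  obtain M where M: "M \<ge> 0" "\<And>x. x \<in> V \<Longrightarrow> norm (g x) \<le> M"
    using graph_shear.g_bounded[OF gs, of "norm p + r"] VB by blast
  define w where "w = mul \<zeta> u"
  define W where "W b = mul \<zeta> (G b) + mul (dd \<zeta> b) u" for b
  have hU: "h0 U w W" unfolding U_def w_def W_def[abs_def] by (rule h0_mult[OF h \<zeta>B])
  have hV: "h0 V w W" using hU UV by (rule h0_mono)
  obtain K where K: "K \<ge> 0" "\<And>\<phi>. \<phi> \<in> C1c \<Omega> \<Longrightarrow> \<bar>en W (Dl \<phi>)\<bar> \<le> K * norm (mk \<phi>)"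
    using energy_mult[OF h \<zeta>t C] unfolding W_def[abs_def] by blast
  have KV: "\<bar>en W (Dl \<phi>)\<bar> \<le> K * norm (mk \<phi>)" if "\<phi> \<in> C1c V" for \<phi>
    by (rule K(2)[OF C1c_mono[OF that]]) (simp add: V_def)
  have q: "dbounded V (W \<tau> + mul (graph_shear.coeff \<tau> g V) (W e)) b" if \<tau>: "\<tau> \<bullet> e = 0" for \<tau> b
  proof -
    interpret graph_shear e \<tau> \<Gamma> g L by (rule gs)
    obtain M' where M': "M' \<ge> 0" "\<And>x h. x \<in> cball 0 (norm p + r) \<Longrightarrow> \<bar>h\<bar> \<le> 1 \<Longrightarrow> norm (flow h x - x) \<le> M' * \<bar>h\<bar>"
      using flow_displacement by blast
    \<comment> \<open>Displacements are then at most r / 3.\<close>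
    define \<delta> where "\<delta> = min 1 (r / (3 * (M' + 1)))"
    have \<delta>: "\<delta> > 0" unfolding \<delta>_def using r M'(1) by simp
    have fV: "flow h x \<in> V" if hh: "\<bar>h\<bar> < \<delta>" and x: "x \<in> U" for h x
    proof -
      have "\<bar>h\<bar> < r / (3 * (M' + 1))" using hh by (simp add: \<delta>_def)
      then have "\<bar>h\<bar> * (3 * (M' + 1)) < r" using M'(1) by (simp add: pos_less_divide_eq)
      then have "3 * (M' * \<bar>h\<bar>) \<le> r" by (simp add: algebra_simps)
      moreover have "norm (flow h x - x) \<le> M' * \<bar>h\<bar>"
        using UV VB x hh by (intro M'(2)) (auto simp: \<delta>_def)
      moreover have "dist p x < 2 * r / 3" using x by (simp add: U_def)
      moreover have "dist p (flow h x) \<le> dist p x + norm (flow h x - x)"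
        using dist_triangle[of p "flow h x" x] by (simp add: dist_norm norm_minus_commute)
      ultimately have b: "flow h x \<in> ball p r" by simp
      have "\<Gamma> (flow h x) = \<Gamma> (x + h *\<^sub>R \<tau>)" by (simp add: flow_def local.inv)
      \<comment> \<open>The rise along e equals the increment of \<Gamma>, and \<tau>, being
        orthogonal to e, adds nothing to the height.\<close>
      then have "flow h x \<bullet> e - \<Gamma> (flow h x) = x \<bullet> e - \<Gamma> x"
        by (simp add: flow_def inner_add_left \<tau> e1)
      then have "flow h x \<in> \<Omega>" using x UV b by (intro assms(4)[of x "flow h x"]) (auto simp: U_def V_def)
      then show ?thesis using b by (simp add: V_def)
    qed
    show ?thesis
      by (rule dbounded_mono[OF tangential_dbounded[OF UV Vm M(2,1) \<delta> fV hU KV K(1)]]) auto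
  qed
  have dV: "dbounded V (W a) b" for a b
    by (rule normal_recovery[OF gs hV Vm M(2,1) q KV])
  note b0 = CC_bmult[OF C1c_CC[OF \<zeta>C]] and b1 = CC_bmult[OF C1c_dd_CC[OF \<zeta>C]]
  \<comment> \<open>Bounds on V reach all of \<Omega> through a second factor \<zeta>, which turns
    every test function on \<Omega> into one on V; this is the origin of the square.\<close>
  have dQ: "dbounded \<Omega> (mul \<zeta> (W a)) b" for a b
  proof -
    obtain K1 where K1: "\<And>\<phi>. \<phi> \<in> C1c V \<Longrightarrow> \<bar>W a \<bullet> Dl \<phi> b\<bar> \<le> K1 * norm (mk \<phi>)" using dV unfolding dbounded_def by blast
    obtain K2 where K2: "K2 \<ge> 0" "\<And>u. norm (mul \<zeta> u) \<le> K2 * norm u" using mul_CC_norm[OF C1c_CC[OF \<zeta>C]] by blast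
    obtain K3 where K3: "K3 \<ge> 0" "\<And>u. norm (mul (dd \<zeta> b) u) \<le> K3 * norm u" using mul_CC_norm[OF C1c_dd_CC[OF \<zeta>C]] by blast
    show ?thesis
    proof (rule dbounded_I[where C="\<bar>K1\<bar> * K2 + norm (W a) * K3"])
      fix \<phi> assume \<phi>: "\<phi> \<in> C1c \<Omega>"
      have "csupp (\<Omega> \<inter> ?B) (\<lambda>x. \<zeta> x * \<phi> x)" using csupp_mult_Int[of \<Omega> \<phi> ?B \<zeta>] \<phi> \<zeta>B by (auto simp: C1c_def)
      then have "(\<lambda>x. \<zeta> x * \<phi> x) \<in> C1c U" using C1_mult[OF C1c_C1[OF \<zeta>C] C1c_C1[OF \<phi>]] by (simp add: C1c_def U_def)
      then have c: "(\<lambda>x. \<zeta> x * \<phi> x) \<in> C1c V" using UV by (rule C1c_mono)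
      have eq: "mul \<zeta> (W a) \<bullet> Dl \<phi> b = W a \<bullet> Dl (\<lambda>x. \<zeta> x * \<phi> x) b - W a \<bullet> mul (dd \<zeta> b) (mk \<phi>)"
        by (simp add: mul_inner[OF b0] mul_Dl[OF \<zeta>C \<phi>] inner_diff_right)
      have "\<bar>W a \<bullet> Dl (\<lambda>x. \<zeta> x * \<phi> x) b\<bar> \<le> \<bar>K1\<bar> * norm (mul \<zeta> (mk \<phi>))"
        unfolding mul_mk[OF b0 C1c_sqint[OF \<phi>]] by (rule order_trans[OF K1[OF c]]) (intro mult_right_mono, auto)
      also have "\<dots> \<le> \<bar>K1\<bar> * (K2 * norm (mk \<phi>))" using K2 by (intro mult_left_mono) auto
      finally have 1: "\<bar>W a \<bullet> Dl (\<lambda>x. \<zeta> x * \<phi> x) b\<bar> \<le> \<bar>K1\<bar> * K2 * norm (mk \<phi>)" by (simp only: mult.assoc)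
      have "\<bar>W a \<bullet> mul (dd \<zeta> b) (mk \<phi>)\<bar> \<le> norm (W a) * norm (mul (dd \<zeta> b) (mk \<phi>))" by (rule Cauchy_Schwarz_ineq2)
      also have "\<dots> \<le> norm (W a) * (K3 * norm (mk \<phi>))" using K3 by (intro mult_left_mono) auto
      finally have 2: "\<bar>W a \<bullet> mul (dd \<zeta> b) (mk \<phi>)\<bar> \<le> norm (W a) * K3 * norm (mk \<phi>)" by (simp only: mult.assoc)
      show "\<bar>mul \<zeta> (W a) \<bullet> Dl \<phi> b\<bar> \<le> (\<bar>K1\<bar> * K2 + norm (W a) * K3) * norm (mk \<phi>)"
        unfolding eq distrib_right using 1 2 by linarith
    qed
  qed
  have dZ: "dbounded \<Omega> (mul (\<lambda>x. \<zeta> x * \<zeta> x) (G a)) b" if a: "a \<in> Basis" for a b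
  proof -
    have "(\<lambda>x. \<zeta> x * dd \<zeta> a x) \<in> C1c UNIV" by (rule C1c_mult'[OF \<zeta>C C1c_C1[OF test_C1c[OF test_dd[OF \<zeta>t a]]]])
    then have "dbounded \<Omega> (mul (\<lambda>x. \<zeta> x * dd \<zeta> a x) u) b" by (rule dbounded_mul_h0[OF h])
    then have "dbounded \<Omega> (mul \<zeta> (W a) - mul (\<lambda>x. \<zeta> x * dd \<zeta> a x) u) b" by (rule dbounded_diff[OF dQ])
    moreover have "mul \<zeta> (W a) = mul (\<lambda>x. \<zeta> x * \<zeta> x) (G a) + mul (\<lambda>x. \<zeta> x * dd \<zeta> a x) u"
      unfolding W_def by (simp add: linear_add[OF mul_linear[OF b0]] mul_mul[OF b0 b0] mul_mul[OF b0 b1])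
    ultimately show ?thesis by simp
  qed
  have lG: "linear G" using h by (rule h0_linear)
  have "dbounded \<Omega> (mul (\<lambda>x. \<zeta> x * \<zeta> x) (G a)) b" for a b
  proof -
    have "G a = (\<Sum>i\<in>Basis. (a \<bullet> i) *\<^sub>R G i)"
      using linear_sum[OF lG, of "\<lambda>i. (a \<bullet> i) *\<^sub>R i" Basis] linear_scale[OF lG] by (simp add: euclidean_representation)
    then have "mul (\<lambda>x. \<zeta> x * \<zeta> x) (G a) = (\<Sum>i\<in>Basis. (a \<bullet> i) *\<^sub>R mul (\<lambda>x. \<zeta> x * \<zeta> x) (G i))"
      by (simp add: linear_sum[OF mul_linear[OF bmult_mult[OF b0 b0]]] linear_scale[OF mul_linear[OF bmult_mult[OF b0 b0]]])
    then show ?thesis using dZ by (simp add: dbounded_sum dbounded_scale)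
  qed
  then show ?thesis using \<zeta>t \<zeta>p by blast
qed

text \<open>Z may have zeros outside U. The set where Z is nonzero and the complement of a compact
  set carrying \<phi> are open and cover the space, and on the latter the quotient is zero.\<close>

lemma C1c_divide:
  assumes \<phi>: "\<phi> \<in> C1c U" and Z: "Z \<in> C1" "\<And>x. x \<in> U \<Longrightarrow> Z x \<noteq> 0"
  shows "(\<lambda>x. \<phi> x / Z x) \<in> C1c U"
proof -
  obtain K where K: "compact K" "K \<subseteq> U" "\<And>x. x \<notin> K \<Longrightarrow> \<phi> x = 0" using \<phi> unfolding C1c_def csupp_def by blast
  have cK: "closed K" using K(1) by (rule compact_imp_closed)
  let ?F = "\<lambda>x b. (dd \<phi> b x * Z x - \<phi> x * dd Z b x) / (Z x * Z x)"
  have F0: "?F x b = 0" if "x \<notin> K" for x b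
    using dd_zero_outside[of K \<phi> x b, OF cK K(3) that] K(3)[OF that] by simp
  have d: "((\<lambda>x. \<phi> x / Z x) has_derivative ?F x) (at x)" for x
  proof (cases "Z x = 0")
    case True
    then have x: "x \<notin> K" using K(2) Z(2) by blast
    have "((\<lambda>x. 0) has_derivative (\<lambda>b. 0)) (at x)" by simp
    then have "((\<lambda>x. \<phi> x / Z x) has_derivative (\<lambda>b. 0)) (at x)"
      by (rule has_derivative_transform_within_open[of _ _ _ _ "- K"]) (use x cK K(3) in \<open>auto simp: open_Compl\<close>)
    moreover have "?F x = (\<lambda>b. 0)" by (rule ext) (rule F0[OF x])
    ultimately show ?thesis by (simp only:)
  next
    case False
    then show ?thesis
      using C1_has_derivative[OF C1c_C1[OF \<phi>], of x] C1_has_derivative[OF Z(1), of x]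
      by (auto intro!: derivative_eq_intros simp: field_simps)
  qed
  have c: "continuous_on UNIV (\<lambda>x. ?F x b)" for b
  proof -
    have o: "open {x. Z x \<noteq> 0}" "open (- K)"
      using open_Collect_neq[OF C1_cont[OF Z(1)] continuous_on_const, of 0] cK by (auto simp: open_Compl)
    have "continuous_on {x. Z x \<noteq> 0} (\<lambda>x. ?F x b)"
      by (intro continuous_intros continuous_on_subset[OF C1_cont[OF Z(1)]] continuous_on_subset[OF C1_dd_cont[OF Z(1)]]
          continuous_on_subset[OF C1_cont[OF C1c_C1[OF \<phi>]]] continuous_on_subset[OF C1_dd_cont[OF C1c_C1[OF \<phi>]]]) auto
    moreover have "continuous_on (- K) (\<lambda>x. ?F x b)"
      using continuous_on_cong[of "- K" "- K" "\<lambda>x. ?F x b" "\<lambda>x. 0"] F0 by auto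
    ultimately have "continuous_on ({x. Z x \<noteq> 0} \<union> - K) (\<lambda>x. ?F x b)"
      using o by (intro continuous_on_open_Un)
    moreover have "{x. Z x \<noteq> 0} \<union> - K = UNIV" using K(2) Z(2) by blast
    ultimately show ?thesis by simp
  qed
  have "(\<lambda>x. \<phi> x / Z x) \<in> C1" using C1_I[OF d c] by blast
  moreover have "csupp U (\<lambda>x. \<phi> x / Z x)" unfolding csupp_def using K by auto
  ultimately show ?thesis by (simp add: C1c_def)
qed

text \<open>Compactness leaves finitely many squared cut-offs, whose sum Z is bounded below on the
  domain. Instead of normalising them to a partition of unity, the test function is written as Z
  times another one.\<close>

lemma global_regularity:
  fixes \<Omega> :: "'a::euclidean_space set"
  assumes \<Omega>: "bounded \<Omega>" "\<Omega> \<noteq> {}"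
    and loc: "\<And>p. p \<in> closure \<Omega> \<Longrightarrow> \<exists>\<zeta>\<in>test_functions UNIV. \<zeta> p \<noteq> 0 \<and> (\<forall>a b. dbounded \<Omega> (mul (\<lambda>x. \<zeta> x * \<zeta> x) (G a)) b)"
  shows "dbounded \<Omega> (G a) b"
proof -
  obtain \<zeta> where \<zeta>: "\<And>p. p \<in> closure \<Omega> \<Longrightarrow> \<zeta> p \<in> test_functions UNIV" "\<And>p. p \<in> closure \<Omega> \<Longrightarrow> \<zeta> p p \<noteq> 0"
    "\<And>p a b. p \<in> closure \<Omega> \<Longrightarrow> dbounded \<Omega> (mul (\<lambda>x. \<zeta> p x * \<zeta> p x) (G a)) b" using loc by metis
  have cO: "compact (closure \<Omega>)" using \<Omega>(1) by (simp add: compact_closure)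
  have \<zeta>C: "\<zeta> p \<in> C1c UNIV" if "p \<in> closure \<Omega>" for p by (rule test_C1c[OF \<zeta>(1)[OF that]])
  have op: "open {x. \<zeta> p x \<noteq> 0}" if "p \<in> closure \<Omega>" for p
    using open_Collect_neq[OF C1_cont[OF C1c_C1[OF \<zeta>C[OF that]]] continuous_on_const] .
  have "closure \<Omega> \<subseteq> (\<Union>p\<in>closure \<Omega>. {x. \<zeta> p x \<noteq> 0})" using \<zeta>(2) by blast
  then obtain P where P: "P \<subseteq> closure \<Omega>" "finite P" "closure \<Omega> \<subseteq> (\<Union>p\<in>P. {x. \<zeta> p x \<noteq> 0})"
    using compactE_image[OF cO, of "closure \<Omega>" "\<lambda>p. {x. \<zeta> p x \<noteq> 0}"] op by blast
  have PC: "\<zeta> p \<in> C1c UNIV" if "p \<in> P" for p using \<zeta>C P(1) that by blast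
  define Z where "Z x = (\<Sum>p\<in>P. \<zeta> p x * \<zeta> p x)" for x
  have sqC: "(\<lambda>x. \<zeta> p x * \<zeta> p x) \<in> C1c UNIV" if "p \<in> P" for p by (rule C1c_mult'[OF PC[OF that] C1c_C1[OF PC[OF that]]])
  have ZC1: "Z \<in> C1" unfolding Z_def[abs_def] using C1_sum[of P "\<lambda>p x. \<zeta> p x * \<zeta> p x"] C1c_C1[OF sqC] by blast
  have csum: "csupp UNIV (\<lambda>x. \<Sum>p\<in>A. f p x)" if "\<And>p. p \<in> A \<Longrightarrow> csupp UNIV (f p)" for A and f :: "'a \<Rightarrow> 'a \<Rightarrow> real"
    using that by (induction A rule: infinite_finite_induct) (auto simp: csupp_zero csupp_add)
  have ZC: "Z \<in> C1c UNIV" unfolding C1c_def using ZC1 csum[of P "\<lambda>p x. \<zeta> p x * \<zeta> p x"] sqC by (auto simp: Z_def[abs_def] C1c_def)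
  have Zpos: "Z x > 0" if x: "x \<in> closure \<Omega>" for x
  proof -
    obtain p where p: "p \<in> P" "\<zeta> p x \<noteq> 0" using P(3) x by blast
    then have "0 < \<zeta> p x * \<zeta> p x" by (metis not_real_square_gt_zero)
    also have "\<dots> \<le> Z x" unfolding Z_def by (rule member_le_sum) (use p P(2) in auto)
    finally show ?thesis .
  qed
  have "closure \<Omega> \<noteq> {}" using \<Omega>(2) by simp
  then obtain x0 where x0: "x0 \<in> closure \<Omega>" "\<And>x. x \<in> closure \<Omega> \<Longrightarrow> Z x0 \<le> Z x"
    using continuous_attains_inf[OF cO _ continuous_on_subset[OF C1_cont[OF ZC1] subset_UNIV]] by blast
  define c where "c = Z x0"
  have c: "c > 0" "\<And>x. x \<in> \<Omega> \<Longrightarrow> c \<le> Z x" using Zpos x0 closure_subset[of \<Omega>] by (auto simp: c_def)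
  have "\<exists>C\<ge>0. \<forall>\<phi>\<in>C1c \<Omega>. \<bar>mul (\<lambda>x. \<zeta> p x * \<zeta> p x) (G a) \<bullet> Dl \<phi> b\<bar> \<le> C * norm (mk \<phi>)" if "p \<in> P" for p
    using dbounded_nonneg[OF \<zeta>(3)] P(1) that by blast
  then obtain C where C: "\<And>p. p \<in> P \<Longrightarrow> C p \<ge> 0"
    "\<And>p \<phi>. p \<in> P \<Longrightarrow> \<phi> \<in> C1c \<Omega> \<Longrightarrow> \<bar>mul (\<lambda>x. \<zeta> p x * \<zeta> p x) (G a) \<bullet> Dl \<phi> b\<bar> \<le> C p * norm (mk \<phi>)" by metis
  obtain K where K: "K \<ge> 0" "\<And>u. norm (mul (dd Z b) u) \<le> K * norm u" using mul_CC_norm[OF C1c_dd_CC[OF ZC]] by blast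
  note bZ = CC_bmult[OF C1c_CC[OF ZC]]
  show ?thesis
  proof (rule dbounded_I[where C="((\<Sum>p\<in>P. C p) + norm (G a) * K) * (1 / c)"])
    fix \<phi> assume \<phi>: "\<phi> \<in> C1c \<Omega>"
    define \<psi> where "\<psi> x = \<phi> x / Z x" for x
    have Z0: "Z x \<noteq> 0" if "x \<in> \<Omega>" for x using c(1) c(2)[OF that] by linarith
    have \<psi>: "\<psi> \<in> C1c \<Omega>" unfolding \<psi>_def[abs_def] by (rule C1c_divide[OF \<phi> ZC1 Z0])
    have \<phi>0: "\<phi> x = 0" if "x \<notin> \<Omega>" for x using \<phi> that unfolding C1c_def csupp_def by blast
    have eq: "\<phi> = (\<lambda>x. Z x * \<psi> x)" by (rule ext) (use Z0 \<phi>0 in \<open>auto simp: \<psi>_def\<close>)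
    have n\<psi>: "norm (mk \<psi>) \<le> (1 / c) * norm (mk \<phi>)"
    proof -
      have "norm (mk \<psi>) \<le> norm (mk (\<lambda>x. (1 / c) * \<phi> x))"
      proof (rule norm_mk_mono[OF C1c_sqint[OF \<psi>] sqint_scale[OF C1c_sqint[OF \<phi>]]], rule AE_I2)
        fix x
        show "\<bar>\<psi> x\<bar> \<le> \<bar>(1 / c) * \<phi> x\<bar>"
        proof (cases "x \<in> \<Omega>")
          case True
          have "\<bar>\<phi> x\<bar> / Z x \<le> \<bar>\<phi> x\<bar> / c" using c True by (intro divide_left_mono) (auto intro: mult_pos_pos less_le_trans)
          then show ?thesis using c(1) c(2)[OF True] by (simp add: \<psi>_def abs_mult)
        qed (simp add: \<psi>_def \<phi>0)
      qed
      also have "norm (mk (\<lambda>x. (1 / c) * \<phi> x)) = (1 / c) * norm (mk \<phi>)"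
        by (subst mk_scale[OF C1c_sqint[OF \<phi>]]) (use c(1) in simp)
      finally show ?thesis .
    qed
    have Zsum: "mul Z v = (\<Sum>p\<in>P. mul (\<lambda>x. \<zeta> p x * \<zeta> p x) v)" for v
      unfolding mul_def Z_def sum_distrib_right
      using mk_sum[of P "\<lambda>p x. \<zeta> p x * \<zeta> p x * fn v x"] bmult_sqint[OF CC_bmult[OF C1c_CC[OF sqC]]] by simp
    have "Dl \<phi> b = mul Z (Dl \<psi> b) + mul (dd Z b) (mk \<psi>)"
      using mul_Dl[OF ZC \<psi>, of b] eq by simp
    then have e: "G a \<bullet> Dl \<phi> b = (\<Sum>p\<in>P. mul (\<lambda>x. \<zeta> p x * \<zeta> p x) (G a) \<bullet> Dl \<psi> b) + G a \<bullet> mul (dd Z b) (mk \<psi>)"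
    proof -
      have "G a \<bullet> mul Z (Dl \<psi> b) = (\<Sum>p\<in>P. mul (\<lambda>x. \<zeta> p x * \<zeta> p x) (G a) \<bullet> Dl \<psi> b)"
        unfolding mul_inner[OF bZ, symmetric] Zsum[of "G a"] inner_sum_left ..
      moreover assume "Dl \<phi> b = mul Z (Dl \<psi> b) + mul (dd Z b) (mk \<psi>)"
      ultimately show ?thesis by (simp only: inner_add_right)
    qed
    have "\<bar>\<Sum>p\<in>P. mul (\<lambda>x. \<zeta> p x * \<zeta> p x) (G a) \<bullet> Dl \<psi> b\<bar> \<le> (\<Sum>p\<in>P. C p * norm (mk \<psi>))"
      by (rule order_trans[OF sum_abs sum_mono]) (rule C(2)[OF _ \<psi>])
    then have 1: "\<bar>\<Sum>p\<in>P. mul (\<lambda>x. \<zeta> p x * \<zeta> p x) (G a) \<bullet> Dl \<psi> b\<bar> \<le> (\<Sum>p\<in>P. C p) * norm (mk \<psi>)"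
      by (simp add: sum_distrib_right)
    have "\<bar>G a \<bullet> mul (dd Z b) (mk \<psi>)\<bar> \<le> norm (G a) * norm (mul (dd Z b) (mk \<psi>))" by (rule Cauchy_Schwarz_ineq2)
    also have "\<dots> \<le> norm (G a) * (K * norm (mk \<psi>))" using K by (intro mult_left_mono) auto
    finally have 2: "\<bar>G a \<bullet> mul (dd Z b) (mk \<psi>)\<bar> \<le> norm (G a) * K * norm (mk \<psi>)" by (simp only: mult.assoc)
    have "\<bar>G a \<bullet> Dl \<phi> b\<bar> \<le> ((\<Sum>p\<in>P. C p) + norm (G a) * K) * norm (mk \<psi>)"
      unfolding e distrib_right using 1 2 by linarith
    also have "\<dots> \<le> ((\<Sum>p\<in>P. C p) + norm (G a) * K) * ((1 / c) * norm (mk \<phi>))"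
      using n\<psi> C(1) K(1) by (intro mult_left_mono add_nonneg_nonneg sum_nonneg mult_nonneg_nonneg) auto
    finally show "\<bar>G a \<bullet> Dl \<phi> b\<bar> \<le> ((\<Sum>p\<in>P. C p) + norm (G a) * K) * (1 / c) * norm (mk \<phi>)" by (simp only: mult.assoc)
  qed
qed

section \<open>Second derivatives on domains with boundary of class C^{1,1}\<close>

lemma graph_shear_of_C11:
  fixes e :: "'a::euclidean_space"
  assumes e: "norm e = 1" and \<gamma>: "C11 \<gamma>"
  shows "\<exists>g L. graph_shear e (\<lambda>x. \<gamma> (x - (x \<bullet> e) *\<^sub>R e)) g L"
proof -
  have ee: "e \<bullet> e = 1" using e by (simp add: norm_eq_1)
  obtain g0 L where g0: "\<And>x. (\<gamma> has_derivative (\<lambda>h. g0 x \<bullet> h)) (at x)" and L: "L-lipschitz_on UNIV g0"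
    using \<gamma> unfolding C11_def by blast
  \<comment> \<open>The orthogonal projection onto the hyperplane. \<open>C11_boundary\<close>
    evaluates \<gamma> only there, so composing with the projection describes the same region and
    makes the function constant along e.\<close>
  define \<pi> where "\<pi> x = x - (x \<bullet> e) *\<^sub>R e" for x
  have adj: "\<pi> x \<bullet> y = x \<bullet> \<pi> y" for x y
    by (simp add: \<pi>_def inner_diff_left inner_diff_right inner_commute)
  have lin: "\<pi> (x - y) = \<pi> x - \<pi> y" for x y by (simp add: \<pi>_def algebra_simps inner_diff_left)
  have n\<pi>: "norm (\<pi> x) \<le> norm x" for x
  proof -
    have "(norm (\<pi> x))\<^sup>2 = (norm x)\<^sup>2 - (x \<bullet> e)\<^sup>2"
      unfolding power2_norm_eq_inner by (simp add: \<pi>_def inner_diff_left inner_diff_right ee inner_commute power2_eq_square)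
    then have "(norm (\<pi> x))\<^sup>2 \<le> (norm x)\<^sup>2" by simp
    then show ?thesis by (rule power2_le_imp_le) simp
  qed
  have L0: "L \<ge> 0" using L by (simp add: lipschitz_on_def)
  have "graph_shear e (\<lambda>x. \<gamma> (\<pi> x)) (\<lambda>x. \<pi> (g0 (\<pi> x))) L"
  proof
    show "norm e = 1" by (rule e)
    show "((\<lambda>x. \<gamma> (\<pi> x)) has_derivative (\<lambda>h. \<pi> (g0 (\<pi> x)) \<bullet> h)) (at x)" for x
    proof -
      have "(\<pi> has_derivative \<pi>) (at x)" unfolding \<pi>_def[abs_def] by (auto intro!: derivative_eq_intros)
      from has_derivative_compose[OF this g0] show ?thesis by (simp add: adj)
    qed
    show "norm (\<pi> (g0 (\<pi> x)) - \<pi> (g0 (\<pi> y))) \<le> L * norm (x - y)" for x y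
    proof -
      have "norm (\<pi> (g0 (\<pi> x)) - \<pi> (g0 (\<pi> y))) \<le> norm (g0 (\<pi> x) - g0 (\<pi> y))" unfolding lin[symmetric] by (rule n\<pi>)
      also have "\<dots> \<le> L * norm (\<pi> x - \<pi> y)" using lipschitz_onD[OF L, of "\<pi> x" "\<pi> y"] by (simp add: dist_norm)
      also have "\<dots> \<le> L * norm (x - y)" unfolding lin[symmetric] using L0 by (intro mult_left_mono n\<pi>)
      finally show ?thesis .
    qed
    show "\<gamma> (\<pi> (x + t *\<^sub>R e)) = \<gamma> (\<pi> x)" for x t
    proof -
      have "\<pi> (x + t *\<^sub>R e) = \<pi> x" by (simp add: \<pi>_def inner_add_left ee algebra_simps)
      then show ?thesis by simp
    qed
  qed
  then show ?thesis unfolding \<pi>_def by blast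
qed

text \<open>Riesz representation turns the bound obtained by localisation into a function H, the
  weak second derivative; the sign is that of one integration by parts.\<close>

theorem H2_regularity:
  fixes \<Omega> :: "'a::euclidean_space set"
  assumes dom: "bounded_C11_domain \<Omega>" and h: "h0 \<Omega> u G"
    and C: "\<And>\<phi>. \<phi> \<in> C1c \<Omega> \<Longrightarrow> \<bar>en G (Dl \<phi>)\<bar> \<le> C * norm (mk \<phi>)"
  shows "\<exists>H. \<forall>\<phi>\<in>C1c \<Omega>. G a \<bullet> Dl \<phi> b = - (H \<bullet> mk \<phi>)"
proof -
  have \<Omega>: "open \<Omega>" "\<Omega> \<noteq> {}" "bounded \<Omega>" "C11_boundary \<Omega>" using dom unfolding bounded_C11_domain_def by auto
  have "\<exists>\<zeta>\<in>test_functions UNIV. \<zeta> p \<noteq> 0 \<and> (\<forall>a b. dbounded \<Omega> (mul (\<lambda>x. \<zeta> x * \<zeta> x) (G a)) b)" if p: "p \<in> closure \<Omega>" for p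
  proof (cases "p \<in> \<Omega>")
    case True
    obtain e :: 'a where e: "graph_shear e (\<lambda>x. 0) (\<lambda>x. 0::'a) 0" using translation_shear by blast
    obtain r where r: "r > 0" "ball p r \<subseteq> \<Omega>" using \<Omega>(1) True open_contains_ball by blast
    show ?thesis by (rule local_regularity[OF e \<Omega>(1) r(1) _ h C]) (use r(2) in blast)
  next
    case False
    then have "p \<in> frontier \<Omega>" using p \<Omega>(1) by (simp add: frontier_def interior_open)
    then obtain r e \<gamma> where r: "r > 0" and e: "norm e = 1" and \<gamma>: "C11 \<gamma>"
      and eq: "\<Omega> \<inter> ball p r = {x \<in> ball p r. x \<bullet> e > \<gamma> (x - (x \<bullet> e) *\<^sub>R e)}"
      using \<Omega>(4) unfolding C11_boundary_def by blast
    obtain g L where gs: "graph_shear e (\<lambda>x. \<gamma> (x - (x \<bullet> e) *\<^sub>R e)) g L" using graph_shear_of_C11[OF e \<gamma>] by blast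
    show ?thesis
    proof (rule local_regularity[OF gs \<Omega>(1) r _ h C])
      fix x y assume xy: "x \<in> \<Omega>" "x \<in> ball p r" "y \<in> ball p r"
        "y \<bullet> e - \<gamma> (y - (y \<bullet> e) *\<^sub>R e) = x \<bullet> e - \<gamma> (x - (x \<bullet> e) *\<^sub>R e)"
      have "x \<in> \<Omega> \<inter> ball p r" using xy by blast
      then have "x \<bullet> e > \<gamma> (x - (x \<bullet> e) *\<^sub>R e)" unfolding eq by blast
      then have "y \<in> \<Omega> \<inter> ball p r" unfolding eq using xy by auto
      then show "y \<in> \<Omega>" by blast
    qed
  qed
  then have "dbounded \<Omega> (G a) b" by (rule global_regularity[OF \<Omega>(3,2)])
  then obtain K where K: "\<And>\<phi>. \<phi> \<in> C1c \<Omega> \<Longrightarrow> \<bar>G a \<bullet> Dl \<phi> b\<bar> \<le> K * norm (mk \<phi>)" unfolding dbounded_def by blast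
  have "\<exists>H. \<forall>\<phi>\<in>C1c \<Omega>. - (G a \<bullet> Dl \<phi> b) = H \<bullet> mk \<phi>"
    by (rule riesz_C1c[where C=K]) (use K in \<open>auto simp: Dl_add Dl_scale inner_add_right\<close>)
  then obtain H where "\<And>\<phi>. \<phi> \<in> C1c \<Omega> \<Longrightarrow> - (G a \<bullet> Dl \<phi> b) = H \<bullet> mk \<phi>" by blast
  then show ?thesis by (intro exI[of _ H]) (metis minus_minus)
qed

subsection \<open>Orthogonal projections onto piecewise constant functions\<close>

context
  fixes I :: "'i set" and f :: "'i \<Rightarrow> 'h::real_inner"
  assumes fin: "finite I" and on: "\<And>i j. i \<in> I \<Longrightarrow> j \<in> I \<Longrightarrow> f i \<bullet> f j = (if i = j then 1 else 0)"
begin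

lemma orthonormal_comb_inner: "j \<in> I \<Longrightarrow> (\<Sum>i\<in>I. c i *\<^sub>R f i) \<bullet> f j = c j"
  using fin by (simp add: inner_sum_left on if_distrib sum.delta cong: if_cong)

lemma orthonormal_comb_norm: "(norm (\<Sum>i\<in>I. c i *\<^sub>R f i))\<^sup>2 = (\<Sum>i\<in>I. (c i)\<^sup>2)"
  unfolding power2_norm_eq_inner inner_sum_right by (simp add: orthonormal_comb_inner power2_eq_square)

lemma orthonormal_pythagoras:
  "(norm (v - (\<Sum>i\<in>I. (v \<bullet> f i) *\<^sub>R f i)))\<^sup>2 = (norm v)\<^sup>2 - (\<Sum>i\<in>I. (v \<bullet> f i)\<^sup>2)"
proof -
  let ?P = "\<Sum>i\<in>I. (v \<bullet> f i) *\<^sub>R f i"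
  have "v \<bullet> ?P = (\<Sum>i\<in>I. (v \<bullet> f i)\<^sup>2)" by (simp add: inner_sum_right power2_eq_square)
  moreover have "?P \<bullet> ?P = (\<Sum>i\<in>I. (v \<bullet> f i)\<^sup>2)" using orthonormal_comb_norm by (simp add: power2_norm_eq_inner)
  ultimately show ?thesis by (simp add: power2_norm_eq_inner inner_diff_left inner_diff_right inner_commute)
qed

lemma orthonormal_proj_norm: "norm (\<Sum>i\<in>I. (v \<bullet> f i) *\<^sub>R f i) \<le> norm v"
proof (rule power2_le_imp_le)
  have "0 \<le> (norm v)\<^sup>2 - (\<Sum>i\<in>I. (v \<bullet> f i)\<^sup>2)" unfolding orthonormal_pythagoras[symmetric] by simp
  then show "(norm (\<Sum>i\<in>I. (v \<bullet> f i) *\<^sub>R f i))\<^sup>2 \<le> (norm v)\<^sup>2" by (simp add: orthonormal_comb_norm)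
qed simp

end

text \<open>The integer point that labels the half-open cube of side \<delta> containing x.\<close>

definition cell :: "real \<Rightarrow> 'a::euclidean_space \<Rightarrow> 'a" where
  "cell \<delta> x = (\<Sum>b\<in>Basis. of_int \<lfloor>(x \<bullet> b) / \<delta>\<rfloor> *\<^sub>R b)"

definition cube :: "real \<Rightarrow> 'a::euclidean_space \<Rightarrow> 'a set" where
  "cube \<delta> z = {x. cell \<delta> x = z}"

definition cube_fn :: "real \<Rightarrow> 'a::euclidean_space \<Rightarrow> 'a l2" where
  "cube_fn \<delta> z = (1 / sqrt (\<delta> ^ DIM('a))) *\<^sub>R mk (indicator (cube \<delta> z))"

text \<open>The cubes meeting \<Omega> may protrude, so projections need not vanish outside
  \<Omega>.\<close>

definition proj :: "real \<Rightarrow> 'a::euclidean_space set \<Rightarrow> 'a l2 \<Rightarrow> 'a l2" where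
  "proj \<delta> \<Omega> v = (\<Sum>z\<in>cell \<delta> ` \<Omega>. (v \<bullet> cube_fn \<delta> z) *\<^sub>R cube_fn \<delta> z)"

lemma cell_inner: "b \<in> Basis \<Longrightarrow> cell \<delta> x \<bullet> b = of_int \<lfloor>(x \<bullet> b) / \<delta>\<rfloor>"
  by (simp add: cell_def inner_sum_left_Basis)

lemma cell_measurable [measurable]: "cell \<delta> \<in> borel_measurable borel"
  unfolding cell_def by measurable

lemma cube_sets [measurable]: "cube \<delta> z \<in> sets borel"
  unfolding cube_def by measurable

lemma cell_close:
  assumes "\<delta> > 0" "cell \<delta> x = cell \<delta> y" "b \<in> Basis"
  shows "\<bar>x \<bullet> b - y \<bullet> b\<bar> \<le> \<delta>"
proof -
  have "\<lfloor>(x \<bullet> b) / \<delta>\<rfloor> = \<lfloor>(y \<bullet> b) / \<delta>\<rfloor>" using cell_inner[OF assms(3), of \<delta> x] cell_inner[OF assms(3), of \<delta> y] assms(2) by simp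
  then have "\<bar>(x \<bullet> b) / \<delta> - (y \<bullet> b) / \<delta>\<bar> \<le> 1" by linarith
  then show ?thesis using assms(1) by (simp add: diff_divide_distrib[symmetric] abs_divide divide_le_eq)
qed

text \<open>The half-open cube lies between an open and a closed box of the same volume.\<close>

lemma emeasure_cube:
  fixes x0 :: "'a::euclidean_space"
  assumes d: "\<delta> > 0"
  shows "emeasure lborel (cube \<delta> (cell \<delta> x0)) = ennreal (\<delta> ^ DIM('a))"
proof -
  let ?z = "cell \<delta> x0"
  let ?l = "\<delta> *\<^sub>R ?z" and ?u = "\<delta> *\<^sub>R ?z + \<delta> *\<^sub>R One"
  have lu: "?l \<bullet> b \<le> ?u \<bullet> b" if "b \<in> Basis" for b using that d by (simp add: inner_add_left)
  have pr: "(\<Prod>b\<in>Basis. (?u - ?l) \<bullet> b) = \<delta> ^ DIM('a)" by simp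
  have ub: "emeasure lborel (cube \<delta> ?z) \<le> emeasure lborel (cbox ?l ?u)"
  proof (rule emeasure_mono)
    show "cube \<delta> ?z \<subseteq> cbox ?l ?u"
    proof
      fix x assume x: "x \<in> cube \<delta> ?z"
      show "x \<in> cbox ?l ?u" unfolding mem_box
      proof
        fix b :: 'a assume b: "b \<in> Basis"
        have f: "?z \<bullet> b = of_int \<lfloor>(x \<bullet> b) / \<delta>\<rfloor>" using cell_inner[OF b, of \<delta> x] x by (simp add: cube_def)
        then have "?z \<bullet> b \<le> (x \<bullet> b) / \<delta>" "(x \<bullet> b) / \<delta> \<le> ?z \<bullet> b + 1" by linarith+
        then show "?l \<bullet> b \<le> x \<bullet> b \<and> x \<bullet> b \<le> ?u \<bullet> b" using d b by (simp add: inner_add_left field_simps)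
      qed
    qed
  qed simp
  have lb: "emeasure lborel (box ?l ?u) \<le> emeasure lborel (cube \<delta> ?z)"
  proof (rule emeasure_mono)
    show "box ?l ?u \<subseteq> cube \<delta> ?z"
    proof
      fix x assume x: "x \<in> box ?l ?u"
      have "cell \<delta> x = ?z"
      proof (rule euclidean_eqI)
        fix b :: 'a assume b: "b \<in> Basis"
        have f: "?z \<bullet> b = of_int \<lfloor>(x0 \<bullet> b) / \<delta>\<rfloor>" by (rule cell_inner[OF b])
        have "?l \<bullet> b < x \<bullet> b" "x \<bullet> b < ?u \<bullet> b" using x b unfolding mem_box by auto
        then have "?z \<bullet> b < (x \<bullet> b) / \<delta>" "(x \<bullet> b) / \<delta> < ?z \<bullet> b + 1" using d b by (simp_all add: inner_add_left field_simps)
        then have "\<lfloor>(x \<bullet> b) / \<delta>\<rfloor> = \<lfloor>(x0 \<bullet> b) / \<delta>\<rfloor>" unfolding f by linarith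
        then show "cell \<delta> x \<bullet> b = ?z \<bullet> b" using cell_inner[OF b] by metis
      qed
      then show "x \<in> cube \<delta> ?z" by (simp add: cube_def)
    qed
  qed simp
  have "emeasure lborel (cbox ?l ?u) = ennreal (\<delta> ^ DIM('a))" "emeasure lborel (box ?l ?u) = ennreal (\<delta> ^ DIM('a))"
    using lu pr by (simp_all only: emeasure_lborel_cbox_eq emeasure_lborel_box) auto
  then show ?thesis using ub lb by simp
qed

lemma cube_fn_orthonormal:
  fixes \<Omega> :: "'a::euclidean_space set"
  assumes d: "\<delta> > 0" and z: "z \<in> cell \<delta> ` \<Omega>" "z' \<in> cell \<delta> ` \<Omega>"
  shows "cube_fn \<delta> z \<bullet> cube_fn \<delta> z' = (if z = z' then 1 else 0)"
proof -
  obtain x0 where x0: "z = cell \<delta> x0" using z by blast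
  obtain x1 where x1: "z' = cell \<delta> x1" using z by blast
  let ?\<nu> = "\<delta> ^ DIM('a)"
  have nu: "?\<nu> > 0" using d by simp
  have f: "emeasure lborel (cube \<delta> z) < \<infinity>" "emeasure lborel (cube \<delta> z') < \<infinity>" unfolding x0 x1 emeasure_cube[OF d] by auto
  have "(\<integral>x. indicator (cube \<delta> z) x * indicator (cube \<delta> z') x \<partial>lborel) = (if z = z' then ?\<nu> else (0::real))"
  proof (cases "z = z'")
    case True
    have "(\<lambda>x. indicator (cube \<delta> z) x * indicator (cube \<delta> z) x) = (indicator (cube \<delta> z) :: 'a \<Rightarrow> real)" by (auto simp: indicator_def)
    then show ?thesis using True nu emeasure_cube[OF d, of x0] by (simp add: measure_def x0)
  next
    case False
    then have "(\<lambda>x. indicator (cube \<delta> z) x * indicator (cube \<delta> z') x) = (\<lambda>x::'a. 0::real)" by (auto simp: indicator_def cube_def)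
    then show ?thesis using False by simp
  qed
  then show ?thesis unfolding cube_fn_def using nu d
    by (simp add: inner_mk[OF sqint_indicator[OF cube_sets f(1)] sqint_indicator[OF cube_sets f(2)]])
qed

lemma finite_cells:
  fixes \<Omega> :: "'a::euclidean_space set"
  assumes d: "\<delta> > 0" and \<Omega>: "bounded \<Omega>"
  shows "finite (cell \<delta> ` \<Omega>)"
proof -
  obtain B where B: "\<And>x. x \<in> \<Omega> \<Longrightarrow> norm x \<le> B" using \<Omega> bounded_iff by metis
  let ?J = "{\<lfloor>- B / \<delta>\<rfloor> .. \<lfloor>B / \<delta>\<rfloor>}"
  have "cell \<delta> ` \<Omega> \<subseteq> (\<lambda>f. \<Sum>b\<in>Basis. of_int (f b) *\<^sub>R b) ` (PiE Basis (\<lambda>_. ?J))"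
  proof safe
    fix x assume x: "x \<in> \<Omega>"
    let ?f = "restrict (\<lambda>b. \<lfloor>(x \<bullet> b) / \<delta>\<rfloor>) Basis"
    have "cell \<delta> x = (\<Sum>b\<in>Basis. of_int (?f b) *\<^sub>R b)" unfolding cell_def by (intro sum.cong) auto
    moreover have "?f \<in> PiE Basis (\<lambda>_. ?J)"
    proof (rule restrict_PiE_iff[THEN iffD2], rule ballI)
      fix b :: 'a assume b: "b \<in> Basis"
      have "\<bar>x \<bullet> b\<bar> \<le> B" using Basis_le_norm[OF b, of x] B[OF x] by linarith
      then have "- B \<le> x \<bullet> b" "x \<bullet> b \<le> B" by linarith+
      then have "- B / \<delta> \<le> (x \<bullet> b) / \<delta>" "(x \<bullet> b) / \<delta> \<le> B / \<delta>" using d by (intro divide_right_mono, auto)+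
      then show "\<lfloor>(x \<bullet> b) / \<delta>\<rfloor> \<in> ?J" unfolding atLeastAtMost_iff by (intro conjI floor_mono)
    qed
    ultimately show "cell \<delta> x \<in> (\<lambda>f. \<Sum>b\<in>Basis. of_int (f b) *\<^sub>R b) ` (PiE Basis (\<lambda>_. ?J))" by (rule image_eqI)
  qed
  moreover have "finite (PiE (Basis::'a set) (\<lambda>_. ?J))" by (intro finite_PiE) auto
  ultimately show ?thesis using finite_surj by blast
qed

lemma proj_bounded_linear:
  shows "bounded_linear (proj \<delta> \<Omega>)"
  unfolding proj_def
  by (intro bounded_linear_sum bounded_linear_compose[OF bounded_linear_scaleR_left bounded_linear_inner_left])

lemma proj_symmetric: "proj \<delta> \<Omega> u \<bullet> v = u \<bullet> proj \<delta> \<Omega> v"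
  unfolding proj_def by (simp add: inner_sum_left inner_sum_right inner_commute mult.commute)

section \<open>The projection error of functions with square integrable gradient\<close>

lemma norm_translation_diff:
  fixes \<phi> :: "'a::euclidean_space \<Rightarrow> real"
  assumes \<phi>: "\<phi> \<in> C1c UNIV"
  shows "(\<integral>\<^sup>+y. ennreal ((\<phi> (y + z) - \<phi> y)\<^sup>2) \<partial>lborel) \<le> ennreal ((real DIM('a) * norm z * gn (Dl \<phi>))\<^sup>2)"
proof -
  have s: "sqint \<phi>" by (rule C1c_sqint[OF \<phi>])
  have st: "sqint (\<lambda>x. \<phi> (x + z))" by (rule mpres_sqint[OF mpres_translation s])
  have "(\<integral>\<^sup>+y. ennreal ((\<phi> (y + z) - \<phi> y)\<^sup>2) \<partial>lborel) = ennreal ((norm (mk (\<lambda>x. \<phi> (x + z) - \<phi> x)))\<^sup>2)"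
    by (rule nn_norm_mk_sq[OF sqint_diff[OF st s]])
  also have "mk (\<lambda>x. \<phi> (x + z) - \<phi> x) = comp_op (\<lambda>x. x + z) (mk \<phi>) - mk \<phi>"
    by (simp only: mk_diff[OF st s] comp_op_mk[OF mpres_translation s])
  also have "ennreal ((norm (comp_op (\<lambda>x. x + z) (mk \<phi>) - mk \<phi>))\<^sup>2) \<le> ennreal ((real DIM('a) * norm z * gn (Dl \<phi>))\<^sup>2)"
  proof (intro ennreal_leI power_mono)
    have "norm (comp_op (\<lambda>x. x + z) (mk \<phi>) - mk \<phi>) \<le> norm (Dl \<phi> z)"
      using translation_quotient(2)[OF \<phi>] by (simp add: Dl_def)
    also have "\<dots> \<le> (real DIM('a) * norm z) * gn (Dl \<phi>)" by (rule norm_dir_le_gn[OF Dl_linear[OF \<phi>]])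
    finally show "norm (comp_op (\<lambda>x. x + z) (mk \<phi>) - mk \<phi>) \<le> real DIM('a) * norm z * gn (Dl \<phi>)" .
  qed simp
  finally show ?thesis .
qed

text \<open>Two points of one cube differ by a vector in the box of side 2 \<delta> about the
  origin. After the substitution x = y + z the order of integration is exchanged, and the
  translation estimate applies for each z.\<close>

lemma double_integral_bound:
  fixes \<phi> :: "'a::euclidean_space \<Rightarrow> real"
  assumes d: "\<delta> > 0" and \<phi>: "\<phi> \<in> C1c UNIV"
  shows "(\<integral>\<^sup>+y. \<integral>\<^sup>+x. indicator {x. cell \<delta> x = cell \<delta> y} x * ennreal ((\<phi> x - \<phi> y)\<^sup>2) \<partial>lborel \<partial>lborel)
    \<le> ennreal ((2 * \<delta>) ^ DIM('a) * (real DIM('a) * (real DIM('a) * \<delta>) * gn (Dl \<phi>))\<^sup>2)"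
proof -
  have [measurable]: "\<phi> \<in> borel_measurable borel" using CC_measurable[OF C1c_CC[OF \<phi>]] .
  define B :: "'a set" where "B = cbox (- \<delta> *\<^sub>R One) (\<delta> *\<^sub>R One)"
  have [measurable]: "B \<in> sets borel" by (simp add: B_def)
  let ?K = "real DIM('a) * (real DIM('a) * \<delta>) * gn (Dl \<phi>)"
  have nB: "norm z \<le> real DIM('a) * \<delta>" if "z \<in> B" for z
  proof -
    have "norm z \<le> (\<Sum>b\<in>Basis. \<bar>z \<bullet> b\<bar>)" by (rule norm_le_l1)
    also have "\<dots> \<le> (\<Sum>b\<in>(Basis::'a set). \<delta>)" using that by (intro sum_mono) (auto simp: B_def mem_box abs_le_iff)
    finally show ?thesis by simp
  qed
  have "(\<integral>\<^sup>+y. \<integral>\<^sup>+x. indicator {x. cell \<delta> x = cell \<delta> y} x * ennreal ((\<phi> x - \<phi> y)\<^sup>2) \<partial>lborel \<partial>lborel)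
    \<le> (\<integral>\<^sup>+y. \<integral>\<^sup>+z. indicator B z * ennreal ((\<phi> (y + z) - \<phi> y)\<^sup>2) \<partial>lborel \<partial>lborel)"
  proof (rule nn_integral_mono)
    fix y :: 'a
    have "(\<integral>\<^sup>+x. indicator {x. cell \<delta> x = cell \<delta> y} x * ennreal ((\<phi> x - \<phi> y)\<^sup>2) \<partial>lborel)
      = (\<integral>\<^sup>+z. indicator {x. cell \<delta> x = cell \<delta> y} (z + y) * ennreal ((\<phi> (z + y) - \<phi> y)\<^sup>2) \<partial>lborel)"
      by (rule mpres_nn_integral[OF mpres_translation, symmetric]) measurable
    also have "\<dots> \<le> (\<integral>\<^sup>+z. indicator B z * ennreal ((\<phi> (y + z) - \<phi> y)\<^sup>2) \<partial>lborel)"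
    proof (rule nn_integral_mono)
      fix z :: 'a
      have "z \<in> B" if "cell \<delta> (z + y) = cell \<delta> y"
        unfolding B_def mem_box
      proof
        fix b :: 'a assume b: "b \<in> Basis"
        show "(- \<delta> *\<^sub>R One) \<bullet> b \<le> z \<bullet> b \<and> z \<bullet> b \<le> (\<delta> *\<^sub>R One) \<bullet> b"
          using cell_close[OF d that b] b by (simp add: inner_add_left abs_le_iff)
      qed
      then show "indicator {x. cell \<delta> x = cell \<delta> y} (z + y) * ennreal ((\<phi> (z + y) - \<phi> y)\<^sup>2)
        \<le> indicator B z * ennreal ((\<phi> (y + z) - \<phi> y)\<^sup>2)"
        by (auto simp: indicator_def add.commute)
    qed
    finally show "(\<integral>\<^sup>+x. indicator {x. cell \<delta> x = cell \<delta> y} x * ennreal ((\<phi> x - \<phi> y)\<^sup>2) \<partial>lborel)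
      \<le> (\<integral>\<^sup>+z. indicator B z * ennreal ((\<phi> (y + z) - \<phi> y)\<^sup>2) \<partial>lborel)" .
  qed
  also have "\<dots> = (\<integral>\<^sup>+z. \<integral>\<^sup>+y. indicator B z * ennreal ((\<phi> (y + z) - \<phi> y)\<^sup>2) \<partial>lborel \<partial>lborel)"
    by (rule lborel_pair.Fubini') measurable
  also have "\<dots> \<le> (\<integral>\<^sup>+z. ennreal (?K\<^sup>2) * indicator B z \<partial>lborel)"
  proof (rule nn_integral_mono)
    fix z :: 'a
    show "(\<integral>\<^sup>+y. indicator B z * ennreal ((\<phi> (y + z) - \<phi> y)\<^sup>2) \<partial>lborel) \<le> ennreal (?K\<^sup>2) * indicator B z"
    proof (cases "z \<in> B")
      case True
      have "(\<integral>\<^sup>+y. ennreal ((\<phi> (y + z) - \<phi> y)\<^sup>2) \<partial>lborel) \<le> ennreal ((real DIM('a) * norm z * gn (Dl \<phi>))\<^sup>2)"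
        by (rule norm_translation_diff[OF \<phi>])
      also have "\<dots> \<le> ennreal (?K\<^sup>2)"
        using nB[OF True] gn_nonneg[of "Dl \<phi>"] by (intro ennreal_leI power_mono mult_right_mono mult_left_mono mult_nonneg_nonneg) auto
      finally show ?thesis using True by simp
    qed simp
  qed
  also have "\<dots> = ennreal (?K\<^sup>2) * emeasure lborel B" by (rule nn_integral_cmult_indicator) simp
  also have "emeasure lborel B = ennreal ((2 * \<delta>) ^ DIM('a))"
  proof -
    have pr: "(\<Prod>b\<in>(Basis::'a set). ((\<delta> *\<^sub>R One) - (- \<delta> *\<^sub>R One)) \<bullet> b) = (2 * \<delta>) ^ DIM('a)"
      by (simp add: inner_add_left)
    have le: "\<forall>b\<in>(Basis::'a set). (- \<delta> *\<^sub>R One) \<bullet> b \<le> (\<delta> *\<^sub>R One) \<bullet> b" using d by simp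
    show ?thesis unfolding B_def by (simp only: emeasure_lborel_cbox_eq if_P[OF le] pr)
  qed
  also have "ennreal (?K\<^sup>2) * ennreal ((2 * \<delta>) ^ DIM('a)) = ennreal ((2 * \<delta>) ^ DIM('a) * ?K\<^sup>2)"
    using d by (simp add: ennreal_mult mult.commute)
  finally show ?thesis .
qed

text \<open>On each cube the mean is the best constant, so the squared error is at most the integral
  of (\<phi> x - \<phi> y)^2 over x, for every y. Averaging over y in the cube gives the double
  integral, whose factor \<open>\<delta> ^ DIM('a)\<close> cancels against the volume of the
  cube.\<close>

lemma proj_estimate_C1c:
  fixes \<phi> :: "'a::euclidean_space \<Rightarrow> real"
  assumes d: "\<delta> > 0" and \<Omega>: "bounded \<Omega>" and \<phi>: "\<phi> \<in> C1c \<Omega>"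
  shows "(norm (mk \<phi> - proj \<delta> \<Omega> (mk \<phi>)))\<^sup>2 \<le> 2 ^ DIM('a) * (real DIM('a) * (real DIM('a) * \<delta>) * gn (Dl \<phi>))\<^sup>2"
proof -
  let ?\<nu> = "\<delta> ^ DIM('a)" and ?Z = "cell \<delta> ` \<Omega>"
  let ?Q = "\<lambda>z x. indicator (cube \<delta> z) x :: real"
  have nu: "?\<nu> > 0" using d by simp
  have fin: "finite ?Z" by (rule finite_cells[OF d \<Omega>])
  have \<phi>U: "\<phi> \<in> C1c UNIV" using \<phi> C1c_mono by blast
  have s: "sqint \<phi>" by (rule C1c_sqint[OF \<phi>])
  have [measurable]: "\<phi> \<in> borel_measurable borel" using CC_measurable[OF C1c_CC[OF \<phi>]] .
  have em: "emeasure lborel (cube \<delta> z) = ennreal ?\<nu>" if "z \<in> ?Z" for z using that emeasure_cube[OF d] by blast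
  have sQ: "sqint (?Q z)" if "z \<in> ?Z" for z by (rule sqint_indicator[OF cube_sets]) (simp add: em[OF that])
  have QQ: "?Q z x * ?Q z x = ?Q z x" for z x by (simp add: indicator_def)
  have bQ: "bmult (?Q z)" for z unfolding bmult_def by (intro conjI exI[of _ 1]) auto
  have iQ: "integrable lborel (?Q z)" if "z \<in> ?Z" for z
    using sqint_integrable_mult[OF sQ[OF that] sQ[OF that]] by (simp add: QQ)
  have mQ: "(\<integral>x. ?Q z x \<partial>lborel) = ?\<nu>" if "z \<in> ?Z" for z using em[OF that] nu by (simp add: measure_def)
  have iQ1: "integrable lborel (\<lambda>x. ?Q z x * \<phi> x)" if "z \<in> ?Z" for z by (rule sqint_integrable_mult[OF sQ[OF that] s])
  have iQ2: "integrable lborel (\<lambda>x. ?Q z x * (\<phi> x)\<^sup>2)" for z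
    using sqint_integrable_mult[OF bmult_sqint[OF bQ s] s] by (simp add: power2_eq_square mult.assoc)
  define a1 where "a1 z = (\<integral>x. ?Q z x * \<phi> x \<partial>lborel)" for z
  define a2 where "a2 z = (\<integral>x. ?Q z x * (\<phi> x)\<^sup>2 \<partial>lborel)" for z
  \<comment> \<open>The squared distance of \<phi> from the constants on the cube: the integral of
    the square minus the squared integral over the volume.\<close>
  define A where "A z = a2 z - (a1 z)\<^sup>2 / ?\<nu>" for z
  have shift: "(\<integral>x. ?Q z x * (\<phi> x - c)\<^sup>2 \<partial>lborel) = a2 z - 2 * c * a1 z + c\<^sup>2 * ?\<nu>"
    and ishift: "integrable lborel (\<lambda>x. ?Q z x * (\<phi> x - c)\<^sup>2)" if z: "z \<in> ?Z" for z c
  proof -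
    have e: "(\<lambda>x. ?Q z x * (\<phi> x - c)\<^sup>2) = (\<lambda>x. ?Q z x * (\<phi> x)\<^sup>2 - (2 * c) * (?Q z x * \<phi> x) + c\<^sup>2 * ?Q z x)"
      by (auto simp: power2_eq_square algebra_simps)
    show "(\<integral>x. ?Q z x * (\<phi> x - c)\<^sup>2 \<partial>lborel) = a2 z - 2 * c * a1 z + c\<^sup>2 * ?\<nu>"
      unfolding e using iQ1[OF z] iQ2 iQ[OF z] mQ[OF z] by (simp add: a1_def a2_def del: integral_indicator)
    show "integrable lborel (\<lambda>x. ?Q z x * (\<phi> x - c)\<^sup>2)"
      unfolding e using iQ1[OF z] iQ2 iQ[OF z] by (intro Bochner_Integration.integrable_add Bochner_Integration.integrable_diff integrable_mult_right)
  qed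
  have Ale: "A z \<le> (\<integral>x. ?Q z x * (\<phi> x - c)\<^sup>2 \<partial>lborel)" if z: "z \<in> ?Z" for z c
  proof -
    have "0 \<le> (a1 z - c * ?\<nu>)\<^sup>2 / ?\<nu>" using nu by simp
    also have "\<dots> = (a1 z)\<^sup>2 / ?\<nu> - 2 * c * a1 z + c\<^sup>2 * ?\<nu>"
    proof -
      have "(p - c * n)\<^sup>2 / n = p\<^sup>2 / n - 2 * c * p + c\<^sup>2 * n" if "n \<noteq> 0" for p n :: real
        using that by (simp add: power2_eq_square field_simps)
      from this[of ?\<nu> "a1 z"] nu show ?thesis by linarith
    qed
    finally show ?thesis unfolding shift[OF z] A_def by linarith
  qed
  have A0: "0 \<le> A z" if z: "z \<in> ?Z" for z
  proof -
    have "A z = (\<integral>x. ?Q z x * (\<phi> x - a1 z / ?\<nu>)\<^sup>2 \<partial>lborel)"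
      unfolding shift[OF z] A_def using nu by (simp add: power2_eq_square field_simps)
    then show ?thesis by (simp add: integral_nonneg_AE)
  qed
  have "(norm (mk \<phi> - proj \<delta> \<Omega> (mk \<phi>)))\<^sup>2 = (norm (mk \<phi>))\<^sup>2 - (\<Sum>z\<in>?Z. (mk \<phi> \<bullet> cube_fn \<delta> z)\<^sup>2)"
    unfolding proj_def by (rule orthonormal_pythagoras[OF fin]) (rule cube_fn_orthonormal[OF d])
  also have "(norm (mk \<phi>))\<^sup>2 = (\<Sum>z\<in>?Z. a2 z)"
  proof -
    have "(\<phi> x)\<^sup>2 = (\<Sum>z\<in>?Z. ?Q z x * (\<phi> x)\<^sup>2)" for x
    proof (cases "x \<in> \<Omega>")
      case True
      have "(\<Sum>z\<in>?Z. ?Q z x) = (\<Sum>z\<in>?Z. if z = cell \<delta> x then 1 else 0)"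
        by (intro sum.cong) (auto simp: indicator_def cube_def)
      then have "(\<Sum>z\<in>?Z. ?Q z x) = 1" using fin True by simp
      then show ?thesis by (simp only: sum_distrib_right[symmetric] mult_1)
    next
      case False
      then have "\<phi> x = 0" using \<phi> unfolding C1c_def csupp_def by blast
      then show ?thesis by simp
    qed
    then have "(norm (mk \<phi>))\<^sup>2 = (\<integral>x. (\<Sum>z\<in>?Z. ?Q z x * (\<phi> x)\<^sup>2) \<partial>lborel)" by (simp only: norm_mk_sq[OF s])
    also have "\<dots> = (\<Sum>z\<in>?Z. a2 z)" unfolding a2_def by (rule Bochner_Integration.integral_sum) (rule iQ2)
    finally show ?thesis .
  qed
  also have "(\<Sum>z\<in>?Z. (mk \<phi> \<bullet> cube_fn \<delta> z)\<^sup>2) = (\<Sum>z\<in>?Z. (a1 z)\<^sup>2 / ?\<nu>)"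
  proof (rule sum.cong[OF refl])
    fix z assume z: "z \<in> ?Z"
    have "mk \<phi> \<bullet> cube_fn \<delta> z = (1 / sqrt ?\<nu>) * a1 z"
      unfolding cube_fn_def a1_def by (simp add: inner_mk[OF s sQ[OF z]] mult.commute)
    then show "(mk \<phi> \<bullet> cube_fn \<delta> z)\<^sup>2 = (a1 z)\<^sup>2 / ?\<nu>" using nu by (simp add: power_mult_distrib power_divide)
  qed
  also have "(\<Sum>z\<in>?Z. a2 z) - (\<Sum>z\<in>?Z. (a1 z)\<^sup>2 / ?\<nu>) = (\<Sum>z\<in>?Z. A z)" by (simp add: A_def sum_subtractf)
  finally have N: "(norm (mk \<phi> - proj \<delta> \<Omega> (mk \<phi>)))\<^sup>2 = (\<Sum>z\<in>?Z. A z)" .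
  \<comment> \<open>Multiplying by the volume amounts to integrating the constant \<open>A z\<close>
    over the cube; under that integral the bound with c = \<phi> y may be inserted.\<close>
  have "ennreal (?\<nu> * (\<Sum>z\<in>?Z. A z)) = (\<Sum>z\<in>?Z. ennreal (A z) * ennreal ?\<nu>)"
    using nu A0 by (simp add: sum_distrib_left ennreal_mult[symmetric] mult.commute)
  also have "\<dots> = (\<Sum>z\<in>?Z. \<integral>\<^sup>+y. ennreal (A z) * indicator (cube \<delta> z) y \<partial>lborel)"
    by (intro sum.cong refl) (simp add: nn_integral_cmult_indicator em)
  also have "\<dots> \<le> (\<Sum>z\<in>?Z. \<integral>\<^sup>+y. (\<integral>\<^sup>+x. indicator (cube \<delta> z) x * ennreal ((\<phi> x - \<phi> y)\<^sup>2) \<partial>lborel) * indicator (cube \<delta> z) y \<partial>lborel)"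
  proof (intro sum_mono nn_integral_mono mult_right_mono)
    fix z y assume z: "z \<in> ?Z"
    have "ennreal (A z) \<le> ennreal (\<integral>x. ?Q z x * (\<phi> x - \<phi> y)\<^sup>2 \<partial>lborel)" by (intro ennreal_leI Ale z)
    also have "\<dots> = (\<integral>\<^sup>+x. ennreal (?Q z x * (\<phi> x - \<phi> y)\<^sup>2) \<partial>lborel)"
      by (rule nn_integral_eq_integral[symmetric, OF ishift[OF z]]) simp
    also have "\<dots> = (\<integral>\<^sup>+x. indicator (cube \<delta> z) x * ennreal ((\<phi> x - \<phi> y)\<^sup>2) \<partial>lborel)"
      by (intro nn_integral_cong) (auto simp: indicator_def)
    finally show "ennreal (A z) \<le> (\<integral>\<^sup>+x. indicator (cube \<delta> z) x * ennreal ((\<phi> x - \<phi> y)\<^sup>2) \<partial>lborel)" .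
  qed simp
  also have "\<dots> = (\<integral>\<^sup>+y. (\<Sum>z\<in>?Z. (\<integral>\<^sup>+x. indicator (cube \<delta> z) x * ennreal ((\<phi> x - \<phi> y)\<^sup>2) \<partial>lborel) * indicator (cube \<delta> z) y) \<partial>lborel)"
    by (rule nn_integral_sum[symmetric]) measurable
  also have "\<dots> \<le> (\<integral>\<^sup>+y. \<integral>\<^sup>+x. indicator {x. cell \<delta> x = cell \<delta> y} x * ennreal ((\<phi> x - \<phi> y)\<^sup>2) \<partial>lborel \<partial>lborel)"
  proof (rule nn_integral_mono)
    fix y :: 'a
    let ?g = "\<lambda>z. \<integral>\<^sup>+x. indicator (cube \<delta> z) x * ennreal ((\<phi> x - \<phi> y)\<^sup>2) \<partial>lborel"
    have "(\<Sum>z\<in>?Z. ?g z * indicator (cube \<delta> z) y) = (\<Sum>z\<in>?Z. if z = cell \<delta> y then ?g z else 0)"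
      by (intro sum.cong) (auto simp: indicator_def cube_def)
    also have "\<dots> \<le> ?g (cell \<delta> y)" using fin by (simp add: sum.delta)
    finally show "(\<Sum>z\<in>?Z. ?g z * indicator (cube \<delta> z) y) \<le> (\<integral>\<^sup>+x. indicator {x. cell \<delta> x = cell \<delta> y} x * ennreal ((\<phi> x - \<phi> y)\<^sup>2) \<partial>lborel)"
      by (simp add: cube_def)
  qed
  also have "\<dots> \<le> ennreal ((2 * \<delta>) ^ DIM('a) * (real DIM('a) * (real DIM('a) * \<delta>) * gn (Dl \<phi>))\<^sup>2)"
    by (rule double_integral_bound[OF d \<phi>U])
  finally have "?\<nu> * (\<Sum>z\<in>?Z. A z) \<le> (2 * \<delta>) ^ DIM('a) * (real DIM('a) * (real DIM('a) * \<delta>) * gn (Dl \<phi>))\<^sup>2"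
    using d by (subst (asm) ennreal_le_iff) auto
  also have "\<dots> = ?\<nu> * (2 ^ DIM('a) * (real DIM('a) * (real DIM('a) * \<delta>) * gn (Dl \<phi>))\<^sup>2)"
    by (simp add: power_mult_distrib mult_ac)
  finally show ?thesis unfolding N using nu by (rule mult_left_le_imp_le)
qed

text \<open>The linear dependence on \<delta> with a constant independent of u is used twice, for
  compactness and for passing to the limit in the Galerkin scheme.\<close>

lemma proj_estimate:
  fixes \<Omega> :: "'a::euclidean_space set"
  assumes \<Omega>: "bounded \<Omega>"
  shows "\<exists>K\<ge>0. \<forall>\<delta>>0. \<forall>u G. h0 \<Omega> u G \<longrightarrow> norm (u - proj \<delta> \<Omega> u) \<le> K * \<delta> * gn G"
proof -
  define K where "K = sqrt (2 ^ DIM('a)) * (real DIM('a) * real DIM('a))"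
  have K: "K \<ge> 0" by (simp add: K_def)
  have "norm (u - proj \<delta> \<Omega> u) \<le> K * \<delta> * gn G" if d: "\<delta> > 0" and h: "h0 \<Omega> u G" for \<delta> u G
  proof -
    obtain f where f: "\<And>n. f n \<in> C1c \<Omega>" "(\<lambda>n. mk (f n)) \<longlonglongrightarrow> u" "\<And>b. (\<lambda>n. Dl (f n) b) \<longlonglongrightarrow> G b"
      using h unfolding h0_def by blast
    have le: "norm (mk (f n) - proj \<delta> \<Omega> (mk (f n))) \<le> K * \<delta> * gn (Dl (f n))" for n
    proof (rule power2_le_imp_le)
      have "(norm (mk (f n) - proj \<delta> \<Omega> (mk (f n))))\<^sup>2 \<le> 2 ^ DIM('a) * (real DIM('a) * (real DIM('a) * \<delta>) * gn (Dl (f n)))\<^sup>2"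
        by (rule proj_estimate_C1c[OF d \<Omega> f(1)])
      also have "\<dots> = (K * \<delta> * gn (Dl (f n)))\<^sup>2" by (simp add: K_def power_mult_distrib)
      finally show "(norm (mk (f n) - proj \<delta> \<Omega> (mk (f n))))\<^sup>2 \<le> (K * \<delta> * gn (Dl (f n)))\<^sup>2" .
      show "0 \<le> K * \<delta> * gn (Dl (f n))" using K d gn_nonneg by (intro mult_nonneg_nonneg) auto
    qed
    show ?thesis
    proof (rule LIMSEQ_le)
      show "(\<lambda>n. norm (mk (f n) - proj \<delta> \<Omega> (mk (f n)))) \<longlonglongrightarrow> norm (u - proj \<delta> \<Omega> u)"
        by (intro tendsto_intros f bounded_linear.tendsto[OF proj_bounded_linear])
      have c: "(\<lambda>n. sqrt (en (Dl (f n)) (Dl (f n)))) \<longlonglongrightarrow> sqrt (en G G)"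
        unfolding en_def by (intro tendsto_intros f)
      have g: "gn G = sqrt (en G G)" for G :: "'a \<Rightarrow> 'a l2" by (simp add: gn_sq[symmetric] gn_nonneg)
      show "(\<lambda>n. K * \<delta> * gn (Dl (f n))) \<longlonglongrightarrow> K * \<delta> * gn G"
        unfolding g by (intro tendsto_mult tendsto_const c)
      show "\<exists>N. \<forall>n\<ge>N. norm (mk (f n) - proj \<delta> \<Omega> (mk (f n))) \<le> K * \<delta> * gn (Dl (f n))" using le by blast
    qed
  qed
  then show ?thesis using K by blast
qed

subsection \<open>Compactness\<close>

lemma finite_convergent_subseq:
  fixes f :: "'i \<Rightarrow> nat \<Rightarrow> real"
  assumes "finite E" "\<And>i k. i \<in> E \<Longrightarrow> \<bar>f i k\<bar> \<le> B i"
  shows "\<exists>r::nat\<Rightarrow>nat. strict_mono r \<and> (\<forall>i\<in>E. convergent (\<lambda>k. f i (r k)))"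
  using assms
proof (induction E rule: finite_induct)
  case empty
  show ?case by (intro exI[of _ id]) (auto simp: strict_mono_def)
next
  case (insert i E)
  then obtain r :: "nat \<Rightarrow> nat" where r: "strict_mono r" "\<And>j. j \<in> E \<Longrightarrow> convergent (\<lambda>k. f j (r k))" by auto
  have "bounded (range (\<lambda>k. f i (r k)))" using insert.prems[of i] by (auto simp: bounded_iff)
  then obtain l s where s: "strict_mono s" "((\<lambda>k. f i (r k)) \<circ> s) \<longlonglongrightarrow> l"
    using bounded_imp_convergent_subsequence by blast
  have "convergent (\<lambda>k. f j ((r \<circ> s) k))" if "j \<in> insert i E" for j
  proof (cases "j = i")
    case True
    then show ?thesis using s(2) by (auto simp: convergent_def comp_def)
  next
    case False
    then have "convergent (\<lambda>k. f j (r k))" using r(2) that by blast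
    then show ?thesis using convergent_subseq_convergent[OF _ s(1), of "\<lambda>k. f j (r k)"] by (simp add: comp_def)
  qed
  then show ?case using strict_mono_o[OF r(1) s(1)] by blast
qed

text \<open>The projections have finite rank, so along a diagonal sequence all of them converge; the
  projection error is uniform in k because the gradients are bounded, which makes the sequence
  itself Cauchy.\<close>

lemma rellich:
  fixes \<Omega> :: "'a::euclidean_space set" and u :: "nat \<Rightarrow> 'a l2"
  assumes \<Omega>: "bounded \<Omega>" and h: "\<And>k. h0 \<Omega> (u k) (G k)" and M: "\<And>k. gn (G k) \<le> M"
  shows "\<exists>r::nat\<Rightarrow>nat. strict_mono r \<and> convergent (u \<circ> r)"
proof -
  obtain P where P: "P \<ge> 0" "\<And>u G. h0 \<Omega> u G \<Longrightarrow> norm u \<le> P * gn G" using h0_poincare[OF \<Omega>] by blast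
  obtain K where K: "K \<ge> 0" "\<And>\<delta> u G. \<delta> > 0 \<Longrightarrow> h0 \<Omega> u G \<Longrightarrow> norm (u - proj \<delta> \<Omega> u) \<le> K * \<delta> * gn G"
    using proj_estimate[OF \<Omega>] by blast
  have M0: "0 \<le> M" using M[of 0] gn_nonneg[of "G 0"] by linarith
  have ub: "norm (u k) \<le> P * M" for k
    using P(2)[OF h[of k]] mult_left_mono[OF M[of k] P(1)] by linarith
  let ?\<delta> = "\<lambda>n::nat. 1 / real (Suc n)"
  interpret subseqs "\<lambda>n s. convergent (\<lambda>k. proj (?\<delta> n) \<Omega> (u (s k)))"
  proof
    fix n and s :: "nat \<Rightarrow> nat" assume "strict_mono s"
    have d: "?\<delta> n > 0" by simp
    have "\<exists>r::nat\<Rightarrow>nat. strict_mono r \<and> (\<forall>z\<in>cell (?\<delta> n) ` \<Omega>. convergent (\<lambda>k. u (s (r k)) \<bullet> cube_fn (?\<delta> n) z))"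
    proof (rule finite_convergent_subseq[where f="\<lambda>z k. u (s k) \<bullet> cube_fn (?\<delta> n) z" and B="\<lambda>z. P * M * norm (cube_fn (?\<delta> n) z)"])
      show "finite (cell (?\<delta> n) ` \<Omega>)" by (rule finite_cells[OF d \<Omega>])
      show "\<bar>u (s k) \<bullet> cube_fn (?\<delta> n) z\<bar> \<le> P * M * norm (cube_fn (?\<delta> n) z)" for z k
        by (rule order_trans[OF Cauchy_Schwarz_ineq2]) (intro mult_right_mono ub norm_ge_zero)
    qed
    then obtain r :: "nat \<Rightarrow> nat" where r: "strict_mono r"
      "\<And>z. z \<in> cell (?\<delta> n) ` \<Omega> \<Longrightarrow> convergent (\<lambda>k. u (s (r k)) \<bullet> cube_fn (?\<delta> n) z)" by blast
    then obtain c where c: "\<And>z. z \<in> cell (?\<delta> n) ` \<Omega> \<Longrightarrow> (\<lambda>k. u (s (r k)) \<bullet> cube_fn (?\<delta> n) z) \<longlonglongrightarrow> c z"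
      unfolding convergent_def by metis
    have "(\<lambda>k. proj (?\<delta> n) \<Omega> (u ((s \<circ> r) k))) \<longlonglongrightarrow> (\<Sum>z\<in>cell (?\<delta> n) ` \<Omega>. c z *\<^sub>R cube_fn (?\<delta> n) z)"
      unfolding proj_def comp_def by (intro tendsto_sum tendsto_scaleR tendsto_const c)
    then show "\<exists>r'. strict_mono r' \<and> convergent (\<lambda>k. proj (?\<delta> n) \<Omega> (u ((s \<circ> r') k)))"
      using r(1) unfolding convergent_def by blast
  qed
  have conv: "convergent (\<lambda>k. proj (?\<delta> n) \<Omega> (u (diagseq k)))" for n
  proof -
    \<comment> \<open>The diagonal sequence is controlled by the n-th choice only from index n + 1
      on, so a finite initial segment has to be set aside and restored.\<close>
    have "convergent (\<lambda>k. proj (?\<delta> n) \<Omega> (u ((diagseq \<circ> ((+) (Suc n))) k)))"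
    proof (rule diagseq_holds)
      fix r s :: "nat \<Rightarrow> nat" and n assume "strict_mono r" "convergent (\<lambda>k. proj (?\<delta> n) \<Omega> (u (s k)))"
      then show "convergent (\<lambda>k. proj (?\<delta> n) \<Omega> (u ((s \<circ> r) k)))"
        using convergent_subseq_convergent[of "\<lambda>k. proj (?\<delta> n) \<Omega> (u (s k))" r] by (simp add: comp_def)
    qed
    then have "convergent (\<lambda>k. proj (?\<delta> n) \<Omega> (u (diagseq (k + Suc n))))" by (simp add: comp_def add.commute)
    then show ?thesis using convergent_ignore_initial_segment[of "\<lambda>k. proj (?\<delta> n) \<Omega> (u (diagseq k))" "Suc n"] by simp
  qed
  have "Cauchy (\<lambda>k. u (diagseq k))"
    unfolding Cauchy_def dist_norm
  proof (intro allI impI)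
    fix \<epsilon> :: real assume e: "\<epsilon> > 0"
    have "K * M + 1 > 0" using K(1) M0 by (simp add: add_nonneg_pos)
    then have "\<epsilon> / (4 * (K * M + 1)) > 0" using e by simp
    then obtain n where n: "1 / real (Suc n) < \<epsilon> / (4 * (K * M + 1))" by (rule nat_approx_posE)
    have KM: "K * ?\<delta> n * M < \<epsilon> / 4"
    proof -
      have "(K * M) * ?\<delta> n \<le> (K * M) * (\<epsilon> / (4 * (K * M + 1)))" using n K(1) M0 by (intro mult_left_mono) auto
      also have "\<dots> = (\<epsilon> / 4) * (K * M / (K * M + 1))" by simp
      also have "\<dots> < (\<epsilon> / 4) * 1"
        using e \<open>K * M + 1 > 0\<close> by (intro mult_strict_left_mono) (auto simp: divide_less_eq)
      finally show ?thesis by (simp add: mult_ac)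
    qed
    have cl: "norm (u k - proj (?\<delta> n) \<Omega> (u k)) < \<epsilon> / 4" for k
    proof -
      have "norm (u k - proj (?\<delta> n) \<Omega> (u k)) \<le> K * ?\<delta> n * gn (G k)" by (rule K(2)[OF _ h]) simp
      also have "\<dots> \<le> K * ?\<delta> n * M" using M K(1) by (intro mult_left_mono) auto
      finally show ?thesis using KM by linarith
    qed
    have "Cauchy (\<lambda>k. proj (?\<delta> n) \<Omega> (u (diagseq k)))" using conv by (rule convergent_Cauchy)
    then obtain N where N: "\<And>i j. i \<ge> N \<Longrightarrow> j \<ge> N \<Longrightarrow> norm (proj (?\<delta> n) \<Omega> (u (diagseq i)) - proj (?\<delta> n) \<Omega> (u (diagseq j))) < \<epsilon> / 4"
      unfolding Cauchy_def dist_norm using e by (metis divide_pos_pos zero_less_numeral)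
    have "norm (u (diagseq i) - u (diagseq j)) < \<epsilon>" if "i \<ge> N" "j \<ge> N" for i j
    proof -
      let ?p = "\<lambda>i. proj (?\<delta> n) \<Omega> (u (diagseq i))"
      have tri: "norm (A + B - C) \<le> norm A + norm B + norm C" for A B C :: "'a l2"
        using norm_triangle_ineq4[of "A + B" C] norm_triangle_ineq[of A B] by linarith
      have "norm (u (diagseq i) - u (diagseq j)) \<le> norm (u (diagseq i) - ?p i) + norm (?p i - ?p j) + norm (u (diagseq j) - ?p j)"
        using tri[of "u (diagseq i) - ?p i" "?p i - ?p j" "u (diagseq j) - ?p j"] by simp
      then show ?thesis using cl[of "diagseq i"] cl[of "diagseq j"] N[OF that] e by linarith
    qed
    then show "\<exists>M. \<forall>i\<ge>M. \<forall>j\<ge>M. norm (u (diagseq i) - u (diagseq j)) < \<epsilon>" by blast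
  qed
  then have "convergent (u \<circ> diagseq)" by (simp add: Cauchy_convergent comp_def)
  then show ?thesis using subseq_diagseq by blast
qed

subsection \<open>Brouwer's fixed point theorem in coordinates\<close>

text \<open>The dimension has to vary, so Brouwer's theorem is needed for cubes of sequences rather than
  for a type of fixed dimension; it follows from the combinatorial lemma of Kuhn.\<close>

lemma brouwer_coordinates:
  fixes F :: "(nat \<Rightarrow> real) \<Rightarrow> nat \<Rightarrow> real"
  assumes R: "R > 0"
    and F: "\<And>x i. (\<And>j. j < n \<Longrightarrow> \<bar>x j\<bar> \<le> R) \<Longrightarrow> i < n \<Longrightarrow> \<bar>F x i\<bar> \<le> R"
    and cont: "\<And>X x i. (\<And>k j. j < n \<Longrightarrow> \<bar>X k j\<bar> \<le> R) \<Longrightarrow> (\<And>j. j < n \<Longrightarrow> (\<lambda>k::nat. X k j) \<longlonglongrightarrow> x j) \<Longrightarrow> i < n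
      \<Longrightarrow> (\<lambda>k. F (X k) i) \<longlonglongrightarrow> F x i"
  shows "\<exists>x. (\<forall>j<n. \<bar>x j\<bar> \<le> R) \<and> (\<forall>i<n. F x i = x i)"
proof -
  \<comment> \<open>A grid of mesh 2 R / p on the cube with side 2 R about the origin: an integer
    vector with entries between 0 and p labels a grid point.\<close>
  define \<xi> where "\<xi> p q j = - R + 2 * R * real (q j) / real p" for p :: nat and q :: "nat \<Rightarrow> nat" and j
  \<comment> \<open>Besides lying in the cube, the grid point of a is within one mesh width of that
    of q in each coordinate, so both have the same limit as p grows.\<close>
  define good where "good p q a \<longleftrightarrow> (\<forall>j<n. \<bar>\<xi> p a j\<bar> \<le> R \<and> \<bar>\<xi> p a j - \<xi> p q j\<bar> \<le> 2 * R / real p)" for p q a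
  have \<xi>R: "\<bar>\<xi> p a j\<bar> \<le> R" if "p > 0" "a j \<le> p" for p a j
  proof -
    have "0 \<le> real (a j) / real p" "real (a j) / real p \<le> 1" using that by auto
    then have "0 \<le> (2 * R) * (real (a j) / real p)" using R by simp
    moreover have "(2 * R) * (real (a j) / real p) \<le> (2 * R) * 1"
      using \<open>real (a j) / real p \<le> 1\<close> by (rule mult_left_mono) (use R in simp)
    ultimately show ?thesis by (simp add: \<xi>_def abs_le_iff)
  qed
  have step: "\<exists>q. good p q q \<and> (\<forall>i<n. \<exists>a b. good p q a \<and> good p q b \<and> F (\<xi> p a) i \<ge> \<xi> p a i \<and> F (\<xi> p b) i \<le> \<xi> p b i)"
    if p: "p > 0" for p
  proof -
    \<comment> \<open>Label 0 means that F does not decrease the coordinate. Where q i = p the label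
      1 is imposed, as Kuhn's lemma requires; there the coordinate is R, which F cannot exceed, so
      the inequality expected of label 1 still holds. On the opposite face label 0 is
      automatic.\<close>
    define label :: "(nat \<Rightarrow> nat) \<Rightarrow> nat \<Rightarrow> nat"
      where "label q i = (if F (\<xi> p q) i \<ge> \<xi> p q i \<and> q i \<noteq> p then 0 else 1)" for q i
    obtain q where q: "\<forall>i<n. q i < p"
      and rs: "\<forall>i<n. \<exists>r s. (\<forall>j<n. q j \<le> r j \<and> r j \<le> q j + 1) \<and> (\<forall>j<n. q j \<le> s j \<and> s j \<le> q j + 1) \<and> label r i \<noteq> label s i"
    proof (rule kuhn_lemma[OF p, of n label])
      show "\<forall>x. (\<forall>i<n. x i \<le> p) \<longrightarrow> (\<forall>i<n. label x i = 0 \<or> label x i = 1)" by (simp add: label_def)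
      show "\<forall>x. (\<forall>i<n. x i \<le> p) \<longrightarrow> (\<forall>i<n. x i = p \<longrightarrow> label x i = 1)" by (simp add: label_def)
      show "\<forall>x. (\<forall>i<n. x i \<le> p) \<longrightarrow> (\<forall>i<n. x i = 0 \<longrightarrow> label x i = 0)"
      proof (intro allI impI)
        fix x :: "nat \<Rightarrow> nat" and i assume x: "\<forall>i<n. x i \<le> p" "i < n" "x i = 0"
        have "\<bar>F (\<xi> p x) i\<bar> \<le> R" by (rule F[OF \<xi>R[OF p] x(2)]) (use x(1) in blast)
        then show "label x i = 0" using x(3) p by (simp add: label_def \<xi>_def)
      qed
    qed blast
    have gd: "good p q a" if a: "\<forall>j<n. q j \<le> a j \<and> a j \<le> q j + 1" for a
      unfolding good_def
    proof (intro allI impI)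
      fix j assume j: "j < n"
      have "a j \<le> p" using a q j by (metis Suc_eq_plus1 Suc_leI le_trans)
      moreover have "\<bar>\<xi> p a j - \<xi> p q j\<bar> \<le> 2 * R / real p"
      proof -
        have "\<xi> p a j - \<xi> p q j = (2 * R / real p) * (real (a j) - real (q j))" by (simp add: \<xi>_def diff_divide_distrib algebra_simps)
        moreover have "\<bar>real (a j) - real (q j)\<bar> \<le> 1"
        proof -
          have "q j \<le> a j" "a j \<le> q j + 1" using a j by auto
          then show ?thesis by linarith
        qed
        ultimately show ?thesis using R mult_left_mono[of "\<bar>real (a j) - real (q j)\<bar>" 1 "2 * R / real p"] by (simp add: abs_mult)
      qed
      ultimately show "\<bar>\<xi> p a j\<bar> \<le> R \<and> \<bar>\<xi> p a j - \<xi> p q j\<bar> \<le> 2 * R / real p" using \<xi>R[OF p] by blast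
    qed
    have "\<exists>a b. good p q a \<and> good p q b \<and> F (\<xi> p a) i \<ge> \<xi> p a i \<and> F (\<xi> p b) i \<le> \<xi> p b i" if i: "i < n" for i
    proof -
      have "\<exists>r s. (\<forall>j<n. q j \<le> r j \<and> r j \<le> q j + 1) \<and> (\<forall>j<n. q j \<le> s j \<and> s j \<le> q j + 1) \<and> label r i \<noteq> label s i"
        using rs i by (simp only:)
      then obtain r s where "\<forall>j<n. q j \<le> r j \<and> r j \<le> q j + 1" "\<forall>j<n. q j \<le> s j \<and> s j \<le> q j + 1" and l: "label r i \<noteq> label s i"
        by (elim exE conjE)
      then have r: "good p q r" and s: "good p q s" by (auto intro: gd)
      have l0: "F (\<xi> p a) i \<ge> \<xi> p a i" if "label a i = 0" for a using that by (simp add: label_def split: if_splits)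
      have l1: "F (\<xi> p a) i \<le> \<xi> p a i" if "label a i \<noteq> 0" "good p q a" for a
      proof (cases "a i = p")
        case True
        have "\<bar>F (\<xi> p a) i\<bar> \<le> R" by (rule F[OF _ i]) (use that(2) in \<open>auto simp: good_def\<close>)
        then show ?thesis using True p by (simp add: \<xi>_def)
      next
        case False
        then show ?thesis using that(1) by (simp add: label_def split: if_splits)
      qed
      show ?thesis
      proof (cases "label r i = 0")
        case True
        then show ?thesis using r s l l0[of r] l1[of s] by metis
      next
        case False
        then have "label s i = 0" using l by (simp add: label_def split: if_splits)
        then show ?thesis using r s False l0[of s] l1[of r] by metis
      qed
    qed
    moreover have "good p q q" by (rule gd) simp
    ultimately show ?thesis by blast
  qed
  have "\<forall>k. \<exists>q. good (Suc k) q q \<and> (\<forall>i<n. \<exists>a b. good (Suc k) q a \<and> good (Suc k) q b \<and> F (\<xi> (Suc k) a) i \<ge> \<xi> (Suc k) a i \<and> F (\<xi> (Suc k) b) i \<le> \<xi> (Suc k) b i)"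
    using step by blast
  then obtain q where q: "\<And>k. good (Suc k) (q k) (q k)"
    "\<And>k i. i < n \<Longrightarrow> \<exists>a b. good (Suc k) (q k) a \<and> good (Suc k) (q k) b \<and> F (\<xi> (Suc k) a) i \<ge> \<xi> (Suc k) a i \<and> F (\<xi> (Suc k) b) i \<le> \<xi> (Suc k) b i"
    by metis
  \<comment> \<open>The vertices witnessing the two inequalities depend on the coordinate i; they
    come together only in the limit.\<close>
  have "\<forall>k i. \<exists>a. i < n \<longrightarrow> good (Suc k) (q k) a \<and> F (\<xi> (Suc k) a) i \<ge> \<xi> (Suc k) a i" using q(2) by blast
  then obtain a where a: "\<And>k i. i < n \<Longrightarrow> good (Suc k) (q k) (a k i)" "\<And>k i. i < n \<Longrightarrow> F (\<xi> (Suc k) (a k i)) i \<ge> \<xi> (Suc k) (a k i) i"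
    by metis
  have "\<forall>k i. \<exists>b. i < n \<longrightarrow> good (Suc k) (q k) b \<and> F (\<xi> (Suc k) b) i \<le> \<xi> (Suc k) b i" using q(2) by blast
  then obtain b where b: "\<And>k i. i < n \<Longrightarrow> good (Suc k) (q k) (b k i)" "\<And>k i. i < n \<Longrightarrow> F (\<xi> (Suc k) (b k i)) i \<le> \<xi> (Suc k) (b k i) i"
    by metis
  have "\<exists>r::nat\<Rightarrow>nat. strict_mono r \<and> (\<forall>j\<in>{..<n}. convergent (\<lambda>k. \<xi> (Suc (r k)) (q (r k)) j))"
    by (rule finite_convergent_subseq[where f="\<lambda>j k. \<xi> (Suc k) (q k) j" and B="\<lambda>j. R"]) (use q(1) in \<open>auto simp: good_def\<close>)
  then obtain r :: "nat \<Rightarrow> nat" and x where r: "strict_mono r" "\<And>j. j < n \<Longrightarrow> (\<lambda>k. \<xi> (Suc (r k)) (q (r k)) j) \<longlonglongrightarrow> x j"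
    unfolding convergent_def by (metis lessThan_iff)
  have near: "(\<lambda>k. \<xi> (Suc (r k)) (c k) j) \<longlonglongrightarrow> x j" if c: "\<And>k. good (Suc (r k)) (q (r k)) (c k)" and j: "j < n" for c j
  proof -
    have "(\<lambda>k. 2 * R / real (Suc k)) \<longlonglongrightarrow> 0" using LIMSEQ_Suc[OF lim_const_over_n[of "2 * R"]] by simp
    then have "(\<lambda>k. 2 * R / real (Suc (r k))) \<longlonglongrightarrow> 0"
      using LIMSEQ_subseq_LIMSEQ[OF _ r(1)] by (fastforce simp: comp_def)
    then have "(\<lambda>k. \<xi> (Suc (r k)) (c k) j - \<xi> (Suc (r k)) (q (r k)) j) \<longlonglongrightarrow> 0"
      by (rule Lim_null_comparison[OF always_eventually, rotated]) (use c j in \<open>auto simp: good_def\<close>)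
    from tendsto_add[OF this r(2)[OF j]] show ?thesis by simp
  qed
  have xR: "\<bar>x j\<bar> \<le> R" if j: "j < n" for j
    by (rule LIMSEQ_le_const2[OF tendsto_rabs[OF r(2)[OF j]]]) (use q(1) j in \<open>auto simp: good_def\<close>)
  have "F x i = x i" if i: "i < n" for i
  proof (rule antisym)
    have lb: "(\<lambda>k. F (\<xi> (Suc (r k)) (b (r k) i)) i) \<longlonglongrightarrow> F x i"
      by (rule cont[OF _ near[OF b(1)[OF i]] i]) (use b(1)[OF i] in \<open>auto simp: good_def\<close>)
    show "F x i \<le> x i"
      by (rule LIMSEQ_le[OF lb near[OF b(1)[OF i] i]]) (use b(2)[OF i] in blast)
    have la: "(\<lambda>k. F (\<xi> (Suc (r k)) (a (r k) i)) i) \<longlonglongrightarrow> F x i"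
      by (rule cont[OF _ near[OF a(1)[OF i]] i]) (use a(1)[OF i] in \<open>auto simp: good_def\<close>)
    show "x i \<le> F x i"
      by (rule LIMSEQ_le[OF near[OF a(1)[OF i] i] la]) (use a(2)[OF i] in blast)
  qed
  then show ?thesis using xR by blast
qed

text \<open>T is controlled only on the ball, so it is composed with the radial retraction, and
  Brouwer's theorem is applied to coefficients in a cube. A fixed point has norm at most R by
  Bessel's inequality, hence the retraction does not move it. Continuity is asked only of the
  coefficients against each f i, which weak continuity provides.\<close>

lemma galerkin:
  fixes T :: "'h::real_inner \<Rightarrow> 'h" and f :: "'i \<Rightarrow> 'h"
  assumes R: "R > 0" and T: "\<And>v. norm v \<le> R \<Longrightarrow> norm (T v) \<le> R"
    and fin: "finite I" and on: "\<And>i j. i \<in> I \<Longrightarrow> j \<in> I \<Longrightarrow> f i \<bullet> f j = (if i = j then 1 else 0)"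
    and cont: "\<And>V v i. (\<And>k. norm (V k) \<le> R) \<Longrightarrow> V \<longlonglongrightarrow> v \<Longrightarrow> (\<lambda>k. T (V k) \<bullet> f i) \<longlonglongrightarrow> T v \<bullet> f i"
  shows "\<exists>v. norm v \<le> R \<and> v = (\<Sum>i\<in>I. (T v \<bullet> f i) *\<^sub>R f i)"
proof -
  obtain h where h: "bij_betw h {0..<card I} I" using ex_bij_betw_nat_finite[OF fin] by blast
  define n where "n = card I"
  have hI: "h i \<in> I" if "i < n" for i using h that by (auto simp: bij_betw_def n_def)
  have reidx: "(\<Sum>i\<in>I. g i) = (\<Sum>i<n. g (h i))" for g :: "'i \<Rightarrow> 'h"
    using sum.reindex_bij_betw[OF h, of g] by (simp add: n_def atLeast0LessThan)
  define S where "S x = (\<Sum>i<n. x i *\<^sub>R f (h i))" for x :: "nat \<Rightarrow> real"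
  define \<rho> where "\<rho> v = (R / max R (norm v)) *\<^sub>R v" for v :: 'h
  have \<rho>R: "norm (\<rho> v) \<le> R" for v
  proof -
    have "norm v / max R (norm v) \<le> 1" using R by (simp add: divide_le_eq)
    then have "R * (norm v / max R (norm v)) \<le> R * 1" using R by (intro mult_left_mono) auto
    then show ?thesis using R by (simp add: \<rho>_def abs_of_pos)
  qed
  have \<rho>id: "\<rho> v = v" if "norm v \<le> R" for v using that R by (simp add: \<rho>_def max_def)
  have nf: "norm (f i) = 1" if "i \<in> I" for i using on[OF that that] by (simp add: norm_eq_1)
  have "\<exists>x. (\<forall>j<n. \<bar>x j\<bar> \<le> R) \<and> (\<forall>i<n. T (\<rho> (S x)) \<bullet> f (h i) = x i)"
  proof (rule brouwer_coordinates[OF R])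
    fix x i assume i: "i < n"
    have "\<bar>T (\<rho> (S x)) \<bullet> f (h i)\<bar> \<le> norm (T (\<rho> (S x))) * norm (f (h i))" by (rule Cauchy_Schwarz_ineq2)
    also have "\<dots> \<le> R" using T[OF \<rho>R] nf[OF hI[OF i]] by simp
    finally show "\<bar>T (\<rho> (S x)) \<bullet> f (h i)\<bar> \<le> R" .
  next
    fix X :: "nat \<Rightarrow> nat \<Rightarrow> real" and x i
    assume c: "\<And>j. j < n \<Longrightarrow> (\<lambda>k. X k j) \<longlonglongrightarrow> x j" and i: "i < n"
    have S: "(\<lambda>k. S (X k)) \<longlonglongrightarrow> S x" unfolding S_def by (intro tendsto_sum tendsto_scaleR tendsto_const c) auto
    have "max R (norm (S x)) \<noteq> 0" using R by linarith
    then have "(\<lambda>k. \<rho> (S (X k))) \<longlonglongrightarrow> \<rho> (S x)"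
      unfolding \<rho>_def by (intro tendsto_scaleR tendsto_divide tendsto_const tendsto_max tendsto_norm S)
    then show "(\<lambda>k. T (\<rho> (S (X k))) \<bullet> f (h i)) \<longlonglongrightarrow> T (\<rho> (S x)) \<bullet> f (h i)" by (rule cont[OF \<rho>R])
  qed
  then obtain x where x: "\<And>i. i < n \<Longrightarrow> T (\<rho> (S x)) \<bullet> f (h i) = x i" by blast
  have Sx: "S x = (\<Sum>i\<in>I. (T (\<rho> (S x)) \<bullet> f i) *\<^sub>R f i)"
    unfolding reidx by (subst S_def) (simp add: x)
  have "norm (S x) \<le> norm (T (\<rho> (S x)))"
    by (subst Sx) (rule orthonormal_proj_norm[OF fin on])
  also have "\<dots> \<le> R" by (rule T[OF \<rho>R])
  finally have n: "norm (S x) \<le> R" .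
  then show ?thesis using Sx \<rho>id[OF n] by metis
qed

section \<open>Fixed points of weakly sequentially closed maps\<close>

lemma LIMSEQ_by_subsequences:
  fixes X :: "nat \<Rightarrow> real"
  assumes "\<And>s::nat\<Rightarrow>nat. strict_mono s \<Longrightarrow> \<exists>r::nat\<Rightarrow>nat. strict_mono r \<and> (\<lambda>k. X (s (r k))) \<longlonglongrightarrow> l"
  shows "X \<longlonglongrightarrow> l"
proof (rule ccontr)
  assume "\<not> X \<longlonglongrightarrow> l"
  then obtain e where e: "e > 0" "\<forall>N. \<exists>n\<ge>N. \<not> dist (X n) l < e" unfolding LIMSEQ_def by blast
  then have "infinite {n. \<not> dist (X n) l < e}"
    unfolding infinite_nat_iff_unbounded_le by blast
  then obtain s :: "nat \<Rightarrow> nat" where s: "strict_mono s" "\<And>n. s n \<in> {n. \<not> dist (X n) l < e}"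
    using infinite_enumerate by blast
  obtain r :: "nat \<Rightarrow> nat" where r: "(\<lambda>k. X (s (r k))) \<longlonglongrightarrow> l" using assms[OF s(1)] by blast
  then obtain k where "dist (X (s (r k))) l < e" using e(1) unfolding LIMSEQ_def by blast
  then show False using s(2) by blast
qed

text \<open>The Nemytskii operator need not be continuous into \<open>L\<^sup>2\<close> under hypothesis (f2), only sequentially
  closed for the weak topology on its values. This suffices: a Galerkin scheme is solved by Brouwer's
  theorem, and the symmetry of the solution operator \<open>K\<close> together with the projection error estimate on
  its range allows passage to the limit.\<close>

lemma weak_fixed_point:
  fixes \<Omega> :: "'a::euclidean_space set" and K N :: "'a l2 \<Rightarrow> 'a l2"
  assumes \<Omega>: "bounded \<Omega>" and l: "l \<ge> 0" and R: "R > 0"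
    and K: "\<And>v. h0 \<Omega> (K v) (D v)" "\<And>v \<phi>. \<phi> \<in> C1c \<Omega> \<Longrightarrow> en (D v) (Dl \<phi>) + l * (K v \<bullet> mk \<phi>) = v \<bullet> mk \<phi>"
    and N: "\<And>v. norm v \<le> R \<Longrightarrow> norm (N (K v)) \<le> R"
    and closed: "\<And>V u. (\<And>k. norm (V k) \<le> R) \<Longrightarrow> (\<lambda>k. K (V k)) \<longlonglongrightarrow> u \<Longrightarrow>
      \<exists>r::nat\<Rightarrow>nat. strict_mono r \<and> norm (N u) \<le> R \<and> (\<forall>y. (\<lambda>k. N (K (V (r k))) \<bullet> y) \<longlonglongrightarrow> N u \<bullet> y)"
  shows "\<exists>v. norm v \<le> R \<and> v = N (K v)"
proof -
  obtain P where P: "P \<ge> 0" "\<And>u G. h0 \<Omega> u G \<Longrightarrow> norm u \<le> P * gn G" using h0_poincare[OF \<Omega>] by blast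
  obtain Q where Q: "Q \<ge> 0" "\<And>\<delta> u G. \<delta> > 0 \<Longrightarrow> h0 \<Omega> u G \<Longrightarrow> norm (u - proj \<delta> \<Omega> u) \<le> Q * \<delta> * gn G"
    using proj_estimate[OF \<Omega>] by blast
  have test: "en (D v) W + l * (K v \<bullet> w) = v \<bullet> w" if "h0 \<Omega> w W" for v w W
    by (rule weak_eq_h0[OF K(2) that])
  \<comment> \<open>Both sides equal the symmetric bilinear form evaluated at \<open>K v\<close> and
    \<open>K w\<close>.\<close>
  have sym: "K v \<bullet> w = v \<bullet> K w" for v w
    using test[OF K(1)[of w], of v] test[OF K(1)[of v], of w] en_commute[of "D v" "D w"] inner_commute[of "K v" "K w"] inner_commute[of w "K v"] by simp
  have energy: "gn G \<le> P * norm v"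
    if h: "h0 \<Omega> u G" and eq: "en G G + l * (u \<bullet> u) = v \<bullet> u" for u G and v :: "'a l2"
  proof (cases "gn G = 0")
    case False
    then have p: "gn G > 0" using gn_nonneg[of G] by linarith
    have "(gn G)\<^sup>2 \<le> en G G + l * (u \<bullet> u)" using l by (simp add: gn_sq)
    also have "\<dots> \<le> norm v * norm u" unfolding eq by (rule norm_cauchy_schwarz)
    also have "\<dots> \<le> norm v * (P * gn G)" by (intro mult_left_mono P(2)[OF h]) auto
    finally have "gn G * gn G \<le> (P * norm v) * gn G" by (simp add: power2_eq_square mult_ac)
    then show ?thesis using p by simp
  qed (use P(1) in simp)
  have gD: "gn (D v) \<le> P * norm v" for v by (rule energy[OF K(1) test[OF K(1)]])
  have Klip: "norm (K v - K w) \<le> P * P * norm (v - w)" for v w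
  proof -
    let ?u = "K v - K w" and ?G = "\<lambda>b. D v b - D w b"
    have h: "h0 \<Omega> ?u ?G" by (rule h0_diff[OF K(1) K(1)])
    have "en ?G ?G = en (D v) ?G - en (D w) ?G" by (simp add: en_def inner_diff_left sum_subtractf)
    then have "en ?G ?G + l * (?u \<bullet> ?u) = (v - w) \<bullet> ?u"
      using test[OF h, of v] test[OF h, of w] unfolding inner_diff_left[of _ _ ?u] right_diff_distrib by linarith
    then have "gn ?G \<le> P * norm (v - w)" by (rule energy[OF h])
    then have "P * gn ?G \<le> P * (P * norm (v - w))" using P(1) by (rule mult_left_mono)
    then show ?thesis using P(2)[OF h] by (simp add: mult.assoc)
  qed
  have Kcont: "(\<lambda>k. K (V k)) \<longlonglongrightarrow> K v" if V: "V \<longlonglongrightarrow> v" for V v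
  proof -
    have "(\<lambda>k. P * P * norm (V k - v)) \<longlonglongrightarrow> P * P * norm (v - v)" by (intro tendsto_intros V)
    then have "(\<lambda>k. K (V k) - K v) \<longlonglongrightarrow> 0"
      by (intro Lim_null_comparison[OF always_eventually, of "\<lambda>k. K (V k) - K v"]) (use Klip in auto)
    then show ?thesis by (simp only: LIM_zero_iff)
  qed
  \<comment> \<open>Every subsequence has a further one along which \<open>closed\<close> provides a
    weak limit. That limit is always \<open>N (K v)\<close>, so the whole sequence converges
    weakly.\<close>
  have wcont: "(\<lambda>k. N (K (V k)) \<bullet> y) \<longlonglongrightarrow> N (K v) \<bullet> y" if VR: "\<And>k. norm (V k) \<le> R" and V: "V \<longlonglongrightarrow> v" for V v y
  proof (rule LIMSEQ_by_subsequences)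
    fix s :: "nat \<Rightarrow> nat" assume s: "strict_mono s"
    have "(\<lambda>k. K (V (s k))) \<longlonglongrightarrow> K v" using LIMSEQ_subseq_LIMSEQ[OF Kcont[OF V] s] by (simp add: comp_def)
    from closed[of "\<lambda>k. V (s k)", OF VR this]
    show "\<exists>r::nat\<Rightarrow>nat. strict_mono r \<and> (\<lambda>k. N (K (V (s (r k)))) \<bullet> y) \<longlonglongrightarrow> N (K v) \<bullet> y" by blast
  qed
  let ?\<delta> = "\<lambda>n::nat. 1 / real (Suc n)"
  have "\<exists>v. norm v \<le> R \<and> v = proj (?\<delta> n) \<Omega> (N (K v))" for n
    unfolding proj_def
    by (rule galerkin[where T="\<lambda>v. N (K v)", OF R N finite_cells[OF _ \<Omega>] cube_fn_orthonormal wcont]) auto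
  then obtain v where v: "\<And>n. norm (v n) \<le> R" "\<And>n. v n = proj (?\<delta> n) \<Omega> (N (K (v n)))" by metis
  have "gn (D (v n)) \<le> P * R" for n using gD[of "v n"] mult_left_mono[OF v(1)[of n] P(1)] by linarith
  \<comment> \<open>The fixed points v n are merely bounded; it is their images under K that
    converge.\<close>
  then obtain r1 :: "nat \<Rightarrow> nat" where r1: "strict_mono r1" "convergent ((\<lambda>n. K (v n)) \<circ> r1)"
    using rellich[OF \<Omega>, of "\<lambda>n. K (v n)" "\<lambda>n. D (v n)", OF K(1)] by blast
  then obtain u where u: "(\<lambda>k. K (v (r1 k))) \<longlonglongrightarrow> u" unfolding convergent_def comp_def by blast
  obtain r2 :: "nat \<Rightarrow> nat" where r2: "strict_mono r2" "norm (N u) \<le> R"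
    "\<And>y. (\<lambda>k. N (K (v (r1 (r2 k)))) \<bullet> y) \<longlonglongrightarrow> N u \<bullet> y"
    using closed[of "\<lambda>k. v (r1 k)", OF v(1) u] by blast
  define s where "s k = r1 (r2 k)" for k
  have sm: "strict_mono s" using strict_mono_o[OF r1(1) r2(1)] by (simp add: s_def[abs_def] comp_def)
  let ?z = "N u"
  have us: "(\<lambda>k. K (v (s k))) \<longlonglongrightarrow> u" using LIMSEQ_subseq_LIMSEQ[OF u r2(1)] by (simp add: s_def comp_def)
  have "u \<bullet> w = K ?z \<bullet> w" for w
  proof (rule LIMSEQ_unique)
    show "(\<lambda>k. K (v (s k)) \<bullet> w) \<longlonglongrightarrow> u \<bullet> w" by (intro tendsto_intros us)
    \<comment> \<open>Symmetry of K and of the projection moves both onto w. There the projection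
      acts on \<open>K w\<close>, which has a square integrable gradient, so its error vanishes with
      the mesh.\<close>
    have eq: "K (v (s k)) \<bullet> w = N (K (v (s k))) \<bullet> K w - N (K (v (s k))) \<bullet> (K w - proj (?\<delta> (s k)) \<Omega> (K w))" for k
    proof -
      have "K (v (s k)) \<bullet> w = proj (?\<delta> (s k)) \<Omega> (N (K (v (s k)))) \<bullet> K w" unfolding sym by (simp only: v(2)[of "s k", symmetric])
      then show ?thesis by (simp add: proj_symmetric inner_diff_right)
    qed
    have "(\<lambda>k. N (K (v (s k))) \<bullet> (K w - proj (?\<delta> (s k)) \<Omega> (K w))) \<longlonglongrightarrow> 0"
    proof (rule Lim_null_comparison[OF always_eventually])
      show "\<forall>k. norm (N (K (v (s k))) \<bullet> (K w - proj (?\<delta> (s k)) \<Omega> (K w))) \<le> (R * Q * gn (D w)) * ?\<delta> (s k)"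
      proof
        fix k
        have "norm (N (K (v (s k))) \<bullet> (K w - proj (?\<delta> (s k)) \<Omega> (K w))) \<le> norm (N (K (v (s k)))) * norm (K w - proj (?\<delta> (s k)) \<Omega> (K w))"
          by (simp add: Cauchy_Schwarz_ineq2)
        also have "\<dots> \<le> R * (Q * ?\<delta> (s k) * gn (D w))"
          by (intro mult_mono N v(1) Q(2) K(1)) (use R in auto)
        finally show "norm (N (K (v (s k))) \<bullet> (K w - proj (?\<delta> (s k)) \<Omega> (K w))) \<le> (R * Q * gn (D w)) * ?\<delta> (s k)" by (simp add: mult_ac)
      qed
      have "(\<lambda>k. ?\<delta> k) \<longlonglongrightarrow> 0" by (rule LIMSEQ_Suc[OF lim_1_over_n])
      then have "(\<lambda>k. ?\<delta> (s k)) \<longlonglongrightarrow> 0" using LIMSEQ_subseq_LIMSEQ[OF _ sm] by (fastforce simp: comp_def)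
      from tendsto_mult[OF tendsto_const this] show "(\<lambda>k. (R * Q * gn (D w)) * ?\<delta> (s k)) \<longlonglongrightarrow> 0" by simp
    qed
    moreover have "(\<lambda>k. N (K (v (s k))) \<bullet> K w) \<longlonglongrightarrow> ?z \<bullet> K w" unfolding s_def by (rule r2(3))
    ultimately have "(\<lambda>k. K (v (s k)) \<bullet> w) \<longlonglongrightarrow> ?z \<bullet> K w - 0" unfolding eq by (intro tendsto_diff)
    then show "(\<lambda>k. K (v (s k)) \<bullet> w) \<longlonglongrightarrow> K ?z \<bullet> w" by (simp add: sym)
  qed
  then have "\<forall>w. u \<bullet> w = K ?z \<bullet> w" by blast
  \<comment> \<open>Since \<open>?z\<close> is \<open>N u\<close>, this makes \<open>?z\<close> the
    fixed point.\<close>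
  then have "u = K ?z" unfolding vector_eq_rdot .
  then show ?thesis using r2(2) by metis
qed

lemma fn_sum: "AE x in lborel. fn (\<Sum>i\<in>A. z i) x = (\<Sum>i\<in>A. fn (z i) x)"
proof -
  have s: "sqint (\<lambda>x. \<Sum>i\<in>A. fn (z i) x)" "mk (\<lambda>x. \<Sum>i\<in>A. fn (z i) x) = (\<Sum>i\<in>A. z i)"
    using mk_sum[of A "\<lambda>i. fn (z i)"] by simp_all
  show ?thesis using fn_mk[OF s(1)] unfolding s(2) .
qed

subsection \<open>Representatives of square integrable functions on a domain\<close>

lemma AE_lebesgue_on_iff:
  fixes \<Omega> :: "'a::euclidean_space set"
  assumes "\<Omega> \<in> sets borel"
  shows "(AE x in lebesgue_on \<Omega>. P x) \<longleftrightarrow> (AE x in lborel. x \<in> \<Omega> \<longrightarrow> P x)"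
proof -
  have "\<Omega> \<inter> space lebesgue \<in> sets lebesgue" using assms by auto
  then have "(AE x in lebesgue_on \<Omega>. P x) \<longleftrightarrow> (AE x in lebesgue. x \<in> \<Omega> \<longrightarrow> P x)"
    by (rule AE_restrict_space_iff)
  then show ?thesis by (simp add: AE_completion_iff)
qed

lemma integral_lebesgue_on_borel:
  fixes \<Omega> :: "'a::euclidean_space set" and f :: "'a \<Rightarrow> real"
  assumes \<Omega>: "\<Omega> \<in> sets borel" and f: "f \<in> borel_measurable borel"
  shows "(LINT x|lebesgue_on \<Omega>. f x) = (\<integral>x. indicator \<Omega> x * f x \<partial>lborel)"
    and "integrable (lebesgue_on \<Omega>) f \<longleftrightarrow> integrable lborel (\<lambda>x. indicator \<Omega> x * f x)"
proof -
  have O: "\<Omega> \<inter> space lebesgue \<in> sets lebesgue" using \<Omega> by auto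
  have m: "(\<lambda>x. indicator \<Omega> x * f x) \<in> borel_measurable lborel" using \<Omega> f by simp
  show "(LINT x|lebesgue_on \<Omega>. f x) = (\<integral>x. indicator \<Omega> x * f x \<partial>lborel)"
    using integral_restrict_space[OF O, of f] integral_completion[OF m] by simp
  show "integrable (lebesgue_on \<Omega>) f \<longleftrightarrow> integrable lborel (\<lambda>x. indicator \<Omega> x * f x)"
    using integrable_restrict_space[OF O, of f] integrable_completion[OF m] by simp
qed

lemma borel_measurable_lebesgue_on: "f \<in> borel_measurable borel \<Longrightarrow> f \<in> borel_measurable (lebesgue_on \<Omega>)"
  by (intro measurable_restrict_space1 measurable_completion) simp

text \<open>Relates a function in the sense of the statement, Lebesgue measurable on \<Omega> and
  arbitrary elsewhere, to a class on the whole space. The class is constrained only on \<Omega>;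
  \<open>vanish\<close> selects the extension by zero.\<close>

definition rep_on :: "'a::euclidean_space set \<Rightarrow> ('a \<Rightarrow> real) \<Rightarrow> 'a l2 \<Rightarrow> bool" where
  "rep_on \<Omega> v z \<longleftrightarrow> v \<in> L2 \<Omega> \<and> (AE x in lborel. x \<in> \<Omega> \<longrightarrow> v x = fn z x)"

definition vanish :: "'a::euclidean_space set \<Rightarrow> 'a l2 \<Rightarrow> bool" where
  "vanish \<Omega> z \<longleftrightarrow> (AE x in lborel. x \<notin> \<Omega> \<longrightarrow> fn z x = 0)"

context
  fixes \<Omega> :: "'a::euclidean_space set"
  assumes \<Omega>o: "open \<Omega>" and \<Omega>b: "bounded \<Omega>"
begin

lemma \<Omega>m: "\<Omega> \<in> sets borel" using \<Omega>o by simp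

lemma ind_bmult: "bmult (indicator \<Omega>)"
  unfolding bmult_def using \<Omega>m by (intro conjI exI[of _ 1]) auto

lemma fn_L2: "fn z \<in> L2 \<Omega>"
proof -
  have "(\<lambda>x. indicator \<Omega> x * (fn z x)\<^sup>2) = (\<lambda>x. (indicator \<Omega> x * fn z x) * fn z x)"
    by (auto simp: power2_eq_square)
  then have "integrable (lebesgue_on \<Omega>) (\<lambda>x. (fn z x)\<^sup>2)"
    using sqint_integrable_mult[OF bmult_sqint[OF ind_bmult sqint_fn] sqint_fn, of z z]
    by (subst integral_lebesgue_on_borel(2)[OF \<Omega>m]) simp_all
  then show ?thesis unfolding L2_def using borel_measurable_lebesgue_on[OF fn_measurable] by simp
qed

lemma rep_on_fn: "rep_on \<Omega> (fn z) z"
  using fn_L2 by (simp add: rep_on_def)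

lemma L2_norm_rep:
  assumes "rep_on \<Omega> v z"
  shows "L2_norm \<Omega> v = norm (mul (indicator \<Omega>) z)"
proof -
  have v: "v \<in> L2 \<Omega>" "AE x in lborel. x \<in> \<Omega> \<longrightarrow> v x = fn z x" using assms by (auto simp: rep_on_def)
  have "AE x in lebesgue_on \<Omega>. v x = fn z x" using v(2) by (simp add: AE_lebesgue_on_iff[OF \<Omega>m])
  then have ae: "AE x in lebesgue_on \<Omega>. (v x)\<^sup>2 = (fn z x)\<^sup>2" by eventually_elim simp
  have "(LINT x|lebesgue_on \<Omega>. (v x)\<^sup>2) = (LINT x|lebesgue_on \<Omega>. (fn z x)\<^sup>2)"
    using v(1) borel_measurable_lebesgue_on[OF fn_measurable, of z \<Omega>]
    by (intro integral_cong_AE ae) (auto simp: L2_def)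
  also have "\<dots> = (\<integral>x. indicator \<Omega> x * (fn z x)\<^sup>2 \<partial>lborel)" by (rule integral_lebesgue_on_borel(1)[OF \<Omega>m]) simp
  also have "(\<lambda>x. indicator \<Omega> x * (fn z x)\<^sup>2) = (\<lambda>x. (indicator \<Omega> x * fn z x)\<^sup>2)" by (auto simp: indicator_def)
  also have "(\<integral>x. (indicator \<Omega> x * fn z x)\<^sup>2 \<partial>lborel) = (norm (mul (indicator \<Omega>) z))\<^sup>2"
    unfolding mul_def by (rule norm_mk_sq[OF bmult_sqint[OF ind_bmult sqint_fn], symmetric])
  finally show ?thesis by (simp add: L2_norm_def)
qed

lemma mul_ind_vanish: "vanish \<Omega> z \<Longrightarrow> mul (indicator \<Omega>) z = z"
proof -
  assume "vanish \<Omega> z"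
  then have "AE x in lborel. indicator \<Omega> x * fn z x = fn z x"
    unfolding vanish_def by eventually_elim (auto simp: indicator_def)
  then have "mk (\<lambda>x. indicator \<Omega> x * fn z x) = mk (fn z)"
    by (subst mk_eq_iff[OF bmult_sqint[OF ind_bmult sqint_fn] sqint_fn])
  then show ?thesis by (simp add: mul_def)
qed

lemma mul_ind_norm_le: "norm (mul (indicator \<Omega>) z) \<le> norm z"
  using mul_norm[of "indicator \<Omega> :: 'a \<Rightarrow> real" 1 z] \<Omega>m by simp

lemma L2_norm_le: "rep_on \<Omega> v z \<Longrightarrow> L2_norm \<Omega> v \<le> norm z"
  using L2_norm_rep mul_ind_norm_le by metis

lemma L2_norm_vanish: "rep_on \<Omega> v z \<Longrightarrow> vanish \<Omega> z \<Longrightarrow> L2_norm \<Omega> v = norm z"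
  using L2_norm_rep mul_ind_vanish by metis

text \<open>A Lebesgue measurable function agrees almost everywhere with a Borel one, and this one
  has a class in \<open>l2\<close>.\<close>

lemma L2_rep_exists:
  assumes v: "v \<in> L2 \<Omega>"
  shows "\<exists>z. rep_on \<Omega> v z \<and> vanish \<Omega> z"
proof -
  let ?v = "\<lambda>x. if x \<in> \<Omega> then v x else 0"
  have O: "\<Omega> \<in> sets lebesgue" using \<Omega>m by auto
  have vm: "v \<in> borel_measurable (lebesgue_on \<Omega>)" and vi: "integrable (lebesgue_on \<Omega>) (\<lambda>x. (v x)\<^sup>2)"
    using v by (auto simp: L2_def)
  have m: "?v \<in> borel_measurable lebesgue" using borel_measurable_if_I[OF vm O] .
  have O': "\<Omega> \<inter> space lebesgue \<in> sets lebesgue" using O by auto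
  have "integrable lebesgue (\<lambda>x. indicator \<Omega> x *\<^sub>R (v x)\<^sup>2)"
    using vi integrable_restrict_space[OF O', of "\<lambda>x. (v x)\<^sup>2"] by simp
  moreover have "(\<lambda>x. indicator \<Omega> x *\<^sub>R (v x)\<^sup>2) = (\<lambda>x. (?v x)\<^sup>2)" by (auto simp: indicator_def)
  ultimately have i: "integrable lebesgue (\<lambda>x. (?v x)\<^sup>2)" by simp
  obtain g where g: "g \<in> borel_measurable lborel" "AE x in lborel. ?v x = g x"
    using completion_ex_borel_measurable_real[OF m] by blast
  have gi: "integrable lebesgue (\<lambda>x. (g x)\<^sup>2)"
  proof (rule integrable_cong_AE_imp[OF i])
    show "(\<lambda>x. (g x)\<^sup>2) \<in> borel_measurable lebesgue" using measurable_completion[OF g(1)] by (intro borel_measurable_power)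
    have "AE x in lebesgue. ?v x = g x" using g(2) by (simp only: AE_completion_iff)
    then show "AE x in lebesgue. (?v x)\<^sup>2 = (g x)\<^sup>2" by eventually_elim simp
  qed
  have s: "sqint g" unfolding sqint_def using g(1) gi by (simp add: integrable_completion)
  have a: "AE x in lborel. fn (mk g) x = ?v x" using fn_mk[OF s] g(2) by eventually_elim simp
  have "rep_on \<Omega> v (mk g)" unfolding rep_on_def using v a by (auto elim!: eventually_mono)
  moreover have "vanish \<Omega> (mk g)" unfolding vanish_def using a by (rule eventually_mono) auto
  ultimately show ?thesis by blast
qed

lemma rep_on_diff:
  assumes "rep_on \<Omega> u z" "\<phi> \<in> C1c \<Omega>"
  shows "rep_on \<Omega> (\<lambda>x. u x - \<phi> x) (z - mk \<phi>)"
proof -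
  have s: "sqint \<phi>" by (rule C1c_sqint[OF assms(2)])
  have f: "AE x in lborel. fn (z - mk \<phi>) x = fn z x - \<phi> x"
    using fn_mk[OF sqint_diff[OF sqint_fn[of z] s]] by (simp add: mk_diff s)
  have u: "u \<in> L2 \<Omega>" "AE x in lborel. x \<in> \<Omega> \<longrightarrow> u x = fn z x" using assms(1) by (auto simp: rep_on_def)
  have ae: "AE x in lborel. x \<in> \<Omega> \<longrightarrow> u x - \<phi> x = fn (z - mk \<phi>) x"
    using f u(2) by eventually_elim auto
  have m: "(\<lambda>x. u x - \<phi> x) \<in> borel_measurable (lebesgue_on \<Omega>)"
    using u(1) borel_measurable_lebesgue_on[OF CC_measurable[OF C1c_CC[OF assms(2)]]] by (auto simp: L2_def)
  have "integrable (lebesgue_on \<Omega>) (\<lambda>x. (u x - \<phi> x)\<^sup>2)"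
  proof (rule integrable_cong_AE_imp)
    show "integrable (lebesgue_on \<Omega>) (\<lambda>x. (fn (z - mk \<phi>) x)\<^sup>2)" using fn_L2 by (simp add: L2_def)
    show "(\<lambda>x. (u x - \<phi> x)\<^sup>2) \<in> borel_measurable (lebesgue_on \<Omega>)" using m by simp
    have "AE x in lebesgue_on \<Omega>. u x - \<phi> x = fn (z - mk \<phi>) x" using ae by (simp add: AE_lebesgue_on_iff[OF \<Omega>m])
    then show "AE x in lebesgue_on \<Omega>. (fn (z - mk \<phi>) x)\<^sup>2 = (u x - \<phi> x)\<^sup>2" by eventually_elim simp
  qed
  then show ?thesis using m ae by (simp add: rep_on_def L2_def)
qed

lemma rep_on_integral:
  assumes u: "rep_on \<Omega> u z" and \<chi>: "\<eta> \<in> CC \<Omega>"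
  shows "(LINT x|lebesgue_on \<Omega>. u x * \<eta> x) = z \<bullet> mk \<eta>"
proof -
  have m: "\<eta> \<in> borel_measurable borel" using CC_measurable[OF \<chi>] .
  have "AE x in lebesgue_on \<Omega>. u x = fn z x" using u by (simp add: AE_lebesgue_on_iff[OF \<Omega>m] rep_on_def)
  then have ae: "AE x in lebesgue_on \<Omega>. u x * \<eta> x = fn z x * \<eta> x" by eventually_elim simp
  have um: "u \<in> borel_measurable (lebesgue_on \<Omega>)" using u by (auto simp: rep_on_def L2_def)
  note em = borel_measurable_lebesgue_on[OF m, of \<Omega>] and zm = borel_measurable_lebesgue_on[OF fn_measurable, of z \<Omega>]
  have "(LINT x|lebesgue_on \<Omega>. u x * \<eta> x) = (LINT x|lebesgue_on \<Omega>. fn z x * \<eta> x)"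
    by (intro integral_cong_AE ae borel_measurable_times um em zm)
  also have "\<dots> = (\<integral>x. indicator \<Omega> x * (fn z x * \<eta> x) \<partial>lborel)"
    by (rule integral_lebesgue_on_borel(1)[OF \<Omega>m]) (use m in simp)
  also have "(\<lambda>x. indicator \<Omega> x * (fn z x * \<eta> x)) = (\<lambda>x. fn z x * \<eta> x)"
  proof
    fix x
    show "indicator \<Omega> x * (fn z x * \<eta> x) = fn z x * \<eta> x"
    proof (cases "x \<in> \<Omega>")
      case False
      then have "\<eta> x = 0" using \<chi> unfolding CC_def csupp_def by blast
      then show ?thesis by simp
    qed simp
  qed
  also have "(\<integral>x. fn z x * \<eta> x \<partial>lborel) = z \<bullet> mk \<eta>" by (rule inner_mk_right[OF CC_sqint[OF \<chi>], symmetric])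
  finally show ?thesis .
qed

lemma partials_test: "\<phi> \<in> test_functions \<Omega> \<Longrightarrow> bs \<in> lists Basis \<Longrightarrow> partials bs \<phi> \<in> test_functions \<Omega>"
proof (induction bs)
  case (Cons b bs)
  then have "partials bs \<phi> \<in> test_functions \<Omega>" "b \<in> Basis" by auto
  then show ?case using test_dd[of "partials bs \<phi>" \<Omega> b] by (simp add: dd_def[abs_def])
qed simp

lemma test_CC: "\<phi> \<in> test_functions \<Omega> \<Longrightarrow> \<phi> \<in> CC \<Omega>"
  using test_C1c C1c_CC by blast

lemma weak_derivative_iff:
  assumes "rep_on \<Omega> u z" "rep_on \<Omega> g y" "bs \<in> lists Basis"
  shows "is_weak_derivative \<Omega> bs u g \<longleftrightarrow>
    (\<forall>\<phi>\<in>test_functions \<Omega>. z \<bullet> mk (partials bs \<phi>) = (- 1) ^ length bs * (y \<bullet> mk \<phi>))"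
  unfolding is_weak_derivative_def
  using rep_on_integral[OF assms(1) test_CC[OF partials_test[OF _ assms(3)]]] rep_on_integral[OF assms(2) test_CC] by simp

lemma AE_eq_of_test:
  assumes "\<And>\<phi>. \<phi> \<in> test_functions \<Omega> \<Longrightarrow> y \<bullet> mk \<phi> = y' \<bullet> mk \<phi>"
  shows "AE x in lborel. x \<in> \<Omega> \<longrightarrow> fn y x = fn y' x"
proof -
  have "AE x in lborel. x \<in> \<Omega> \<longrightarrow> fn (y - y') x = 0"
    by (rule fundamental_lemma[OF \<Omega>o \<Omega>b]) (simp add: inner_diff_left assms)
  moreover have "AE x in lborel. fn (y - y') x = fn y x - fn y' x"
    using fn_mk[OF sqint_diff[OF sqint_fn[of y] sqint_fn[of y']]] by (simp add: mk_diff)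
  ultimately show ?thesis by eventually_elim auto
qed

text \<open>\<open>weak_derivative\<close> is a choice; by the fundamental lemma any two candidates
  agree almost everywhere on \<Omega>, so the chosen one is represented by y.\<close>

lemma weak_derivative_rep:
  assumes u: "rep_on \<Omega> u z" and bs: "bs \<in> lists Basis"
    and y: "\<And>\<phi>. \<phi> \<in> test_functions \<Omega> \<Longrightarrow> z \<bullet> mk (partials bs \<phi>) = (- 1) ^ length bs * (y \<bullet> mk \<phi>)"
  shows "rep_on \<Omega> (weak_derivative \<Omega> bs u) y"
proof -
  let ?g = "weak_derivative \<Omega> bs u"
  have "is_weak_derivative \<Omega> bs u (fn y)" using weak_derivative_iff[OF u rep_on_fn bs] y by blast
  then have "fn y \<in> L2 \<Omega> \<and> is_weak_derivative \<Omega> bs u (fn y)" using fn_L2 by blast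
  then have g: "?g \<in> L2 \<Omega> \<and> is_weak_derivative \<Omega> bs u ?g"
    unfolding weak_derivative_def by (rule someI[where P="\<lambda>g. g \<in> L2 \<Omega> \<and> is_weak_derivative \<Omega> bs u g"])
  obtain y' where y': "rep_on \<Omega> ?g y'" using L2_rep_exists g by blast
  have "y \<bullet> mk \<phi> = y' \<bullet> mk \<phi>" if "\<phi> \<in> test_functions \<Omega>" for \<phi>
  proof -
    have "z \<bullet> mk (partials bs \<phi>) = (- 1) ^ length bs * (y' \<bullet> mk \<phi>)"
      using weak_derivative_iff[OF u y' bs] g that by blast
    then have "(- 1) ^ length bs * (y \<bullet> mk \<phi>) = (- 1) ^ length bs * (y' \<bullet> mk \<phi>)" using y[OF that] by simp
    then show ?thesis by simp
  qed
  then have "AE x in lborel. x \<in> \<Omega> \<longrightarrow> fn y x = fn y' x" by (rule AE_eq_of_test)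
  moreover have "AE x in lborel. x \<in> \<Omega> \<longrightarrow> ?g x = fn y' x" using y' by (simp add: rep_on_def)
  ultimately have "AE x in lborel. x \<in> \<Omega> \<longrightarrow> ?g x = fn y x" by eventually_elim auto
  then show ?thesis using g by (simp add: rep_on_def)
qed

section \<open>Weak and strong solutions of the linear problem\<close>

lemma partials_single: "mk (partials [b] \<phi>) = Dl \<phi> b"
  by (simp add: Dl_def dd_def[abs_def])

lemma partials_pair: "mk (partials [a, b] \<phi>) = Dl (dd \<phi> b) a"
  by (simp add: Dl_def dd_def[abs_def])

text \<open>The approximants in \<open>h0\<close> are only C^1; each is replaced by a smooth one,
  and the two errors share the tolerance.\<close>

lemma h0_sobolev0:
  assumes u: "rep_on \<Omega> u z" and h: "h0 \<Omega> z G"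
  shows "u \<in> sobolev0 \<Omega>" "\<And>b. b \<in> Basis \<Longrightarrow> rep_on \<Omega> (weak_derivative \<Omega> [b] u) (G b)"
proof -
  have ibpG: "z \<bullet> mk (partials [b] \<phi>) = (- 1) ^ length [b] * (G b \<bullet> mk \<phi>)" if "\<phi> \<in> test_functions \<Omega>" for \<phi> b
    using h0_ibp[OF h C1c_mono[OF test_C1c[OF that] subset_UNIV], of b] by (simp add: partials_single del: partials.simps)
  show wd: "rep_on \<Omega> (weak_derivative \<Omega> [b] u) (G b)" if "b \<in> Basis" for b
    by (rule weak_derivative_rep[OF u _ ibpG]) (use that in auto)
  have s1: "u \<in> sobolev 1 \<Omega>"
    unfolding sobolev_def
  proof (intro CollectI conjI ballI impI)
    show "u \<in> L2 \<Omega>" using u by (simp add: rep_on_def)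
    fix bs :: "'a list" assume bs: "bs \<in> lists Basis" "length bs \<le> 1"
    show "\<exists>g\<in>L2 \<Omega>. is_weak_derivative \<Omega> bs u g"
    proof (cases bs)
      case Nil
      then show ?thesis using u by (intro bexI[of _ u]) (auto simp: is_weak_derivative_def rep_on_def)
    next
      case (Cons b bs')
      then have b: "bs = [b]" using bs by auto
      have "is_weak_derivative \<Omega> bs u (fn (G b))"
        using weak_derivative_iff[OF u rep_on_fn bs(1)] ibpG b by blast
      then show ?thesis using fn_L2 by blast
    qed
  qed
  have "\<exists>\<phi>\<in>test_functions \<Omega>. W12_norm \<Omega> (\<lambda>x. u x - \<phi> x) < \<epsilon>" if e: "\<epsilon> > 0" for \<epsilon>
  proof -
    \<comment> \<open>The squared norm in W^{1,2} has one term for the function and one per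
      coordinate, each at most the square of \<eta>; the sum is then at most the square of
      \<epsilon> / 2, and the spare factor 2 gives the strict inequality.\<close>
    define \<eta> where "\<eta> = \<epsilon> / (2 * (1 + real DIM('a)))"
    have \<eta>: "\<eta> > 0" unfolding \<eta>_def using e by simp
    obtain f where f: "\<And>n. f n \<in> C1c \<Omega>" "(\<lambda>n. mk (f n)) \<longlonglongrightarrow> z" "\<And>b. (\<lambda>n. Dl (f n) b) \<longlonglongrightarrow> G b"
      using h unfolding h0_def by blast
    have "\<forall>\<^sub>F n in sequentially. dist (mk (f n)) z < \<eta> / 2" using f(2) \<eta> by (intro tendstoD) auto
    moreover have "\<forall>\<^sub>F n in sequentially. \<forall>b\<in>Basis. dist (Dl (f n) b) (G b) < \<eta> / 2"
      using \<eta> by (intro eventually_ball_finite ballI tendstoD[OF f(3)]) auto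
    ultimately have "\<forall>\<^sub>F n in sequentially. dist (mk (f n)) z < \<eta> / 2 \<and> (\<forall>b\<in>Basis. dist (Dl (f n) b) (G b) < \<eta> / 2)"
      by (rule eventually_conj)
    then obtain n where n: "dist (mk (f n)) z < \<eta> / 2" "\<And>b. b \<in> Basis \<Longrightarrow> dist (Dl (f n) b) (G b) < \<eta> / 2"
      by (auto simp: eventually_sequentially)
    obtain \<phi> where \<phi>: "\<phi> \<in> test_functions \<Omega>" "norm (mk \<phi> - mk (f n)) < \<eta> / 2"
      "\<And>b. b \<in> Basis \<Longrightarrow> norm (mk (dd \<phi> b) - mk (dd (f n) b)) < \<eta> / 2"
      using test_dense_C1c[OF \<Omega>o C1c_CC[OF f(1)], of "\<eta> / 2" n] f(1)[of n] \<eta> by auto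
    have d0: "norm (z - mk \<phi>) \<le> \<eta>"
    proof -
      have "dist z (mk \<phi>) \<le> dist (mk (f n)) z + dist (mk \<phi>) (mk (f n))" by (metis dist_commute dist_triangle add.commute)
      then show ?thesis using n(1) \<phi>(2) unfolding dist_norm by linarith
    qed
    have d1: "norm (G b - Dl \<phi> b) \<le> \<eta>" if "b \<in> Basis" for b
    proof -
      have "dist (G b) (Dl \<phi> b) \<le> dist (Dl (f n) b) (G b) + dist (Dl \<phi> b) (Dl (f n) b)" by (metis dist_commute dist_triangle add.commute)
      then show ?thesis using n(2)[OF that] \<phi>(3)[OF that] unfolding dist_norm Dl_def by linarith
    qed
    let ?w = "\<lambda>x. u x - \<phi> x"
    have \<phi>C: "\<phi> \<in> C1c \<Omega>" by (rule test_C1c[OF \<phi>(1)])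
    have rw: "rep_on \<Omega> ?w (z - mk \<phi>)" by (rule rep_on_diff[OF u \<phi>C])
    have hw: "h0 \<Omega> (z - mk \<phi>) (\<lambda>b. G b - Dl \<phi> b)" by (rule h0_diff[OF h h0_C1c[OF \<phi>C]])
    have wdw: "rep_on \<Omega> (weak_derivative \<Omega> [b] ?w) (G b - Dl \<phi> b)" if "b \<in> Basis" for b
    proof (rule weak_derivative_rep[OF rw])
      show "[b] \<in> lists Basis" using that by simp
      show "(z - mk \<phi>) \<bullet> mk (partials [b] \<psi>) = (- 1) ^ length [b] * ((G b - Dl \<phi> b) \<bullet> mk \<psi>)" if "\<psi> \<in> test_functions \<Omega>" for \<psi>
        using h0_ibp[OF hw C1c_mono[OF test_C1c[OF that] subset_UNIV], of b] by (simp add: partials_single del: partials.simps)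
    qed
    have n0: "L2_norm \<Omega> ?w \<le> \<eta>" using L2_norm_le[OF rw] d0 by linarith
    have n1: "L2_norm \<Omega> (weak_derivative \<Omega> [b] ?w) \<le> \<eta>" if "b \<in> Basis" for b
      using L2_norm_le[OF wdw[OF that]] d1[OF that] by linarith
    have nn: "0 \<le> L2_norm \<Omega> v" for v by (simp add: L2_norm_def)
    have "(L2_norm \<Omega> ?w)\<^sup>2 + (\<Sum>b\<in>Basis. (L2_norm \<Omega> (weak_derivative \<Omega> [b] ?w))\<^sup>2) \<le> \<eta>\<^sup>2 + (\<Sum>b\<in>(Basis::'a set). \<eta>\<^sup>2)"
      by (intro add_mono sum_mono power_mono n0 n1 nn)
    also have "\<dots> = (1 + real DIM('a)) * \<eta>\<^sup>2" by (simp add: algebra_simps)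
    also have "\<dots> \<le> ((1 + real DIM('a)) * \<eta>)\<^sup>2"
    proof -
      have "(1 + real DIM('a)) * 1 \<le> (1 + real DIM('a)) * (1 + real DIM('a))" by (intro mult_left_mono) auto
      then have "(1 + real DIM('a)) * \<eta>\<^sup>2 \<le> ((1 + real DIM('a)) * (1 + real DIM('a))) * \<eta>\<^sup>2" by (intro mult_right_mono) auto
      then show ?thesis by (simp add: power2_eq_square mult_ac)
    qed
    also have "(1 + real DIM('a)) * \<eta> = \<epsilon> / 2" unfolding \<eta>_def by (simp add: field_simps)
    finally have "W12_norm \<Omega> ?w \<le> sqrt ((\<epsilon> / 2)\<^sup>2)" unfolding W12_norm_def by (rule real_sqrt_le_mono)
    also have "\<dots> < \<epsilon>" using e by simp
    finally show ?thesis using \<phi>(1) by blast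
  qed
  then show "u \<in> sobolev0 \<Omega>" using s1 unfolding sobolev0_def by blast
qed

text \<open>Moving the zero order term to the right yields the energy bound required for regularity;
  the second derivatives so obtained are then compared with the equation by the fundamental
  lemma.\<close>

lemma weak_is_strong:
  assumes dom: "bounded_C11_domain \<Omega>" and u: "rep_on \<Omega> u z" and h: "h0 \<Omega> z G"
    and eq: "\<And>\<phi>. \<phi> \<in> C1c \<Omega> \<Longrightarrow> en G (Dl \<phi>) + l * (z \<bullet> mk \<phi>) = v \<bullet> mk \<phi>"
  shows "u \<in> sobolev 2 \<Omega> \<inter> sobolev0 \<Omega>" "AE x in lborel. x \<in> \<Omega> \<longrightarrow> - laplacian \<Omega> u x + l * fn z x = fn v x"
proof -
  have eq': "en G (Dl \<phi>) = (v - l *\<^sub>R z) \<bullet> mk \<phi>" if "\<phi> \<in> C1c \<Omega>" for \<phi>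
    using eq[OF that] by (simp add: inner_diff_left)
  have en: "\<bar>en G (Dl \<phi>)\<bar> \<le> norm (v - l *\<^sub>R z) * norm (mk \<phi>)" if "\<phi> \<in> C1c \<Omega>" for \<phi>
    unfolding eq'[OF that] by (rule Cauchy_Schwarz_ineq2)
  have "\<exists>H. \<forall>\<phi>\<in>C1c \<Omega>. G a \<bullet> Dl \<phi> b = - (H \<bullet> mk \<phi>)" for a b by (rule H2_regularity[OF dom h en])
  then obtain H where H: "\<And>a b \<phi>. \<phi> \<in> C1c \<Omega> \<Longrightarrow> G a \<bullet> Dl \<phi> b = - (H a b \<bullet> mk \<phi>)" by metis
  have second: "z \<bullet> mk (partials [a, b] \<phi>) = (- 1) ^ length [a, b] * (H a b \<bullet> mk \<phi>)"
    if "b \<in> Basis" "\<phi> \<in> test_functions \<Omega>" for a b \<phi>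
  proof -
    have c: "dd \<phi> b \<in> C1c UNIV" using C1c_mono[OF test_C1c[OF test_dd[OF that(2,1)]] subset_UNIV] .
    have "z \<bullet> Dl (dd \<phi> b) a = - (G a \<bullet> mk (dd \<phi> b))" using h0_ibp[OF h c, of a] by simp
    also have "\<dots> = H a b \<bullet> mk \<phi>" using H[OF test_C1c[OF that(2)], of a b] by (simp add: Dl_def)
    finally show ?thesis by (simp add: partials_pair del: partials.simps)
  qed
  have s0: "u \<in> sobolev0 \<Omega>" by (rule h0_sobolev0(1)[OF u h])
  have "u \<in> sobolev 2 \<Omega>"
    unfolding sobolev_def
  proof (intro CollectI conjI ballI impI)
    show "u \<in> L2 \<Omega>" using u by (simp add: rep_on_def)
    fix bs :: "'a list" assume bs: "bs \<in> lists Basis" "length bs \<le> 2"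
    show "\<exists>g\<in>L2 \<Omega>. is_weak_derivative \<Omega> bs u g"
    proof (cases "length bs \<le> 1")
      case True
      then show ?thesis using s0 bs(1) unfolding sobolev0_def sobolev_def by blast
    next
      case False
      then have "length bs = Suc (Suc 0)" using bs(2) by simp
      then obtain a b where ab: "bs = [a, b]" by (auto simp: length_Suc_conv)
      then have "is_weak_derivative \<Omega> bs u (fn (H a b))"
        using weak_derivative_iff[OF u rep_on_fn bs(1)] second[of b _ a] bs(1) by auto
      then show ?thesis using fn_L2 by blast
    qed
  qed
  then show "u \<in> sobolev 2 \<Omega> \<inter> sobolev0 \<Omega>" using s0 by blast
  have wd: "AE x in lborel. x \<in> \<Omega> \<longrightarrow> weak_derivative \<Omega> [b, b] u x = fn (H b b) x" if b: "b \<in> Basis" for b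
    using weak_derivative_rep[OF u _ second[OF b], of b] b by (simp add: rep_on_def)
  define S where "S = (\<Sum>b\<in>Basis. H b b)"
  have fS: "AE x in lborel. fn S x = (\<Sum>b\<in>Basis. fn (H b b) x)"
    unfolding S_def by (rule fn_sum)
  have "AE x in lborel. \<forall>b\<in>Basis. x \<in> \<Omega> \<longrightarrow> weak_derivative \<Omega> [b, b] u x = fn (H b b) x"
    by (subst AE_finite_all) (auto intro: wd)
  then have lap: "AE x in lborel. x \<in> \<Omega> \<longrightarrow> laplacian \<Omega> u x = fn S x"
    using fS by eventually_elim (auto simp: laplacian_def)
  have "(- S) \<bullet> mk \<phi> = (v - l *\<^sub>R z) \<bullet> mk \<phi>" if "\<phi> \<in> test_functions \<Omega>" for \<phi>
  proof -
    have c: "\<phi> \<in> C1c \<Omega>" by (rule test_C1c[OF that])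
    have "(- S) \<bullet> mk \<phi> = (\<Sum>b\<in>Basis. G b \<bullet> Dl \<phi> b)" by (simp add: S_def inner_sum_left H[OF c] sum_negf)
    then show ?thesis using eq'[OF c] by (simp add: en_def)
  qed
  then have "AE x in lborel. x \<in> \<Omega> \<longrightarrow> fn (- S) x = fn (v - l *\<^sub>R z) x" by (rule AE_eq_of_test)
  moreover have "AE x in lborel. fn (- S) x = - fn S x"
    using fn_mk[OF sqint_minus[OF sqint_fn[of S]]] by (simp add: mk_uminus)
  moreover have "AE x in lborel. fn (v - l *\<^sub>R z) x = fn v x - l * fn z x"
    using fn_mk[OF sqint_diff[OF sqint_fn[of v] sqint_scale[OF sqint_fn[of z], of l]]] by (simp add: mk_diff mk_scale sqint_scale)
  ultimately show "AE x in lborel. x \<in> \<Omega> \<longrightarrow> - laplacian \<Omega> u x + l * fn z x = fn v x"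
    using lap by eventually_elim auto
qed

text \<open>Needed because the inverse of the Laplacian returns some strong solution about which
  nothing else is known. Classes vanishing outside \<Omega> are used so that norms over \<Omega>
  become norms in \<open>l2\<close> and the approximating test functions converge there together
  with their gradients.\<close>

lemma strong_is_weak:
  assumes u: "u \<in> sobolev 2 \<Omega> \<inter> sobolev0 \<Omega>" and y: "AE x in lborel. x \<in> \<Omega> \<longrightarrow> - laplacian \<Omega> u x = fn y x"
  shows "\<exists>z G. rep_on \<Omega> u z \<and> h0 \<Omega> z G \<and> (\<forall>\<phi>\<in>C1c \<Omega>. en G (Dl \<phi>) = y \<bullet> mk \<phi>)"
proof -
  have uL: "u \<in> L2 \<Omega>" and wex: "\<And>bs. bs \<in> lists Basis \<Longrightarrow> length bs \<le> 2 \<Longrightarrow> \<exists>g\<in>L2 \<Omega>. is_weak_derivative \<Omega> bs u g"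
    using u by (auto simp: sobolev_def)
  obtain z where z: "rep_on \<Omega> u z" "vanish \<Omega> z" using L2_rep_exists[OF uL] by blast
  have wrep: "\<exists>g. rep_on \<Omega> (weak_derivative \<Omega> bs u) g \<and> vanish \<Omega> g \<and>
      (\<forall>\<phi>\<in>test_functions \<Omega>. z \<bullet> mk (partials bs \<phi>) = (- 1) ^ length bs * (g \<bullet> mk \<phi>))"
    if bs: "bs \<in> lists Basis" "length bs \<le> 2" for bs
  proof -
    obtain g where "g \<in> L2 \<Omega> \<and> is_weak_derivative \<Omega> bs u g" using wex[OF bs] by blast
    then have w: "weak_derivative \<Omega> bs u \<in> L2 \<Omega> \<and> is_weak_derivative \<Omega> bs u (weak_derivative \<Omega> bs u)"
      unfolding weak_derivative_def by (rule someI[where P="\<lambda>g. g \<in> L2 \<Omega> \<and> is_weak_derivative \<Omega> bs u g"])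
    then obtain g' where g': "rep_on \<Omega> (weak_derivative \<Omega> bs u) g'" "vanish \<Omega> g'" using L2_rep_exists by blast
    then show ?thesis using weak_derivative_iff[OF z(1) g'(1) bs(1)] w by blast
  qed
  have "\<forall>b\<in>Basis. \<exists>g. rep_on \<Omega> (weak_derivative \<Omega> [b] u) g \<and> vanish \<Omega> g \<and>
      (\<forall>\<phi>\<in>test_functions \<Omega>. z \<bullet> mk (partials [b] \<phi>) = (- 1) ^ length [b] * (g \<bullet> mk \<phi>))"
    by (intro ballI wrep) auto
  then obtain g where g: "\<And>b. b \<in> Basis \<Longrightarrow> vanish \<Omega> (g b)"
    "\<And>b \<phi>. b \<in> Basis \<Longrightarrow> \<phi> \<in> test_functions \<Omega> \<Longrightarrow> z \<bullet> mk (partials [b] \<phi>) = (- 1) ^ length [b] * (g b \<bullet> mk \<phi>)" by metis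
  have "\<forall>b\<in>Basis. \<exists>g. rep_on \<Omega> (weak_derivative \<Omega> [b, b] u) g \<and> vanish \<Omega> g \<and>
      (\<forall>\<phi>\<in>test_functions \<Omega>. z \<bullet> mk (partials [b, b] \<phi>) = (- 1) ^ length [b, b] * (g \<bullet> mk \<phi>))"
    by (intro ballI wrep) auto
  then obtain H where H: "\<And>b. b \<in> Basis \<Longrightarrow> rep_on \<Omega> (weak_derivative \<Omega> [b, b] u) (H b)"
    "\<And>b \<phi>. b \<in> Basis \<Longrightarrow> \<phi> \<in> test_functions \<Omega> \<Longrightarrow> z \<bullet> mk (partials [b, b] \<phi>) = (- 1) ^ length [b, b] * (H b \<bullet> mk \<phi>)" by metis
  have vd: "vanish \<Omega> (a - mk \<phi>)" if "vanish \<Omega> a" "\<phi> \<in> CC \<Omega>" for a \<phi>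
  proof -
    have s: "sqint \<phi>" by (rule CC_sqint[OF that(2)])
    have f: "AE x in lborel. fn (a - mk \<phi>) x = fn a x - \<phi> x"
      using fn_mk[OF sqint_diff[OF sqint_fn[of a] s]] by (simp add: mk_diff s)
    have z0: "\<phi> x = 0" if "x \<notin> \<Omega>" for x using \<open>\<phi> \<in> CC \<Omega>\<close> that unfolding CC_def csupp_def by blast
    from f that(1) show ?thesis unfolding vanish_def by eventually_elim (simp add: z0)
  qed
  have "\<exists>\<phi>\<in>test_functions \<Omega>. W12_norm \<Omega> (\<lambda>x. u x - \<phi> x) < 1 / real (Suc n)" for n
    using u by (auto simp: sobolev0_def)
  then obtain f where f: "\<And>n. f n \<in> test_functions \<Omega>" "\<And>n. W12_norm \<Omega> (\<lambda>x. u x - f n x) < 1 / real (Suc n)" by metis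
  have fC: "f n \<in> C1c \<Omega>" for n by (rule test_C1c[OF f(1)])
  have rd: "rep_on \<Omega> (\<lambda>x. u x - f n x) (z - mk (f n))" for n by (rule rep_on_diff[OF z(1) fC])
  have wd: "rep_on \<Omega> (weak_derivative \<Omega> [b] (\<lambda>x. u x - f n x)) (g b - Dl (f n) b)" if b: "b \<in> Basis" for b n
  proof (rule weak_derivative_rep[OF rd])
    show "[b] \<in> lists Basis" using b by simp
    fix \<psi> assume \<psi>: "\<psi> \<in> test_functions \<Omega>"
    have "Dl (f n) b \<bullet> mk \<psi> = - (mk (f n) \<bullet> Dl \<psi> b)"
      unfolding Dl_def by (rule ibp[OF C1c_mono[OF fC subset_UNIV] C1c_mono[OF test_C1c[OF \<psi>] subset_UNIV]])
    then show "(z - mk (f n)) \<bullet> mk (partials [b] \<psi>) = (- 1) ^ length [b] * ((g b - Dl (f n) b) \<bullet> mk \<psi>)"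
      using g(2)[OF b \<psi>] by (simp add: partials_single inner_diff_left del: partials.simps)
  qed
  have W: "L2_norm \<Omega> (\<lambda>x. u x - f n x) \<le> W12_norm \<Omega> (\<lambda>x. u x - f n x)"
    "\<And>b. b \<in> Basis \<Longrightarrow> L2_norm \<Omega> (weak_derivative \<Omega> [b] (\<lambda>x. u x - f n x)) \<le> W12_norm \<Omega> (\<lambda>x. u x - f n x)" for n
  proof -
    let ?w = "\<lambda>x. u x - f n x"
    have s: "0 \<le> (\<Sum>b\<in>Basis. (L2_norm \<Omega> (weak_derivative \<Omega> [b] ?w))\<^sup>2)" by (simp add: sum_nonneg)
    then show "L2_norm \<Omega> ?w \<le> W12_norm \<Omega> ?w" unfolding W12_norm_def by (intro real_le_rsqrt) simp
    fix b :: 'a assume b: "b \<in> Basis"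
    have "(L2_norm \<Omega> (weak_derivative \<Omega> [b] ?w))\<^sup>2 \<le> (\<Sum>b\<in>Basis. (L2_norm \<Omega> (weak_derivative \<Omega> [b] ?w))\<^sup>2)"
      using b by (intro member_le_sum) auto
    then show "L2_norm \<Omega> (weak_derivative \<Omega> [b] ?w) \<le> W12_norm \<Omega> ?w"
      unfolding W12_norm_def by (intro real_le_rsqrt) (simp add: add_increasing)
  qed
  have lim0: "(\<lambda>n. 1 / real (Suc n)) \<longlonglongrightarrow> 0" by (rule LIMSEQ_Suc[OF lim_1_over_n])
  have "norm (mk (f n) - z) \<le> 1 / real (Suc n)" for n
    using L2_norm_vanish[OF rd vd[OF z(2) C1c_CC[OF fC]], of n] W(1)[of n] f(2)[of n] by (simp add: norm_minus_commute)
  then have "(\<lambda>n. mk (f n) - z) \<longlonglongrightarrow> 0"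
    by (intro Lim_null_comparison[OF always_eventually lim0]) blast
  then have lz: "(\<lambda>n. mk (f n)) \<longlonglongrightarrow> z" by (simp only: LIM_zero_iff)
  have lg: "(\<lambda>n. Dl (f n) b) \<longlonglongrightarrow> g b" if b: "b \<in> Basis" for b
  proof -
    have "vanish \<Omega> (g b - Dl (f n) b)" for n unfolding Dl_def by (rule vd[OF g(1)[OF b] C1c_dd_CC[OF fC]])
    then have "norm (Dl (f n) b - g b) \<le> 1 / real (Suc n)" for n
      using L2_norm_vanish[OF wd[OF b], of n] W(2)[OF b, of n] f(2)[of n] by (simp add: norm_minus_commute)
    then have "(\<lambda>n. Dl (f n) b - g b) \<longlonglongrightarrow> 0"
      by (intro Lim_null_comparison[OF always_eventually lim0]) blast
    then show ?thesis by (simp only: LIM_zero_iff)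
  qed
  \<comment> \<open>\<open>h0\<close> asks for limits in all directions, so the gradient is obtained
    as a linear extension G and then matched with g on the coordinate directions.\<close>
  obtain z' G where G: "h0 \<Omega> z' G" "(\<lambda>n. mk (f n)) \<longlonglongrightarrow> z'" "\<And>b. (\<lambda>n. Dl (f n) b) \<longlonglongrightarrow> G b"
    using h0_of_Cauchy[of f \<Omega>, OF fC LIMSEQ_imp_Cauchy[OF lz] LIMSEQ_imp_Cauchy[OF lg]] by blast
  have zz: "z' = z" using G(2) lz by (rule LIMSEQ_unique)
  have Gg: "G b = g b" if "b \<in> Basis" for b using G(3) lg[OF that] by (rule LIMSEQ_unique)
  define S where "S = (\<Sum>b\<in>Basis. H b)"
  have fS: "AE x in lborel. fn S x = (\<Sum>b\<in>Basis. fn (H b) x)"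
    unfolding S_def by (rule fn_sum)
  have "AE x in lborel. \<forall>b\<in>Basis. x \<in> \<Omega> \<longrightarrow> weak_derivative \<Omega> [b, b] u x = fn (H b) x"
    using H(1) by (subst AE_finite_all) (auto simp: rep_on_def)
  then have lap: "AE x in lborel. x \<in> \<Omega> \<longrightarrow> fn y x = - fn S x"
    using fS y by eventually_elim (auto simp: laplacian_def)
  have test: "en G (Dl \<phi>) = y \<bullet> mk \<phi>" if \<phi>: "\<phi> \<in> test_functions \<Omega>" for \<phi>
  proof -
    have "G b \<bullet> Dl \<phi> b = - (H b \<bullet> mk \<phi>)" if b: "b \<in> Basis" for b
    proof -
      have "z \<bullet> mk (partials [b] (dd \<phi> b)) = - (g b \<bullet> mk (dd \<phi> b))" using g(2)[OF b test_dd[OF \<phi> b]] by simp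
      moreover have "z \<bullet> mk (partials [b, b] \<phi>) = H b \<bullet> mk \<phi>" using H(2)[OF b \<phi>] by simp
      ultimately show ?thesis by (simp add: partials_single partials_pair Gg[OF b] Dl_def[of \<phi>] del: partials.simps)
    qed
    then have "en G (Dl \<phi>) = (- S) \<bullet> mk \<phi>" by (simp add: en_def S_def inner_sum_left sum_negf)
    also have "\<dots> = y \<bullet> mk \<phi>"
    proof -
      have s: "sqint \<phi>" by (rule CC_sqint[OF test_CC[OF \<phi>]])
      have z\<phi>: "\<phi> x = 0" if "x \<notin> \<Omega>" for x using test_CC[OF \<phi>] that unfolding CC_def csupp_def by blast
      have m: "AE x in lborel. fn (- S) x = - fn S x"
        using fn_mk[OF sqint_minus[OF sqint_fn[of S]]] by (simp add: mk_uminus)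
      have [measurable]: "\<phi> \<in> borel_measurable borel" using CC_measurable[OF test_CC[OF \<phi>]] .
      have "(\<integral>x. fn (- S) x * \<phi> x \<partial>lborel) = (\<integral>x. fn y x * \<phi> x \<partial>lborel)"
      proof (rule integral_cong_AE)
        show "AE x in lborel. fn (- S) x * \<phi> x = fn y x * \<phi> x"
          using m lap
        proof eventually_elim
          case (elim x)
          then show ?case using z\<phi>[of x] by (cases "x \<in> \<Omega>") auto
        qed
      qed measurable
      then show ?thesis by (simp add: inner_mk_right[OF s])
    qed
    finally show ?thesis .
  qed
  \<comment> \<open>Density extends the equation from smooth to C^1 test functions.\<close>
  have "en G (Dl \<phi>) = y \<bullet> mk \<phi>" if \<phi>: "\<phi> \<in> C1c \<Omega>" for \<phi>
  proof -
    have "\<exists>\<psi>\<in>test_functions \<Omega>. norm (mk \<psi> - mk \<phi>) < 1 / real (Suc n) \<and> (\<forall>b\<in>Basis. norm (Dl \<psi> b - Dl \<phi> b) < 1 / real (Suc n))" for n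
      using test_dense_C1c[OF \<Omega>o C1c_CC[OF \<phi>], of "1 / real (Suc n)"] \<phi> by (auto simp: Dl_def)
    then obtain \<psi> where \<psi>: "\<And>n. \<psi> n \<in> test_functions \<Omega>" "\<And>n. norm (mk (\<psi> n) - mk \<phi>) < 1 / real (Suc n)"
      "\<And>n b. b \<in> Basis \<Longrightarrow> norm (Dl (\<psi> n) b - Dl \<phi> b) < 1 / real (Suc n)" by metis
    have "(\<lambda>n. mk (\<psi> n) - mk \<phi>) \<longlonglongrightarrow> 0"
      by (intro Lim_null_comparison[OF always_eventually lim0]) (use \<psi>(2) in \<open>auto intro: less_imp_le\<close>)
    then have l1: "(\<lambda>n. mk (\<psi> n)) \<longlonglongrightarrow> mk \<phi>" by (simp only: LIM_zero_iff)
    have l2: "(\<lambda>n. Dl (\<psi> n) b) \<longlonglongrightarrow> Dl \<phi> b" if "b \<in> Basis" for b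
    proof -
      have "(\<lambda>n. Dl (\<psi> n) b - Dl \<phi> b) \<longlonglongrightarrow> 0"
        by (intro Lim_null_comparison[OF always_eventually lim0]) (use \<psi>(3)[OF that] in \<open>auto intro: less_imp_le\<close>)
      then show ?thesis by (simp only: LIM_zero_iff)
    qed
    have "(\<lambda>n. en G (Dl (\<psi> n))) \<longlonglongrightarrow> en G (Dl \<phi>)" unfolding en_def by (intro tendsto_intros l2)
    moreover have "(\<lambda>n. en G (Dl (\<psi> n))) \<longlonglongrightarrow> y \<bullet> mk \<phi>" unfolding test[OF \<psi>(1)] by (intro tendsto_intros l1)
    ultimately show ?thesis by (rule LIMSEQ_unique)
  qed
  then show ?thesis using z(1) G(1) unfolding zz by blast
qed

text \<open>The difference of two solutions has zero energy, and the Poincare inequality makes it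
  zero.\<close>

lemma weak_unique:
  assumes h: "h0 \<Omega> z G" "h0 \<Omega> z' G'"
    and eq: "\<And>\<phi>. \<phi> \<in> C1c \<Omega> \<Longrightarrow> en G (Dl \<phi>) = y \<bullet> mk \<phi>" "\<And>\<phi>. \<phi> \<in> C1c \<Omega> \<Longrightarrow> en G' (Dl \<phi>) = y \<bullet> mk \<phi>"
  shows "z = z'"
proof -
  obtain P where P: "\<And>u G. h0 \<Omega> u G \<Longrightarrow> norm u \<le> P * gn G" using h0_poincare[OF \<Omega>b] by blast
  have d: "h0 \<Omega> (z - z') (\<lambda>b. G b - G' b)" by (rule h0_diff[OF h])
  have "en G (\<lambda>b. G b - G' b) = y \<bullet> (z - z')" "en G' (\<lambda>b. G b - G' b) = y \<bullet> (z - z')"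
    using weak_eq_h0[where l=0 and u=0, OF _ d] eq by auto
  then have "en (\<lambda>b. G b - G' b) (\<lambda>b. G b - G' b) = 0"
    by (simp add: en_def inner_diff_left sum_subtractf)
  then have "(gn (\<lambda>b. G b - G' b))\<^sup>2 = 0" by (simp add: gn_sq)
  then have "norm (z - z') \<le> 0" using P[OF d] by simp
  then show ?thesis by simp
qed

end

section \<open>The semilinear problem\<close>

lemma semilinear_dirichlet:
  fixes \<Omega> :: "'a::euclidean_space set" and f :: "'a \<Rightarrow> real \<Rightarrow> real \<Rightarrow> real"
  assumes dom: "bounded_C11_domain \<Omega>" and f1: "caratheodory \<Omega> f" and \<mu>: "\<mu> > 0" and R: "R > 0"
    and f2: "(nemytskii f \<mu> \<circ> neg_laplacian_inverse \<Omega>) ` L2_ball \<Omega> R \<subseteq> L2_ball \<Omega> R" and l: "l \<ge> 0"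
  shows "\<exists>u. strong_solution \<Omega> f \<mu> l u"
proof -
  have \<Omega>: "open \<Omega>" "bounded \<Omega>" using dom by (auto simp: bounded_C11_domain_def)
  note ae_iff = AE_lebesgue_on_iff[OF \<Omega>m[OF \<Omega>]]
  have "\<forall>v. \<exists>z G. h0 \<Omega> z G \<and> (\<forall>\<phi>\<in>C1c \<Omega>. en G (Dl \<phi>) + l * (z \<bullet> mk \<phi>) = v \<bullet> mk \<phi>)"
    using weak_solution[OF \<Omega>(2) l] by blast
  then obtain K D where K: "\<And>v. h0 \<Omega> (K v) (D v)"
    "\<And>v \<phi>. \<phi> \<in> C1c \<Omega> \<Longrightarrow> en (D v) (Dl \<phi>) + l * (K v \<bullet> mk \<phi>) = v \<bullet> mk \<phi>" by metis
  define F where "F u x = (if x \<in> \<Omega> then f x (fn u x) \<mu> else 0)" for u :: "'a l2" and x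
  \<comment> \<open>A choice, since \<open>F u\<close> need not be square integrable for arbitrary
    u; \<open>N u\<close> is meaningful only once some class is known to represent
    \<open>F u\<close>.\<close>
  define N where "N u = (SOME n. AE x in lborel. fn n x = F u x)" for u
  have NI: "AE x in lborel. fn (N u) x = F u x" if "\<exists>n. AE x in lborel. fn n x = F u x" for u
    unfolding N_def by (rule someI_ex[OF that])
  have range: "(\<exists>n. AE x in lborel. fn n x = F (K v) x) \<and> norm (N (K v)) \<le> R" if v: "norm v \<le> R" for v
  proof -
    let ?z = "K v"
    \<comment> \<open>The source for which \<open>?z\<close> solves the problem without zero order
      term. It is cut off because v ranges over the whole ball, including projections that do not
      vanish outside \<Omega>.\<close>
    define y where "y = mul (indicator \<Omega>) (v - l *\<^sub>R ?z)"
    have eqy: "en (D v) (Dl \<phi>) = y \<bullet> mk \<phi>" if \<phi>: "\<phi> \<in> C1c \<Omega>" for \<phi>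
    proof -
      have "\<phi> x = 0" if "x \<notin> \<Omega>" for x using \<phi> that unfolding C1c_def csupp_def by blast
      then have "indicator \<Omega> x * \<phi> x = \<phi> x" for x by (cases "x \<in> \<Omega>") simp_all
      then have i: "(\<lambda>x. indicator \<Omega> x * \<phi> x) = \<phi>" by (rule ext)
      have "y \<bullet> mk \<phi> = (v - l *\<^sub>R ?z) \<bullet> mul (indicator \<Omega>) (mk \<phi>)" unfolding y_def by (rule mul_inner[OF ind_bmult[OF \<Omega>]])
      also have "\<dots> = (v - l *\<^sub>R ?z) \<bullet> mk \<phi>" by (simp add: mul_mk[OF ind_bmult[OF \<Omega>] C1c_sqint[OF \<phi>]] i)
      finally show ?thesis using K(2)[OF \<phi>, of v] by (simp add: inner_diff_left)
    qed
    have "norm y \<le> R"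
    proof -
      have yz: "y \<bullet> ?z = en (D v) (D v)"
        using weak_eq_h0[where l=0 and u=0 and v=y, OF _ K(1)[of v]] eqy by simp
      have lin: "linear (mul (indicator \<Omega>) :: 'a l2 \<Rightarrow> 'a l2)" by (rule mul_linear[OF ind_bmult[OF \<Omega>]])
      have ii: "mul (indicator \<Omega>) (mul (indicator \<Omega>) w) = mul (indicator \<Omega>) w" for w :: "'a l2"
      proof -
        have "(\<lambda>x. indicator \<Omega> x * indicator \<Omega> x) = (indicator \<Omega> :: 'a \<Rightarrow> real)" by (auto simp: indicator_def)
        then show ?thesis using mul_mul[OF ind_bmult[OF \<Omega>] ind_bmult[OF \<Omega>], of w] by simp
      qed
      have yi: "mul (indicator \<Omega>) y = y" unfolding y_def by (rule ii)
      let ?zi = "mul (indicator \<Omega>) ?z"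
      have "mul (indicator \<Omega>) v = y + l *\<^sub>R ?zi" by (simp add: y_def linear_diff[OF lin] linear_scale[OF lin])
      then have "(norm (mul (indicator \<Omega>) v))\<^sup>2 = (norm y)\<^sup>2 + 2 * l * (y \<bullet> ?zi) + l\<^sup>2 * (norm ?zi)\<^sup>2"
        unfolding power2_norm_eq_inner by (simp add: inner_add_left inner_add_right inner_commute power2_eq_square)
      moreover have "y \<bullet> ?zi = y \<bullet> ?z" using mul_inner[OF ind_bmult[OF \<Omega>], of y ?z] yi by simp
      moreover have "0 \<le> y \<bullet> ?z" unfolding yz gn_sq[symmetric] by simp
      ultimately have "(norm y)\<^sup>2 \<le> (norm (mul (indicator \<Omega>) v))\<^sup>2" using l by simp
      then have "norm y \<le> norm (mul (indicator \<Omega>) v)" by (rule power2_le_imp_le) simp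
      then show ?thesis using mul_ind_norm_le[OF \<Omega>, of v] v by linarith
    qed
    then have yb: "fn y \<in> L2_ball \<Omega> R"
      unfolding L2_ball_def using fn_L2[OF \<Omega>] L2_norm_le[OF \<Omega> rep_on_fn[OF \<Omega>], of y] by auto
    have y0: "en (D v) (Dl \<phi>) + 0 * (?z \<bullet> mk \<phi>) = y \<bullet> mk \<phi>" if "\<phi> \<in> C1c \<Omega>" for \<phi> using eqy[OF that] by simp
    \<comment> \<open>This choice is known to be a solution only because \<open>fn ?z\<close> is
      one; uniqueness then identifies the two almost everywhere on \<Omega>.\<close>
    let ?u = "neg_laplacian_inverse \<Omega> (fn y)"
    have "fn ?z \<in> sobolev 2 \<Omega> \<inter> sobolev0 \<Omega> \<and> (AE x in lebesgue_on \<Omega>. - laplacian \<Omega> (fn ?z) x = fn y x)"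
      using weak_is_strong[OF \<Omega> dom rep_on_fn[OF \<Omega>] K(1) y0] by (simp add: ae_iff)
    then have u: "?u \<in> sobolev 2 \<Omega> \<inter> sobolev0 \<Omega> \<and> (AE x in lebesgue_on \<Omega>. - laplacian \<Omega> ?u x = fn y x)"
      unfolding neg_laplacian_inverse_def
      by (rule someI[where P="\<lambda>u. u \<in> sobolev 2 \<Omega> \<inter> sobolev0 \<Omega> \<and> (AE x in lebesgue_on \<Omega>. - laplacian \<Omega> u x = fn y x)"])
    obtain z' G' where z': "rep_on \<Omega> ?u z'" "h0 \<Omega> z' G'" "\<And>\<phi>. \<phi> \<in> C1c \<Omega> \<Longrightarrow> en G' (Dl \<phi>) = y \<bullet> mk \<phi>"
      using strong_is_weak[OF \<Omega>, of ?u y] u by (auto simp: ae_iff)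
    have "z' = ?z" by (rule weak_unique[OF \<Omega> z'(2) K(1) z'(3) eqy])
    then have uz: "AE x in lborel. x \<in> \<Omega> \<longrightarrow> ?u x = fn ?z x" using z'(1) by (simp add: rep_on_def)
    have nb: "nemytskii f \<mu> ?u \<in> L2_ball \<Omega> R" using f2 yb by (auto simp: image_subset_iff)
    then obtain n where n: "rep_on \<Omega> (nemytskii f \<mu> ?u) n" "vanish \<Omega> n" using L2_rep_exists[OF \<Omega>] by (auto simp: L2_ball_def)
    have "AE x in lborel. x \<in> \<Omega> \<longrightarrow> nemytskii f \<mu> ?u x = fn n x" using n(1) by (simp add: rep_on_def)
    then have nF: "AE x in lborel. fn n x = F ?z x"
      using n(2) uz unfolding vanish_def by eventually_elim (auto simp: F_def nemytskii_def)
    then have ex: "\<exists>n. AE x in lborel. fn n x = F ?z x" by blast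
    have "AE x in lborel. fn (N ?z) x = fn n x" using NI[OF ex] nF by eventually_elim simp
    then have "N ?z = n" using mk_eq_iff[OF sqint_fn sqint_fn, of "N ?z" n] by simp
    moreover have "norm n \<le> R" using L2_norm_vanish[OF \<Omega> n] nb by (simp add: L2_ball_def)
    ultimately show ?thesis using ex by simp
  qed
  have fc: "AE x in lborel. x \<in> \<Omega> \<longrightarrow> continuous_on UNIV (\<lambda>s. f x s \<mu>)"
  proof -
    have "AE x in lborel. x \<in> \<Omega> \<longrightarrow> continuous_on (UNIV \<times> {0<..}) (\<lambda>(s, \<mu>). f x s \<mu>)"
      using f1 by (simp add: caratheodory_def ae_iff)
    then show ?thesis
    proof eventually_elim
      case (elim x)
      show ?case
      proof
        assume "x \<in> \<Omega>"
        then have "continuous_on (UNIV \<times> {0<..}) (\<lambda>(s, \<mu>). f x s \<mu>)" using elim by blast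
        moreover have "continuous_on UNIV (\<lambda>s. (s, \<mu>))" by (intro continuous_intros)
        ultimately have "continuous_on UNIV (\<lambda>s. case (s, \<mu>) of (s, \<mu>) \<Rightarrow> f x s \<mu>)"
          by (rule continuous_on_compose2) (use \<mu> in auto)
        then show "continuous_on UNIV (\<lambda>s. f x s \<mu>)" by simp
      qed
    qed
  qed
  have closed: "\<exists>r::nat\<Rightarrow>nat. strict_mono r \<and> norm (N u) \<le> R \<and> (\<forall>y. (\<lambda>k. N (K (V (r k))) \<bullet> y) \<longlonglongrightarrow> N u \<bullet> y)"
    if VR: "\<And>k. norm (V k) \<le> R" and Ku: "(\<lambda>k. K (V k)) \<longlonglongrightarrow> u" for V u
  proof -
    \<comment> \<open>Convergence in norm gives pointwise convergence only along a subsequence,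
      which is why the closedness property is stated with one.\<close>
    obtain r :: "nat \<Rightarrow> nat" where r: "strict_mono r" "AE x in lborel. (\<lambda>k. fn (K (V (r k))) x) \<longlonglongrightarrow> fn u x"
      using l2_tendsto_AE_subseq[OF Ku] by blast
    let ?n = "\<lambda>k. N (K (V (r k)))"
    have "AE x in lborel. fn (?n k) x = F (K (V (r k))) x" for k using NI range[OF VR] by blast
    then have "AE x in lborel. \<forall>k. fn (?n k) x = F (K (V (r k))) x" by (subst AE_all_countable) blast
    then have conv: "AE x in lborel. (\<lambda>k. fn (?n k) x) \<longlonglongrightarrow> F u x"
      using fc r(2)
    proof eventually_elim
      case (elim x)
      show ?case
      proof (cases "x \<in> \<Omega>")
        case True
        then have "continuous_on UNIV (\<lambda>s. f x s \<mu>)" using elim(2) by blast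
        then have "isCont (\<lambda>s. f x s \<mu>) (fn u x)" by (simp add: continuous_on_eq_continuous_at)
        then have "(\<lambda>k. f x (fn (K (V (r k))) x) \<mu>) \<longlonglongrightarrow> f x (fn u x) \<mu>" using elim(3) by (rule isCont_tendsto_compose)
        then show ?thesis using True elim(1) by (simp add: F_def)
      next
        case False
        then show ?thesis using elim(1) by (simp add: F_def)
      qed
    qed
    \<comment> \<open>A measurable substitute for \<open>F u\<close>: that \<open>F u\<close> has a
      class in \<open>l2\<close> is deduced from the convergence by Fatou's lemma.\<close>
    define g where "g x = lim (\<lambda>k. fn (?n k) x)" for x
    have gm: "g \<in> borel_measurable lborel" unfolding g_def[abs_def] by (rule borel_measurable_lim_metric) simp
    have gF: "AE x in lborel. g x = F u x" using conv by eventually_elim (simp add: g_def limI)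
    have gc: "AE x in lborel. (\<lambda>k. fn (?n k) x) \<longlonglongrightarrow> g x" using conv gF by eventually_elim simp
    have nb: "norm (?n k) \<le> R" for k using range[OF VR] by blast
    have sg: "sqint g" using fatou_l2(1)[of "\<lambda>k. fn (?n k)" R g] nb gm gc by simp
    have "AE x in lborel. fn (mk g) x = F u x" using fn_mk[OF sg] gF by eventually_elim simp
    then have "AE x in lborel. fn (N u) x = F u x" by (intro NI) blast
    then have "AE x in lborel. (\<lambda>k. fn (?n k) x) \<longlonglongrightarrow> fn (N u) x" using conv by eventually_elim simp
    then show ?thesis using AE_bounded_weak_conv[of ?n R "N u", OF nb] r(1) by blast
  qed
  obtain v where v: "norm v \<le> R" "v = N (K v)"
    using weak_fixed_point[where N=N and K=K and D=D, OF \<Omega>(2) l R K conjunct2[OF range] closed] by blast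
  have vF: "AE x in lborel. fn v x = F (K v) x" using NI range[OF v(1)] v(2) by metis
  have s: "fn (K v) \<in> sobolev 2 \<Omega> \<inter> sobolev0 \<Omega>"
    "AE x in lborel. x \<in> \<Omega> \<longrightarrow> - laplacian \<Omega> (fn (K v)) x + l * fn (K v) x = fn v x"
    using weak_is_strong[OF \<Omega> dom rep_on_fn[OF \<Omega>] K] by blast+
  have "AE x in lborel. x \<in> \<Omega> \<longrightarrow> - laplacian \<Omega> (fn (K v)) x + l * fn (K v) x = f x (fn (K v) x) \<mu>"
    using s(2) vF by eventually_elim (auto simp: F_def)
  then have "strong_solution \<Omega> f \<mu> l (fn (K v))" using s(1) by (simp add: strong_solution_def ae_iff)
  then show ?thesis by blast
qed

theorem theorem4p2:
  fixes \<Omega> :: "(real ^ 'n) set"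
    and f :: "real ^ 'n \<Rightarrow> real \<Rightarrow> real \<Rightarrow> real"
    and \<mu> R :: real
  assumes dim: "CARD('n) \<ge> 3"
    and domain: "bounded_C11_domain \<Omega>"
    and f1: "caratheodory \<Omega> f"
    and f2: "\<mu> > 0" "R > 0"
      "(nemytskii f \<mu> \<circ> neg_laplacian_inverse \<Omega>) ` L2_ball \<Omega> R \<subseteq> L2_ball \<Omega> R"
  shows "\<forall>l\<ge>0. \<exists>u. strong_solution \<Omega> f \<mu> l u"
  using semilinear_dirichlet[OF domain f1 f2] by blast

end
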